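(* Let $P$ be a manifold, $G$ a compact Lie group and $(C^{\infty}(P),G,\alpha)$ a smooth dynamical system. Then the following statements are equivalent: (a) The smooth dynamical system $(C^{\infty}(P),G,\alpha)$ is free. (b) The induced smooth group action $\sigma:P\times G\to P$ is free. In particular, in this situation the two concepts of freeness coincide.
   Context: Manifolds are finite-dimensional, paracompact, second countable and smooth; $C^{\infty}(P)$ is the Fréchet algebra of smooth $\mathbb{C}$-valued functions. A smooth dynamical system $(A,G,\alpha)$ consists of a unital locally convex algebra $A$, a Lie group $G$ and a group homomorphism $\alpha:G\to\operatorname{Aut}(A)$ such that $G\times A\to A$, $(g,a)\mapsto\alpha(g)(a)$ is smooth. The induced action $\sigma:P\times G\to P$ is the smooth right action determined by $\delta_{\sigma(p,g)}=\delta_p\circ\alpha(g)$, where $\delta_p(f)=f(p)$ and $P$ is identified with the set $\Gamma_{C^\infty(P)}$ of characters (nonzero algebra homomorphisms to $\mathbb{C}$) via $p\mapsto\delta_p$. For a commutative unital locally convex algebra $A$ and a continuous representation $(\pi,V)$ of $G$ (on a locally convex space $V$), let $\Gamma_AV:=\{s\in A\otimes V:(\forall g\in G)\ (\alpha(g)\otimes\operatorname{id}_V)(s)=(\operatorname{id}_A\otimes\pi(g^{-1}))(s)\}$. The system $(A,G,\alpha)$ is free if there is a family $(\pi_j,V_j)_{j\in J}$ of continuous representations of $G$ separating the points of $G$ (for each $g\ne1_G$ some $\pi_j(g)\neq\operatorname{id}_{V_j}$) such that for all $j\in J$ and all characters $\chi$ of $A$ the map $\Gamma_AV_j\to V_j$,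 $a\otimes v\mapsto\chi(a)v$ (the restriction of $\chi\otimes\operatorname{id}_{V_j}$) is surjective. A group action is free if all stabilizers are trivial. *)

theory Defs
  imports
    "HOL-Analysis.Analysis"
    "HOL-Algebra.Module"
    "HOL-Algebra.Bij"
    "HOL-Algebra.Group_Action"
    "HOL-Library.Poly_Mapping"
    "HOL-Library.Equipollence"
begin

section \<open>Locally convex spaces and algebras\<close>

text \<open>
  Vector spaces and algebras are the modules of \<^theory>\<open>HOL-Algebra.Module\<close> over the scalar
  field, together with a topology.  For a mere vector space the inherited fields \<open>mult\<close> and
  \<open>one\<close> carry no meaning.
\<close>

record ('s, 'a) tvs = "('s, 'a) module" +
  topol :: "'a topology"

definition scalars :: "'s::field ring" where
  "scalars = \<lparr>carrier = UNIV, mult = (*), one = 1, zero = 0, add = (+)\<rparr>"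

definition convex_in :: "('s::real_normed_field, 'a) tvs \<Rightarrow> 'a set \<Rightarrow> bool" where
  "convex_in E W \<longleftrightarrow> W \<subseteq> carrier E \<and>
     (\<forall>x\<in>W. \<forall>y\<in>W. \<forall>t\<in>{0..1}.
        (of_real (1 - t) \<odot>\<^bsub>E\<^esub> x) \<oplus>\<^bsub>E\<^esub> (of_real t \<odot>\<^bsub>E\<^esub> y) \<in> W)"

definition locally_convex_space :: "('s::real_normed_field, 'a) tvs \<Rightarrow> bool" where
  "locally_convex_space E \<longleftrightarrow>
     Module.module scalars E \<and>
     topspace (topol E) = carrier E \<and>
     Hausdorff_space (topol E) \<and>
     continuous_map (prod_topology (topol E) (topol E)) (topol E) (\<lambda>(x, y). x \<oplus>\<^bsub>E\<^esub> y) \<and>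
     continuous_map (prod_topology euclidean (topol E)) (topol E) (\<lambda>(c, x). c \<odot>\<^bsub>E\<^esub> x) \<and>
     (\<forall>U. openin (topol E) U \<and> \<zero>\<^bsub>E\<^esub> \<in> U \<longrightarrow>
        (\<exists>W. openin (topol E) W \<and> convex_in E W \<and> \<zero>\<^bsub>E\<^esub> \<in> W \<and> W \<subseteq> U))"

definition locally_convex_algebra :: "(complex, 'a) tvs \<Rightarrow> bool" where
  "locally_convex_algebra A \<longleftrightarrow>
     locally_convex_space A \<and>
     Ring.ring A \<and>
     (\<forall>c. \<forall>a\<in>carrier A. \<forall>b\<in>carrier A.
        (c \<odot>\<^bsub>A\<^esub> a) \<otimes>\<^bsub>A\<^esub> b = c \<odot>\<^bsub>A\<^esub> (a \<otimes>\<^bsub>A\<^esub> b) \<and>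
        a \<otimes>\<^bsub>A\<^esub> (c \<odot>\<^bsub>A\<^esub> b) = c \<odot>\<^bsub>A\<^esub> (a \<otimes>\<^bsub>A\<^esub> b)) \<and>
     continuous_map (prod_topology (topol A) (topol A)) (topol A) (\<lambda>(a, b). a \<otimes>\<^bsub>A\<^esub> b)"

definition euclidean_tvs :: "nat \<Rightarrow> (real, nat \<Rightarrow> real) tvs" where
  "euclidean_tvs n =
     \<lparr>carrier = topspace (Euclidean_space n), mult = undefined, one = undefined,
      zero = (\<lambda>i. 0), add = (\<lambda>x y i. x i + y i), smult = (\<lambda>c x i. c * x i),
      topol = Euclidean_space n\<rparr>"

definition complex_tvs :: "(complex, complex) tvs" where
  "complex_tvs =
     \<lparr>carrier = UNIV, mult = (*), one = 1, zero = 0, add = (+), smult = (*),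
      topol = euclidean\<rparr>"

definition real_tvs :: "(complex, 'a) tvs \<Rightarrow> (real, 'a) tvs" where
  "real_tvs E =
     \<lparr>carrier = carrier E, mult = mult E, one = one E, zero = zero E, add = add E,
      smult = (\<lambda>r. smult E (complex_of_real r)), topol = topol E\<rparr>"

definition prod_tvs :: "('s, 'a) tvs \<Rightarrow> ('s, 'b) tvs \<Rightarrow> ('s, 'a \<times> 'b) tvs" where
  "prod_tvs E F =
     \<lparr>carrier = carrier E \<times> carrier F, mult = undefined, one = undefined,
      zero = (\<zero>\<^bsub>E\<^esub>, \<zero>\<^bsub>F\<^esub>),
      add = (\<lambda>(x, y) (x', y'). (x \<oplus>\<^bsub>E\<^esub> x', y \<oplus>\<^bsub>F\<^esub> y')),
      smult = (\<lambda>c (x, y). (c \<odot>\<^bsub>E\<^esub> x, c \<odot>\<^bsub>F\<^esub> y)),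
      topol = prod_topology (topol E) (topol F)\<rparr>"


section \<open>Smooth maps between locally convex spaces\<close>

definition has_dir_deriv ::
  "(real, 'a) tvs \<Rightarrow> (real, 'b) tvs \<Rightarrow> ('a \<Rightarrow> 'b) \<Rightarrow> 'a \<Rightarrow> 'a \<Rightarrow> 'b \<Rightarrow> bool" where
  "has_dir_deriv E F f x h l \<longleftrightarrow>
     limitin (topol F)
       (\<lambda>t. inverse t \<odot>\<^bsub>F\<^esub> (f (x \<oplus>\<^bsub>E\<^esub> (t \<odot>\<^bsub>E\<^esub> h)) \<ominus>\<^bsub>F\<^esub> f x)) l (at 0)"

definition dir_deriv ::
  "(real, 'a) tvs \<Rightarrow> (real, 'b) tvs \<Rightarrow> ('a \<Rightarrow> 'b) \<Rightarrow> 'a \<Rightarrow> 'a \<Rightarrow> 'b" where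
  "dir_deriv E F f h x = (THE l. has_dir_deriv E F f x h l)"

primrec iter_deriv ::
  "(real, 'a) tvs \<Rightarrow> (real, 'b) tvs \<Rightarrow> ('a \<Rightarrow> 'b) \<Rightarrow> 'a list \<Rightarrow> 'a \<Rightarrow> 'b" where
  "iter_deriv E F f [] = f"
| "iter_deriv E F f (h # hs) = dir_deriv E F (iter_deriv E F f hs) h"

text \<open>
  Smoothness in the Michal--Bastiani sense on an open set \<open>U\<close>: all iterated directional derivatives
  exist, and each \<open>d\<^sup>k f\<close> is continuous on \<open>U \<times> E\<^sup>k\<close>.  The case \<open>k = 0\<close> says
  that \<open>f\<close> itself is continuous.
\<close>

definition smooth_on ::
  "(real, 'a) tvs \<Rightarrow> (real, 'b) tvs \<Rightarrow> 'a set \<Rightarrow> ('a \<Rightarrow> 'b) \<Rightarrow> bool" where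
  "smooth_on E F U f \<longleftrightarrow>
     (\<forall>hs h x. set hs \<subseteq> carrier E \<and> h \<in> carrier E \<and> x \<in> U \<longrightarrow>
        (\<exists>l. has_dir_deriv E F (iter_deriv E F f hs) x h l)) \<and>
     (\<forall>k. continuous_map
        (prod_topology (subtopology (topol E) U) (product_topology (\<lambda>_. topol E) {..<k}))
        (topol F)
        (\<lambda>(x, h). iter_deriv E F f (map h [0..<k]) x))"


section \<open>Manifolds\<close>

text \<open>
  A chart is a pair of its domain and the coordinate map; the latter is relevant only on the domain.
\<close>

record ('p, 'e) manifold =
  mtop :: "'p topology"
  model :: "(real, 'e) tvs"
  charts :: "('p set \<times> ('p \<Rightarrow> 'e)) set"

definition locally_convex_manifold :: "('p, 'e) manifold \<Rightarrow> bool" where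
  "locally_convex_manifold M \<longleftrightarrow>
     locally_convex_space (model M) \<and>
     Hausdorff_space (mtop M) \<and>
     (\<Union>(U, \<phi>)\<in>charts M. U) = topspace (mtop M) \<and>
     (\<forall>(U, \<phi>)\<in>charts M.
        openin (mtop M) U \<and> openin (topol (model M)) (\<phi> ` U) \<and>
        homeomorphic_map (subtopology (mtop M) U) (subtopology (topol (model M)) (\<phi> ` U)) \<phi>) \<and>
     (\<forall>(U, \<phi>)\<in>charts M. \<forall>(W, \<psi>)\<in>charts M.
        smooth_on (model M) (model M) (\<phi> ` (U \<inter> W)) (\<psi> \<circ> inv_into U \<phi>))"

definition second_countable_space :: "'p topology \<Rightarrow> bool" where
  "second_countable_space X \<longleftrightarrow>
     (\<exists>\<B>. countable \<B> \<and> (\<forall>B\<in>\<B>. openin X B) \<and>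
        (\<forall>U x. openin X U \<and> x \<in> U \<longrightarrow> (\<exists>B\<in>\<B>. x \<in> B \<and> B \<subseteq> U)))"

definition paracompact_space :: "'p topology \<Rightarrow> bool" where
  "paracompact_space X \<longleftrightarrow>
     (\<forall>\<U>. (\<forall>U\<in>\<U>. openin X U) \<and> \<Union>\<U> = topspace X \<longrightarrow>
        (\<exists>\<V>. (\<forall>V\<in>\<V>. openin X V \<and> (\<exists>U\<in>\<U>. V \<subseteq> U)) \<and> \<Union>\<V> = topspace X \<and>
           locally_finite_in X \<V>))"

definition smooth_manifold :: "('p, nat \<Rightarrow> real) manifold \<Rightarrow> bool" where
  "smooth_manifold M \<longleftrightarrow>
     locally_convex_manifold M \<and> (\<exists>n. model M = euclidean_tvs n) \<and>
     paracompact_space (mtop M) \<and> second_countable_space (mtop M)"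

definition tvs_manifold :: "(real, 'e) tvs \<Rightarrow> ('e, 'e) manifold" where
  "tvs_manifold E = \<lparr>mtop = topol E, model = E, charts = {(carrier E, \<lambda>x. x)}\<rparr>"

definition prod_manifold ::
  "('p, 'e) manifold \<Rightarrow> ('q, 'f) manifold \<Rightarrow> ('p \<times> 'q, 'e \<times> 'f) manifold" where
  "prod_manifold M N =
     \<lparr>mtop = prod_topology (mtop M) (mtop N),
      model = prod_tvs (model M) (model N),
      charts = {(U \<times> W, map_prod \<phi> \<psi>) | U \<phi> W \<psi>. (U, \<phi>) \<in> charts M \<and> (W, \<psi>) \<in> charts N}\<rparr>"

definition smooth_map ::
  "('p, 'e) manifold \<Rightarrow> ('q, 'f) manifold \<Rightarrow> ('p \<Rightarrow> 'q) \<Rightarrow> bool" where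
  "smooth_map M N f \<longleftrightarrow>
     continuous_map (mtop M) (mtop N) f \<and>
     (\<forall>(U, \<phi>)\<in>charts M. \<forall>(W, \<psi>)\<in>charts N.
        smooth_on (model M) (model N) (\<phi> ` (U \<inter> f -` W)) (\<psi> \<circ> f \<circ> inv_into U \<phi>))"


section \<open>The algebra of smooth functions\<close>

definition smooth_functions :: "('p, 'e) manifold \<Rightarrow> ('p \<Rightarrow> complex) set" where
  "smooth_functions P =
     {f \<in> extensional (topspace (mtop P)). smooth_map P (tvs_manifold (real_tvs complex_tvs)) f}"

text \<open>
  The subbasic open sets are the balls, with arbitrary centre \<open>f\<close>, of the seminorms
  \<open>g \<mapsto> sup\<^sub>K |\<partial>\<^bsub>h\<^sub>1\<^esub> \<dots> \<partial>\<^bsub>h\<^sub>k\<^esub> (g \<circ> \<phi>\<inverse>)|\<close>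
  for charts \<open>\<phi>\<close> and compact subsets \<open>K\<close> of their images.
\<close>

definition smooth_ball ::
  "('p, 'e) manifold \<Rightarrow> ('p \<Rightarrow> complex) \<Rightarrow> 'p set \<Rightarrow> ('p \<Rightarrow> 'e) \<Rightarrow> 'e set \<Rightarrow> 'e list \<Rightarrow> real
     \<Rightarrow> ('p \<Rightarrow> complex) set" where
  "smooth_ball P f U \<phi> K hs \<epsilon> =
     {g \<in> smooth_functions P. \<forall>x\<in>K.
        cmod (iter_deriv (model P) (real_tvs complex_tvs)
                (\<lambda>y. g (inv_into U \<phi> y) - f (inv_into U \<phi> y)) hs x) < \<epsilon>}"

definition smooth_topology :: "('p, 'e) manifold \<Rightarrow> ('p \<Rightarrow> complex) topology" where
  "smooth_topology P =
     topology_generated_by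
       (insert (smooth_functions P)
          {smooth_ball P f U \<phi> K hs \<epsilon> | f U \<phi> K hs \<epsilon>.
             f \<in> smooth_functions P \<and> (U, \<phi>) \<in> charts P \<and>
             compactin (topol (model P)) K \<and> K \<subseteq> \<phi> ` U \<and>
             set hs \<subseteq> carrier (model P) \<and> 0 < \<epsilon>})"

definition smooth_algebra :: "('p, 'e) manifold \<Rightarrow> (complex, 'p \<Rightarrow> complex) tvs" where
  "smooth_algebra P =
     (let X = topspace (mtop P) in
      \<lparr>carrier = smooth_functions P,
       mult = (\<lambda>f g. \<lambda>p\<in>X. f p * g p),
       one = (\<lambda>p\<in>X. 1),
       zero = (\<lambda>p\<in>X. 0),
       add = (\<lambda>f g. \<lambda>p\<in>X. f p + g p),
       smult = (\<lambda>c f. \<lambda>p\<in>X. c * f p),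
       topol = smooth_topology P\<rparr>)"


section \<open>Lie groups and smooth dynamical systems\<close>

record ('g, 'e) lie_group = "'g monoid" +
  mfd :: "('g, 'e) manifold"

definition Lie_group :: "('g, nat \<Rightarrow> real) lie_group \<Rightarrow> bool" where
  "Lie_group G \<longleftrightarrow>
     Group.group G \<and> smooth_manifold (mfd G) \<and> topspace (mtop (mfd G)) = carrier G \<and>
     smooth_map (prod_manifold (mfd G) (mfd G)) (mfd G) (\<lambda>(g, h). g \<otimes>\<^bsub>G\<^esub> h) \<and>
     smooth_map (mfd G) (mfd G) (\<lambda>g. inv\<^bsub>G\<^esub> g)"

definition compact_Lie_group :: "('g, nat \<Rightarrow> real) lie_group \<Rightarrow> bool" where
  "compact_Lie_group G \<longleftrightarrow> Lie_group G \<and> compact_space (mtop (mfd G))"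

definition algebra_Aut :: "(complex, 'a) tvs \<Rightarrow> ('a \<Rightarrow> 'a) monoid" where
  "algebra_Aut A = BijGroup (carrier A)
     \<lparr>carrier := {f \<in> Bij (carrier A). f \<in> ring_hom A A \<and>
        (\<forall>c. \<forall>a\<in>carrier A. f (c \<odot>\<^bsub>A\<^esub> a) = c \<odot>\<^bsub>A\<^esub> f a)}\<rparr>"

definition smooth_dynamical_system ::
  "(complex, 'a) tvs \<Rightarrow> ('g, nat \<Rightarrow> real) lie_group \<Rightarrow> ('g \<Rightarrow> 'a \<Rightarrow> 'a) \<Rightarrow> bool" where
  "smooth_dynamical_system A G \<alpha> \<longleftrightarrow>
     locally_convex_algebra A \<and> Lie_group G \<and> \<alpha> \<in> hom G (algebra_Aut A) \<and>
     smooth_map (prod_manifold (mfd G) (tvs_manifold (real_tvs A))) (tvs_manifold (real_tvs A))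
       (\<lambda>(g, a). \<alpha> g a)"

definition characters :: "(complex, 'a) tvs \<Rightarrow> ('a \<Rightarrow> complex) set" where
  "characters A = {\<omega> \<in> extensional (carrier A).
     (\<forall>a\<in>carrier A. \<forall>b\<in>carrier A.
        \<omega> (a \<oplus>\<^bsub>A\<^esub> b) = \<omega> a + \<omega> b \<and> \<omega> (a \<otimes>\<^bsub>A\<^esub> b) = \<omega> a * \<omega> b) \<and>
     (\<forall>c. \<forall>a\<in>carrier A. \<omega> (c \<odot>\<^bsub>A\<^esub> a) = c * \<omega> a) \<and>
     (\<exists>a\<in>carrier A. \<omega> a \<noteq> 0)}"


section \<open>Tensor products\<close>

text \<open>
  The algebraic tensor product of complex vector spaces, as the quotient of the free vector space
  on \<open>A \<times> V\<close> by the subspace spanned by the bilinearity relations.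
\<close>

definition free_space ::
  "(complex, 'a) tvs \<Rightarrow> (complex, 'v) tvs \<Rightarrow> (('a \<times> 'v) \<Rightarrow>\<^sub>0 complex) set" where
  "free_space A V = {s. Poly_Mapping.keys s \<subseteq> carrier A \<times> carrier V}"

inductive_set tensor_relations ::
  "(complex, 'a) tvs \<Rightarrow> (complex, 'v) tvs \<Rightarrow> (('a \<times> 'v) \<Rightarrow>\<^sub>0 complex) set"
  for A V where
  zero: "0 \<in> tensor_relations A V"
| add: "s \<in> tensor_relations A V \<Longrightarrow> t \<in> tensor_relations A V \<Longrightarrow> s + t \<in> tensor_relations A V"
| scale: "s \<in> tensor_relations A V \<Longrightarrow> Poly_Mapping.map ((*) c) s \<in> tensor_relations A V"
| add_left: "a \<in> carrier A \<Longrightarrow> b \<in> carrier A \<Longrightarrow> v \<in> carrier V \<Longrightarrow>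
    Poly_Mapping.single (a \<oplus>\<^bsub>A\<^esub> b, v) 1
      - Poly_Mapping.single (a, v) 1 - Poly_Mapping.single (b, v) 1 \<in> tensor_relations A V"
| add_right: "a \<in> carrier A \<Longrightarrow> v \<in> carrier V \<Longrightarrow> w \<in> carrier V \<Longrightarrow>
    Poly_Mapping.single (a, v \<oplus>\<^bsub>V\<^esub> w) 1
      - Poly_Mapping.single (a, v) 1 - Poly_Mapping.single (a, w) 1 \<in> tensor_relations A V"
| scale_left: "a \<in> carrier A \<Longrightarrow> v \<in> carrier V \<Longrightarrow>
    Poly_Mapping.single (c \<odot>\<^bsub>A\<^esub> a, v) 1 - Poly_Mapping.single (a, v) c \<in> tensor_relations A V"
| scale_right: "a \<in> carrier A \<Longrightarrow> v \<in> carrier V \<Longrightarrow>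
    Poly_Mapping.single (a, c \<odot>\<^bsub>V\<^esub> v) 1 - Poly_Mapping.single (a, v) c \<in> tensor_relations A V"

definition tensor_rel ::
  "(complex, 'a) tvs \<Rightarrow> (complex, 'v) tvs \<Rightarrow> (('a \<times> 'v) \<Rightarrow>\<^sub>0 complex) rel" where
  "tensor_rel A V =
     {(s, t). s \<in> free_space A V \<and> t \<in> free_space A V \<and> s - t \<in> tensor_relations A V}"

definition tensor ::
  "(complex, 'a) tvs \<Rightarrow> (complex, 'v) tvs \<Rightarrow> (('a \<times> 'v) \<Rightarrow>\<^sub>0 complex) set set" where
  "tensor A V = free_space A V // tensor_rel A V"

text \<open>The map \<open>f \<otimes> h\<close> on \<open>A \<otimes> V\<close>, for linear \<open>f : A \<rightarrow> A\<close> and \<open>h : V \<rightarrow> V\<close>.\<close>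

definition tensor_map ::
  "(complex, 'a) tvs \<Rightarrow> (complex, 'v) tvs \<Rightarrow> ('a \<Rightarrow> 'a) \<Rightarrow> ('v \<Rightarrow> 'v)
     \<Rightarrow> (('a \<times> 'v) \<Rightarrow>\<^sub>0 complex) set \<Rightarrow> (('a \<times> 'v) \<Rightarrow>\<^sub>0 complex) set" where
  "tensor_map A V f h S =
     (\<Union>s\<in>S. tensor_rel A V ``
        {\<Sum>(a, v)\<in>Poly_Mapping.keys s.
           Poly_Mapping.single (f a, h v) (Poly_Mapping.lookup s (a, v))})"

text \<open>The map \<open>\<omega> \<otimes> id\<close> from \<open>A \<otimes> V\<close> to \<open>V\<close>, for a linear functional \<open>\<omega>\<close>: the
  common value on all representatives of the class \<open>S\<close>.\<close>

definition tensor_eval ::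
  "(complex, 'v) tvs \<Rightarrow> ('a \<Rightarrow> complex) \<Rightarrow> (('a \<times> 'v) \<Rightarrow>\<^sub>0 complex) set \<Rightarrow> 'v" where
  "tensor_eval V \<omega> S =
     the_elem ((\<lambda>s. \<Oplus>\<^bsub>V\<^esub>x\<in>Poly_Mapping.keys s.
        (Poly_Mapping.lookup s x * \<omega> (fst x)) \<odot>\<^bsub>V\<^esub> snd x) ` S)"


section \<open>Freeness\<close>

definition general_linear :: "(complex, 'v) tvs \<Rightarrow> ('v \<Rightarrow> 'v) monoid" where
  "general_linear V = BijGroup (carrier V)
     \<lparr>carrier := {f \<in> Bij (carrier V).
        (\<forall>v\<in>carrier V. \<forall>w\<in>carrier V. f (v \<oplus>\<^bsub>V\<^esub> w) = f v \<oplus>\<^bsub>V\<^esub> f w) \<and>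
        (\<forall>c. \<forall>v\<in>carrier V. f (c \<odot>\<^bsub>V\<^esub> v) = c \<odot>\<^bsub>V\<^esub> f v)}\<rparr>"

definition continuous_representation ::
  "('g, nat \<Rightarrow> real) lie_group \<Rightarrow> (complex, 'v) tvs \<Rightarrow> ('g \<Rightarrow> 'v \<Rightarrow> 'v) \<Rightarrow> bool" where
  "continuous_representation G V \<pi> \<longleftrightarrow>
     locally_convex_space V \<and> \<pi> \<in> hom G (general_linear V) \<and>
     continuous_map (prod_topology (mtop (mfd G)) (topol V)) (topol V) (\<lambda>(g, v). \<pi> g v)"

text \<open>The space \<open>\<Gamma>\<^sub>A V\<close>.\<close>

definition equivariants ::
  "(complex, 'a) tvs \<Rightarrow> ('g, nat \<Rightarrow> real) lie_group \<Rightarrow> ('g \<Rightarrow> 'a \<Rightarrow> 'a)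
     \<Rightarrow> (complex, 'v) tvs \<Rightarrow> ('g \<Rightarrow> 'v \<Rightarrow> 'v) \<Rightarrow> (('a \<times> 'v) \<Rightarrow>\<^sub>0 complex) set set" where
  "equivariants A G \<alpha> V \<pi> =
     {S \<in> tensor A V. \<forall>g\<in>carrier G.
        tensor_map A V (\<alpha> g) (\<lambda>v. v) S = tensor_map A V (\<lambda>a. a) (\<pi> (inv\<^bsub>G\<^esub> g)) S}"

text \<open>
  HOL cannot quantify over types inside a formula, so the underlying sets of the representation
  spaces are taken from a type \<open>'v\<close>.  A family of representations is given by the set of its
  members.  The choice of \<open>'v\<close> is immaterial as long as it is large enough: if \<open>G\<close> and the set
  of characters of \<open>A\<close> have at most the cardinality of the continuum (as is the case for Lie groups
  and for the algebra of smooth functions on a second countable manifold), then every separating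
  family as below can be replaced by one consisting of invariant subspaces of cardinality at most
  that of the continuum.
\<close>

definition free_dynamical_system ::
  "'v itself \<Rightarrow> (complex, 'a) tvs \<Rightarrow> ('g, nat \<Rightarrow> real) lie_group \<Rightarrow> ('g \<Rightarrow> 'a \<Rightarrow> 'a) \<Rightarrow> bool" where
  "free_dynamical_system _ A G \<alpha> \<longleftrightarrow>
     (\<exists>\<R> :: (('g \<Rightarrow> 'v \<Rightarrow> 'v) \<times> (complex, 'v) tvs) set.
        (\<forall>(\<pi>, V)\<in>\<R>. continuous_representation G V \<pi>) \<and>
        (\<forall>g\<in>carrier G. g \<noteq> \<one>\<^bsub>G\<^esub> \<longrightarrow> (\<exists>(\<pi>, V)\<in>\<R>. \<exists>v\<in>carrier V. \<pi> g v \<noteq> v)) \<and>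
        (\<forall>(\<pi>, V)\<in>\<R>. \<forall>\<omega>\<in>characters A.
           tensor_eval V \<omega> ` equivariants A G \<alpha> V \<pi> = carrier V))"

definition point_evaluation :: "('p, 'e) manifold \<Rightarrow> 'p \<Rightarrow> ('p \<Rightarrow> complex) \<Rightarrow> complex" where
  "point_evaluation P p = (\<lambda>f\<in>smooth_functions P. f p)"

definition induced_action ::
  "('p, 'e) manifold \<Rightarrow> ('g \<Rightarrow> ('p \<Rightarrow> complex) \<Rightarrow> ('p \<Rightarrow> complex)) \<Rightarrow> 'p \<Rightarrow> 'g \<Rightarrow> 'p" where
  "induced_action P \<alpha> p g =
     (THE q. q \<in> topspace (mtop P) \<and>
        point_evaluation P q = compose (smooth_functions P) (point_evaluation P p) (\<alpha> g))"

definition free_action :: "('g, 'm) monoid_scheme \<Rightarrow> 'p set \<Rightarrow> ('p \<Rightarrow> 'g \<Rightarrow> 'p) \<Rightarrow> bool" where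
  "free_action G X \<sigma> \<longleftrightarrow> (\<forall>p\<in>X. stabilizer G (\<lambda>g p. \<sigma> p g) p = {\<one>\<^bsub>G\<^esub>})"

end

theory Submission
  imports Defs
begin

text \<open>
  Write \<open>p g\<close> for the induced action, so that \<open>f (p g) = (\<alpha> g f) p\<close> for smooth \<open>f\<close>.  This determines
  \<open>p g\<close>, since every character of \<open>C\<^sup>\<infinity>(P)\<close> is the evaluation at a unique point
  (\<open>character_is_point_evaluation\<close>, \<open>point_evaluation_inj\<close>).

  Suppose that the system is free and \<open>p g = p\<close>.  Evaluation at \<open>p\<close> is then invariant under
  \<open>\<alpha> g\<close>, so the value at \<open>p\<close> of an equivariant element of \<open>C\<^sup>\<infinity>(P) \<otimes> V\<close> is fixed by
  \<open>\<pi> (g\<inverse>)\<close> (\<open>eval_invariant\<close>).  These values exhaust \<open>V\<close>, so \<open>\<pi> (g\<inverse>)\<close> is the identity for every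
  representation of the family, and \<open>g = 1\<close> because the family separates points
  (\<open>free_action_if_free_system\<close>).

  Conversely, suppose that the action is free.  By the Peter--Weyl theorem the finite-dimensional
  representations separate the points of \<open>G\<close> (\<open>matrix_representations_separate_points\<close>), and it
  suffices to show that for each of them and each \<open>p\<close> the equivariant elements take all values at
  \<open>p\<close>.  For a smooth function \<open>F\<close> and a vector \<open>u\<close>, the average of \<open>F (q g) \<pi>(g) u\<close> over \<open>g\<close> is an
  equivariant function of \<open>q\<close>, smooth because differentiation commutes with averaging
  (\<open>smooth_average\<close>).  As \<open>p\<close> has trivial stabilizer, \<open>F \<ge> 0\<close> can be chosen such that
  \<open>g \<mapsto> F (p g)\<close> is positive at \<open>1\<close> and lives on a small neighbourhood of \<open>1\<close>
  (\<open>concentrated_function\<close>).  On this neighbourhood \<open>\<pi>(g)\<close> is close to the identity, so the value of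
  the average at \<open>p\<close> is \<open>R u\<close> with a matrix \<open>R\<close> that is close to a positive multiple of the identity,
  hence invertible (\<open>average_invertible\<close>).

  The invariant mean on continuous functions is constructed by averaging over finitely many
  translations.  The Peter--Weyl theorem is proved with it by applying the power method to a
  symmetric convolution kernel (\<open>symmetric_kernel_eigenfunction\<close>).
\<close>

section \<open>The invariant mean of a compact group\<close>

text \<open>
  The tube lemma turns continuity at the points of \<open>X \<times> {y}\<close> into uniformity over \<open>X\<close>.  All
  uniform estimates over the group rest on this.
\<close>

lemma compact_uniform_continuity:
  fixes F :: "'a \<times> 'b \<Rightarrow> 'c::metric_space"
  assumes X: "compact_space X" and F: "continuous_map (prod_topology X Y) euclidean F"
    and y: "y \<in> topspace Y" and e: "0 < e"
  shows "\<exists>V. openin Y V \<and> y \<in> V \<and> (\<forall>x\<in>topspace X. \<forall>y'\<in>V. dist (F (x, y')) (F (x, y)) < e)"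
proof -
  have fst: "continuous_map (prod_topology X Y) (prod_topology X Y) (\<lambda>z. (fst z, y))"
    using y by (intro continuous_map_pairedI) (auto simp: continuous_map_fst)
  have "continuous_map (prod_topology X Y) euclideanreal (\<lambda>z. dist (F z) (F (fst z, y)))"
    using continuous_map_compose[OF continuous_map_pairedI[OF F continuous_map_compose[OF fst F]],
      of euclideanreal "\<lambda>(a, b). dist a b"]
    by (simp add: o_def case_prod_unfold continuous_intros)
  then have op: "openin (prod_topology X Y)
      {z \<in> topspace (prod_topology X Y). dist (F z) (F (fst z, y)) \<in> {..<e}}"
    by (intro openin_continuous_map_preimage) (auto simp: open_openin[symmetric])
  have K: "compactin X (topspace X)" "compactin Y {y}"
    using X y by (auto simp: compact_space_def)
  obtain U V where UV: "openin X U" "openin Y V" "topspace X \<subseteq> U" "{y} \<subseteq> V"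
    "U \<times> V \<subseteq> {z \<in> topspace (prod_topology X Y). dist (F z) (F (fst z, y)) \<in> {..<e}}"
    by (rule Wallace_theorem_prod_topology[OF K op]) (use y e in auto)
  show ?thesis
  proof (intro exI[of _ V] conjI ballI)
    show "openin Y V" "y \<in> V" using UV by auto
    fix x y' assume "x \<in> topspace X" "y' \<in> V"
    then have "(x, y') \<in> U \<times> V" using UV by auto
    then show "dist (F (x, y')) (F (x, y)) < e" using UV(5) by auto
  qed
qed

locale compact_group = group G for G :: "('g, 'm) monoid_scheme" (structure) +
  fixes T :: "'g topology"
  assumes topspace_T: "topspace T = carrier G"
    and compact_T: "compact_space T"
    and Hausdorff_T: "Hausdorff_space T"
    and continuous_mult: "continuous_map (prod_topology T T) T (\<lambda>(x, y). x \<otimes> y)"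
    and continuous_inv: "continuous_map T T (\<lambda>x. inv x)"
begin

abbreviation cont :: "('g \<Rightarrow> real) \<Rightarrow> bool" where
  "cont f \<equiv> continuous_map T euclideanreal f"

lemma continuous_map_mult:
  assumes "continuous_map X T f" "continuous_map X T g"
  shows "continuous_map X T (\<lambda>x. f x \<otimes> g x)"
  using continuous_map_compose[OF continuous_map_pairedI[OF assms] continuous_mult]
  by (simp add: o_def)

lemma continuous_map_inverse:
  assumes "continuous_map X T f"
  shows "continuous_map X T (\<lambda>x. inv (f x))"
  using continuous_map_compose[OF assms continuous_inv] by (simp add: o_def)

lemma continuous_map_const_T: "a \<in> carrier G \<Longrightarrow> continuous_map X T (\<lambda>x. a)"
  by (simp add: topspace_T)

lemma cont_compose: "cont f \<Longrightarrow> continuous_map X T h \<Longrightarrow> continuous_map X euclideanreal (\<lambda>x. f (h x))"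
  using continuous_map_compose[of X T h euclideanreal f] by (simp add: o_def)

lemma cont_left: "cont f \<Longrightarrow> a \<in> carrier G \<Longrightarrow> cont (\<lambda>x. f (a \<otimes> x))"
  by (rule cont_compose, assumption, intro continuous_map_mult continuous_map_const_T) auto

lemma cont_right: "cont f \<Longrightarrow> a \<in> carrier G \<Longrightarrow> cont (\<lambda>x. f (x \<otimes> a))"
  by (rule cont_compose, assumption, intro continuous_map_mult continuous_map_const_T) auto

lemma cont_inv: "cont f \<Longrightarrow> cont (\<lambda>x. f (inv x))"
  by (rule cont_compose, assumption, intro continuous_map_inverse) auto

lemma cont_bounded:
  assumes "cont f"
  shows "\<exists>B>0. \<forall>x\<in>carrier G. \<bar>f x\<bar> \<le> B"
proof -
  have "compactin T (carrier G)"
    using compact_T by (simp add: compact_space_def topspace_T)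
  then have "compact (f ` carrier G)"
    using image_compactin[OF _ assms] by (simp add: compactin_euclidean_iff)
  then obtain B where "0 < B" "\<forall>y\<in>f ` carrier G. norm y \<le> B"
    using compact_imp_bounded[of "f ` carrier G"] unfolding bounded_pos by blast
  then show ?thesis by auto
qed

definition lavg :: "'g list \<Rightarrow> ('g \<Rightarrow> real) \<Rightarrow> 'g \<Rightarrow> real" where
  "lavg as f x = (\<Sum>a\<leftarrow>as. f (a \<otimes> x)) / real (length as)"

definition ravg :: "'g list \<Rightarrow> ('g \<Rightarrow> real) \<Rightarrow> 'g \<Rightarrow> real" where
  "ravg bs f x = (\<Sum>b\<leftarrow>bs. f (x \<otimes> b)) / real (length bs)"

definition points :: "'g list \<Rightarrow> bool" where
  "points as \<longleftrightarrow> as \<noteq> [] \<and> set as \<subseteq> carrier G"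

lemma sum_list_bounds:
  fixes f :: "'x \<Rightarrow> real"
  assumes "\<And>a. a \<in> set as \<Longrightarrow> l \<le> f a \<and> f a \<le> u"
  shows "real (length as) * l \<le> (\<Sum>a\<leftarrow>as. f a) \<and> (\<Sum>a\<leftarrow>as. f a) \<le> real (length as) * u"
  using assms
proof (induction as)
  case (Cons a as)
  have "l \<le> f a \<and> f a \<le> u" using Cons.prems by simp
  moreover have "real (length as) * l \<le> (\<Sum>a\<leftarrow>as. f a) \<and> (\<Sum>a\<leftarrow>as. f a) \<le> real (length as) * u"
    using Cons.prems by (intro Cons.IH) auto
  ultimately show ?case by (simp add: algebra_simps)
qed simp

lemma mean_bounds:
  fixes f :: "'x \<Rightarrow> real"
  assumes "as \<noteq> []" "\<And>a. a \<in> set as \<Longrightarrow> l \<le> f a \<and> f a \<le> u"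
  shows "l \<le> (\<Sum>a\<leftarrow>as. f a) / real (length as)" "(\<Sum>a\<leftarrow>as. f a) / real (length as) \<le> u"
  using sum_list_bounds[of as l f u, OF assms(2)] assms(1) by (simp_all add: pos_le_divide_eq pos_divide_le_eq mult.commute)

lemma lavg_bounds:
  assumes "points as" "x \<in> carrier G" "\<And>y. y \<in> carrier G \<Longrightarrow> l \<le> f y \<and> f y \<le> u"
  shows "l \<le> lavg as f x \<and> lavg as f x \<le> u"
  unfolding lavg_def using assms
  by (intro conjI mean_bounds) (auto simp: points_def)

lemma ravg_bounds:
  assumes "points as" "x \<in> carrier G" "\<And>y. y \<in> carrier G \<Longrightarrow> l \<le> f y \<and> f y \<le> u"
  shows "l \<le> ravg as f x \<and> ravg as f x \<le> u"
  unfolding ravg_def using assms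
  by (intro conjI mean_bounds) (auto simp: points_def)

lemma cont_lavg:
  assumes "cont f" "points as"
  shows "cont (lavg as f)"
proof -
  have "cont (\<lambda>x. \<Sum>a\<leftarrow>as. f (a \<otimes> x))" if "set as \<subseteq> carrier G" for as
    using that
  proof (induction as)
    case (Cons a as)
    then show ?case by (simp add: continuous_map_add cont_left[OF assms(1)])
  qed simp
  then show ?thesis
    using assms unfolding lavg_def[abs_def] points_def
    by (intro continuous_map_real_divide) auto
qed

lemma lavg_lavg:
  assumes "points as" "points bs"
  shows "\<exists>cs. points cs \<and> (\<forall>f. \<forall>x\<in>carrier G. lavg bs (lavg as f) x = lavg cs f x)"
proof -
  define cs where "cs = concat (map (\<lambda>b. map (\<lambda>a. a \<otimes> b) as) bs)"
  have len: "length cs = length bs * length as"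
    unfolding cs_def by (induction bs) auto
  have "length cs \<noteq> 0"
    using assms len by (simp add: points_def)
  then have "cs \<noteq> []" by auto
  moreover have "set cs \<subseteq> carrier G"
    using assms by (auto simp: points_def cs_def)
  ultimately have "points cs" by (simp add: points_def)
  moreover have "lavg bs (lavg as f) x = lavg cs f x" if x: "x \<in> carrier G" for f x
  proof -
  have "(\<Sum>b\<leftarrow>bs. (\<Sum>a\<leftarrow>as. f (a \<otimes> (b \<otimes> x))) / real (length as))
      = (\<Sum>c\<leftarrow>cs. f (c \<otimes> x)) / real (length as)" if "set bs \<subseteq> carrier G"
    using that unfolding cs_def
  proof (induction bs)
    case (Cons b bs)
    have "f (a \<otimes> (b \<otimes> x)) = f (a \<otimes> b \<otimes> x)" if "a \<in> set as" for a
      using assms Cons.prems x that by (auto simp: points_def m_assoc subset_iff)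
    then have "(\<Sum>a\<leftarrow>as. f (a \<otimes> (b \<otimes> x))) = (\<Sum>a\<leftarrow>as. f (a \<otimes> b \<otimes> x))"
      by (intro arg_cong[where f=sum_list] map_cong refl)
    then show ?case
      using Cons by (simp add: add_divide_distrib o_def)
  qed simp
  then show "lavg bs (lavg as f) x = lavg cs f x"
    using assms by (simp add: lavg_def points_def len mult.commute)
  qed
  ultimately show ?thesis by blast
qed

lemma sum_list_swap:
  "(\<Sum>a\<leftarrow>as. \<Sum>b\<leftarrow>bs. F a b) = (\<Sum>b\<leftarrow>bs. \<Sum>a\<leftarrow>as. F a b)" for F :: "'x \<Rightarrow> 'y \<Rightarrow> real"
  by (induction as) (auto simp: sum_list_addf)

lemma lavg_ravg:
  assumes "points as" "points bs" "x \<in> carrier G"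
  shows "lavg as (ravg bs f) x = ravg bs (lavg as f) x"
proof -
  have assoc: "f (a \<otimes> x \<otimes> b) = f (a \<otimes> (x \<otimes> b))" if "a \<in> set as" "b \<in> set bs" for a b
    using assms that by (auto simp: points_def m_assoc subset_iff)
  have "(\<Sum>a\<leftarrow>as. \<Sum>b\<leftarrow>bs. f (a \<otimes> x \<otimes> b)) = (\<Sum>a\<leftarrow>as. \<Sum>b\<leftarrow>bs. f (a \<otimes> (x \<otimes> b)))"
    using assoc by (intro arg_cong[where f=sum_list] map_cong refl) auto
  also have "\<dots> = (\<Sum>b\<leftarrow>bs. \<Sum>a\<leftarrow>as. f (a \<otimes> (x \<otimes> b)))" by (rule sum_list_swap)
  finally show ?thesis
    by (simp only: lavg_def ravg_def divide_inverse sum_list_mult_const) (simp add: mult_ac)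
qed

text \<open>
  Left and right translations commute, so an average of both kinds lies in either range.  This
  is how all almost constant averages are seen to approach the same constant.
\<close>

lemma averages_overlap:
  assumes "points as" "points bs"
    and "\<And>x. x \<in> carrier G \<Longrightarrow> l \<le> lavg as f x \<and> lavg as f x \<le> u"
    and "\<And>x. x \<in> carrier G \<Longrightarrow> l' \<le> ravg bs f x \<and> ravg bs f x \<le> u'"
  shows "l \<le> u'" "l' \<le> u"
proof -
  have "l \<le> ravg bs (lavg as f) \<one> \<and> ravg bs (lavg as f) \<one> \<le> u"
    by (rule ravg_bounds[OF assms(2) one_closed]) (rule assms(3))
  moreover have "l' \<le> lavg as (ravg bs f) \<one> \<and> lavg as (ravg bs f) \<one> \<le> u'"
    by (rule lavg_bounds[OF assms(1) one_closed]) (rule assms(4))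
  ultimately show "l \<le> u'" "l' \<le> u"
    using lavg_ravg[OF assms(1,2) one_closed, of f] by linarith+
qed

text \<open>
  Finitely many translates of a neighbourhood of \<open>1\<close> cover the group.  Averaging over as many
  translations makes a value near the minimum contribute at every point, which lowers the upper
  bound by a fixed amount.  This amount depends only on the modulus of continuity of \<open>f\<close> under right
  translation, which all left averages of \<open>f\<close> inherit, so the step can be iterated.
\<close>

lemma oscillation_step:
  assumes f: "cont f" and \<delta>: "0 < \<delta>"
  shows "\<exists>n. (0::nat) < n \<and> (\<forall>as l d. points as \<longrightarrow> 2 * \<delta> \<le> d \<longrightarrow>
      (\<forall>x\<in>carrier G. l \<le> lavg as f x \<and> lavg as f x \<le> l + d) \<longrightarrow>
      (\<exists>bs l'. points bs \<and>
        (\<forall>x\<in>carrier G. l' \<le> lavg bs f x \<and> lavg bs f x \<le> l' + (d - \<delta> / n))))"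
proof -
  have c: "continuous_map (prod_topology T T) euclideanreal (\<lambda>z. f (fst z \<otimes> snd z))"
    by (rule cont_compose[OF f], intro continuous_map_mult continuous_map_fst continuous_map_snd)
  have one: "\<one> \<in> topspace T" and half: "0 < \<delta> / 2" using \<delta> by (auto simp: topspace_T)
  obtain U where U: "openin T U" "\<one> \<in> U"
    and fU': "\<forall>x\<in>topspace T. \<forall>u\<in>U. dist (f (fst (x, u) \<otimes> snd (x, u)))
      (f (fst (x, \<one>) \<otimes> snd (x, \<one>))) < \<delta> / 2"
    using compact_uniform_continuity[OF compact_T c one half] by blast
  have fU: "dist (f (x \<otimes> u)) (f x) < \<delta> / 2" if "x \<in> carrier G" "u \<in> U" for x u
    using fU' that by (simp add: topspace_T)
  have Uc: "U \<subseteq> carrier G" using openin_subset[OF U(1)] by (simp add: topspace_T)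
  define N where "N b = {x \<in> topspace T. inv b \<otimes> x \<in> U}" for b
  have "openin T (N b)" if "b \<in> carrier G" for b
    unfolding N_def by (rule openin_continuous_map_preimage[OF _ U(1)])
      (intro continuous_map_mult continuous_map_const_T, use that in auto)
  then have "\<forall>V\<in>N ` carrier G. openin T V" by blast
  moreover have "topspace T \<subseteq> \<Union>(N ` carrier G)"
    using U by (auto simp: topspace_T N_def)
  ultimately obtain \<F> where \<F>: "finite \<F>" "\<F> \<subseteq> N ` carrier G" "topspace T \<subseteq> \<Union>\<F>"
    using compact_T unfolding compact_space_alt by meson
  obtain B0 where B: "finite B0" "B0 \<subseteq> carrier G" and B0: "\<F> = N ` B0"
    using finite_subset_image[OF \<F>(1,2)] by blast
  have cover: "\<exists>b\<in>B0. inv b \<otimes> x \<in> U" if "x \<in> carrier G" for x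
    using \<F>(3) that unfolding B0 N_def topspace_T by blast
  obtain B where Bl: "set B = B0" using finite_list B(1) by blast
  have Bne: "B \<noteq> []" using cover[OF one_closed] Bl by auto
  define n where "n = 2 * length B"
  have npos: "n \<ge> 2" "n > 0" using Bne by (cases B; simp add: n_def)+
  have "\<exists>bs l'. points bs \<and>
        (\<forall>x\<in>carrier G. l' \<le> lavg bs f x \<and> lavg bs f x \<le> l' + (d - \<delta> / n))"
    if as: "points as" and d: "2 * \<delta> \<le> d"
      and b': "\<forall>x\<in>carrier G. l \<le> lavg as f x \<and> lavg as f x \<le> l + d" for as l d
  proof -
    have b: "l \<le> lavg as f x \<and> lavg as f x \<le> l + d" if "x \<in> carrier G" for x
      using b' that by blast
    show "\<exists>bs l'. points bs \<and>
        (\<forall>x\<in>carrier G. l' \<le> lavg bs f x \<and> lavg bs f x \<le> l' + (d - \<delta> / n))"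
    proof (cases "\<exists>x0\<in>carrier G. lavg as f x0 \<le> l + \<delta> / 2")
      case False
      \<comment> \<open>The lower bound is not attained up to \<open>\<delta> / 2\<close>, so it can be raised instead.\<close>
      have "\<delta> / n \<le> \<delta> / 2"
        using npos \<delta> by (intro divide_left_mono) auto
      moreover have "l + \<delta> / 2 < lavg as f x \<and> lavg as f x \<le> l + d" if "x \<in> carrier G" for x
        using False b[OF that] that by force
      ultimately have "l + \<delta> / 2 \<le> lavg as f x \<and> lavg as f x \<le> (l + \<delta> / 2) + (d - \<delta> / n)"
        if "x \<in> carrier G" for x
        using that by fastforce
      then show ?thesis using as by blast
    next
      case True
      then obtain x0 where x0: "x0 \<in> carrier G" "lavg as f x0 \<le> l + \<delta> / 2" by blast
      have small: "lavg as f (x0 \<otimes> u) \<le> l + \<delta>" if u: "u \<in> U" for u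
      proof -
        have "- (\<delta> / 2) \<le> f (a \<otimes> x0 \<otimes> u) - f (a \<otimes> x0) \<and>
            f (a \<otimes> x0 \<otimes> u) - f (a \<otimes> x0) \<le> \<delta> / 2" if "a \<in> set as" for a
        proof -
          have "a \<otimes> x0 \<in> carrier G" using as x0 that by (auto simp: points_def)
          from fU[OF this u] show ?thesis unfolding dist_real_def by linarith
        qed
        then have "(\<Sum>a\<leftarrow>as. f (a \<otimes> x0 \<otimes> u) - f (a \<otimes> x0)) / length as \<le> \<delta> / 2"
          using as by (intro mean_bounds(2)[where l="- (\<delta> / 2)"]) (auto simp: points_def)
        also have "(\<Sum>a\<leftarrow>as. f (a \<otimes> x0 \<otimes> u) - f (a \<otimes> x0)) =
            (\<Sum>a\<leftarrow>as. f (a \<otimes> (x0 \<otimes> u)) - f (a \<otimes> x0))"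
          using as x0 u Uc by (intro arg_cong[where f=sum_list] map_cong refl)
            (auto simp: points_def m_assoc subset_iff)
        finally have "lavg as f (x0 \<otimes> u) - lavg as f x0 \<le> \<delta> / 2"
          by (simp add: lavg_def sum_list_subtractf diff_divide_distrib)
        then show ?thesis using x0 by linarith
      qed
      define cs where "cs = map (\<lambda>b. x0 \<otimes> inv b) B"
      have cs: "points cs" "length cs = length B"
        using Bne Bl B(2) x0 by (auto simp: points_def cs_def)
      have up: "lavg cs (lavg as f) x \<le> l + (d - \<delta> / n)" if x: "x \<in> carrier G" for x
      proof -
        obtain b where b0: "b \<in> B0" "inv b \<otimes> x \<in> U" using cover[OF x] by blast
        define c where "c = x0 \<otimes> inv b"
        have c: "c \<in> set cs" using b0 Bl by (auto simp: c_def cs_def)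
        have "c \<otimes> x = x0 \<otimes> (inv b \<otimes> x)"
          using b0 B x x0 by (auto simp: c_def m_assoc)
        then have cx: "lavg as f (c \<otimes> x) \<le> l + \<delta>" using small b0 by simp
        have "(\<Sum>c\<leftarrow>cs. lavg as f (c \<otimes> x)) = lavg as f (c \<otimes> x) + (\<Sum>c\<leftarrow>remove1 c cs. lavg as f (c \<otimes> x))"
          by (rule sum_list_map_remove1[OF c])
        also have "(\<Sum>c\<leftarrow>remove1 c cs. lavg as f (c \<otimes> x)) \<le> real (length (remove1 c cs)) * (l + d)"
          using cs b x set_remove1_subset[of c cs]
          by (intro sum_list_bounds[of _ l, THEN conjunct2]) (auto simp: points_def subset_iff)
        also have "real (length (remove1 c cs)) = real (length B) - 1"
          using c cs Bne by (simp add: length_remove1 Suc_le_eq of_nat_diff)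
        finally have "(\<Sum>c\<leftarrow>cs. lavg as f (c \<otimes> x)) \<le> l + \<delta> + (real (length B) - 1) * (l + d)"
          using cx by simp
        also have "\<dots> = real (length B) * (l + d) - (d - \<delta>)" by (simp add: algebra_simps)
        also have "\<dots> \<le> real (length B) * (l + d) - \<delta> / 2" using d \<delta> by simp
        finally show ?thesis
          using Bne \<delta> unfolding lavg_def[of cs] cs(2) n_def
          by (simp add: field_simps)
      qed
      have lo: "l \<le> lavg cs (lavg as f) x" if x: "x \<in> carrier G" for x
        using lavg_bounds[OF cs(1) x, of l "lavg as f" "l + d"] b by blast
      obtain bs where bs: "points bs" "\<forall>f. \<forall>x\<in>carrier G. lavg cs (lavg as f) x = lavg bs f x"
        using lavg_lavg[OF as cs(1)] by blast
      then show ?thesis using up lo by (intro exI[of _ bs] exI[of _ l]) auto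
    qed
  qed
  then show ?thesis using npos(2) by blast
qed

lemma lavg_almost_constant:
  assumes f: "cont f" and e: "0 < e"
  shows "\<exists>as l. points as \<and> (\<forall>x\<in>carrier G. l \<le> lavg as f x \<and> lavg as f x \<le> l + e)"
proof -
  define \<delta> where "\<delta> = e / 2"
  have \<delta>: "0 < \<delta>" using e by (simp add: \<delta>_def)
  obtain n :: nat where n: "0 < n" and step: "\<forall>as l d. points as \<longrightarrow> 2 * \<delta> \<le> d \<longrightarrow>
      (\<forall>x\<in>carrier G. l \<le> lavg as f x \<and> lavg as f x \<le> l + d) \<longrightarrow>
      (\<exists>bs l'. points bs \<and>
        (\<forall>x\<in>carrier G. l' \<le> lavg bs f x \<and> lavg bs f x \<le> l' + (d - \<delta> / n)))"
    using oscillation_step[OF f \<delta>] by blast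
  have *: "\<exists>bs l'. points bs \<and> (\<forall>x\<in>carrier G. l' \<le> lavg bs f x \<and> lavg bs f x \<le> l' + e)"
    if "points as" "\<forall>x\<in>carrier G. l \<le> lavg as f x \<and> lavg as f x \<le> l + d"
      "d \<le> e + real k * (\<delta> / n)" for as l d k
    using that
  proof (induction k arbitrary: as l d)
    case 0
    then show ?case by (intro exI[of _ as] exI[of _ l]) force
  next
    case (Suc k)
    show ?case
    proof (cases "2 * \<delta> \<le> d")
      case True
      then obtain bs l' where bs: "points bs" 
        "\<forall>x\<in>carrier G. l' \<le> lavg bs f x \<and> lavg bs f x \<le> l' + (d - \<delta> / n)"
        using step Suc.prems(1,2) by blast
      have "d - \<delta> / n \<le> e + real k * (\<delta> / n)"
        using Suc.prems(3) unfolding of_nat_Suc ring_distribs by linarith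
      then show ?thesis using bs by (intro Suc.IH[of bs l' "d - \<delta> / n"]) auto
    next
      case False
      then have "d \<le> e" by (simp add: \<delta>_def)
      then show ?thesis using Suc.prems(1,2) by (intro exI[of _ as] exI[of _ l]) force
    qed
  qed
  obtain B where B: "0 < B" "\<forall>x\<in>carrier G. \<bar>f x\<bar> \<le> B" using cont_bounded[OF f] by blast
  obtain k where k: "2 * B < real k * (\<delta> / n)"
    using reals_Archimedean3[of "\<delta> / n"] n \<delta> by auto
  have "points [\<one>]" by (simp add: points_def)
  moreover have "- B \<le> lavg [\<one>] f x \<and> lavg [\<one>] f x \<le> - B + 2 * B" if "x \<in> carrier G" for x
    using bspec[OF B(2) that] that by (simp add: lavg_def abs_le_iff)
  ultimately show ?thesis using *[of "[\<one>]" "-B" "2 * B" k] k e by auto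
qed

lemma ravg_almost_constant:
  assumes f: "cont f" and e: "0 < e"
  shows "\<exists>bs l. points bs \<and> (\<forall>x\<in>carrier G. l \<le> ravg bs f x \<and> ravg bs f x \<le> l + e)"
proof -
  obtain as l where as: "points as"
    "\<forall>x\<in>carrier G. l \<le> lavg as (\<lambda>x. f (inv x)) x \<and> lavg as (\<lambda>x. f (inv x)) x \<le> l + e"
    using lavg_almost_constant[OF cont_inv[OF f] e] by blast
  have eq: "ravg (map (\<lambda>a. inv a) as) f x = lavg as (\<lambda>x. f (inv x)) (inv x)" if "x \<in> carrier G" for x
  proof -
    have "f (x \<otimes> inv a) = f (inv (a \<otimes> inv x))" if "a \<in> set as" for a
      using as that \<open>x \<in> carrier G\<close> by (auto simp: points_def inv_mult_group subset_iff)
    then have "(\<Sum>a\<leftarrow>as. f (x \<otimes> inv a)) = (\<Sum>a\<leftarrow>as. f (inv (a \<otimes> inv x)))"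
      by (intro arg_cong[where f=sum_list] map_cong refl)
    then show ?thesis by (simp add: lavg_def ravg_def o_def)
  qed
  have "points (map (\<lambda>a. inv a) as)" using as by (auto simp: points_def)
  then show ?thesis
    using as(2) eq by (intro exI[of _ "map (\<lambda>a. inv a) as"] exI[of _ l]) simp
qed

text \<open>
  The left averages of a continuous function come arbitrarily close to being constant, and
  comparison with right averages shows that the constant is unique.  No left average has a
  smaller upper bound, so this constant is the infimum of these upper bounds.
\<close>

definition mean :: "('g \<Rightarrow> real) \<Rightarrow> real" where
  "mean f = Inf {c. \<exists>as. points as \<and> (\<forall>x\<in>carrier G. lavg as f x \<le> c)}"

lemma mean_between:
  assumes f: "cont f" and as: "points as"
    and b: "\<And>x. x \<in> carrier G \<Longrightarrow> l \<le> lavg as f x \<and> lavg as f x \<le> u"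
  shows "l \<le> mean f" "mean f \<le> u"
proof -
  let ?S = "{c. \<exists>as. points as \<and> (\<forall>x\<in>carrier G. lavg as f x \<le> c)}"
  have lower: "l \<le> c" if "c \<in> ?S" for c
  proof (rule field_le_epsilon)
    fix e :: real assume e: "0 < e"
    from that obtain bs where bs: "points bs" "\<And>x. x \<in> carrier G \<Longrightarrow> lavg bs f x \<le> c" by blast
    obtain B where B: "\<forall>x\<in>carrier G. \<bar>f x\<bar> \<le> B" using cont_bounded[OF f] by blast
    have lb: "- B \<le> lavg bs f x \<and> lavg bs f x \<le> c" if "x \<in> carrier G" for x
    proof -
      have "- B \<le> lavg bs f x \<and> lavg bs f x \<le> B"
        by (rule lavg_bounds[OF bs(1) that]) (use B in \<open>force simp: abs_le_iff\<close>)
      then show ?thesis using bs(2) that by simp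
    qed
    obtain rs l' where rs: "points rs" "\<forall>x\<in>carrier G. l' \<le> ravg rs f x \<and> ravg rs f x \<le> l' + e"
      using ravg_almost_constant[OF f e] by blast
    note rs2 = bspec[OF rs(2)]
    have "l \<le> l' + e" by (rule averages_overlap(1)[OF as rs(1) b rs2])
    also have "l' \<le> c" by (rule averages_overlap(2)[OF bs(1) rs(1) lb rs2])
    finally show "l \<le> c + e" by simp
  qed
  have u: "u \<in> ?S" using as b by blast
  show "l \<le> mean f" unfolding mean_def by (rule cInf_greatest) (use u lower in blast)+
  show "mean f \<le> u" unfolding mean_def by (intro cInf_lower u bdd_belowI[of _ l] lower)
qed

lemma mean_approx:
  assumes f: "cont f" and e: "0 < e"
  shows "\<exists>as. points as \<and> (\<forall>x\<in>carrier G. \<bar>lavg as f x - mean f\<bar> \<le> e)"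
proof -
  obtain as l where as: "points as" "\<forall>x\<in>carrier G. l \<le> lavg as f x \<and> lavg as f x \<le> l + e"
    using lavg_almost_constant[OF f e] by blast
  have "l \<le> mean f" "mean f \<le> l + e" using mean_between[OF f as(1) bspec[OF as(2)]] by auto
  then have "\<bar>lavg as f x - mean f\<bar> \<le> e" if "x \<in> carrier G" for x
    using bspec[OF as(2) that] by linarith
  then show ?thesis using as(1) by blast
qed

lemma mean_eqI:
  assumes f: "cont f"
    and c: "\<And>e. 0 < e \<Longrightarrow> \<exists>as. points as \<and> (\<forall>x\<in>carrier G. \<bar>lavg as f x - c\<bar> \<le> e)"
  shows "mean f = c"
proof -
  have "\<bar>mean f - c\<bar> \<le> 0 + e" if "0 < e" for e
  proof -
    obtain as where as: "points as" "\<forall>x\<in>carrier G. \<bar>lavg as f x - c\<bar> \<le> e"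
      using c[OF \<open>0 < e\<close>] by blast
    have "c - e \<le> lavg as f x \<and> lavg as f x \<le> c + e" if "x \<in> carrier G" for x
      using bspec[OF as(2) that] by linarith
    from mean_between[OF f as(1) this] show ?thesis by linarith
  qed
  from field_le_epsilon[OF this] show ?thesis by simp
qed

lemma mean_lavg:
  assumes f: "cont f" and as: "points as"
  shows "mean (lavg as f) = mean f"
proof (rule sym, rule mean_eqI[OF f])
  fix e :: real assume "0 < e"
  then obtain bs where bs: "points bs" "\<forall>x\<in>carrier G. \<bar>lavg bs (lavg as f) x - mean (lavg as f)\<bar> \<le> e"
    using mean_approx[OF cont_lavg[OF f as]] by blast
  obtain cs where "points cs" "\<forall>f. \<forall>x\<in>carrier G. lavg bs (lavg as f) x = lavg cs f x"
    using lavg_lavg[OF as bs(1)] by blast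
  then show "\<exists>as'. points as' \<and> (\<forall>x\<in>carrier G. \<bar>lavg as' f x - mean (lavg as f)\<bar> \<le> e)"
    using bs(2) by (intro exI[of _ cs]) auto
qed

text \<open>
  An average of an almost constant function is still almost constant, so the functions can be
  treated one after the other.
\<close>

lemma mean_approx_finite:
  assumes "finite F" "\<And>f. f \<in> F \<Longrightarrow> cont f" and e: "0 < e"
  shows "\<exists>as. points as \<and> (\<forall>f\<in>F. \<forall>x\<in>carrier G. \<bar>lavg as f x - mean f\<bar> \<le> e)"
    using assms(1,2)
  proof (induction F rule: finite_induct)
    case empty
    show ?case by (intro exI[of _ "[\<one>]"]) (simp add: points_def)
  next
    case (insert f F)
    then obtain as where as: "points as" and as': "\<forall>f\<in>F. \<forall>x\<in>carrier G. \<bar>lavg as f x - mean f\<bar> \<le> e"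
      by auto
    have f: "cont f" using insert by auto
    obtain bs where bs: "points bs" "\<forall>x\<in>carrier G. \<bar>lavg bs (lavg as f) x - mean (lavg as f)\<bar> \<le> e"
      using mean_approx[OF cont_lavg[OF f as] e] by blast
    obtain cs where cs: "points cs" "\<forall>f. \<forall>x\<in>carrier G. lavg bs (lavg as f) x = lavg cs f x"
      using lavg_lavg[OF as(1) bs(1)] by blast
    have "\<bar>lavg cs h x - mean h\<bar> \<le> e" if h: "h \<in> F" and x: "x \<in> carrier G" for h x
    proof -
      have "mean h - e \<le> lavg as h y \<and> lavg as h y \<le> mean h + e" if "y \<in> carrier G" for y
        using bspec[OF bspec[OF as' h] that] by linarith
      from lavg_bounds[OF bs(1) x this] show ?thesis using cs(2) x by fastforce
    qed
    moreover have "\<bar>lavg cs f x - mean f\<bar> \<le> e" if "x \<in> carrier G" for x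
      using bs(2) cs(2) that mean_lavg[OF f as(1)] by simp
    ultimately show ?case using cs(1) by (intro exI[of _ cs]) auto
  qed

lemma lavg_cong:
  assumes "points as" "x \<in> carrier G" "\<And>x. x \<in> carrier G \<Longrightarrow> f x = g x"
  shows "lavg as f x = lavg as g x"
  unfolding lavg_def using assms 
  by (intro arg_cong2[where f="(/)"] arg_cong[where f=sum_list] map_cong refl) (auto simp: points_def)

lemma mean_cong:
  assumes "\<And>x. x \<in> carrier G \<Longrightarrow> f x = g x"
  shows "mean f = mean g"
  unfolding mean_def using lavg_cong[OF _ _ assms]
  by (intro arg_cong[where f=Inf] Collect_cong ex_cong1) auto

lemma mean_const [simp]: "mean (\<lambda>x. c) = c"
proof (rule mean_eqI)
  show "\<exists>as. points as \<and> (\<forall>x\<in>carrier G. \<bar>lavg as (\<lambda>x. c) x - c\<bar> \<le> e)" if "0 < e" for e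
    using that by (intro exI[of _ "[\<one>]"]) (simp add: lavg_def points_def)
qed simp

lemma mean_add:
  assumes "cont f" "cont g"
  shows "mean (\<lambda>x. f x + g x) = mean f + mean g"
proof (rule mean_eqI)
  show "cont (\<lambda>x. f x + g x)" using assms by (intro continuous_intros)
  fix e :: real assume e: "0 < e"
  obtain as where as: "points as" "\<forall>h\<in>{f, g}. \<forall>x\<in>carrier G. \<bar>lavg as h x - mean h\<bar> \<le> e / 2"
    using mean_approx_finite[of "{f, g}" "e / 2"] assms e by auto
  have "lavg as (\<lambda>x. f x + g x) x = lavg as f x + lavg as g x" for x
    by (simp add: lavg_def sum_list_addf add_divide_distrib)
  moreover have "\<bar>lavg as f x - mean f\<bar> \<le> e / 2" "\<bar>lavg as g x - mean g\<bar> \<le> e / 2" if "x \<in> carrier G" for x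
    using as(2) that by blast+
  ultimately have "\<bar>lavg as (\<lambda>x. f x + g x) x - (mean f + mean g)\<bar> \<le> e" if "x \<in> carrier G" for x
    using that by (smt (verit, best) field_sum_of_halves)
  then show "\<exists>as. points as \<and> (\<forall>x\<in>carrier G. \<bar>lavg as (\<lambda>x. f x + g x) x - (mean f + mean g)\<bar> \<le> e)"
    using as(1) by blast
qed

lemma mean_cmult:
  assumes "cont f"
  shows "mean (\<lambda>x. c * f x) = c * mean f"
proof (rule mean_eqI)
  show "cont (\<lambda>x. c * f x)" using assms by (intro continuous_intros)
  fix e :: real assume e: "0 < e"
  have "0 < e / (\<bar>c\<bar> + 1)" using e by (simp add: divide_pos_pos)
  then obtain as where as: "points as" "\<forall>x\<in>carrier G. \<bar>lavg as f x - mean f\<bar> \<le> e / (\<bar>c\<bar> + 1)"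
    using mean_approx[OF assms] by blast
  have "lavg as (\<lambda>x. c * f x) x = c * lavg as f x" for x
    by (simp add: lavg_def sum_list_const_mult)
  then have "\<bar>lavg as (\<lambda>x. c * f x) x - c * mean f\<bar> \<le> e" if "x \<in> carrier G" for x
  proof -
    have "\<bar>c * lavg as f x - c * mean f\<bar> = \<bar>c\<bar> * \<bar>lavg as f x - mean f\<bar>"
      by (simp add: abs_mult flip: right_diff_distrib)
    also have "\<dots> \<le> \<bar>c\<bar> * (e / (\<bar>c\<bar> + 1))" using as(2) that by (intro mult_left_mono) auto
    also have "\<dots> \<le> e" using e by (simp add: field_simps)
    finally show ?thesis by (simp add: lavg_def sum_list_const_mult)
  qed
  then show "\<exists>as. points as \<and> (\<forall>x\<in>carrier G. \<bar>lavg as (\<lambda>x. c * f x) x - c * mean f\<bar> \<le> e)"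
    using as(1) by blast
qed

lemma mean_minus: "cont f \<Longrightarrow> mean (\<lambda>x. - f x) = - mean f"
  using mean_cmult[of f "-1"] by simp

lemma mean_diff: "cont f \<Longrightarrow> cont g \<Longrightarrow> mean (\<lambda>x. f x - g x) = mean f - mean g"
  using mean_add[of f "\<lambda>x. - g x"] mean_minus[of g] by simp

lemma mean_sum:
  assumes "finite I" "\<And>i. i \<in> I \<Longrightarrow> cont (f i)"
  shows "mean (\<lambda>x. \<Sum>i\<in>I. f i x) = (\<Sum>i\<in>I. mean (f i))"
  using assms
proof (induction I rule: finite_induct)
  case (insert i I)
  have "cont (\<lambda>x. \<Sum>i\<in>I. f i x)" using insert by (intro continuous_map_sum) auto
  then show ?case using insert by (simp add: mean_add)
qed simp

lemma mean_bounds_between: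
  assumes "cont f" "\<And>x. x \<in> carrier G \<Longrightarrow> l \<le> f x \<and> f x \<le> u"
  shows "l \<le> mean f" "mean f \<le> u"
proof -
  have "points [\<one>]" by (simp add: points_def)
  moreover have "l \<le> lavg [\<one>] f x \<and> lavg [\<one>] f x \<le> u" if "x \<in> carrier G" for x
    using assms(2)[OF that] that by (simp add: lavg_def)
  ultimately show "l \<le> mean f" "mean f \<le> u" using mean_between[OF assms(1)] by blast+
qed

lemma mean_nonneg:
  assumes "cont f" "\<And>x. x \<in> carrier G \<Longrightarrow> 0 \<le> f x"
  shows "0 \<le> mean f"
proof -
  obtain B where "\<forall>x\<in>carrier G. \<bar>f x\<bar> \<le> B" using cont_bounded[OF assms(1)] by blast
  then have "0 \<le> f x \<and> f x \<le> B" if "x \<in> carrier G" for x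
    using assms(2) that by (auto simp: abs_le_iff)
  then show ?thesis by (rule mean_bounds_between(1)[OF assms(1)])
qed

lemma mean_mono:
  assumes "cont f" "cont g" "\<And>x. x \<in> carrier G \<Longrightarrow> f x \<le> g x"
  shows "mean f \<le> mean g"
  using mean_nonneg[of "\<lambda>x. g x - f x"] mean_diff[OF assms(2,1)] assms by (auto intro: continuous_map_diff)

lemma mean_abs_le:
  assumes "cont f" "\<And>x. x \<in> carrier G \<Longrightarrow> \<bar>f x\<bar> \<le> e"
  shows "\<bar>mean f\<bar> \<le> e"
proof -
  have "- e \<le> f x \<and> f x \<le> e" if "x \<in> carrier G" for x using assms(2)[OF that] by linarith
  from mean_bounds_between[OF assms(1) this] show ?thesis by linarith
qed

lemma mean_translate_left:
  assumes f: "cont f" and a: "a \<in> carrier G"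
  shows "mean (\<lambda>x. f (a \<otimes> x)) = mean f"
proof -
  have "mean (\<lambda>x. f (a \<otimes> x)) = mean (lavg [a] f)" by (rule mean_cong) (simp add: lavg_def)
  also have "\<dots> = mean f" using f a by (intro mean_lavg) (auto simp: points_def)
  finally show ?thesis .
qed

lemma mean_translate_right:
  assumes f: "cont f" and a: "a \<in> carrier G"
  shows "mean (\<lambda>x. f (x \<otimes> a)) = mean f"
proof (rule mean_eqI[OF cont_right[OF f a]])
  fix e :: real assume "0 < e"
  then obtain as where as: "points as" "\<forall>x\<in>carrier G. \<bar>lavg as f x - mean f\<bar> \<le> e"
    using mean_approx[OF f] by blast
  have "lavg as (\<lambda>x. f (x \<otimes> a)) x = lavg as f (x \<otimes> a)" if "x \<in> carrier G" for x
    unfolding lavg_def using as that a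
    by (intro arg_cong2[where f="(/)"] arg_cong[where f=sum_list] map_cong refl) (auto simp: points_def m_assoc subset_iff)
  then show "\<exists>as. points as \<and> (\<forall>x\<in>carrier G. \<bar>lavg as (\<lambda>x. f (x \<otimes> a)) x - mean f\<bar> \<le> e)"
    using as a by (intro exI[of _ as]) auto
qed

lemma mean_inv:
  assumes f: "cont f"
  shows "mean (\<lambda>x. f (inv x)) = mean f"
proof (rule mean_eqI[OF cont_inv[OF f]])
  fix e :: real assume e: "0 < e"
  then have e2: "0 < e / 2" by simp
  obtain bs l where bs: "points bs" "\<forall>x\<in>carrier G. l \<le> ravg bs f x \<and> ravg bs f x \<le> l + e / 2"
    using ravg_almost_constant[OF f e2] by blast
  obtain as where as: "points as" "\<forall>x\<in>carrier G. \<bar>lavg as f x - mean f\<bar> \<le> e / 2"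
    using mean_approx[OF f e2] by blast
  have "mean f - e / 2 \<le> lavg as f x \<and> lavg as f x \<le> mean f + e / 2" if "x \<in> carrier G" for x
    using bspec[OF as(2) that] by linarith
  from averages_overlap[OF as(1) bs(1) this bspec[OF bs(2)]]
  have "mean f - e / 2 \<le> l + e / 2" "l \<le> mean f + e / 2" by auto
  then have b: "\<bar>ravg bs f x - mean f\<bar> \<le> e" if "x \<in> carrier G" for x
    using bspec[OF bs(2) that] \<open>0 < e\<close> by linarith
  have eq: "lavg (map (\<lambda>a. inv a) bs) (\<lambda>x. f (inv x)) x = ravg bs f (inv x)" if "x \<in> carrier G" for x
  proof -
    have "f (inv (inv a \<otimes> x)) = f (inv x \<otimes> a)" if "a \<in> set bs" for a
      using bs that \<open>x \<in> carrier G\<close> by (auto simp: points_def inv_mult_group subset_iff)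
    then have "(\<Sum>a\<leftarrow>bs. f (inv (inv a \<otimes> x))) = (\<Sum>a\<leftarrow>bs. f (inv x \<otimes> a))"
      by (intro arg_cong[where f=sum_list] map_cong refl)
    then show ?thesis by (simp add: lavg_def ravg_def o_def)
  qed
  show "\<exists>as. points as \<and> (\<forall>x\<in>carrier G. \<bar>lavg as (\<lambda>x. f (inv x)) x - mean f\<bar> \<le> e)"
    using b bs eq by (intro exI[of _ "map (\<lambda>a. inv a) bs"]) (auto simp: points_def)
qed

end

lemma continuous_map_euclidean_iff_dist:
  fixes f :: "'a \<Rightarrow> 'b::metric_space"
  shows "continuous_map X euclidean f \<longleftrightarrow>
    (\<forall>x\<in>topspace X. \<forall>e>0. \<exists>U. openin X U \<and> x \<in> U \<and> (\<forall>y\<in>U. dist (f y) (f x) < e))"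
  using Met_TC.continuous_map_to_metric[of X f] by (simp add: dist_commute)

context compact_group
begin

lemma continuous_map_mean:
  assumes "continuous_map (prod_topology T X) euclideanreal (\<lambda>z. F (fst z) (snd z))"
  shows "continuous_map X euclideanreal (\<lambda>x. mean (\<lambda>g. F g x))"
  unfolding continuous_map_euclidean_iff_dist
proof (intro ballI allI impI)
  fix x :: 'a and e :: real assume x: "x \<in> topspace X" and e: "0 < e"
  have sec: "cont (\<lambda>g. F g y)" if "y \<in> topspace X" for y
  proof -
    have "continuous_map T (prod_topology T X) (\<lambda>g. (g, y))"
      using that by (intro continuous_map_pairedI) auto
    from continuous_map_compose[OF this assms] show ?thesis by (simp add: o_def)
  qed
  have "0 < e / 2" using e by simp
  from compact_uniform_continuity[OF compact_T assms x this]
  obtain V where V: "openin X V" "x \<in> V"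
    "\<forall>g\<in>topspace T. \<forall>y\<in>V. dist (F g y) (F g x) < e / 2" by auto
  have "dist (mean (\<lambda>g. F g y)) (mean (\<lambda>g. F g x)) < e" if y: "y \<in> V" for y
  proof -
    have yX: "y \<in> topspace X" using y openin_subset[OF V(1)] by blast
    have "\<bar>mean (\<lambda>g. F g y - F g x)\<bar> \<le> e / 2"
    proof (rule mean_abs_le)
      show "cont (\<lambda>g. F g y - F g x)" using sec x yX by (intro continuous_map_diff) auto
      show "\<bar>F g y - F g x\<bar> \<le> e / 2" if "g \<in> carrier G" for g
        using V(3) y that by (force simp: dist_real_def topspace_T)
    qed
    then show ?thesis using mean_diff[OF sec[OF yX] sec[OF x]] e by (simp add: dist_real_def)
  qed
  then show "\<exists>U. openin X U \<and> x \<in> U \<and> (\<forall>y\<in>U. dist (mean (\<lambda>g. F g y)) (mean (\<lambda>g. F g x)) < e)"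
    using V by blast
qed

text \<open>
  Finitely many translates of the region where \<open>f\<close> exceeds \<open>f x0 / 2\<close> cover the group, so that
  some left average is bounded below by a positive constant.
\<close>

lemma mean_pos:
  assumes f: "cont f" and nn: "\<And>x. x \<in> carrier G \<Longrightarrow> 0 \<le> f x" and x0: "x0 \<in> carrier G" "0 < f x0"
  shows "0 < mean f"
proof -
  define N where "N a = {x \<in> topspace T. f (a \<otimes> x) \<in> {f x0 / 2<..}}" for a
  have "openin T (N a)" if "a \<in> carrier G" for a
    unfolding N_def
    by (rule openin_continuous_map_preimage[OF cont_left[OF f that]]) (simp add: open_openin[symmetric])
  then have "\<forall>V\<in>N ` carrier G. openin T V" by blast
  moreover have "topspace T \<subseteq> \<Union>(N ` carrier G)"
  proof
    fix x assume x: "x \<in> topspace T"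
    then have "x0 \<otimes> inv x \<otimes> x = x0" using x0 by (simp add: topspace_T m_assoc)
    then have "x \<in> N (x0 \<otimes> inv x)" using x x0 by (simp add: N_def)
    then show "x \<in> \<Union>(N ` carrier G)" using x x0 by (auto simp: topspace_T)
  qed
  ultimately obtain \<F> where \<F>: "finite \<F>" "\<F> \<subseteq> N ` carrier G" "topspace T \<subseteq> \<Union>\<F>"
    using compact_T unfolding compact_space_alt by meson
  obtain A where A: "finite A" "A \<subseteq> carrier G" "\<F> = N ` A"
    using finite_subset_image[OF \<F>(1,2)] by blast
  obtain as where as: "set as = A" using finite_list A(1) by blast
  have "as \<noteq> []" using as A \<F> x0 by (auto simp: topspace_T)
  then have pas: "points as" using as A by (simp add: points_def)
  define l where "l = f x0 / 2 / real (length as)"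
  have l: "0 < l" using x0 \<open>as \<noteq> []\<close> by (simp add: l_def)
  obtain B where B: "\<forall>x\<in>carrier G. \<bar>f x\<bar> \<le> B" using cont_bounded[OF f] by blast
  have "l \<le> lavg as f x \<and> lavg as f x \<le> B" if x: "x \<in> carrier G" for x
  proof
    obtain a where a: "a \<in> set as" "f x0 / 2 < f (a \<otimes> x)"
      using x \<F>(3) by (auto simp: A(3) as N_def topspace_T)
    have "f (a \<otimes> x) \<le> (\<Sum>a\<leftarrow>as. f (a \<otimes> x))"
    proof (rule member_le_sum_list)
      show "f (a \<otimes> x) \<in> set (map (\<lambda>a. f (a \<otimes> x)) as)" using a by simp
      show "0 \<le> y" if y: "y \<in> set (map (\<lambda>a. f (a \<otimes> x)) as)" for y
      proof -
        from y obtain b where "b \<in> set as" "y = f (b \<otimes> x)" unfolding set_map by blast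
        then show ?thesis using nn[OF m_closed, of b x] pas x unfolding points_def by blast
      qed
    qed
    then have "f x0 / 2 \<le> (\<Sum>a\<leftarrow>as. f (a \<otimes> x))" using a by simp
    then show "l \<le> lavg as f x" unfolding l_def lavg_def by (rule divide_right_mono) simp
    have "- B \<le> f y \<and> f y \<le> B" if "y \<in> carrier G" for y using bspec[OF B that] by linarith
    then show "lavg as f x \<le> B" by (rule lavg_bounds[OF pas x, THEN conjunct2])
  qed
  then have "l \<le> mean f" by (rule mean_between(1)[OF f pas])
  then show ?thesis using l by linarith
qed

lemma cont_section:
  assumes F: "continuous_map (prod_topology T T) euclideanreal (\<lambda>z. F (fst z) (snd z))" and x: "x \<in> carrier G"
  shows "cont (F x)" "cont (\<lambda>y. F y x)"
proof -
  have "continuous_map T (prod_topology T T) (\<lambda>g. (x, g))" "continuous_map T (prod_topology T T) (\<lambda>g. (g, x))"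
    using x by (auto intro!: continuous_map_pairedI simp: topspace_T)
  from this[THEN continuous_map_compose, OF F] show "cont (F x)" "cont (\<lambda>y. F y x)"
    by (simp_all add: o_def)
qed

lemma continuous_map_swap_args:
  assumes "continuous_map (prod_topology T T) euclideanreal (\<lambda>z. F (fst z) (snd z))"
  shows "continuous_map (prod_topology T T) euclideanreal (\<lambda>z. F (snd z) (fst z))"
proof -
  have "continuous_map (prod_topology T T) (prod_topology T T) (\<lambda>z. (snd z, fst z))"
    by (intro continuous_map_pairedI continuous_map_fst continuous_map_snd)
  from continuous_map_compose[OF this assms] show ?thesis by (simp add: o_def)
qed

text \<open>
  Both iterated means are limits of the same finite averages: one list of translations serves a
  finite set of sections \<open>F x\<close> that approximates all of them, and the function of the other
  variable obtained by integrating out the first one.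
\<close>

lemma mean_swap:
  assumes F: "continuous_map (prod_topology T T) euclideanreal (\<lambda>z. F (fst z) (snd z))"
  shows "mean (\<lambda>x. mean (\<lambda>y. F x y)) = mean (\<lambda>y. mean (\<lambda>x. F x y))"
proof -
  note F' = continuous_map_swap_args[OF F]
  define h where "h y = mean (\<lambda>x. F x y)" for y
  define m where "m x = mean (F x)" for x
  have h: "cont h" unfolding h_def by (rule continuous_map_mean[OF F])
  have m: "cont m" unfolding m_def by (rule continuous_map_mean[OF F'])
  have "\<bar>mean m - mean h\<bar> \<le> 0 + d" if d: "0 < d" for d
  proof -
    define e where "e = d / 4"
    have e: "0 < e" using d by (simp add: e_def)
    define N where "N a = {x \<in> carrier G. \<forall>y\<in>carrier G. \<bar>F x y - F a y\<bar> \<le> e}" for a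
    have "\<exists>V. openin T V \<and> a \<in> V \<and> V \<subseteq> N a" if "a \<in> carrier G" for a
    proof -
      have a: "a \<in> topspace T" using that by (simp add: topspace_T)
      obtain V where V: "openin T V" "a \<in> V"
        "\<forall>x\<in>topspace T. \<forall>y\<in>V. dist (F (snd (x, y)) (fst (x, y))) (F (snd (x, a)) (fst (x, a))) < e"
        using compact_uniform_continuity[OF compact_T F' a e] by blast
      have "V \<subseteq> N a"
        using V(3) openin_subset[OF V(1)] by (force simp: N_def topspace_T dist_real_def)
      then show ?thesis using V by blast
    qed
    then obtain V where V: "\<forall>a\<in>carrier G. openin T (V a) \<and> a \<in> V a \<and> V a \<subseteq> N a" by metis
    then have "\<forall>W\<in>V ` carrier G. openin T W" by blast
    moreover have "topspace T \<subseteq> \<Union>(V ` carrier G)" using V by (auto simp: topspace_T)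
    ultimately obtain \<F> where \<F>: "finite \<F>" "\<F> \<subseteq> V ` carrier G" "topspace T \<subseteq> \<Union>\<F>"
      using compact_T unfolding compact_space_alt by meson
    obtain A where A: "finite A" "A \<subseteq> carrier G" "\<F> = V ` A"
      using finite_subset_image[OF \<F>(1,2)] by blast
    have "cont f" if "f \<in> insert h (F ` A)" for f
      using that h cont_section(1)[OF F] A(2) by auto
    then obtain as where as: "points as"
      "\<forall>f\<in>insert h (F ` A). \<forall>x\<in>carrier G. \<bar>lavg as f x - mean f\<bar> \<le> e"
      using mean_approx_finite[OF _ _ e, of "insert h (F ` A)"] A(1) by auto
    have near: "\<bar>lavg as (F x) \<one> - m x\<bar> \<le> 3 * e" if x: "x \<in> carrier G" for x
    proof -
      have "x \<in> topspace T" using x by (simp add: topspace_T)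
      then obtain a where a: "a \<in> A" "x \<in> V a" using \<F>(3) unfolding A(3) by blast
      then have aG: "a \<in> carrier G" and xN: "x \<in> N a" using A(2) V by blast+
      have close: "- e \<le> F x y - F a y \<and> F x y - F a y \<le> e" if "y \<in> carrier G" for y
        using xN that by (force simp: N_def abs_le_iff)
      have c: "cont (\<lambda>y. F x y - F a y)"
        using cont_section(1)[OF F] x aG by (intro continuous_map_diff) auto
      have "\<bar>mean (\<lambda>y. F x y - F a y)\<bar> \<le> e" using close by (intro mean_abs_le[OF c]) (force simp: abs_le_iff)
      then have 1: "\<bar>m x - mean (F a)\<bar> \<le> e"
        using mean_diff[OF cont_section(1)[OF F x] cont_section(1)[OF F aG]] by (simp add: m_def)
      have "lavg as (\<lambda>y. F x y - F a y) \<one> = lavg as (F x) \<one> - lavg as (F a) \<one>"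
        by (simp add: lavg_def sum_list_subtractf diff_divide_distrib)
      then have 2: "\<bar>lavg as (F x) \<one> - lavg as (F a) \<one>\<bar> \<le> e"
        using lavg_bounds[OF as(1) one_closed, of "- e" "\<lambda>y. F x y - F a y" e] close by (simp add: abs_le_iff)
      have "\<bar>lavg as (F a) \<one> - mean (F a)\<bar> \<le> e" using as(2) a(1) by blast
      then show ?thesis using 1 2 by linarith
    qed
    have avg: "cont (\<lambda>x. \<Sum>a\<leftarrow>as. F x (a \<otimes> \<one>)) \<and>
        mean (\<lambda>x. \<Sum>a\<leftarrow>as. F x (a \<otimes> \<one>)) = (\<Sum>a\<leftarrow>as. h (a \<otimes> \<one>))" if "set as \<subseteq> carrier G" for as
      using that
    proof (induction as)
      case (Cons a as)
      then have "cont (\<lambda>x. F x (a \<otimes> \<one>))" using cont_section(2)[OF F, of "a \<otimes> \<one>"] by simp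
      then show ?case using Cons by (simp add: mean_add h_def continuous_map_add)
    qed simp
    have cavg: "cont (\<lambda>x. lavg as (F x) \<one>)"
      using avg[of as] as(1) unfolding lavg_def points_def by (intro continuous_map_real_divide) auto
    have "mean (\<lambda>x. lavg as (F x) \<one>) = lavg as h \<one>"
      using mean_cmult[of "\<lambda>x. \<Sum>a\<leftarrow>as. F x (a \<otimes> \<one>)" "1 / real (length as)"] avg[of as] as(1)
      by (simp add: lavg_def points_def)
    moreover have "\<bar>lavg as h \<one> - mean h\<bar> \<le> e" using as(2) by blast
    moreover have "\<bar>mean (\<lambda>x. lavg as (F x) \<one> - m x)\<bar> \<le> 3 * e"
      using near by (intro mean_abs_le continuous_map_diff cavg m)
    ultimately show ?thesis using mean_diff[OF cavg m] unfolding e_def by linarith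
  qed
  from field_le_epsilon[OF this] show ?thesis by (simp add: h_def[abs_def] m_def[abs_def])
qed

subsection \<open>Inner product and convolution\<close>

definition ip :: "('g \<Rightarrow> real) \<Rightarrow> ('g \<Rightarrow> real) \<Rightarrow> real" where
  "ip f h = mean (\<lambda>x. f x * h x)"

lemma ip_cong: "(\<And>x. x \<in> carrier G \<Longrightarrow> f x = f' x) \<Longrightarrow> (\<And>x. x \<in> carrier G \<Longrightarrow> h x = h' x) \<Longrightarrow> ip f h = ip f' h'"
  unfolding ip_def by (rule mean_cong) simp

lemma ip_commute: "ip f h = ip h f"
  by (simp add: ip_def mult.commute)

lemma ip_cmult: "cont f \<Longrightarrow> cont k \<Longrightarrow> ip k (\<lambda>x. c * f x) = c * ip k f"
  using mean_cmult[of "\<lambda>x. k x * f x" c] by (simp add: ip_def continuous_map_real_mult mult_ac)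

lemma ip_diff: "cont f \<Longrightarrow> cont h \<Longrightarrow> cont k \<Longrightarrow> ip k (\<lambda>x. f x - h x) = ip k f - ip k h"
  unfolding ip_def ring_distribs by (intro mean_diff continuous_map_real_mult)

lemma ip_sum:
  assumes "finite I" "\<And>i. i \<in> I \<Longrightarrow> cont (f i)" "cont k"
  shows "ip k (\<lambda>x. \<Sum>i\<in>I. c i * f i x) = (\<Sum>i\<in>I. c i * ip k (f i))"
proof -
  have "ip k (\<lambda>x. \<Sum>i\<in>I. c i * f i x) = (\<Sum>i\<in>I. ip k (\<lambda>x. c i * f i x))"
    unfolding ip_def sum_distrib_left using assms
    by (intro mean_sum continuous_map_real_mult) auto
  also have "\<dots> = (\<Sum>i\<in>I. c i * ip k (f i))"
    using assms by (intro sum.cong refl ip_cmult) auto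
  finally show ?thesis .
qed

lemma ip_nonneg: "cont f \<Longrightarrow> 0 \<le> ip f f"
  unfolding ip_def by (intro mean_nonneg continuous_map_real_mult) auto

lemma ip_pos: "cont f \<Longrightarrow> x \<in> carrier G \<Longrightarrow> f x \<noteq> 0 \<Longrightarrow> 0 < ip f f"
  unfolding ip_def
  by (rule mean_pos[of _ x]) (simp_all add: continuous_map_real_mult zero_less_mult_iff, linarith)

lemma ip_diff_diff:
  assumes "cont f" "cont h"
  shows "ip (\<lambda>x. a * f x - b * h x) (\<lambda>x. a * f x - b * h x)
    = a * a * ip f f - 2 * a * b * ip f h + b * b * ip h h"
proof -
  have c: "cont (\<lambda>x. a * f x)" "cont (\<lambda>x. b * h x)" "cont (\<lambda>x. a * f x - b * h x)"
    using assms by (intro continuous_map_diff continuous_map_real_mult; simp)+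
  let ?k = "\<lambda>x. a * f x - b * h x"
  have "ip ?k ?k = a * ip ?k f - b * ip ?k h"
    using assms c by (simp add: ip_diff ip_cmult)
  moreover have "ip ?k f = a * ip f f - b * ip f h"
    unfolding ip_commute[of ?k f] using assms c by (simp add: ip_diff ip_cmult)
  moreover have "ip ?k h = a * ip f h - b * ip h h"
    unfolding ip_commute[of ?k h] ip_commute[of f h] using assms c by (simp add: ip_diff ip_cmult)
  ultimately show ?thesis by (simp add: algebra_simps)
qed

lemma cont_lincomb: "cont f \<Longrightarrow> cont h \<Longrightarrow> cont (\<lambda>x. a * f x - b * h x)"
  by (intro continuous_map_diff continuous_map_real_mult) auto

lemma Cauchy_Schwarz:
  assumes "cont f" "cont h"
  shows "(ip f h)\<^sup>2 \<le> ip f f * ip h h"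
proof (cases "ip h h = 0")
  case False
  then have C: "0 < ip h h" using ip_nonneg[OF assms(2)] by simp
  have "0 \<le> ip h h * ip h h * ip f f - 2 * ip h h * ip f h * ip f h + ip f h * ip f h * ip h h"
    using ip_nonneg[OF cont_lincomb[OF assms, of "ip h h" "ip f h"]] unfolding ip_diff_diff[OF assms] .
  also have "\<dots> = ip h h * (ip f f * ip h h - (ip f h)\<^sup>2)" by (simp add: power2_eq_square algebra_simps)
  finally show ?thesis using C by (simp add: zero_le_mult_iff)
next
  case True
  have "ip f h = 0"
  proof (rule ccontr)
    assume n: "ip f h \<noteq> 0"
    define t where "t = (ip f f + 1) / (2 * ip f h)"
    have "0 \<le> ip f f - 2 * t * ip f h"
      using ip_nonneg[OF cont_lincomb[OF assms, of 1 t]] True unfolding ip_diff_diff[OF assms] by simp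
    moreover have "2 * t * ip f h = ip f f + 1" using n by (simp add: t_def)
    ultimately show False by linarith
  qed
  then show ?thesis using True by simp
qed

definition conv :: "('g \<Rightarrow> real) \<Rightarrow> ('g \<Rightarrow> real) \<Rightarrow> 'g \<Rightarrow> real" where
  "conv f h x = mean (\<lambda>y. f y * h (inv y \<otimes> x))"

lemma conv_cong:
  assumes "\<And>x. x \<in> carrier G \<Longrightarrow> f x = f' x" "\<And>x. x \<in> carrier G \<Longrightarrow> h x = h' x" "x \<in> carrier G"
  shows "conv f h x = conv f' h' x"
  unfolding conv_def using assms by (intro mean_cong) auto

lemma cont_kernel:
  assumes "cont h" "x \<in> carrier G"
  shows "cont (\<lambda>y. h (inv y \<otimes> x))"
  by (rule cont_compose[OF assms(1)], intro continuous_map_mult continuous_map_inverse continuous_map_const_T assms(2))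
    simp

lemma cont_conv:
  assumes "cont f" "cont h"
  shows "cont (conv f h)"
  unfolding conv_def[abs_def]
  by (rule continuous_map_mean)
    (intro continuous_map_real_mult cont_compose[OF assms(1)] cont_compose[OF assms(2)]
      continuous_map_mult continuous_map_inverse continuous_map_fst continuous_map_snd)

lemma conv_diff:
  assumes "cont f" "cont h" "cont k" "x \<in> carrier G"
  shows "conv k (\<lambda>x. f x - h x) x = conv k f x - conv k h x"
  unfolding conv_def ring_distribs using assms
  by (intro mean_diff continuous_map_real_mult cont_kernel)

lemma conv_cmult:
  assumes "cont f" "cont k" "x \<in> carrier G"
  shows "conv k (\<lambda>x. c * f x) x = c * conv k f x"
  using mean_cmult[of "\<lambda>y. k y * f (inv y \<otimes> x)" c] assms cont_kernel[of f x]
  by (simp add: conv_def continuous_map_real_mult mult_ac)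

lemma mean_kernel:
  assumes "cont h" "x \<in> carrier G"
  shows "mean (\<lambda>y. h (inv y \<otimes> x)) = mean h"
  using mean_inv[OF cont_right[OF assms]] mean_translate_right[OF assms] by simp

lemma conv_bound:
  assumes "cont f" "cont h" "x \<in> carrier G"
  shows "(conv f h x)\<^sup>2 \<le> ip f f * ip h h"
proof -
  have "(conv f h x)\<^sup>2 \<le> ip f f * ip (\<lambda>y. h (inv y \<otimes> x)) (\<lambda>y. h (inv y \<otimes> x))"
    using Cauchy_Schwarz[OF assms(1) cont_kernel[OF assms(2,3)]] by (simp add: conv_def ip_def)
  also have "ip (\<lambda>y. h (inv y \<otimes> x)) (\<lambda>y. h (inv y \<otimes> x)) = ip h h"
    unfolding ip_def using mean_kernel[of "\<lambda>y. h y * h y" x] assms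
    by (simp add: continuous_map_real_mult)
  finally show ?thesis .
qed

lemma conv_assoc:
  assumes f: "cont f" and h: "cont h" and k: "cont k" and x: "x \<in> carrier G"
  shows "conv (conv f h) k x = conv f (conv h k) x"
proof -
  note intros = continuous_map_real_mult cont_compose[OF f] cont_compose[OF h] cont_compose[OF k]
      continuous_map_mult continuous_map_inverse continuous_map_fst continuous_map_snd continuous_map_const_T
  have "conv (conv f h) k x = mean (\<lambda>y. mean (\<lambda>z. f z * h (inv z \<otimes> y) * k (inv y \<otimes> x)))"
    unfolding conv_def
  proof (rule mean_cong)
    fix y assume y: "y \<in> carrier G"
    have "cont (\<lambda>z. f z * h (inv z \<otimes> y))" using f cont_kernel[OF h y] by (intro continuous_map_real_mult)
    from mean_cmult[OF this, of "k (inv y \<otimes> x)"]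
    show "mean (\<lambda>z. f z * h (inv z \<otimes> y)) * k (inv y \<otimes> x) = mean (\<lambda>z. f z * h (inv z \<otimes> y) * k (inv y \<otimes> x))"
      by (simp add: mult_ac)
  qed
  also have "\<dots> = mean (\<lambda>z. mean (\<lambda>y. f z * h (inv z \<otimes> y) * k (inv y \<otimes> x)))"
    by (rule mean_swap) (intro intros x)
  also have "\<dots> = conv f (conv h k) x"
    unfolding conv_def[of f]
  proof (rule mean_cong)
    fix z assume z: "z \<in> carrier G"
    have c: "cont (\<lambda>y. h (inv z \<otimes> y) * k (inv y \<otimes> x))"
      using z x by (intro continuous_map_real_mult cont_left h cont_kernel k) auto
    have "mean (\<lambda>y. f z * h (inv z \<otimes> y) * k (inv y \<otimes> x)) = f z * mean (\<lambda>y. h (inv z \<otimes> y) * k (inv y \<otimes> x))"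
      using mean_cmult[OF c, of "f z"] by (simp add: mult_ac)
    also have "mean (\<lambda>y. h (inv z \<otimes> y) * k (inv y \<otimes> x)) = mean (\<lambda>y. h (inv z \<otimes> (z \<otimes> y)) * k (inv (z \<otimes> y) \<otimes> x))"
      by (rule mean_translate_left[OF c z, symmetric])
    also have "\<dots> = conv h k (inv z \<otimes> x)"
      unfolding conv_def using z x by (intro mean_cong) (simp add: inv_mult_group m_assoc flip: m_assoc[of "inv z" z])
    finally show "mean (\<lambda>y. f z * h (inv z \<otimes> y) * k (inv y \<otimes> x)) = f z * conv h k (inv z \<otimes> x)" .
  qed
  finally show ?thesis .
qed

definition symm :: "('g \<Rightarrow> real) \<Rightarrow> bool" where
  "symm f \<longleftrightarrow> (\<forall>x\<in>carrier G. f (inv x) = f x)"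

lemma conv_inv:
  assumes f: "cont f" "symm f" and h: "cont h" "symm h" and x: "x \<in> carrier G"
  shows "conv f h (inv x) = conv h f x"
proof -
  have c: "cont (\<lambda>y. h y * f (inv y \<otimes> x))" using h f x by (intro continuous_map_real_mult cont_kernel)
  have "conv h f x = mean (\<lambda>y. h (x \<otimes> y) * f (inv (x \<otimes> y) \<otimes> x))"
    unfolding conv_def by (rule mean_translate_left[OF c x, symmetric])
  also have "\<dots> = conv f h (inv x)"
    unfolding conv_def
  proof (rule mean_cong)
    fix y assume y: "y \<in> carrier G"
    have "inv (x \<otimes> y) \<otimes> x = inv y" using x y by (simp add: inv_mult_group m_assoc)
    moreover have "h (x \<otimes> y) = h (inv y \<otimes> inv x)"
      using h(2) x y by (simp add: symm_def flip: inv_mult_group)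
    moreover have "f (inv y) = f y" using f(2) y by (simp add: symm_def)
    ultimately show "h (x \<otimes> y) * f (inv (x \<otimes> y) \<otimes> x) = f y * h (inv y \<otimes> inv x)"
      by simp
  qed
  finally show ?thesis by simp
qed

lemma conv_one:
  assumes "symm h"
  shows "conv f h \<one> = ip f h"
  unfolding conv_def ip_def by (rule mean_cong) (use assms in \<open>simp add: symm_def\<close>)

text \<open>
  The \<open>(n + 1)\<close>-fold convolution power; there is no continuous unit to start from, in general.
\<close>

primrec cpow :: "('g \<Rightarrow> real) \<Rightarrow> nat \<Rightarrow> 'g \<Rightarrow> real" where
  "cpow f 0 = f"
| "cpow f (Suc n) = conv f (cpow f n)"

lemma cont_cpow: "cont f \<Longrightarrow> cont (cpow f n)"
  by (induction n) (auto intro: cont_conv)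

lemma cpow_add:
  assumes f: "cont f" and x: "x \<in> carrier G"
  shows "conv (cpow f m) (cpow f n) x = cpow f (Suc (m + n)) x"
  using x
proof (induction m arbitrary: x)
  case (Suc m)
  have "conv (cpow f (Suc m)) (cpow f n) x = conv f (conv (cpow f m) (cpow f n)) x"
    using conv_assoc[OF f cont_cpow[OF f] cont_cpow[OF f] Suc.prems] by simp
  also have "\<dots> = conv f (cpow f (Suc (m + n))) x"
    using Suc by (intro conv_cong) auto
  finally show ?case by simp
qed simp

lemma symm_cpow:
  assumes f: "cont f" "symm f"
  shows "symm (cpow f n)"
proof (induction n)
  case (Suc n)
  have "conv f (cpow f n) (inv x) = conv f (cpow f n) x" if x: "x \<in> carrier G" for x
    using conv_inv[OF f cont_cpow[OF f(1)] Suc x] cpow_add[OF f(1) x, of n 0] by simp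
  then show ?case by (simp add: symm_def)
qed (use f in simp)

lemma ip_cpow:
  assumes "cont f" "symm f"
  shows "ip (cpow f m) (cpow f n) = cpow f (Suc (m + n)) \<one>"
  using conv_one[OF symm_cpow[OF assms]] cpow_add[OF assms(1) one_closed] by simp

end

text \<open>
  By logarithmic convexity the ratios \<open>a (n + 1) / a n\<close> increase; let \<open>\<mu>\<close> be their limit.  Then
  \<open>a n / \<mu>^(n+1)\<close> decreases.  It stays above \<open>1\<close>, because
  \<open>a n \<ge> a (m + n + 1) / a m\<close> is a product of \<open>n + 1\<close> successive ratios, which tends to \<open>\<mu>^(n+1)\<close>
  as \<open>m\<close> grows.
\<close>

lemma log_convex_submultiplicative_limit:
  fixes a :: "nat \<Rightarrow> real"
  assumes pos: "\<And>n. 0 < a n"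
    and log_convex: "\<And>n. (a (Suc n))\<^sup>2 \<le> a n * a (Suc (Suc n))"
    and submult: "\<And>m n. a (Suc (m + n)) \<le> a m * a n"
  shows "\<exists>\<mu>>0. \<exists>b>0. (\<lambda>n. a n / \<mu> ^ Suc n) \<longlonglongrightarrow> b"
proof -
  define r where "r n = a (Suc n) / a n" for n
  have rpos: "0 < r n" for n using pos by (simp add: r_def)
  have inc: "r n \<le> r (Suc n)" for n
    using log_convex[of n] pos[of n] pos[of "Suc n"] by (simp add: r_def field_simps power2_eq_square)
  have rinc: "incseq r" using inc by (rule incseq_SucI)
  have bound: "r n \<le> a 0" for n
    using submult[of n 0] pos[of n] by (simp add: r_def field_simps)
  obtain \<mu> where \<mu>: "r \<longlonglongrightarrow> \<mu>" "\<forall>n. r n \<le> \<mu>"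
    using incseq_convergent[OF rinc, of "a 0"] bound by blast
  have \<mu>pos: "0 < \<mu>" using rpos[of 0] \<mu>(2) by (meson less_le_trans)
  have prod: "a (Suc (m + n)) = a m * (\<Prod>i\<le>n. r (i + m))" for m n
  proof (induction n)
    case 0
    show ?case using pos[of m] by (simp add: r_def)
  next
    case (Suc n)
    have "a (Suc (m + Suc n)) = a (Suc (m + n)) * r (Suc n + m)"
      using pos[of "Suc (m + n)"] by (simp add: r_def add_ac)
    then show ?case by (simp add: Suc.IH)
  qed
  have low: "\<mu> ^ Suc n \<le> a n" for n
  proof -
    have "(\<lambda>m. \<Prod>i\<le>n. r (i + m)) \<longlonglongrightarrow> (\<Prod>i\<le>n. \<mu>)"
      using LIMSEQ_ignore_initial_segment[OF \<mu>(1)] by (intro tendsto_prod) (simp add: add.commute)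
    moreover have "(\<Prod>i\<le>n. r (i + m)) \<le> a n" for m
      using submult[of m n] pos[of m] by (simp add: prod)
    then have "\<exists>N. \<forall>m\<ge>N. (\<Prod>i\<le>n. r (i + m)) \<le> a n" by blast
    ultimately have "(\<Prod>i\<le>n. \<mu>) \<le> a n"
      by (rule LIMSEQ_le_const2)
    then show ?thesis by simp
  qed
  define b where "b n = a n / \<mu> ^ Suc n" for n
  have b1: "1 \<le> b n" for n
    using low[of n] \<mu>pos by (simp add: b_def)
  have "b (Suc n) \<le> b n" for n
  proof -
    have "a (Suc n) \<le> \<mu> * a n"
      using \<mu>(2)[rule_format, of n] pos[of n] by (simp add: r_def pos_divide_le_eq)
    then show ?thesis using \<mu>pos by (simp add: b_def field_simps)
  qed
  then have dec: "decseq b" by (rule decseq_SucI)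
  obtain L where L: "b \<longlonglongrightarrow> L" using decseq_convergent[OF dec, of 1] b1 by blast
  have "1 \<le> L" using L b1 by (intro LIMSEQ_le_const) auto
  then show ?thesis using L \<mu>pos unfolding b_def by (intro exI[of _ \<mu>] conjI exI[of _ L]) auto
qed

context compact_group
begin

lemma continuous_map_uniform_limit_real:
  assumes "\<And>n::nat. cont (u n)"
    and "\<And>e. 0 < e \<Longrightarrow> \<exists>N. \<forall>n\<ge>N. \<forall>x\<in>carrier G. \<bar>u n x - \<psi> x\<bar> \<le> e"
  shows "cont \<psi>"
  unfolding continuous_map_euclidean_iff_dist
proof (intro ballI allI impI)
  fix x :: 'g and e :: real assume x: "x \<in> topspace T" and e: "0 < e"
  have "0 < e / 4" using e by simp
  then obtain N where N: "\<forall>n\<ge>N. \<forall>x\<in>carrier G. \<bar>u n x - \<psi> x\<bar> \<le> e / 4" using assms(2) by blast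
  have "\<forall>x\<in>topspace T. \<forall>e>0. \<exists>U. openin T U \<and> x \<in> U \<and> (\<forall>y\<in>U. dist (u N y) (u N x) < e)"
    using assms(1)[of N] unfolding continuous_map_euclidean_iff_dist .
  then obtain U where U: "openin T U" "x \<in> U" "\<forall>y\<in>U. dist (u N y) (u N x) < e / 4"
    using x \<open>0 < e / 4\<close> by blast
  have "dist (\<psi> y) (\<psi> x) < e" if "y \<in> U" for y
  proof -
    have "y \<in> carrier G" using that openin_subset[OF U(1)] by (auto simp: topspace_T)
    then have "\<bar>u N y - \<psi> y\<bar> \<le> e / 4" "\<bar>u N x - \<psi> x\<bar> \<le> e / 4" using N x by (auto simp: topspace_T)
    moreover have "\<bar>u N y - u N x\<bar> < e / 4" using U(3) that by (simp add: dist_real_def)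
    ultimately show ?thesis unfolding dist_real_def using e by linarith
  qed
  then show "\<exists>U. openin T U \<and> x \<in> U \<and> (\<forall>y\<in>U. dist (\<psi> y) (\<psi> x) < e)" using U by blast
qed

lemma ip_self_le:
  assumes "cont f" "\<And>x. x \<in> carrier G \<Longrightarrow> \<bar>f x\<bar> \<le> e"
  shows "ip f f \<le> e\<^sup>2"
proof -
  have c: "cont (\<lambda>x. f x * f x)" using assms(1) by (intro continuous_map_real_mult)
  have "mean (\<lambda>x. f x * f x) \<le> e\<^sup>2"
  proof (rule mean_bounds_between(2)[OF c, of 0])
    fix x assume "x \<in> carrier G"
    then have "\<bar>f x\<bar>\<^sup>2 \<le> e\<^sup>2" by (intro power_mono assms(2)) auto
    then show "0 \<le> f x * f x \<and> f x * f x \<le> e\<^sup>2" by (simp add: power2_eq_square)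
  qed
  then show ?thesis by (simp add: ip_def)
qed

lemma ip_conv_le:
  assumes "cont f" "cont h"
  shows "ip (conv f h) (conv f h) \<le> ip f f * ip h h"
proof -
  have "\<bar>conv f h x\<bar> \<le> sqrt (ip f f * ip h h)" if "x \<in> carrier G" for x
    using conv_bound[OF assms that] real_sqrt_le_mono by fastforce
  from ip_self_le[OF cont_conv[OF assms] this] show ?thesis
    using ip_nonneg[OF assms(1)] ip_nonneg[OF assms(2)] by simp
qed

text \<open>
  The power method.  Convolution with \<open>\<kappa>\<close> is a self-adjoint operator whose Hilbert--Schmidt norm
  is the norm of \<open>\<kappa>\<close> itself.  The norms \<open>a n\<close> of the powers of \<open>\<kappa>\<close> are logarithmically convex because
  of self-adjointness, and submultiplicative because the Hilbert--Schmidt norm is.  So the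
  normalized norms \<open>a n / \<mu>^(n+1)\<close> decrease to a positive limit.  As inner products of powers of
  \<open>\<kappa>\<close> depend on the sum of the exponents only, the normalized even powers form a Cauchy sequence in
  mean square, and a uniform one after a further convolution.  The limit is the kernel of the
  projection on the eigenspace of \<open>\<kappa> * \<kappa>\<close> for the top eigenvalue \<open>\<mu>\<^sup>2\<close>.
\<close>

theorem symmetric_kernel_eigenfunction:
  assumes \<kappa>: "cont \<kappa>" "symm \<kappa>" and nz: "x0 \<in> carrier G" "\<kappa> x0 \<noteq> 0"
  shows "\<exists>\<psi> \<nu>. cont \<psi> \<and> symm \<psi> \<and> 0 < \<nu> \<and> (\<exists>x\<in>carrier G. \<psi> x \<noteq> 0) \<and>
    (\<forall>x\<in>carrier G. conv (conv \<kappa> \<kappa>) \<psi> x = \<nu> * \<psi> x)"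
proof -
  note c = cont_cpow[OF \<kappa>(1)]
  define q where "q n = ip (cpow \<kappa> n) (cpow \<kappa> n)" for n
  define a where "a n = sqrt (q n)" for n
  have ipq: "ip (cpow \<kappa> m) (cpow \<kappa> n) = q k" if "m + n = 2 * k" for m n k
    unfolding q_def ip_cpow[OF \<kappa>] that mult_2 ..
  have qnn: "0 \<le> q n" for n unfolding q_def by (rule ip_nonneg[OF c])
  have logq: "(q (Suc n))\<^sup>2 \<le> q n * q (Suc (Suc n))" for n
    using Cauchy_Schwarz[OF c c, of n "Suc (Suc n)"] ipq[of n "Suc (Suc n)" "Suc n"] by (simp add: q_def)
  have subq: "q (Suc (m + n)) \<le> q m * q n" for m n
  proof -
    have "q (Suc (m + n)) = ip (conv (cpow \<kappa> m) (cpow \<kappa> n)) (conv (cpow \<kappa> m) (cpow \<kappa> n))"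
      unfolding q_def by (rule ip_cong) (simp_all only: cpow_add[OF \<kappa>(1)])
    also have "\<dots> \<le> q m * q n" unfolding q_def by (rule ip_conv_le[OF c c])
    finally show ?thesis .
  qed
  have q0: "0 < q 0" unfolding q_def using ip_pos[OF \<kappa>(1) nz] by simp
  have q1: "0 < q 1"
  proof -
    have "cpow \<kappa> 1 \<one> = q 0" using ip_cpow[OF \<kappa>, of 0 0] by (simp add: q_def)
    then have "cpow \<kappa> 1 \<one> \<noteq> 0" using q0 by linarith
    then show ?thesis unfolding q_def by (rule ip_pos[OF c one_closed])
  qed
  have qpos: "0 < q n" for n
  proof -
    have "0 < q n \<and> 0 < q (Suc n)"
    proof (induction n)
      case (Suc n)
      then have "0 < (q (Suc n))\<^sup>2" by simp
      also have "\<dots> \<le> q n * q (Suc (Suc n))" by (rule logq)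
      finally show ?case using Suc by (simp add: zero_less_mult_iff)
    qed (use q0 q1 in simp)
    then show ?thesis by simp
  qed
  have apos: "0 < a n" for n using qpos by (simp add: a_def)
  have a2: "(a n)\<^sup>2 = q n" for n using qnn by (simp add: a_def)
  have "\<exists>\<mu>>0. \<exists>b>0. (\<lambda>n. a n / \<mu> ^ Suc n) \<longlonglongrightarrow> b"
  proof (rule log_convex_submultiplicative_limit)
    show "(a (Suc n))\<^sup>2 \<le> a n * a (Suc (Suc n))" for n
      unfolding a2 unfolding a_def real_sqrt_mult[symmetric] by (rule real_le_rsqrt) (rule logq)
    show "a (Suc (m + n)) \<le> a m * a n" for m n
      unfolding a_def real_sqrt_mult[symmetric] by (rule real_sqrt_le_mono) (rule subq)
  qed (rule apos)
  then obtain \<mu> b where \<mu>: "0 < \<mu>" and b: "0 < b" and lim: "(\<lambda>n. a n / \<mu> ^ Suc n) \<longlonglongrightarrow> b" by blast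
  define C where "C n = (a (Suc n) / \<mu> ^ Suc (Suc n))\<^sup>2" for n
  have Clim: "C \<longlonglongrightarrow> b\<^sup>2"
    unfolding C_def using lim by (intro tendsto_power) (rule LIMSEQ_Suc)
  define d where "d n = inverse (\<mu> ^ (2 * n + 2))" for n
  \<comment> \<open>The convolution power of exponent \<open>2 n + 2\<close>, divided by the same power of \<open>\<mu>\<close>.\<close>
  define u where "u n x = d n * cpow \<kappa> (Suc (2 * n)) x" for n x
  have cu: "cont (u n)" for n unfolding u_def[abs_def] by (intro continuous_map_real_mult c) simp
  have ipu: "ip (u m) (u n) = C (m + n)" for m n
  proof -
    have "ip (u m) (u n) = d n * ip (u m) (cpow \<kappa> (Suc (2 * n)))"
      unfolding u_def[of n, abs_def] by (rule ip_cmult[OF c cu])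
    also have "ip (u m) (cpow \<kappa> (Suc (2 * n))) = d m * ip (cpow \<kappa> (Suc (2 * m))) (cpow \<kappa> (Suc (2 * n)))"
      unfolding ip_commute[of "u m"] ip_commute[of "cpow \<kappa> (Suc (2 * m))"]
      unfolding u_def[of m, abs_def] by (rule ip_cmult[OF c c])
    also have "ip (cpow \<kappa> (Suc (2 * m))) (cpow \<kappa> (Suc (2 * n))) = q (Suc (m + n))"
      by (rule ipq) simp
    also have "d n * (d m * q (Suc (m + n))) = C (m + n)"
    proof -
      have "d n * d m = inverse (\<mu> ^ (Suc (Suc (m + n)) * 2))"
        unfolding d_def inverse_mult_distrib[symmetric] power_add[symmetric]
        by (intro arg_cong[where f="\<lambda>k. inverse (\<mu> ^ k)"]) simp
      moreover have "C (m + n) = q (Suc (m + n)) * inverse (\<mu> ^ (Suc (Suc (m + n)) * 2))"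
        unfolding C_def power_divide a2 power_mult by (rule divide_inverse)
      moreover have "d n * (d m * q (Suc (m + n))) = q (Suc (m + n)) * (d n * d m)" by (simp only: mult_ac)
      ultimately show ?thesis by simp
    qed
    finally show ?thesis .
  qed
  have ipdiff: "ip (\<lambda>x. u m x - u n x) (\<lambda>x. u m x - u n x) = C (m + m) - 2 * C (m + n) + C (n + n)" for m n
    using ip_diff_diff[OF cu[of m] cu[of n], of 1 1] by (simp add: ipu)
  define \<kappa>2 where "\<kappa>2 = conv \<kappa> \<kappa>"
  have c2: "cont \<kappa>2" unfolding \<kappa>2_def by (rule cont_conv[OF \<kappa>(1) \<kappa>(1)])
  have step: "conv \<kappa>2 (u n) x = \<mu>\<^sup>2 * u (Suc n) x" if x: "x \<in> carrier G" for n x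
  proof -
    have "conv \<kappa>2 (u n) x = d n * conv (cpow \<kappa> 1) (cpow \<kappa> (Suc (2 * n))) x"
      unfolding \<kappa>2_def u_def[abs_def] using conv_cmult[OF c[of "Suc (2 * n)"] c[of 1] x, of "d n"] by simp
    also have "conv (cpow \<kappa> 1) (cpow \<kappa> (Suc (2 * n))) x = cpow \<kappa> (Suc (2 * Suc n)) x"
      using cpow_add[OF \<kappa>(1) x, of 1 "Suc (2 * n)"] by simp
    also have "d n = \<mu>\<^sup>2 * d (Suc n)" using \<mu> by (simp add: d_def power2_eq_square field_simps)
    finally show ?thesis unfolding u_def by (simp only: mult.assoc)
  qed
  define M where "M = ip \<kappa>2 \<kappa>2"
  have M: "0 \<le> M" unfolding M_def by (rule ip_nonneg[OF c2])
  have uclose: "(\<mu>\<^sup>2 * (u (Suc m) x - u (Suc n) x))\<^sup>2 \<le> M * (C (m + m) - 2 * C (m + n) + C (n + n))"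
    if x: "x \<in> carrier G" for m n x
  proof -
    have cd: "cont (\<lambda>x. u m x - u n x)" using cu by (intro continuous_map_diff)
    have "\<mu>\<^sup>2 * (u (Suc m) x - u (Suc n) x) = conv \<kappa>2 (\<lambda>x. u m x - u n x) x"
      unfolding conv_diff[OF cu cu c2 x] step[OF x] by (simp add: algebra_simps)
    then show ?thesis using conv_bound[OF c2 cd x] by (simp add: ipdiff M_def)
  qed
  have Cauchy: "\<exists>N. \<forall>m\<ge>N. \<forall>n\<ge>N. \<forall>x\<in>carrier G. \<bar>u m x - u n x\<bar> \<le> e" if e: "0 < e" for e
  proof -
    define \<delta> where "\<delta> = (\<mu>\<^sup>2 * e)\<^sup>2 / (4 * (M + 1))"
    have \<delta>: "0 < \<delta>" using e \<mu> M by (simp add: \<delta>_def)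
    obtain N where N: "\<forall>n\<ge>N. dist (C n) (b\<^sup>2) < \<delta>"
      using metric_LIMSEQ_D[OF Clim \<delta>] by blast
    have "\<bar>u (Suc m) x - u (Suc n) x\<bar> \<le> e" if mn: "N \<le> m" "N \<le> n" and x: "x \<in> carrier G" for m n x
    proof -
      have "\<bar>C (m + m) - b\<^sup>2\<bar> < \<delta>" "\<bar>C (m + n) - b\<^sup>2\<bar> < \<delta>" "\<bar>C (n + n) - b\<^sup>2\<bar> < \<delta>"
        using N mn unfolding dist_real_def by auto
      then have "C (m + m) - 2 * C (m + n) + C (n + n) \<le> 4 * \<delta>" by linarith
      then have "M * (C (m + m) - 2 * C (m + n) + C (n + n)) \<le> M * (4 * \<delta>)" using M by (rule mult_left_mono)
      also have "\<dots> \<le> (M + 1) * (4 * \<delta>)" using \<delta> by simp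
      also have "\<dots> = (\<mu>\<^sup>2 * e)\<^sup>2"
      proof -
        have "M + 1 \<noteq> 0" using M by linarith
        then show ?thesis unfolding \<delta>_def by (simp add: field_simps)
      qed
      finally have "(\<mu>\<^sup>2 * (u (Suc m) x - u (Suc n) x))\<^sup>2 \<le> (\<mu>\<^sup>2 * e)\<^sup>2" using uclose[OF x, of m n] by simp
      then have "\<bar>\<mu>\<^sup>2 * (u (Suc m) x - u (Suc n) x)\<bar> \<le> \<bar>\<mu>\<^sup>2 * e\<bar>" by (simp add: abs_le_square_iff)
      then show ?thesis using \<mu> e by (simp add: abs_mult)
    qed
    then have "\<bar>u m x - u n x\<bar> \<le> e" if "m \<ge> Suc N" "n \<ge> Suc N" "x \<in> carrier G" for m n x
      using that by (cases m; cases n) auto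
    then show ?thesis by blast
  qed
  define \<psi> where "\<psi> x = lim (\<lambda>n. u n x)" for x
  have ulim: "(\<lambda>n. u n x) \<longlonglongrightarrow> \<psi> x" if x: "x \<in> carrier G" for x
  proof -
    have "Cauchy (\<lambda>n. u n x)"
    proof (rule metric_CauchyI)
      fix e :: real assume "0 < e"
      then have "0 < e / 2" by simp
      then obtain N where N: "\<forall>m\<ge>N. \<forall>n\<ge>N. \<forall>x\<in>carrier G. \<bar>u m x - u n x\<bar> \<le> e / 2" using Cauchy by blast
      have "dist (u m x) (u n x) < e" if "m \<ge> N" "n \<ge> N" for m n
      proof -
        have "\<bar>u m x - u n x\<bar> \<le> e / 2" using N that x by blast
        then show ?thesis unfolding dist_real_def using \<open>0 < e\<close> by linarith
      qed
      then show "\<exists>N. \<forall>m\<ge>N. \<forall>n\<ge>N. dist (u m x) (u n x) < e" by blast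
    qed
    then show ?thesis unfolding \<psi>_def by (simp add: Cauchy_convergent_iff convergent_LIMSEQ_iff)
  qed
  have unif: "\<exists>N. \<forall>n\<ge>N. \<forall>x\<in>carrier G. \<bar>u n x - \<psi> x\<bar> \<le> e" if e: "0 < e" for e
  proof -
    obtain N where N: "\<forall>m\<ge>N. \<forall>n\<ge>N. \<forall>x\<in>carrier G. \<bar>u m x - u n x\<bar> \<le> e" using Cauchy[OF e] by blast
    have "\<bar>u n x - \<psi> x\<bar> \<le> e" if n: "n \<ge> N" and x: "x \<in> carrier G" for n x
    proof (rule LIMSEQ_le_const2)
      show "(\<lambda>m. \<bar>u n x - u m x\<bar>) \<longlonglongrightarrow> \<bar>u n x - \<psi> x\<bar>" by (intro tendsto_intros ulim x)
      show "\<exists>N. \<forall>m\<ge>N. \<bar>u n x - u m x\<bar> \<le> e" using N n x by blast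
    qed
    then show ?thesis by blast
  qed
  have c\<psi>: "cont \<psi>" by (rule continuous_map_uniform_limit_real[OF cu unif])
  have "symm \<psi>"
    using symm_cpow[OF \<kappa>] unfolding symm_def \<psi>_def u_def by (simp del: cpow.simps)
  moreover have "\<exists>x\<in>carrier G. \<psi> x \<noteq> 0"
  proof (rule ccontr)
    assume z: "\<not> (\<exists>x\<in>carrier G. \<psi> x \<noteq> 0)"
    define e where "e = b / 2"
    have e: "0 < e" using b by (simp add: e_def)
    obtain N where N: "\<forall>n\<ge>N. \<forall>x\<in>carrier G. \<bar>u n x - \<psi> x\<bar> \<le> e" using unif[OF e] by blast
    have "C (n + n) \<le> e\<^sup>2" if n: "n \<ge> N" for n
      using ip_self_le[OF cu, of n e] N n z ipu[of n n] by simp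
    moreover have "(\<lambda>n. C (n + n)) \<longlonglongrightarrow> b\<^sup>2"
      using LIMSEQ_subseq_LIMSEQ[OF Clim, of "\<lambda>n. n + n"] by (simp add: strict_mono_def o_def)
    ultimately have "b\<^sup>2 \<le> e\<^sup>2" by (intro LIMSEQ_le_const2) auto
    then show False using b by (simp add: e_def power2_eq_square)
  qed
  moreover have "conv \<kappa>2 \<psi> x = \<mu>\<^sup>2 * \<psi> x" if x: "x \<in> carrier G" for x
  proof (rule LIMSEQ_unique)
    show "(\<lambda>n. conv \<kappa>2 (u n) x) \<longlonglongrightarrow> \<mu>\<^sup>2 * \<psi> x"
      unfolding step[OF x] by (intro tendsto_intros LIMSEQ_Suc ulim x)
    show "(\<lambda>n. conv \<kappa>2 (u n) x) \<longlonglongrightarrow> conv \<kappa>2 \<psi> x"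
    proof (rule metric_LIMSEQ_I)
      fix e :: real assume e: "0 < e"
      define \<delta> where "\<delta> = e / (2 * (sqrt M + 1))"
      have \<delta>: "0 < \<delta>" using e M by (simp add: \<delta>_def add_nonneg_pos)
      obtain N where N: "\<forall>n\<ge>N. \<forall>x\<in>carrier G. \<bar>u n x - \<psi> x\<bar> \<le> \<delta>" using unif[OF \<delta>] by blast
      have "dist (conv \<kappa>2 (u n) x) (conv \<kappa>2 \<psi> x) < e" if n: "n \<ge> N" for n
      proof -
        have cd: "cont (\<lambda>x. u n x - \<psi> x)" using cu c\<psi> by (intro continuous_map_diff)
        have "(conv \<kappa>2 (u n) x - conv \<kappa>2 \<psi> x)\<^sup>2 \<le> M * ip (\<lambda>x. u n x - \<psi> x) (\<lambda>x. u n x - \<psi> x)"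
          using conv_bound[OF c2 cd x] unfolding conv_diff[OF cu c\<psi> c2 x] M_def .
        also have "\<dots> \<le> M * \<delta>\<^sup>2"
          using N n by (intro mult_left_mono M ip_self_le[OF cd]) auto
        finally have "\<bar>conv \<kappa>2 (u n) x - conv \<kappa>2 \<psi> x\<bar> \<le> sqrt (M * \<delta>\<^sup>2)" using real_sqrt_le_mono by fastforce
        also have "\<dots> = sqrt M * \<delta>" using \<delta> by (simp add: real_sqrt_mult)
        also have "\<dots> < e"
        proof -
          have "0 < 2 * (sqrt M + 1)" by (intro mult_pos_pos add_nonneg_pos real_sqrt_ge_zero M) simp_all
          then have "\<delta> * (2 * (sqrt M + 1)) = e" unfolding \<delta>_def by (metis less_irrefl nonzero_divide_eq_eq)
          moreover have "0 \<le> \<delta> * sqrt M" using \<delta> real_sqrt_ge_zero[OF M] by (intro mult_nonneg_nonneg) auto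
          ultimately show ?thesis using \<delta> unfolding ring_distribs by (simp add: mult.commute)
        qed
        finally show ?thesis by (simp add: dist_real_def)
      qed
      then show "\<exists>N. \<forall>n\<ge>N. dist (conv \<kappa>2 (u n) x) (conv \<kappa>2 \<psi> x) < e" by blast
    qed
  qed
  ultimately show ?thesis
    using c\<psi> \<mu> unfolding \<kappa>2_def by (intro exI[of _ \<psi>] exI[of _ "\<mu>\<^sup>2"]) auto
qed

subsection \<open>Eigenspaces of convolution operators\<close>

definition eigen :: "('g \<Rightarrow> real) \<Rightarrow> real \<Rightarrow> ('g \<Rightarrow> real) \<Rightarrow> bool" where
  "eigen k \<nu> f \<longleftrightarrow> cont f \<and> (\<forall>x\<in>carrier G. conv f k x = \<nu> * f x)"

definition orthonormal :: "nat \<Rightarrow> (nat \<Rightarrow> 'g \<Rightarrow> real) \<Rightarrow> bool" where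
  "orthonormal m e \<longleftrightarrow> (\<forall>i<m. \<forall>j<m. ip (e i) (e j) = (if i = j then 1 else 0))"

lemma Bessel:
  assumes e: "\<And>i. i < m \<Longrightarrow> cont (e i)" and on: "orthonormal m e" and f: "cont f"
  shows "(\<Sum>i<m. (ip f (e i))\<^sup>2) \<le> ip f f"
    and "ip (\<lambda>x. f x - (\<Sum>i<m. ip f (e i) * e i x)) (\<lambda>x. f x - (\<Sum>i<m. ip f (e i) * e i x))
      = ip f f - (\<Sum>i<m. (ip f (e i))\<^sup>2)"
    and "\<And>j. j < m \<Longrightarrow> ip (\<lambda>x. f x - (\<Sum>i<m. ip f (e i) * e i x)) (e j) = 0"
proof -
  define p where "p x = (\<Sum>i<m. ip f (e i) * e i x)" for x
  have cp: "cont p" unfolding p_def[abs_def] using e by (intro continuous_map_sum continuous_map_real_mult) auto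
  have cfp: "cont (\<lambda>x. f x - p x)" by (intro continuous_map_diff f cp)
  have ipp: "ip k p = (\<Sum>i<m. ip f (e i) * ip k (e i))" if "cont k" for k
    unfolding p_def[abs_def] using e that by (intro ip_sum) auto
  show orth: "ip (\<lambda>x. f x - p x) (e j) = 0" if j: "j < m" for j
  proof -
    have "ip (\<lambda>x. f x - p x) (e j) = ip (e j) f - ip (e j) p"
      unfolding ip_commute[of "\<lambda>x. f x - p x"] by (rule ip_diff[OF f cp e[OF j]])
    also have "ip (e j) p = (\<Sum>i<m. ip f (e i) * (if j = i then 1 else 0))"
      unfolding ipp[OF e[OF j]] using on j by (intro sum.cong refl) (auto simp: orthonormal_def)
    also have "\<dots> = ip f (e j)" using j by (simp add: if_distrib[where f="\<lambda>z. _ * z"] cong: if_cong)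
    also have "\<dots> = ip (e j) f" by (rule ip_commute)
    finally show ?thesis by simp
  qed
  have "ip (\<lambda>x. f x - p x) (\<lambda>x. f x - p x) = ip (\<lambda>x. f x - p x) f - ip (\<lambda>x. f x - p x) p"
    by (rule ip_diff[OF f cp cfp])
  also have "ip (\<lambda>x. f x - p x) p = 0" unfolding ipp[OF cfp] by (intro sum.neutral) (simp add: orth)
  also have "ip (\<lambda>x. f x - p x) f = ip f f - ip f p"
    unfolding ip_commute[of "\<lambda>x. f x - p x"] by (rule ip_diff[OF f cp f])
  also have "ip f p = (\<Sum>i<m. (ip f (e i))\<^sup>2)" unfolding ipp[OF f] by (simp add: power2_eq_square)
  finally show eq: "ip (\<lambda>x. f x - p x) (\<lambda>x. f x - p x) = ip f f - (\<Sum>i<m. (ip f (e i))\<^sup>2)" by simp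
  show "(\<Sum>i<m. (ip f (e i))\<^sup>2) \<le> ip f f"
    using ip_nonneg[OF cfp] unfolding eq by simp
qed

text \<open>
  The coefficient of \<open>y \<mapsto> k (y\<inverse> x)\<close> with respect to \<open>e i\<close> is \<open>\<nu> * e i x\<close>.  Averaging Bessel's
  inequality over \<open>x\<close> bounds the dimension of the eigenspace.
\<close>

lemma eigen_orthonormal_bound:
  assumes k: "cont k" and e: "\<And>i. i < m \<Longrightarrow> eigen k \<nu> (e i)" and on: "orthonormal m e"
  shows "real m * \<nu>\<^sup>2 \<le> ip k k"
proof -
  have ce: "cont (e i)" if "i < m" for i using e[OF that] by (simp add: eigen_def)
  have "(\<Sum>i<m. \<nu>\<^sup>2 * (e i x * e i x)) \<le> ip k k" if x: "x \<in> carrier G" for x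
  proof -
    let ?f = "\<lambda>y. k (inv y \<otimes> x)"
    have cf: "cont ?f" by (rule cont_kernel[OF k x])
    have "ip ?f (e i) = \<nu> * e i x" if "i < m" for i
      using e[OF that] x unfolding ip_commute[of ?f] by (simp add: eigen_def ip_def conv_def)
    then have "(\<Sum>i<m. \<nu>\<^sup>2 * (e i x * e i x)) = (\<Sum>i<m. (ip ?f (e i))\<^sup>2)"
      by (intro sum.cong refl) (simp add: power2_eq_square)
    also have "\<dots> \<le> ip ?f ?f" by (rule Bessel(1)[OF ce on cf])
    also have "\<dots> = ip k k"
      unfolding ip_def using mean_kernel[of "\<lambda>y. k y * k y" x] x k by (simp add: continuous_map_real_mult)
    finally show ?thesis .
  qed
  then have "mean (\<lambda>x. \<Sum>i<m. \<nu>\<^sup>2 * (e i x * e i x)) \<le> mean (\<lambda>x. ip k k)"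
    using ce by (intro mean_mono continuous_map_sum continuous_map_real_mult) auto
  also have "mean (\<lambda>x. \<Sum>i<m. \<nu>\<^sup>2 * (e i x * e i x)) = (\<Sum>i<m. \<nu>\<^sup>2 * ip (e i) (e i))"
    unfolding ip_def using ce
    by (subst mean_sum) (auto intro!: continuous_map_real_mult sum.cong mean_cmult)
  also have "\<dots> = real m * \<nu>\<^sup>2" using on by (simp add: orthonormal_def)
  finally show ?thesis by simp
qed

lemma conv_left_linear:
  assumes "finite I" "\<And>i. i \<in> I \<Longrightarrow> cont (h i)" "cont f" "cont k" "x \<in> carrier G"
  shows "conv (\<lambda>x. a * (f x - (\<Sum>i\<in>I. c i * h i x))) k x = a * (conv f k x - (\<Sum>i\<in>I. c i * conv (h i) k x))"
proof -
  let ?k = "\<lambda>y. k (inv y \<otimes> x)"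
  have ck: "cont ?k" by (rule cont_kernel[OF assms(4,5)])
  have cs: "cont (\<lambda>x. \<Sum>i\<in>I. c i * h i x)" using assms by (intro continuous_map_sum continuous_map_real_mult) auto
  have cd: "cont (\<lambda>x. f x - (\<Sum>i\<in>I. c i * h i x))" by (intro continuous_map_diff assms cs)
  have conv_ip: "conv g k x = ip ?k g" for g by (simp add: conv_def ip_def mult.commute)
  show ?thesis
    unfolding conv_ip ip_cmult[OF cd ck] ip_diff[OF assms(3) cs ck] 
    by (subst ip_sum[OF assms(1,2) ck]) auto
qed

text \<open>
  A maximal orthonormal family of eigenfunctions is finite and spans, as the remainder of the
  orthogonal expansion of a further eigenfunction could be normalized and added.
\<close>

lemma eigen_finite_basis:
  assumes k: "cont k" and \<nu>: "0 < \<nu>"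
  shows "\<exists>m e. (\<forall>i<m. eigen k \<nu> (e i)) \<and> orthonormal m e \<and>
    (\<forall>f. eigen k \<nu> f \<longrightarrow> (\<forall>x\<in>carrier G. f x = (\<Sum>i<m. ip f (e i) * e i x)))"
proof -
  define P where "P m \<longleftrightarrow> (\<exists>e. (\<forall>i<m. eigen k \<nu> (e i)) \<and> orthonormal m e)" for m
  obtain b :: nat where b: "ip k k / \<nu>\<^sup>2 < real b" using reals_Archimedean2 by blast
  have bound: "m \<le> b" if Pm: "P m" for m
  proof -
    obtain e where "\<forall>i<m. eigen k \<nu> (e i)" "orthonormal m e" using Pm unfolding P_def by blast
    then have "real m * \<nu>\<^sup>2 \<le> ip k k" by (intro eigen_orthonormal_bound[OF k]) auto
    then have "real m \<le> ip k k / \<nu>\<^sup>2" using \<nu> by (simp add: pos_le_divide_eq)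
    then show ?thesis using b by simp
  qed
  have "P 0" by (simp add: P_def orthonormal_def)
  then obtain m where m: "P m" "\<forall>m'. P m' \<longrightarrow> m' \<le> m"
    using bound GreatestI_nat[of P 0 b] Greatest_le_nat[of P _ b] by blast
  then obtain e where e: "\<forall>i<m. eigen k \<nu> (e i)" and on: "orthonormal m e" unfolding P_def by blast
  have ce: "cont (e i)" if "i < m" for i using e that by (simp add: eigen_def)
  have "f x = (\<Sum>i<m. ip f (e i) * e i x)" if f: "eigen k \<nu> f" and x: "x \<in> carrier G" for f x
  proof (rule ccontr)
    assume neq: "f x \<noteq> (\<Sum>i<m. ip f (e i) * e i x)"
    have cf: "cont f" using f by (simp add: eigen_def)
    define r where "r y = f y - (\<Sum>i<m. ip f (e i) * e i y)" for y
    have cr: "cont r" unfolding r_def[abs_def] using ce cf by (intro continuous_map_diff continuous_map_sum continuous_map_real_mult) auto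
    define s where "s = sqrt (ip r r)"
    have "0 < ip r r" using neq by (intro ip_pos[OF cr x]) (simp add: r_def)
    then have s: "0 < s" "ip r r = s\<^sup>2" by (simp_all add: s_def)
    define e' where "e' i = (if i = m then (\<lambda>y. inverse s * r y) else e i)" for i
    have conv_r: "conv (\<lambda>y. inverse s * r y) k y = \<nu> * (inverse s * r y)" if y: "y \<in> carrier G" for y
    proof -
      have "conv (\<lambda>y. inverse s * r y) k y = inverse s * (conv f k y - (\<Sum>i<m. ip f (e i) * conv (e i) k y))"
        unfolding r_def using ce by (intro conv_left_linear cf k y) auto
      also have "(\<Sum>i<m. ip f (e i) * conv (e i) k y) = (\<Sum>i<m. \<nu> * (ip f (e i) * e i y))"
        using e y by (intro sum.cong refl) (simp add: eigen_def)
      also have "\<dots> = \<nu> * (\<Sum>i<m. ip f (e i) * e i y)" by (rule sum_distrib_left[symmetric])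
      also have "conv f k y = \<nu> * f y" using f y by (simp add: eigen_def)
      finally show ?thesis by (simp add: r_def right_diff_distrib)
    qed
    have cs: "cont (\<lambda>y. inverse s * r y)" by (intro continuous_map_real_mult cr) simp
    have "eigen k \<nu> (e' i)" if "i < Suc m" for i
      using that e cs conv_r by (auto simp: e'_def eigen_def less_Suc_eq)
    moreover have "orthonormal (Suc m) e'"
    proof -
      have 1: "ip (\<lambda>y. inverse s * r y) (e j) = 0" if "j < m" for j
      proof -
        have "ip r (e j) = 0" using Bessel(3)[OF ce on cf that] unfolding r_def .
        then show ?thesis unfolding ip_commute[of "\<lambda>y. inverse s * r y"]
          using ip_cmult[OF cr ce[OF that], of "inverse s"] by (simp add: ip_commute[of "e j" r])
      qed
      have "ip (\<lambda>y. inverse s * r y) (\<lambda>y. inverse s * r y) = inverse s * ip (\<lambda>y. inverse s * r y) r"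
        by (rule ip_cmult[OF cr cs])
      also have "ip (\<lambda>y. inverse s * r y) r = inverse s * ip r r"
        unfolding ip_commute[of "\<lambda>y. inverse s * r y" r] by (rule ip_cmult[OF cr cr])
      finally have 2: "ip (\<lambda>y. inverse s * r y) (\<lambda>y. inverse s * r y) = 1"
        using s by (simp add: power2_eq_square field_simps)
      have 3: "ip (e j) (\<lambda>y. inverse s * r y) = 0" if "j < m" for j
        using 1[OF that] ip_commute[of "e j"] by simp
      show ?thesis
        using on 1 2 3 by (auto simp: orthonormal_def e'_def less_Suc_eq)
    qed
    ultimately have "P (Suc m)" unfolding P_def by blast
    then show False using m(2) by fastforce
  qed
  then show ?thesis using e on by blast
qed

text \<open>
  Let \<open>\<eta>\<close> be the difference between a translate by \<open>g\<close> of \<open>\<phi>\<close> and \<open>\<phi>\<close> itself.  Convolution with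
  \<open>\<eta>\<close>, and hence with the symmetric kernel \<open>\<kappa> x = mean (\<lambda>y. \<eta> y * \<eta> (y x))\<close>, annihilates every
  function whose left translates are all fixed by \<open>g\<close>.  As \<open>\<kappa> * \<kappa>\<close> does not annihilate its
  eigenfunction for a positive eigenvalue, \<open>g\<close> moves a translate of this eigenfunction.
\<close>

lemma eigenspace_moved:
  assumes g: "g \<in> carrier G" and \<phi>: "cont \<phi>" "\<phi> (inv g) \<noteq> \<phi> \<one>"
  shows "\<exists>k \<nu> f x. cont k \<and> 0 < \<nu> \<and> eigen k \<nu> f \<and> x \<in> carrier G \<and> f (inv g \<otimes> x) \<noteq> f x"
proof -
  define \<eta> where "\<eta> y = \<phi> (inv g \<otimes> y) - \<phi> y" for y
  have c\<eta>: "cont \<eta>" unfolding \<eta>_def[abs_def] using g by (intro continuous_map_diff cont_left \<phi>) auto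
  define \<kappa> where "\<kappa> x = mean (\<lambda>y. \<eta> y * \<eta> (y \<otimes> x))" for x
  have c\<kappa>: "cont \<kappa>" unfolding \<kappa>_def[abs_def]
    by (rule continuous_map_mean)
      (intro continuous_map_real_mult cont_compose[OF c\<eta>] continuous_map_mult continuous_map_fst continuous_map_snd)
  have sym: "symm \<kappa>"
    unfolding symm_def
  proof
    fix x assume x: "x \<in> carrier G"
    have c: "cont (\<lambda>y. \<eta> y * \<eta> (y \<otimes> inv x))" using x by (intro continuous_map_real_mult cont_right c\<eta>) auto
    have "\<kappa> (inv x) = mean (\<lambda>y. \<eta> (y \<otimes> x) * \<eta> (y \<otimes> x \<otimes> inv x))"
      unfolding \<kappa>_def by (rule mean_translate_right[OF c x, symmetric])
    also have "\<dots> = \<kappa> x"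
      unfolding \<kappa>_def using x by (intro mean_cong) (simp add: m_assoc mult.commute)
    finally show "\<kappa> (inv x) = \<kappa> x" .
  qed
  have "\<kappa> \<one> = ip \<eta> \<eta>" unfolding \<kappa>_def ip_def by (rule mean_cong) simp
  moreover have "0 < ip \<eta> \<eta>" using \<phi>(2) g by (intro ip_pos[OF c\<eta> one_closed]) (simp add: \<eta>_def)
  ultimately have nz: "\<kappa> \<one> \<noteq> 0" by simp
  obtain \<psi> \<nu> where c\<psi>: "cont \<psi>" and sym\<psi>: "symm \<psi>" and \<nu>: "0 < \<nu>" and nz\<psi>: "\<exists>x\<in>carrier G. \<psi> x \<noteq> 0"
    and eig: "\<forall>x\<in>carrier G. conv (conv \<kappa> \<kappa>) \<psi> x = \<nu> * \<psi> x"
    using symmetric_kernel_eigenfunction[OF c\<kappa> sym one_closed nz] by blast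
  define k where "k = conv \<kappa> \<kappa>"
  have ck: "cont k" unfolding k_def by (rule cont_conv[OF c\<kappa> c\<kappa>])
  have symk: "symm k"
    unfolding k_def symm_def using conv_inv[OF c\<kappa> sym c\<kappa> sym] by blast
  have trans: "eigen k \<nu> (\<lambda>x. \<psi> (inv h \<otimes> x))" if h: "h \<in> carrier G" for h
    unfolding eigen_def
  proof (intro conjI ballI)
    show "cont (\<lambda>x. \<psi> (inv h \<otimes> x))" using h by (intro cont_left c\<psi>) simp
    fix x assume x: "x \<in> carrier G"
    have c: "cont (\<lambda>y. \<psi> (inv h \<otimes> y) * k (inv y \<otimes> x))"
      using h x by (intro continuous_map_real_mult cont_left cont_kernel c\<psi> ck) auto
    have "conv (\<lambda>x. \<psi> (inv h \<otimes> x)) k x = mean (\<lambda>y. \<psi> (inv h \<otimes> (h \<otimes> y)) * k (inv (h \<otimes> y) \<otimes> x))"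
      unfolding conv_def by (rule mean_translate_left[OF c h, symmetric])
    also have "\<dots> = conv \<psi> k (inv h \<otimes> x)"
      unfolding conv_def using h x by (intro mean_cong) (simp add: inv_mult_group m_assoc flip: m_assoc[of "inv h" h])
    also have "\<dots> = conv \<psi> k (inv (inv x \<otimes> h))" using h x by (simp add: inv_mult_group)
    also have "\<dots> = conv k \<psi> (inv x \<otimes> h)" by (rule conv_inv[OF c\<psi> sym\<psi> ck symk]) (use x h in simp)
    also have "\<dots> = \<nu> * \<psi> (inv x \<otimes> h)" using eig x h by (simp add: k_def)
    also have "\<psi> (inv x \<otimes> h) = \<psi> (inv (inv x \<otimes> h))" using sym\<psi> x h by (simp add: symm_def)
    also have "inv (inv x \<otimes> h) = inv h \<otimes> x" using x h by (simp add: inv_mult_group)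
    finally show "conv (\<lambda>x. \<psi> (inv h \<otimes> x)) k x = \<nu> * \<psi> (inv h \<otimes> x)" .
  qed
  show ?thesis
  proof (rule ccontr)
    assume contra: "\<not> ?thesis"
    have fixed: "\<psi> (inv h \<otimes> (inv g \<otimes> x)) = \<psi> (inv h \<otimes> x)" if "h \<in> carrier G" "x \<in> carrier G" for h x
      using contra trans[OF that(1)] ck \<nu> that(2) by blast
    have \<eta>\<psi>: "conv \<eta> \<psi> x = 0" if x: "x \<in> carrier G" for x
    proof -
      have c1: "cont (\<lambda>y. \<phi> (inv g \<otimes> y) * \<psi> (inv y \<otimes> x))" and c2: "cont (\<lambda>y. \<phi> y * \<psi> (inv y \<otimes> x))"
        using g x by (auto intro!: continuous_map_real_mult cont_left cont_kernel c\<psi> \<phi>(1))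
      have "conv \<eta> \<psi> x = mean (\<lambda>y. \<phi> (inv g \<otimes> y) * \<psi> (inv y \<otimes> x)) - mean (\<lambda>y. \<phi> y * \<psi> (inv y \<otimes> x))"
        unfolding conv_def \<eta>_def left_diff_distrib by (rule mean_diff[OF c1 c2])
      also have "mean (\<lambda>y. \<phi> (inv g \<otimes> y) * \<psi> (inv y \<otimes> x))
          = mean (\<lambda>y. \<phi> (inv g \<otimes> (g \<otimes> y)) * \<psi> (inv (g \<otimes> y) \<otimes> x))"
        by (rule mean_translate_left[OF c1 g, symmetric])
      also have "\<dots> = mean (\<lambda>y. \<phi> y * \<psi> (inv y \<otimes> x))"
      proof (rule mean_cong)
        fix y assume y: "y \<in> carrier G"
        have "inv g \<otimes> (g \<otimes> y) = y" using g y by (simp flip: m_assoc)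
        moreover have "inv (g \<otimes> y) \<otimes> x = inv y \<otimes> (inv g \<otimes> x)" using g x y by (simp add: inv_mult_group m_assoc)
        ultimately show "\<phi> (inv g \<otimes> (g \<otimes> y)) * \<psi> (inv (g \<otimes> y) \<otimes> x) = \<phi> y * \<psi> (inv y \<otimes> x)"
          using fixed[OF y x] by simp
      qed
      finally show ?thesis by simp
    qed
    have \<kappa>\<psi>: "conv \<kappa> \<psi> x = 0" if x: "x \<in> carrier G" for x
    proof -
      have "conv \<kappa> \<psi> x = mean (\<lambda>z. mean (\<lambda>y. \<eta> y * \<eta> (y \<otimes> z) * \<psi> (inv z \<otimes> x)))"
        unfolding conv_def
      proof (rule mean_cong)
        fix z assume z: "z \<in> carrier G"
        have "cont (\<lambda>y. \<eta> y * \<eta> (y \<otimes> z))" by (intro continuous_map_real_mult cont_right c\<eta> z)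
        from mean_cmult[OF this, of "\<psi> (inv z \<otimes> x)"]
        show "\<kappa> z * \<psi> (inv z \<otimes> x) = mean (\<lambda>y. \<eta> y * \<eta> (y \<otimes> z) * \<psi> (inv z \<otimes> x))"
          by (simp add: \<kappa>_def mult_ac)
      qed
      also have "\<dots> = mean (\<lambda>y. mean (\<lambda>z. \<eta> y * \<eta> (y \<otimes> z) * \<psi> (inv z \<otimes> x)))"
        by (rule mean_swap) (intro continuous_map_real_mult cont_compose[OF c\<eta>] cont_compose[OF c\<psi>]
          continuous_map_mult continuous_map_inverse continuous_map_fst continuous_map_snd continuous_map_const_T x)
      also have "\<dots> = mean (\<lambda>y. 0)"
      proof (rule mean_cong)
        fix y assume y: "y \<in> carrier G"
        have c: "cont (\<lambda>z. \<eta> (y \<otimes> z) * \<psi> (inv z \<otimes> x))"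
          by (intro continuous_map_real_mult cont_left cont_kernel c\<eta> c\<psi> x y)
        have c': "cont (\<lambda>z. \<eta> z * \<psi> (inv z \<otimes> (y \<otimes> x)))"
          using x y by (intro continuous_map_real_mult cont_kernel c\<eta> c\<psi>) auto
        have "mean (\<lambda>z. \<eta> y * \<eta> (y \<otimes> z) * \<psi> (inv z \<otimes> x)) = \<eta> y * mean (\<lambda>z. \<eta> (y \<otimes> z) * \<psi> (inv z \<otimes> x))"
          using mean_cmult[OF c, of "\<eta> y"] by (simp add: mult_ac)
        also have "mean (\<lambda>z. \<eta> (y \<otimes> z) * \<psi> (inv z \<otimes> x)) = mean (\<lambda>z. \<eta> (y \<otimes> z) * \<psi> (inv (y \<otimes> z) \<otimes> (y \<otimes> x)))"
        proof (rule mean_cong)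
          fix z assume z: "z \<in> carrier G"
          have "inv (y \<otimes> z) \<otimes> (y \<otimes> x) = inv z \<otimes> (inv y \<otimes> (y \<otimes> x))"
            using x y z by (simp add: inv_mult_group m_assoc)
          also have "inv y \<otimes> (y \<otimes> x) = x" using x y m_assoc[of "inv y" y x] by simp
          finally show "\<eta> (y \<otimes> z) * \<psi> (inv z \<otimes> x) = \<eta> (y \<otimes> z) * \<psi> (inv (y \<otimes> z) \<otimes> (y \<otimes> x))" by simp
        qed
        also have "\<dots> = conv \<eta> \<psi> (y \<otimes> x)"
          unfolding conv_def by (rule mean_translate_left[OF c' y])
        also have "\<dots> = 0" using x y by (intro \<eta>\<psi>) simp
        finally show "mean (\<lambda>z. \<eta> y * \<eta> (y \<otimes> z) * \<psi> (inv z \<otimes> x)) = 0" by simp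
      qed
      finally show ?thesis by simp
    qed
    obtain x where x: "x \<in> carrier G" "\<psi> x \<noteq> 0" using nz\<psi> by blast
    have "\<nu> * \<psi> x = conv \<kappa> (conv \<kappa> \<psi>) x"
      using eig x conv_assoc[OF c\<kappa> c\<kappa> c\<psi> x(1)] by simp
    also have "\<dots> = mean (\<lambda>y. 0)"
      unfolding conv_def[of \<kappa> "conv \<kappa> \<psi>"] using x by (intro mean_cong) (simp add: \<kappa>\<psi>)
    finally show False using \<nu> x by simp
  qed
qed

text \<open>
  The part of the Peter--Weyl theorem that matters here.  Left translations commute with
  convolution by a kernel on the right, so they act on its finite-dimensional eigenspaces; the matrix
  of this action with respect to an orthonormal basis is \<open>a\<close>.
\<close>

theorem matrix_representations_separate_points:
  assumes g0: "g0 \<in> carrier G" "g0 \<noteq> \<one>"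
  shows "\<exists>(m::nat) a. (\<forall>i<m. \<forall>j<m. cont (a i j)) \<and>
    (\<forall>i<m. \<forall>j<m. a i j \<one> = (if i = j then 1 else 0)) \<and>
    (\<forall>g\<in>carrier G. \<forall>h\<in>carrier G. \<forall>i<m. \<forall>j<m. a i j (g \<otimes> h) = (\<Sum>k<m. a i k g * a k j h)) \<and>
    (\<exists>i<m. \<exists>j<m. a i j g0 \<noteq> (if i = j then 1 else 0))"
proof -
  obtain \<phi> where \<phi>: "cont \<phi>" "\<phi> (inv g0) \<noteq> \<phi> \<one>"
  proof -
    have ne: "inv g0 \<noteq> \<one>" using g0 by (metis inv_inv inv_one)
    have "normal_space T" using compact_T Hausdorff_T by (simp add: compact_Hausdorff_or_regular_imp_normal_space)
    moreover have "closedin T {inv g0}" "closedin T {\<one>}"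
      using Hausdorff_T g0 by (simp_all add: closedin_Hausdorff_singleton topspace_T)
    moreover have "disjnt {inv g0} {\<one>}" using ne by simp
    ultimately obtain f where "continuous_map T (top_of_set {0..1}) f" "f ` {inv g0} \<subseteq> {0}" "f ` {\<one>} \<subseteq> {1::real}"
      using Urysohn_lemma[of T "{inv g0}" "{\<one>}" 0 1] by auto
    then show thesis by (intro that[of f]) (auto simp: continuous_map_in_subtopology)
  qed
  obtain k \<nu> f x0 where k: "cont k" "0 < \<nu>" and f: "eigen k \<nu> f" and x0: "x0 \<in> carrier G" "f (inv g0 \<otimes> x0) \<noteq> f x0"
    using eigenspace_moved[OF g0(1) \<phi>] by blast
  obtain m e where e: "\<forall>i<m. eigen k \<nu> (e i)" and on: "orthonormal m e"
    and basis: "\<forall>f. eigen k \<nu> f \<longrightarrow> (\<forall>x\<in>carrier G. f x = (\<Sum>i<m. ip f (e i) * e i x))"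
    using eigen_finite_basis[OF k] by blast
  have ce: "cont (e i)" if "i < m" for i using e that by (simp add: eigen_def)
  define a where "a i j g = ip (e i) (\<lambda>x. e j (inv g \<otimes> x))" for i j g
  have trans: "eigen k \<nu> (\<lambda>x. h (inv g \<otimes> x))" if h: "eigen k \<nu> h" and g: "g \<in> carrier G" for h g
    unfolding eigen_def
  proof (intro conjI ballI)
    have ch: "cont h" using h by (simp add: eigen_def)
    show "cont (\<lambda>x. h (inv g \<otimes> x))" using g by (intro cont_left ch) simp
    fix x assume x: "x \<in> carrier G"
    have c: "cont (\<lambda>y. h (inv g \<otimes> y) * k (inv y \<otimes> x))"
      using g x by (intro continuous_map_real_mult cont_left cont_kernel ch k) auto
    have "conv (\<lambda>x. h (inv g \<otimes> x)) k x = mean (\<lambda>y. h (inv g \<otimes> (g \<otimes> y)) * k (inv (g \<otimes> y) \<otimes> x))"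
      unfolding conv_def by (rule mean_translate_left[OF c g, symmetric])
    also have "\<dots> = conv h k (inv g \<otimes> x)"
      unfolding conv_def using g x by (intro mean_cong) (simp add: inv_mult_group m_assoc flip: m_assoc[of "inv g" g])
    also have "\<dots> = \<nu> * h (inv g \<otimes> x)" using h g x by (simp add: eigen_def)
    finally show "conv (\<lambda>x. h (inv g \<otimes> x)) k x = \<nu> * h (inv g \<otimes> x)" .
  qed
  have expand: "e j (inv g \<otimes> x) = (\<Sum>i<m. a i j g * e i x)" if "j < m" "g \<in> carrier G" "x \<in> carrier G" for j g x
  proof -
    have "eigen k \<nu> (\<lambda>x. e j (inv g \<otimes> x))" using trans e that by blast
    then have "e j (inv g \<otimes> x) = (\<Sum>i<m. ip (\<lambda>x. e j (inv g \<otimes> x)) (e i) * e i x)" using basis that(3) by blast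
    then show ?thesis unfolding a_def ip_commute[of "\<lambda>x. e j (inv g \<otimes> x)"] .
  qed
  show ?thesis
  proof (rule exI[of _ m], rule exI[of _ a], intro conjI allI ballI impI)
    fix i j assume i: "i < m" and j: "j < m"
    show "cont (a i j)"
      unfolding a_def[abs_def] ip_def
      by (rule continuous_map_mean) (intro continuous_map_real_mult cont_compose[OF ce[OF i]] cont_compose[OF ce[OF j]]
        continuous_map_mult continuous_map_inverse continuous_map_fst continuous_map_snd)
    have "a i j \<one> = ip (e i) (e j)" unfolding a_def by (rule ip_cong) auto
    then show "a i j \<one> = (if i = j then 1 else 0)" using on i j by (simp add: orthonormal_def)
  next
    fix g h i j assume g: "g \<in> carrier G" and h: "h \<in> carrier G" and i: "i < m" and j: "j < m"
    have "a i j (g \<otimes> h) = ip (e i) (\<lambda>x. \<Sum>k<m. a k j h * e k (inv g \<otimes> x))"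
      unfolding a_def[of i j "g \<otimes> h"]
    proof (rule ip_cong)
      fix x assume x: "x \<in> carrier G"
      have "inv (g \<otimes> h) \<otimes> x = inv h \<otimes> (inv g \<otimes> x)" using g h x by (simp add: inv_mult_group m_assoc)
      then show "e j (inv (g \<otimes> h) \<otimes> x) = (\<Sum>k<m. a k j h * e k (inv g \<otimes> x))"
        using expand[OF j h, of "inv g \<otimes> x"] g x by simp
    qed simp
    also have "\<dots> = (\<Sum>k<m. a k j h * ip (e i) (\<lambda>x. e k (inv g \<otimes> x)))"
      using g ce i by (intro ip_sum cont_left) auto
    also have "\<dots> = (\<Sum>k<m. a i k g * a k j h)" by (simp add: a_def mult.commute)
    finally show "a i j (g \<otimes> h) = (\<Sum>k<m. a i k g * a k j h)" .
  next
    show "\<exists>i<m. \<exists>j<m. a i j g0 \<noteq> (if i = j then 1 else 0)"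
    proof (rule ccontr)
      assume "\<not> ?thesis"
      then have id: "a i j g0 = (if i = j then 1 else 0)" if "i < m" "j < m" for i j using that by blast
      have fix_e: "e j (inv g0 \<otimes> x) = e j x" if "j < m" "x \<in> carrier G" for j x
      proof -
        have "e j (inv g0 \<otimes> x) = (\<Sum>i<m. (if i = j then 1 else 0) * e i x)"
          unfolding expand[OF that(1) g0(1) that(2)] using that id by (intro sum.cong refl) simp
        also have "\<dots> = e j x" using that(1) by (simp add: if_distrib[where f="\<lambda>z. z * _"] cong: if_cong)
        finally show ?thesis .
      qed
      have "f (inv g0 \<otimes> x0) = (\<Sum>i<m. ip f (e i) * e i (inv g0 \<otimes> x0))" using basis f g0 x0 by simp
      also have "\<dots> = (\<Sum>i<m. ip f (e i) * e i x0)" using fix_e x0(1) by (intro sum.cong refl) simp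
      also have "\<dots> = f x0" using basis f x0(1) by simp
      finally show False using x0 by simp
    qed
  qed
qed

end

section \<open>The algebraic tensor product\<close>

text \<open>
  The linear map between free vector spaces that extends \<open>F\<close> on the generators.
\<close>

definition push :: "('x \<Rightarrow> 'y) \<Rightarrow> ('x \<Rightarrow>\<^sub>0 complex) \<Rightarrow> ('y \<Rightarrow>\<^sub>0 complex)" where
  "push F s = (\<Sum>x\<in>Poly_Mapping.keys s. Poly_Mapping.single (F x) (Poly_Mapping.lookup s x))"

lemma lookup_map_times: "Poly_Mapping.lookup (Poly_Mapping.map ((*) c) s) k = c * Poly_Mapping.lookup s k"
  for c :: complex
  by transfer (simp add: when_def)

lemma map_times_add: "Poly_Mapping.map ((*) c) (s + t) = Poly_Mapping.map ((*) c) s + Poly_Mapping.map ((*) c) t"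
  for c :: complex
  by (rule poly_mapping_eqI) (simp add: lookup_map_times lookup_add distrib_left)

lemma map_times_minus_one: "Poly_Mapping.map ((*) (-1)) s = - s" for s :: "'x \<Rightarrow>\<^sub>0 complex"
  by (rule poly_mapping_eqI) (simp add: lookup_map_times)

lemma map_times_single: "Poly_Mapping.map ((*) c) (Poly_Mapping.single k b) = Poly_Mapping.single k (c * b)" for c :: complex
  by (rule poly_mapping_eqI) (simp add: lookup_map_times lookup_single when_def)

lemma push_superset:
  assumes "finite K" "Poly_Mapping.keys s \<subseteq> K"
  shows "push F s = (\<Sum>x\<in>K. Poly_Mapping.single (F x) (Poly_Mapping.lookup s x))"
  unfolding push_def using assms by (intro sum.mono_neutral_left) (auto simp: in_keys_iff)

lemma push_add: "push F (s + t) = push F s + push F t"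
proof -
  let ?K = "Poly_Mapping.keys s \<union> Poly_Mapping.keys t"
  have K: "finite ?K" "Poly_Mapping.keys (s + t) \<subseteq> ?K" "Poly_Mapping.keys s \<subseteq> ?K" "Poly_Mapping.keys t \<subseteq> ?K"
    using Poly_Mapping.keys_add[of s t] by auto
  show ?thesis
    unfolding push_superset[OF K(1,2)] push_superset[OF K(1,3)] push_superset[OF K(1,4)]
    by (simp add: lookup_add single_add sum.distrib)
qed

lemma push_map: "push F (Poly_Mapping.map ((*) c) s) = Poly_Mapping.map ((*) c) (push F s)"
proof -
  have "Poly_Mapping.keys (Poly_Mapping.map ((*) c) s) \<subseteq> Poly_Mapping.keys s"
    by (auto simp: in_keys_iff lookup_map_times)
  then have "push F (Poly_Mapping.map ((*) c) s) =
      (\<Sum>x\<in>Poly_Mapping.keys s. Poly_Mapping.single (F x) (c * Poly_Mapping.lookup s x))"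
    by (subst push_superset[of "Poly_Mapping.keys s"]) (simp_all add: lookup_map_times)
  also have "\<dots> = Poly_Mapping.map ((*) c) (push F s)"
  proof -
    have "(\<Sum>x\<in>K. Poly_Mapping.single (F x) (c * Poly_Mapping.lookup s x)) =
      Poly_Mapping.map ((*) c) (\<Sum>x\<in>K. Poly_Mapping.single (F x) (Poly_Mapping.lookup s x))" if "finite K" for K
      using that
    proof (induction K rule: finite_induct)
      case empty
      show ?case by (simp add: poly_mapping_eqI lookup_map_times)
    next
      case (insert x K)
      then show ?case by (simp add: map_times_add map_times_single)
    qed
    then show ?thesis by (simp add: push_def)
  qed
  finally show ?thesis .
qed

lemma push_single: "push F (Poly_Mapping.single k c) = Poly_Mapping.single (F k) c"
  by (cases "c = 0") (simp_all add: push_def)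

lemma push_diff: "push F (s - t) = push F s - push F t"
  using push_add[of F s "- t"] push_map[of F "-1" t] by (simp add: map_times_minus_one)

lemma push_zero [simp]: "push F 0 = 0"
  by (simp add: push_def)

lemma push_sum: "push F (\<Sum>i\<in>I. s i) = (\<Sum>i\<in>I. push F (s i))"
  by (induction I rule: infinite_finite_induct) (simp_all add: push_add)

lemma scalars_simps [simp]:
  "carrier (scalars :: complex ring) = UNIV" "add scalars x y = x + (y :: complex)"
  "mult scalars x y = x * (y :: complex)" "zero scalars = (0 :: complex)" "one scalars = (1 :: complex)"
  by (simp_all add: scalars_def)

locale tensor_product =
  A: module "scalars :: complex ring" A + V: module "scalars :: complex ring" V
  for A :: "(complex, 'a) tvs" and V :: "(complex, 'v) tvs"
begin

abbreviation rel :: "(('a \<times> 'v) \<Rightarrow>\<^sub>0 complex) set" where "rel \<equiv> tensor_relations A V"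
abbreviation free :: "(('a \<times> 'v) \<Rightarrow>\<^sub>0 complex) set" where "free \<equiv> free_space A V"
abbreviation cls :: "(('a \<times> 'v) \<Rightarrow>\<^sub>0 complex) \<Rightarrow> (('a \<times> 'v) \<Rightarrow>\<^sub>0 complex) set" where
  "cls s \<equiv> tensor_rel A V `` {s}"

lemma smult_closed_A: "a \<in> carrier A \<Longrightarrow> c \<odot>\<^bsub>A\<^esub> a \<in> carrier A"
  and smult_closed_V: "v \<in> carrier V \<Longrightarrow> c \<odot>\<^bsub>V\<^esub> v \<in> carrier V"
  using A.smult_closed[of c a] V.smult_closed[of c v] by simp_all

lemma free_single: "a \<in> carrier A \<Longrightarrow> v \<in> carrier V \<Longrightarrow> Poly_Mapping.single (a, v) c \<in> free"
  by (simp add: free_space_def)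

lemma free_add: "s \<in> free \<Longrightarrow> t \<in> free \<Longrightarrow> s + t \<in> free"
  using Poly_Mapping.keys_add[of s t] by (auto simp: free_space_def)

lemma free_map: "s \<in> free \<Longrightarrow> Poly_Mapping.map ((*) c) s \<in> free"
  by (auto simp: free_space_def in_keys_iff lookup_map_times subset_iff)

lemma free_diff: "s \<in> free \<Longrightarrow> t \<in> free \<Longrightarrow> s - t \<in> free"
  using free_add[of s "- t"] free_map[of t "-1"] by (simp add: map_times_minus_one)

lemma free_sum: "(\<And>i. i \<in> I \<Longrightarrow> s i \<in> free) \<Longrightarrow> (\<Sum>i\<in>I. s i) \<in> free"
  by (induction I rule: infinite_finite_induct) (auto simp: free_add, simp_all add: free_space_def)

lemma rel_minus: "s \<in> rel \<Longrightarrow> - s \<in> rel"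
  using tensor_relations.scale[of s A V "-1"] by (simp add: map_times_minus_one)

lemma rel_diff: "s \<in> rel \<Longrightarrow> t \<in> rel \<Longrightarrow> s - t \<in> rel"
  using tensor_relations.add[OF _ rel_minus, of s t] by simp

lemma rel_sum: "(\<And>i. i \<in> I \<Longrightarrow> s i \<in> rel) \<Longrightarrow> (\<Sum>i\<in>I. s i) \<in> rel"
  by (induction I rule: infinite_finite_induct) (simp_all add: tensor_relations.zero tensor_relations.add)

lemma cls_eq_iff: "s \<in> free \<Longrightarrow> t \<in> free \<Longrightarrow> cls s = cls t \<longleftrightarrow> s - t \<in> rel"
proof
  assume s: "s \<in> free" and t: "t \<in> free"
  {
    assume "cls s = cls t"
    moreover have "t \<in> cls t" using t tensor_relations.zero by (auto simp: tensor_rel_def)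
    ultimately have "t \<in> cls s" by simp
    then show "s - t \<in> rel" by (simp add: tensor_rel_def)
  next
    assume st: "s - t \<in> rel"
    have "s - u \<in> rel \<longleftrightarrow> t - u \<in> rel" for u
      using rel_diff[of "s - u" "s - t"] tensor_relations.add[of "t - u" A V "s - t"] st by (auto simp: algebra_simps)
    then show "cls s = cls t" using s t by (auto simp: tensor_rel_def)
  }
qed

lemma tensor_eq: "tensor A V = cls ` free"
  by (auto simp: tensor_def quotient_def)

lemma mem_cls: "t \<in> cls s \<longleftrightarrow> s \<in> free \<and> t \<in> free \<and> s - t \<in> rel"
  by (simp add: tensor_rel_def)

definition linA :: "('a \<Rightarrow> 'a) \<Rightarrow> bool" where
  "linA f \<longleftrightarrow> (\<forall>a\<in>carrier A. f a \<in> carrier A) \<and>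
    (\<forall>a\<in>carrier A. \<forall>b\<in>carrier A. f (a \<oplus>\<^bsub>A\<^esub> b) = f a \<oplus>\<^bsub>A\<^esub> f b) \<and>
    (\<forall>c. \<forall>a\<in>carrier A. f (c \<odot>\<^bsub>A\<^esub> a) = c \<odot>\<^bsub>A\<^esub> f a)"

definition linV :: "('v \<Rightarrow> 'v) \<Rightarrow> bool" where
  "linV h \<longleftrightarrow> (\<forall>v\<in>carrier V. h v \<in> carrier V) \<and>
    (\<forall>v\<in>carrier V. \<forall>w\<in>carrier V. h (v \<oplus>\<^bsub>V\<^esub> w) = h v \<oplus>\<^bsub>V\<^esub> h w) \<and>
    (\<forall>c. \<forall>v\<in>carrier V. h (c \<odot>\<^bsub>V\<^esub> v) = c \<odot>\<^bsub>V\<^esub> h v)"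

definition linF :: "('a \<Rightarrow> complex) \<Rightarrow> bool" where
  "linF \<omega> \<longleftrightarrow> (\<forall>a\<in>carrier A. \<forall>b\<in>carrier A. \<omega> (a \<oplus>\<^bsub>A\<^esub> b) = \<omega> a + \<omega> b) \<and>
    (\<forall>c. \<forall>a\<in>carrier A. \<omega> (c \<odot>\<^bsub>A\<^esub> a) = c * \<omega> a)"

abbreviation two :: "('a \<Rightarrow> 'a) \<Rightarrow> ('v \<Rightarrow> 'v) \<Rightarrow> 'a \<times> 'v \<Rightarrow> 'a \<times> 'v" where
  "two f h \<equiv> (\<lambda>(a, v). (f a, h v))"

lemma push_free:
  assumes "linA f" "linV h" "s \<in> free"
  shows "push (two f h) s \<in> free"
  unfolding push_def using assms
  by (intro free_sum) (auto simp: free_space_def linA_def linV_def split: prod.splits)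

lemma push_rel:
  assumes f: "linA f" and h: "linV h" and s: "s \<in> rel"
  shows "push (two f h) s \<in> rel"
  using s
proof (induction rule: tensor_relations.induct)
  case (add_left a b v)
  have "push (two f h) (Poly_Mapping.single (a \<oplus>\<^bsub>A\<^esub> b, v) 1 - Poly_Mapping.single (a, v) 1 - Poly_Mapping.single (b, v) 1)
    = Poly_Mapping.single (f a \<oplus>\<^bsub>A\<^esub> f b, h v) 1 - Poly_Mapping.single (f a, h v) 1 - Poly_Mapping.single (f b, h v) 1"
    using add_left f by (simp add: push_diff push_single linA_def)
  then show ?case using add_left f h by (auto simp: linA_def linV_def intro: tensor_relations.add_left)
next
  case (add_right a v w)
  have "push (two f h) (Poly_Mapping.single (a, v \<oplus>\<^bsub>V\<^esub> w) 1 - Poly_Mapping.single (a, v) 1 - Poly_Mapping.single (a, w) 1)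
    = Poly_Mapping.single (f a, h v \<oplus>\<^bsub>V\<^esub> h w) 1 - Poly_Mapping.single (f a, h v) 1 - Poly_Mapping.single (f a, h w) 1"
    using add_right h by (simp add: push_diff push_single linV_def)
  then show ?case using add_right f h by (auto simp: linA_def linV_def intro: tensor_relations.add_right)
next
  case (scale_left a v c)
  have "push (two f h) (Poly_Mapping.single (c \<odot>\<^bsub>A\<^esub> a, v) 1 - Poly_Mapping.single (a, v) c)
    = Poly_Mapping.single (c \<odot>\<^bsub>A\<^esub> f a, h v) 1 - Poly_Mapping.single (f a, h v) c"
    using scale_left f by (simp add: push_diff push_single linA_def)
  then show ?case using scale_left f h by (auto simp: linA_def linV_def intro: tensor_relations.scale_left)
next
  case (scale_right a v c)
  have "push (two f h) (Poly_Mapping.single (a, c \<odot>\<^bsub>V\<^esub> v) 1 - Poly_Mapping.single (a, v) c)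
    = Poly_Mapping.single (f a, c \<odot>\<^bsub>V\<^esub> h v) 1 - Poly_Mapping.single (f a, h v) c"
    using scale_right h by (simp add: push_diff push_single linV_def)
  then show ?case using scale_right f h by (auto simp: linA_def linV_def intro: tensor_relations.scale_right)
qed (simp_all add: tensor_relations.zero push_add push_map tensor_relations.add tensor_relations.scale)

lemma tensor_map_cls:
  assumes f: "linA f" and h: "linV h" and s: "s \<in> free"
  shows "tensor_map A V f h (cls s) = cls (push (two f h) s)"
proof -
  have eq: "(\<Sum>(a, v)\<in>Poly_Mapping.keys t. Poly_Mapping.single (f a, h v) (Poly_Mapping.lookup t (a, v))) = push (two f h) t" for t
    unfolding push_def by (intro sum.cong refl) auto
  have "cls (push (two f h) t) = cls (push (two f h) s)" if "t \<in> cls s" for t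
  proof -
    have t: "t \<in> free" "s - t \<in> rel" using that unfolding mem_cls by simp_all
    have "cls (push (two f h) s) = cls (push (two f h) t)"
      unfolding cls_eq_iff[OF push_free[OF f h s] push_free[OF f h t(1)]] push_diff[symmetric]
      by (rule push_rel[OF f h t(2)])
    then show ?thesis by simp
  qed
  moreover have "s \<in> cls s" unfolding mem_cls using s tensor_relations.zero by simp
  ultimately show ?thesis unfolding tensor_map_def eq by blast
qed

text \<open>
  The value of \<open>\<omega> \<otimes> id\<close> on the tensor represented by \<open>s\<close>.
\<close>

definition evt :: "('a \<Rightarrow> complex) \<Rightarrow> (('a \<times> 'v) \<Rightarrow>\<^sub>0 complex) \<Rightarrow> 'v" where
  "evt \<omega> s = (\<Oplus>\<^bsub>V\<^esub>x\<in>Poly_Mapping.keys s. (Poly_Mapping.lookup s x * \<omega> (fst x)) \<odot>\<^bsub>V\<^esub> snd x)"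

lemma zero_smult: "v \<in> carrier V \<Longrightarrow> 0 \<odot>\<^bsub>V\<^esub> v = \<zero>\<^bsub>V\<^esub>"
  using V.smult_l_null[of v] by simp

lemma evt_superset:
  assumes s: "s \<in> free" and K: "finite K" "Poly_Mapping.keys s \<subseteq> K" "K \<subseteq> carrier A \<times> carrier V"
  shows "evt \<omega> s = (\<Oplus>\<^bsub>V\<^esub>x\<in>K. (Poly_Mapping.lookup s x * \<omega> (fst x)) \<odot>\<^bsub>V\<^esub> snd x)"
  unfolding evt_def
proof (rule V.add.finprod_mono_neutral_cong_left[OF K(1,2)])
  show "(Poly_Mapping.lookup s x * \<omega> (fst x)) \<odot>\<^bsub>V\<^esub> snd x = \<zero>\<^bsub>V\<^esub>" if "x \<in> K - Poly_Mapping.keys s" for x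
    using that K(3) by (auto simp: in_keys_iff intro!: zero_smult)
  show "(\<lambda>x. (Poly_Mapping.lookup s x * \<omega> (fst x)) \<odot>\<^bsub>V\<^esub> snd x) \<in> K \<rightarrow> carrier V"
    using K(3) by (auto intro!: smult_closed_V)
qed auto

lemma evt_closed: "s \<in> free \<Longrightarrow> evt \<omega> s \<in> carrier V"
  unfolding evt_def by (intro V.finsum_closed) (auto simp: free_space_def intro!: smult_closed_V)

lemma smult_add_V: "v \<in> carrier V \<Longrightarrow> (c + d) \<odot>\<^bsub>V\<^esub> v = c \<odot>\<^bsub>V\<^esub> v \<oplus>\<^bsub>V\<^esub> d \<odot>\<^bsub>V\<^esub> v"
  using V.smult_l_distr[of c d v] by simp

lemma evt_add:
  assumes s: "s \<in> free" and t: "t \<in> free"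
  shows "evt \<omega> (s + t) = evt \<omega> s \<oplus>\<^bsub>V\<^esub> evt \<omega> t"
proof -
  let ?K = "Poly_Mapping.keys s \<union> Poly_Mapping.keys t"
  have K: "finite ?K" "Poly_Mapping.keys (s + t) \<subseteq> ?K" "Poly_Mapping.keys s \<subseteq> ?K" "Poly_Mapping.keys t \<subseteq> ?K"
    "?K \<subseteq> carrier A \<times> carrier V"
    using Poly_Mapping.keys_add[of s t] s t by (auto simp: free_space_def)
  have mem: "snd x \<in> carrier V" if "x \<in> ?K" for x using K(5) that by auto
  have "evt \<omega> (s + t) = (\<Oplus>\<^bsub>V\<^esub>x\<in>?K. (Poly_Mapping.lookup s x * \<omega> (fst x)) \<odot>\<^bsub>V\<^esub> snd x \<oplus>\<^bsub>V\<^esub> (Poly_Mapping.lookup t x * \<omega> (fst x)) \<odot>\<^bsub>V\<^esub> snd x)"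
    unfolding evt_superset[OF free_add[OF s t] K(1,2,5)]
    by (rule V.finsum_cong'[OF refl]) (auto simp: lookup_add distrib_right smult_add_V mem intro!: smult_closed_V V.a_closed mem)
  also have "\<dots> = evt \<omega> s \<oplus>\<^bsub>V\<^esub> evt \<omega> t"
    unfolding evt_superset[OF s K(1,3,5)] evt_superset[OF t K(1,4,5)]
    by (rule V.finsum_addf) (auto intro!: smult_closed_V mem)
  finally show ?thesis .
qed

lemma evt_single:
  assumes "a \<in> carrier A" "v \<in> carrier V"
  shows "evt \<omega> (Poly_Mapping.single (a, v) c) = (c * \<omega> a) \<odot>\<^bsub>V\<^esub> v"
proof -
  have "evt \<omega> (Poly_Mapping.single (a, v) c) = (\<Oplus>\<^bsub>V\<^esub>x\<in>{(a, v)}. (Poly_Mapping.lookup (Poly_Mapping.single (a, v) c) x * \<omega> (fst x)) \<odot>\<^bsub>V\<^esub> snd x)"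
    by (rule evt_superset[OF free_single[OF assms]]) (use assms in auto)
  then show ?thesis using assms by (simp add: V.finsum_insert smult_closed_V)
qed

lemma evt_zero: "evt \<omega> 0 = \<zero>\<^bsub>V\<^esub>"
  by (simp add: evt_def)

lemma evt_sum:
  assumes "finite I" "\<And>i. i \<in> I \<Longrightarrow> s i \<in> free"
  shows "evt \<omega> (\<Sum>i\<in>I. s i) = (\<Oplus>\<^bsub>V\<^esub>i\<in>I. evt \<omega> (s i))"
  using assms
proof (induction I rule: finite_induct)
  case empty
  then show ?case by (simp add: evt_zero)
next
  case (insert i I)
  then have "evt \<omega> (\<Sum>i\<in>insert i I. s i) = evt \<omega> (s i) \<oplus>\<^bsub>V\<^esub> evt \<omega> (\<Sum>i\<in>I. s i)"
    by (simp add: evt_add free_sum)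
  then show ?case using insert by (subst V.finsum_insert) (auto simp: evt_closed)
qed

lemma evt_push:
  assumes f: "linA f" and h: "linV h" and s: "s \<in> free"
  shows "evt \<omega> (push (two f h) s) = (\<Oplus>\<^bsub>V\<^esub>x\<in>Poly_Mapping.keys s. (Poly_Mapping.lookup s x * \<omega> (f (fst x))) \<odot>\<^bsub>V\<^esub> h (snd x))"
proof -
  have mem: "f (fst x) \<in> carrier A" "h (snd x) \<in> carrier V" if "x \<in> Poly_Mapping.keys s" for x
    using that s f h by (auto simp: free_space_def linA_def linV_def)
  have "evt \<omega> (push (two f h) s) = (\<Oplus>\<^bsub>V\<^esub>x\<in>Poly_Mapping.keys s. evt \<omega> (Poly_Mapping.single (two f h x) (Poly_Mapping.lookup s x)))"
    unfolding push_def by (rule evt_sum) (use mem in \<open>auto simp: case_prod_unfold intro!: free_single\<close>)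
  also have "\<dots> = (\<Oplus>\<^bsub>V\<^esub>x\<in>Poly_Mapping.keys s. (Poly_Mapping.lookup s x * \<omega> (f (fst x))) \<odot>\<^bsub>V\<^esub> h (snd x))"
    by (rule V.finsum_cong'[OF refl]) (use mem in \<open>auto simp: case_prod_unfold evt_single intro!: smult_closed_V\<close>)
  finally show ?thesis .
qed

lemma linV_finsum:
  assumes h: "linV h" and I: "finite I" and v: "\<And>i. i \<in> I \<Longrightarrow> v i \<in> carrier V"
  shows "h (\<Oplus>\<^bsub>V\<^esub>i\<in>I. v i) = (\<Oplus>\<^bsub>V\<^esub>i\<in>I. h (v i))"
  using I v
proof (induction I rule: finite_induct)
  case empty
  have "h \<zero>\<^bsub>V\<^esub> = h (0 \<odot>\<^bsub>V\<^esub> \<zero>\<^bsub>V\<^esub>)" by (simp add: zero_smult)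
  also have "\<dots> = 0 \<odot>\<^bsub>V\<^esub> h \<zero>\<^bsub>V\<^esub>" using h V.zero_closed unfolding linV_def by blast
  also have "\<dots> = \<zero>\<^bsub>V\<^esub>" using h V.zero_closed unfolding linV_def by (intro zero_smult) blast
  finally show ?case by simp
next
  case (insert i I)
  have c: "v \<in> I \<rightarrow> carrier V" "v i \<in> carrier V" "(\<lambda>i. h (v i)) \<in> I \<rightarrow> carrier V" "h (v i) \<in> carrier V"
    using insert h by (auto simp: linV_def)
  then have "h (\<Oplus>\<^bsub>V\<^esub>i\<in>insert i I. v i) = h (v i \<oplus>\<^bsub>V\<^esub> (\<Oplus>\<^bsub>V\<^esub>i\<in>I. v i))"
    using insert by (subst V.finsum_insert) auto
  also have "\<dots> = h (v i) \<oplus>\<^bsub>V\<^esub> h (\<Oplus>\<^bsub>V\<^esub>i\<in>I. v i)" using h c V.finsum_closed[of v I] unfolding linV_def by blast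
  also have "\<dots> = (\<Oplus>\<^bsub>V\<^esub>i\<in>insert i I. h (v i))" using insert c by (subst V.finsum_insert) auto
  finally show ?case .
qed

lemma evt_linear:
  assumes h: "linV h" and s: "s \<in> free"
  shows "h (evt \<omega> s) = (\<Oplus>\<^bsub>V\<^esub>x\<in>Poly_Mapping.keys s. (Poly_Mapping.lookup s x * \<omega> (fst x)) \<odot>\<^bsub>V\<^esub> h (snd x))"
proof -
  have mem: "snd x \<in> carrier V" if "x \<in> Poly_Mapping.keys s" for x
    using that s by (auto simp: free_space_def)
  have "h (evt \<omega> s) = (\<Oplus>\<^bsub>V\<^esub>x\<in>Poly_Mapping.keys s. h ((Poly_Mapping.lookup s x * \<omega> (fst x)) \<odot>\<^bsub>V\<^esub> snd x))"
    unfolding evt_def by (rule linV_finsum[OF h]) (auto intro!: smult_closed_V mem)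
  also have "\<dots> = (\<Oplus>\<^bsub>V\<^esub>x\<in>Poly_Mapping.keys s. (Poly_Mapping.lookup s x * \<omega> (fst x)) \<odot>\<^bsub>V\<^esub> h (snd x))"
    using h mem by (intro V.finsum_cong'[OF refl]) (auto simp: linV_def intro!: smult_closed_V)
  finally show ?thesis .
qed

lemma smult_smult_V: "v \<in> carrier V \<Longrightarrow> c \<odot>\<^bsub>V\<^esub> (d \<odot>\<^bsub>V\<^esub> v) = (c * d) \<odot>\<^bsub>V\<^esub> v"
  using V.smult_assoc1[of c d v] by simp

lemma evt_map: 
  assumes s: "s \<in> free"
  shows "evt \<omega> (Poly_Mapping.map ((*) c) s) = c \<odot>\<^bsub>V\<^esub> evt \<omega> s"
proof -
  have lin: "linV (\<lambda>v. c \<odot>\<^bsub>V\<^esub> v)"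
    using V.smult_r_distr[of c] by (auto simp: linV_def smult_closed_V smult_smult_V mult.commute)
  have mem: "snd x \<in> carrier V" if "x \<in> Poly_Mapping.keys s" for x
    using that s by (auto simp: free_space_def)
  have "evt \<omega> (Poly_Mapping.map ((*) c) s) =
      (\<Oplus>\<^bsub>V\<^esub>x\<in>Poly_Mapping.keys s. (Poly_Mapping.lookup (Poly_Mapping.map ((*) c) s) x * \<omega> (fst x)) \<odot>\<^bsub>V\<^esub> snd x)"
    by (rule evt_superset[OF free_map[OF s]]) (use s in \<open>auto simp: in_keys_iff lookup_map_times free_space_def\<close>)
  also have "\<dots> = (\<Oplus>\<^bsub>V\<^esub>x\<in>Poly_Mapping.keys s. (Poly_Mapping.lookup s x * \<omega> (fst x)) \<odot>\<^bsub>V\<^esub> (c \<odot>\<^bsub>V\<^esub> snd x))"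
    by (rule V.finsum_cong'[OF refl]) (auto simp: lookup_map_times smult_smult_V mem mult_ac intro!: smult_closed_V mem)
  also have "\<dots> = c \<odot>\<^bsub>V\<^esub> evt \<omega> s" using evt_linear[OF lin s] by simp
  finally show ?thesis .
qed

lemma evt_rel:
  assumes \<omega>: "linF \<omega>" and s: "s \<in> rel"
  shows "s \<in> free \<and> evt \<omega> s = \<zero>\<^bsub>V\<^esub>"
proof -
  have minus: "evt \<omega> (- t) = \<ominus>\<^bsub>V\<^esub> evt \<omega> t" if t: "t \<in> free" for t
  proof -
    have mt: "- t \<in> free" using free_map[OF t, of "-1"] by (simp add: map_times_minus_one)
    have "evt \<omega> t \<oplus>\<^bsub>V\<^esub> evt \<omega> (- t) = \<zero>\<^bsub>V\<^esub>"
      using evt_add[OF t mt, of \<omega>] by (simp add: evt_zero)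
    then show ?thesis using V.minus_equality[of "evt \<omega> (- t)" "evt \<omega> t"] evt_closed t mt by (simp add: V.a_comm)
  qed
  have diff: "evt \<omega> (s - t) = \<zero>\<^bsub>V\<^esub>" if "s \<in> free" "t \<in> free" "evt \<omega> s = evt \<omega> t" for s t
  proof -
    have mt: "- t \<in> free" using free_map[OF that(2), of "-1"] by (simp add: map_times_minus_one)
    show ?thesis using evt_add[OF that(1) mt, of \<omega>] minus[OF that(2)] that evt_closed[OF that(2)] by (simp add: V.r_neg)
  qed
  show ?thesis
    using s
  proof (induction rule: tensor_relations.induct)
    case zero
    show ?case by (simp add: evt_zero free_space_def)
  next
    case (add s t)
    then show ?case by (simp add: free_add evt_add)
  next
    case (scale s c)
    then show ?case by (simp add: free_map evt_map V.smult_r_null)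
  next
    case (add_left a b v)
    let ?s = "Poly_Mapping.single (a \<oplus>\<^bsub>A\<^esub> b, v) (1::complex)" and ?t = "Poly_Mapping.single (a, v) (1::complex) + Poly_Mapping.single (b, v) 1"
    have f: "?s \<in> free" "?t \<in> free" using add_left by (auto intro!: free_single free_add)
    have "evt \<omega> ?t = (1 * \<omega> a) \<odot>\<^bsub>V\<^esub> v \<oplus>\<^bsub>V\<^esub> (1 * \<omega> b) \<odot>\<^bsub>V\<^esub> v"
      using add_left by (simp add: evt_add free_single evt_single)
    then have "evt \<omega> ?s = evt \<omega> ?t"
      using add_left \<omega> by (simp add: evt_single linF_def smult_add_V)
    from diff[OF f this] free_diff[OF f] show ?case by (simp add: diff_diff_eq)
  next
    case (add_right a v w)
    let ?s = "Poly_Mapping.single (a, v \<oplus>\<^bsub>V\<^esub> w) (1::complex)" and ?t = "Poly_Mapping.single (a, v) (1::complex) + Poly_Mapping.single (a, w) 1"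
    have f: "?s \<in> free" "?t \<in> free" using add_right by (auto intro!: free_single free_add)
    have "evt \<omega> ?t = (1 * \<omega> a) \<odot>\<^bsub>V\<^esub> v \<oplus>\<^bsub>V\<^esub> (1 * \<omega> a) \<odot>\<^bsub>V\<^esub> w"
      using add_right by (simp add: evt_add free_single evt_single)
    then have "evt \<omega> ?s = evt \<omega> ?t"
      using add_right V.smult_r_distr[of "\<omega> a" v w] by (simp add: evt_single)
    from diff[OF f this] free_diff[OF f] show ?case by (simp add: diff_diff_eq)
  next
    case (scale_left a v c)
    have f: "Poly_Mapping.single (c \<odot>\<^bsub>A\<^esub> a, v) 1 \<in> free" "Poly_Mapping.single (a, v) c \<in> free"
      using scale_left by (auto intro!: free_single smult_closed_A)
    have "evt \<omega> (Poly_Mapping.single (c \<odot>\<^bsub>A\<^esub> a, v) 1) = evt \<omega> (Poly_Mapping.single (a, v) c)"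
      using scale_left \<omega> by (simp add: evt_single smult_closed_A linF_def)
    from diff[OF f this] free_diff[OF f] show ?case by simp
  next
    case (scale_right a v c)
    have f: "Poly_Mapping.single (a, c \<odot>\<^bsub>V\<^esub> v) 1 \<in> free" "Poly_Mapping.single (a, v) c \<in> free"
      using scale_right by (auto intro!: free_single smult_closed_V)
    have "evt \<omega> (Poly_Mapping.single (a, c \<odot>\<^bsub>V\<^esub> v) 1) = evt \<omega> (Poly_Mapping.single (a, v) c)"
      using scale_right by (simp add: evt_single smult_closed_V smult_smult_V mult.commute)
    from diff[OF f this] free_diff[OF f] show ?case by simp
  qed
qed

lemma tensor_eval_cls:
  assumes \<omega>: "linF \<omega>" and s: "s \<in> free"
  shows "tensor_eval V \<omega> (cls s) = evt \<omega> s"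
proof -
  have "evt \<omega> t = evt \<omega> s" if "t \<in> cls s" for t
  proof -
    have t: "t \<in> free" "s - t \<in> rel" using that unfolding mem_cls by simp_all
    have d: "s - t \<in> free" "evt \<omega> (s - t) = \<zero>\<^bsub>V\<^esub>" using evt_rel[OF \<omega> t(2)] by auto
    have "evt \<omega> s = evt \<omega> ((s - t) + t)" by simp
    also have "\<dots> = evt \<omega> (s - t) \<oplus>\<^bsub>V\<^esub> evt \<omega> t" by (rule evt_add[OF d(1) t(1)])
    finally show ?thesis using d(2) evt_closed[OF t(1)] by simp
  qed
  moreover have "s \<in> cls s" unfolding mem_cls using s tensor_relations.zero by simp
  ultimately have "evt \<omega> ` cls s = {evt \<omega> s}" by blast
  then show ?thesis unfolding tensor_eval_def evt_def[symmetric] by simp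
qed

text \<open>
  If \<open>\<omega> \<circ> f = \<omega>\<close>, then \<open>\<omega> \<otimes> id\<close> takes the same value on \<open>S\<close> and on \<open>(f \<otimes> id) S\<close>, while it
  carries \<open>(id \<otimes> h) S\<close> to the image under \<open>h\<close> of the value on \<open>S\<close>.
\<close>

lemma eval_invariant:
  assumes f: "linA f" and h: "linV h" and \<omega>: "linF \<omega>" and inv: "\<And>a. a \<in> carrier A \<Longrightarrow> \<omega> (f a) = \<omega> a"
    and S: "S \<in> tensor A V" and eq: "tensor_map A V f (\<lambda>v. v) S = tensor_map A V (\<lambda>a. a) h S"
  shows "h (tensor_eval V \<omega> S) = tensor_eval V \<omega> S"
proof -
  have idA: "linA (\<lambda>a. a)" and idV: "linV (\<lambda>v. v)" by (simp_all add: linA_def linV_def)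
  obtain s where s: "s \<in> free" "S = cls s" using S by (auto simp: tensor_eq)
  have "cls (push (two f (\<lambda>v. v)) s) = cls (push (two (\<lambda>a. a) h) s)"
    using eq unfolding s(2) tensor_map_cls[OF f idV s(1)] tensor_map_cls[OF idA h s(1)] .
  then have "evt \<omega> (push (two f (\<lambda>v. v)) s) = evt \<omega> (push (two (\<lambda>a. a) h) s)"
    using tensor_eval_cls[OF \<omega> push_free[OF f idV s(1)]] tensor_eval_cls[OF \<omega> push_free[OF idA h s(1)]] by simp
  moreover have "evt \<omega> (push (two f (\<lambda>v. v)) s) = evt \<omega> s"
    unfolding evt_push[OF f idV s(1)] unfolding evt_def
    by (rule V.finsum_cong'[OF refl]) (use s(1) inv in \<open>auto simp: free_space_def intro!: smult_closed_V\<close>)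
  moreover have "evt \<omega> (push (two (\<lambda>a. a) h) s) = h (evt \<omega> s)"
    unfolding evt_push[OF idA h s(1)] evt_linear[OF h s(1)] ..
  ultimately show ?thesis unfolding s(2) tensor_eval_cls[OF \<omega> s(1)] by simp
qed

lemma bilinear_right:
  assumes a: "a \<in> carrier A" and I: "finite I" and v: "\<And>i. i \<in> I \<Longrightarrow> v i \<in> carrier V"
  shows "Poly_Mapping.single (a, \<Oplus>\<^bsub>V\<^esub>i\<in>I. c i \<odot>\<^bsub>V\<^esub> v i) 1 - (\<Sum>i\<in>I. Poly_Mapping.single (a, v i) (c i)) \<in> rel"
  using I v
proof (induction I rule: finite_induct)
  case empty
  have "Poly_Mapping.single (a, 0 \<odot>\<^bsub>V\<^esub> \<zero>\<^bsub>V\<^esub>) 1 - Poly_Mapping.single (a, \<zero>\<^bsub>V\<^esub>) 0 \<in> rel"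
    by (rule tensor_relations.scale_right[OF a V.zero_closed])
  then show ?case by (simp add: zero_smult)
next
  case (insert i I)
  let ?w = "\<Oplus>\<^bsub>V\<^esub>i\<in>I. c i \<odot>\<^bsub>V\<^esub> v i"
  have c: "c i \<odot>\<^bsub>V\<^esub> v i \<in> carrier V" "(\<lambda>i. c i \<odot>\<^bsub>V\<^esub> v i) \<in> I \<rightarrow> carrier V" "v i \<in> carrier V"
    using insert by (auto intro!: smult_closed_V)
  have w: "?w \<in> carrier V" using c by (intro V.finsum_closed)
  have "(Poly_Mapping.single (a, c i \<odot>\<^bsub>V\<^esub> v i \<oplus>\<^bsub>V\<^esub> ?w) 1 - Poly_Mapping.single (a, c i \<odot>\<^bsub>V\<^esub> v i) 1 - Poly_Mapping.single (a, ?w) 1)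
      + ((Poly_Mapping.single (a, c i \<odot>\<^bsub>V\<^esub> v i) 1 - Poly_Mapping.single (a, v i) (c i))
      + (Poly_Mapping.single (a, ?w) 1 - (\<Sum>i\<in>I. Poly_Mapping.single (a, v i) (c i)))) \<in> rel"
    using insert a c w by (intro tensor_relations.add tensor_relations.add_right tensor_relations.scale_right) auto
  then show ?case using insert c by (simp add: V.finsum_insert algebra_simps)
qed

lemma bilinear_left:
  assumes v: "v \<in> carrier V" and I: "finite I" and a: "\<And>i. i \<in> I \<Longrightarrow> a i \<in> carrier A"
  shows "Poly_Mapping.single (\<Oplus>\<^bsub>A\<^esub>i\<in>I. c i \<odot>\<^bsub>A\<^esub> a i, v) 1 - (\<Sum>i\<in>I. Poly_Mapping.single (a i, v) (c i)) \<in> rel"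
  using I a
proof (induction I rule: finite_induct)
  case empty
  have "Poly_Mapping.single (0 \<odot>\<^bsub>A\<^esub> \<zero>\<^bsub>A\<^esub>, v) 1 - Poly_Mapping.single (\<zero>\<^bsub>A\<^esub>, v) 0 \<in> rel"
    by (rule tensor_relations.scale_left[OF A.zero_closed v])
  then show ?case using A.smult_l_null[of "\<zero>\<^bsub>A\<^esub>"] by simp
next
  case (insert i I)
  let ?w = "\<Oplus>\<^bsub>A\<^esub>i\<in>I. c i \<odot>\<^bsub>A\<^esub> a i"
  have c: "c i \<odot>\<^bsub>A\<^esub> a i \<in> carrier A" "(\<lambda>i. c i \<odot>\<^bsub>A\<^esub> a i) \<in> I \<rightarrow> carrier A" "a i \<in> carrier A"
    using insert by (auto intro!: smult_closed_A)
  have w: "?w \<in> carrier A" using c by (intro A.finsum_closed)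
  have "(Poly_Mapping.single (c i \<odot>\<^bsub>A\<^esub> a i \<oplus>\<^bsub>A\<^esub> ?w, v) 1 - Poly_Mapping.single (c i \<odot>\<^bsub>A\<^esub> a i, v) 1 - Poly_Mapping.single (?w, v) 1)
      + ((Poly_Mapping.single (c i \<odot>\<^bsub>A\<^esub> a i, v) 1 - Poly_Mapping.single (a i, v) (c i))
      + (Poly_Mapping.single (?w, v) 1 - (\<Sum>i\<in>I. Poly_Mapping.single (a i, v) (c i)))) \<in> rel"
    using insert v c w by (intro tensor_relations.add tensor_relations.add_left tensor_relations.scale_left) auto
  then show ?case using insert c by (simp add: A.finsum_insert algebra_simps)
qed

text \<open>
  The tensor \<open>\<Sum>i. s i \<otimes> e i\<close> is carried by \<open>f \<otimes> id\<close> and by \<open>id \<otimes> h\<close> to the same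
  element if \<open>f\<close> acts on the \<open>s i\<close> by the transpose of the matrix by which \<open>h\<close> acts on the \<open>e i\<close>.
\<close>

lemma matrix_equivariant:
  fixes c :: "'i \<Rightarrow> 'i \<Rightarrow> complex"
  assumes f: "linA f" and h: "linV h" and I: "finite I"
    and s: "\<And>i. i \<in> I \<Longrightarrow> s i \<in> carrier A" and e: "\<And>i. i \<in> I \<Longrightarrow> e i \<in> carrier V"
    and fs: "\<And>i. i \<in> I \<Longrightarrow> f (s i) = (\<Oplus>\<^bsub>A\<^esub>j\<in>I. c i j \<odot>\<^bsub>A\<^esub> s j)"
    and he: "\<And>j. j \<in> I \<Longrightarrow> h (e j) = (\<Oplus>\<^bsub>V\<^esub>i\<in>I. c i j \<odot>\<^bsub>V\<^esub> e i)"
  defines "t \<equiv> \<Sum>i\<in>I. Poly_Mapping.single (s i, e i) (1::complex)"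
  shows "t \<in> free" and "tensor_map A V f (\<lambda>v. v) (cls t) = tensor_map A V (\<lambda>a. a) h (cls t)"
    and "linF \<omega> \<Longrightarrow> tensor_eval V \<omega> (cls t) = (\<Oplus>\<^bsub>V\<^esub>i\<in>I. \<omega> (s i) \<odot>\<^bsub>V\<^esub> e i)"
proof -
  show t: "t \<in> free" unfolding t_def using s e by (intro free_sum free_single) auto
  have idA: "linA (\<lambda>a. a)" and idV: "linV (\<lambda>v. v)" by (simp_all add: linA_def linV_def)
  have p1: "push (two f (\<lambda>v. v)) t = (\<Sum>i\<in>I. Poly_Mapping.single (\<Oplus>\<^bsub>A\<^esub>j\<in>I. c i j \<odot>\<^bsub>A\<^esub> s j, e i) 1)"
    unfolding t_def push_sum push_single using fs by (intro sum.cong refl) simp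
  have p2: "push (two (\<lambda>a. a) h) t = (\<Sum>j\<in>I. Poly_Mapping.single (s j, \<Oplus>\<^bsub>V\<^esub>i\<in>I. c i j \<odot>\<^bsub>V\<^esub> e i) 1)"
    unfolding t_def push_sum push_single using he by (intro sum.cong refl) simp
  let ?u = "\<Sum>i\<in>I. \<Sum>j\<in>I. Poly_Mapping.single (s j, e i) (c i j)"
  have "push (two f (\<lambda>v. v)) t - ?u \<in> rel"
    unfolding p1 sum_subtractf[symmetric] using s e by (intro rel_sum bilinear_left I) auto
  moreover have "push (two (\<lambda>a. a) h) t - ?u \<in> rel"
  proof -
    have u: "?u = (\<Sum>j\<in>I. \<Sum>i\<in>I. Poly_Mapping.single (s j, e i) (c i j))" by (rule sum.swap)
    show ?thesis
      unfolding p2 u sum_subtractf[symmetric] using s e by (intro rel_sum bilinear_right I) auto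
  qed
  ultimately have "push (two f (\<lambda>v. v)) t - push (two (\<lambda>a. a) h) t \<in> rel"
    using rel_diff[of "push (two f (\<lambda>v. v)) t - ?u" "push (two (\<lambda>a. a) h) t - ?u"] by simp
  then show "tensor_map A V f (\<lambda>v. v) (cls t) = tensor_map A V (\<lambda>a. a) h (cls t)"
    unfolding tensor_map_cls[OF f idV t] tensor_map_cls[OF idA h t]
    by (simp add: cls_eq_iff[OF push_free[OF f idV t] push_free[OF idA h t]])
  show "tensor_eval V \<omega> (cls t) = (\<Oplus>\<^bsub>V\<^esub>i\<in>I. \<omega> (s i) \<odot>\<^bsub>V\<^esub> e i)" if \<omega>: "linF \<omega>"
  proof -
    have "evt \<omega> t = (\<Oplus>\<^bsub>V\<^esub>i\<in>I. evt \<omega> (Poly_Mapping.single (s i, e i) 1))"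
      unfolding t_def using s e by (intro evt_sum I free_single)
    also have "\<dots> = (\<Oplus>\<^bsub>V\<^esub>i\<in>I. \<omega> (s i) \<odot>\<^bsub>V\<^esub> e i)"
      using s e by (intro V.finsum_cong'[OF refl]) (auto simp: evt_single intro!: smult_closed_V)
    finally show ?thesis by (simp add: tensor_eval_cls[OF \<omega> t])
  qed
qed

end

section \<open>Representations by matrices\<close>

text \<open>
  Eliminating the last unknown preserves strict diagonal dominance of the remaining rows.
\<close>

lemma diagonally_dominant_solvable:
  fixes R :: "nat \<Rightarrow> nat \<Rightarrow> complex"
  assumes "\<And>i. i < m \<Longrightarrow> (\<Sum>j\<in>{..<m} - {i}. cmod (R i j)) < cmod (R i i)"
  shows "\<exists>u. \<forall>i<m. (\<Sum>j<m. R i j * u j) = v i"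
  using assms
proof (induction m arbitrary: R v)
  case (Suc m)
  have split: "(\<Sum>j\<in>{..<Suc m} - {i}. cmod (R i j)) = (\<Sum>j\<in>{..<m} - {i}. cmod (R i j)) + cmod (R i m)" if "i < m" for i
  proof -
    have "{..<Suc m} - {i} = insert m ({..<m} - {i})" using that by auto
    then show ?thesis by simp
  qed
  have last: "(\<Sum>j<m. cmod (R m j)) < cmod (R m m)"
  proof -
    have "{..<Suc m} - {m} = {..<m}" by auto
    then show ?thesis using Suc.prems[of m] by simp
  qed
  have nz: "R m m \<noteq> 0" using last sum_nonneg[of "{..<m}" "\<lambda>j. cmod (R m j)"] by force
  define q where "q i = R i m / R m m" for i
  define R' where "R' i j = R i j - q i * R m j" for i j
  have "\<exists>u. \<forall>i<m. (\<Sum>j<m. R' i j * u j) = v i - q i * v m"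
  proof (rule Suc.IH)
    fix i assume i: "i < m"
    have "(\<Sum>j\<in>{..<m} - {i}. cmod (R' i j)) \<le> (\<Sum>j\<in>{..<m} - {i}. cmod (R i j) + cmod (q i) * cmod (R m j))"
      unfolding R'_def by (intro sum_mono) (metis norm_mult norm_triangle_ineq4)
    also have "\<dots> = (\<Sum>j\<in>{..<m} - {i}. cmod (R i j)) + cmod (q i) * (\<Sum>j\<in>{..<m} - {i}. cmod (R m j))"
      by (simp add: sum.distrib sum_distrib_left)
    also have "(\<Sum>j\<in>{..<m} - {i}. cmod (R m j)) = (\<Sum>j<m. cmod (R m j)) - cmod (R m i)"
      using i by (simp add: sum_diff1)
    also have "cmod (q i) * ((\<Sum>j<m. cmod (R m j)) - cmod (R m i)) \<le> cmod (q i) * (cmod (R m m) - cmod (R m i))"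
      using last by (intro mult_left_mono) auto
    also have "\<dots> = cmod (R i m) - cmod (q i * R m i)"
      using nz by (simp add: q_def right_diff_distrib norm_divide norm_mult)
    finally have "(\<Sum>j\<in>{..<m} - {i}. cmod (R' i j)) \<le> (\<Sum>j\<in>{..<m} - {i}. cmod (R i j)) + cmod (R i m) - cmod (q i * R m i)"
      by simp
    also have "\<dots> < cmod (R i i) - cmod (q i * R m i)" using Suc.prems[of i] split[OF i] i by simp
    also have "\<dots> \<le> cmod (R' i i)" unfolding R'_def by (rule norm_triangle_ineq2)
    finally show "(\<Sum>j\<in>{..<m} - {i}. cmod (R' i j)) < cmod (R' i i)" .
  qed
  then obtain u where u: "\<forall>i<m. (\<Sum>j<m. R' i j * u j) = v i - q i * v m" by blast
  define um where "um = (v m - (\<Sum>j<m. R m j * u j)) / R m m"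
  define w where "w j = (if j < m then u j else um)" for j
  have row: "(\<Sum>j<Suc m. R i j * w j) = (\<Sum>j<m. R i j * u j) + R i m * um" for i
    by (simp add: w_def)
  have "(\<Sum>j<Suc m. R i j * w j) = v i" if "i < Suc m" for i
  proof (cases "i = m")
    case True
    then show ?thesis unfolding row using nz by (simp add: um_def)
  next
    case False
    then have "(\<Sum>j<m. R i j * u j) - q i * (\<Sum>j<m. R m j * u j) = v i - q i * v m"
      using u that by (simp add: R'_def left_diff_distrib sum_subtractf sum_distrib_left mult.assoc)
    then have eq: "(\<Sum>j<m. R i j * u j) = v i - q i * v m + q i * (\<Sum>j<m. R m j * u j)"
      by (simp only: diff_eq_eq)
    have "R i m * um = q i * (v m - (\<Sum>j<m. R m j * u j))" by (simp add: um_def q_def)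
    then show ?thesis unfolding row eq by (simp only: right_diff_distrib) simp
  qed
  then show ?case by blast
qed simp

definition Cm :: "nat \<Rightarrow> (nat \<Rightarrow> complex) set" where
  "Cm m = {v. \<forall>i\<ge>m. v i = 0}"

text \<open>
  A pairing function \<open>\<real> \<times> \<real> \<rightarrow> \<real>\<close> encodes finitely many real numbers in one.
\<close>

lemma Cm_embedding:
  assumes "(UNIV :: real set) \<lesssim> (UNIV :: 'v set)"
  shows "\<exists>J :: (nat \<Rightarrow> complex) \<Rightarrow> 'v. inj_on J (Cm m)"
proof -
  have "infinite (UNIV :: real set)" by (rule infinite_UNIV_char_0)
  then obtain p :: "real \<times> real \<Rightarrow> real" where p: "inj p"
    using card_of_Times_same_infinite[of "UNIV :: real set"]
    unfolding UNIV_Times_UNIV card_of_ordIso[symmetric] bij_betw_def by blast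
  have "\<exists>j :: (nat \<Rightarrow> complex) \<Rightarrow> real. inj_on j (Cm m)"
  proof (induction m)
    case 0
    have "inj_on (\<lambda>v. 0) (Cm 0)" by (auto simp: Cm_def inj_on_def fun_eq_iff)
    then show ?case by blast
  next
    case (Suc m)
    then obtain j :: "(nat \<Rightarrow> complex) \<Rightarrow> real" where j: "inj_on j (Cm m)" by blast
    define j' where "j' v = p (j (v(m := 0)), p (Re (v m), Im (v m)))" for v
    have "inj_on j' (Cm (Suc m))"
    proof (rule inj_onI)
      fix v w assume v: "v \<in> Cm (Suc m)" and w: "w \<in> Cm (Suc m)" and eq: "j' v = j' w"
      have "(j (v(m := 0)), p (Re (v m), Im (v m))) = (j (w(m := 0)), p (Re (w m), Im (w m)))"
        using eq unfolding j'_def by (rule injD[OF p])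
      then have 1: "j (v(m := 0)) = j (w(m := 0))" and 2: "p (Re (v m), Im (v m)) = p (Re (w m), Im (w m))" by auto
      have "v(m := 0) \<in> Cm m" "w(m := 0) \<in> Cm m" using v w by (auto simp: Cm_def)
      then have "v(m := 0) = w(m := 0)" using inj_onD[OF j, OF 1] by blast
      moreover have "v m = w m" using injD[OF p, OF 2] by (simp add: complex_eq_iff)
      ultimately show "v = w" by (metis fun_upd_triv fun_upd_upd)
    qed
    then show ?case by blast
  qed
  then obtain j :: "(nat \<Rightarrow> complex) \<Rightarrow> real" where j: "inj_on j (Cm m)" by blast
  obtain k :: "real \<Rightarrow> 'v" where k: "inj k" using assms unfolding lepoll_def by blast
  have "inj_on (k \<circ> j) (Cm m)" using j k by (auto intro: comp_inj_on inj_on_subset)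
  then show ?thesis by blast
qed

lemma continuous_map_complex:
  fixes f g :: "'a \<Rightarrow> complex"
  assumes "continuous_map X euclidean f" "continuous_map X euclidean g"
  shows "continuous_map X euclidean (\<lambda>x. f x + g x)" "continuous_map X euclidean (\<lambda>x. f x * g x)"
    "continuous_map X euclidean (\<lambda>x. f x - g x)"
proof -
  have p: "continuous_map X (euclidean :: (complex \<times> complex) topology) (\<lambda>x. (f x, g x))"
    using continuous_map_pairedI[OF assms] by simp
  show "continuous_map X euclidean (\<lambda>x. f x + g x)" "continuous_map X euclidean (\<lambda>x. f x * g x)"
    "continuous_map X euclidean (\<lambda>x. f x - g x)"
    using continuous_map_compose[OF p, of euclidean "\<lambda>z. fst z + snd z"]
      continuous_map_compose[OF p, of euclidean "\<lambda>z. fst z * snd z"]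
      continuous_map_compose[OF p, of euclidean "\<lambda>z. fst z - snd z"]
    by (simp_all add: o_def continuous_intros)
qed

text \<open>
  Representation spaces have to live in a prescribed type that is at least as large as the
  continuum.  The space \<open>\<complex>\<^sup>m\<close> is transported to this type along an injection \<open>J\<close>, with inverse \<open>r\<close>.
\<close>

locale coord_space =
  fixes m :: nat and J :: "(nat \<Rightarrow> complex) \<Rightarrow> 'v"
  assumes inj: "inj_on J (Cm m)"
begin

definition r :: "'v \<Rightarrow> nat \<Rightarrow> complex" where "r = inv_into (Cm m) J"

definition V :: "(complex, 'v) tvs" where
  "V = \<lparr>carrier = J ` Cm m, mult = undefined, one = undefined, zero = J (\<lambda>i. 0),
    add = (\<lambda>x y. J (\<lambda>i. r x i + r y i)), smult = (\<lambda>c x. J (\<lambda>i. c * r x i)),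
    topol = pullback_topology (J ` Cm m) r (top_of_set (Cm m))\<rparr>"

lemma V_simps [simp]:
  "carrier V = J ` Cm m" "zero V = J (\<lambda>i. 0)" "add V x y = J (\<lambda>i. r x i + r y i)"
  "smult V c x = J (\<lambda>i. c * r x i)" "topol V = pullback_topology (J ` Cm m) r (top_of_set (Cm m))"
  by (simp_all add: V_def)

lemma r_J [simp]: "v \<in> Cm m \<Longrightarrow> r (J v) = v"
  unfolding r_def by (rule inv_into_f_f[OF inj])

lemma Cm_closed [simp]:
  "(\<lambda>i. 0) \<in> Cm m" "v \<in> Cm m \<Longrightarrow> w \<in> Cm m \<Longrightarrow> (\<lambda>i. v i + w i) \<in> Cm m" "v \<in> Cm m \<Longrightarrow> (\<lambda>i. c * v i) \<in> Cm m"
  "v \<in> Cm m \<Longrightarrow> (\<lambda>i. - v i) \<in> Cm m"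
  by (auto simp: Cm_def)

lemma r_closed: "x \<in> J ` Cm m \<Longrightarrow> r x \<in> Cm m"
  by auto

lemma J_r: "x \<in> J ` Cm m \<Longrightarrow> J (r x) = x"
  by auto

lemma module_V:
  assumes "cring (scalars :: complex ring)"
  shows "Module.module scalars V"
proof -
  have "abelian_group V"
  proof (rule abelian_groupI)
    fix x assume "x \<in> carrier V"
    then obtain v where v: "v \<in> Cm m" "x = J v" by auto
    show "\<exists>y\<in>carrier V. y \<oplus>\<^bsub>V\<^esub> x = \<zero>\<^bsub>V\<^esub>"
      using v by (intro bexI[of _ "J (\<lambda>i. - v i)"]) auto
  qed (auto simp: add.commute add.left_commute add.assoc)
  moreover have scalars_simp: "carrier (scalars :: complex ring) = UNIV" "add scalars x y = x + (y :: complex)"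
    "mult scalars x y = x * (y :: complex)" "one scalars = (1 :: complex)" for x y
    by (simp_all add: scalars_def)
  ultimately show ?thesis
    using assms by (intro moduleI) (auto simp: scalars_simp algebra_simps)
qed

lemma continuous_r: "continuous_map (topol V) (top_of_set (Cm m)) r"
proof -
  have "continuous_map (topol V) (top_of_set (Cm m)) (id \<circ> r)"
    unfolding V_simps by (rule continuous_map_pullback) simp
  then show ?thesis by simp
qed

lemma topspace_V: "topspace (topol V) = J ` Cm m"
proof -
  have "topspace (topol V) = r -` Cm m \<inter> J ` Cm m"
    unfolding V_simps(5) topspace_pullback_topology by simp
  also have "\<dots> = J ` Cm m" using r_closed by blast
  finally show ?thesis .
qed

lemma continuous_into_V:
  assumes "\<And>i. i < m \<Longrightarrow> continuous_map Y euclidean (\<lambda>y. f y i)" and f: "\<And>y. y \<in> topspace Y \<Longrightarrow> f y \<in> Cm m"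
  shows "continuous_map Y (topol V) (\<lambda>y. J (f y))"
  unfolding V_simps
proof (rule continuous_map_pullback')
  have "continuous_map Y (product_topology (\<lambda>_::nat. euclidean) UNIV) f"
    unfolding continuous_map_componentwise_UNIV
  proof
    fix i
    show "continuous_map Y euclidean (\<lambda>y. f y i)"
    proof (cases "i < m")
      case False
      have "continuous_map Y euclidean (\<lambda>y. 0::complex)" by simp
      then show ?thesis by (rule continuous_map_eq) (use f False in \<open>simp add: Cm_def\<close>)
    qed (use assms in blast)
  qed
  then have "continuous_map Y (top_of_set (Cm m)) f"
    using f by (simp add: continuous_map_in_subtopology euclidean_product_topology image_subset_iff)
  then show "continuous_map Y (top_of_set (Cm m)) (r \<circ> (\<lambda>y. J (f y)))"
    by (rule continuous_map_eq) (use f in simp)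
  show "topspace Y \<subseteq> (\<lambda>y. J (f y)) -` (J ` Cm m)" using f by auto
qed

lemma continuous_coord:
  assumes "continuous_map Y (topol V) f"
  shows "continuous_map Y euclidean (\<lambda>y. r (f y) i)"
proof -
  have 1: "continuous_map Y (top_of_set (Cm m)) (r \<circ> f)"
    by (rule continuous_map_compose[OF assms continuous_r])
  have 2: "continuous_map (top_of_set (Cm m)) euclidean (\<lambda>v. v i)"
    by (simp add: continuous_on_subset[OF continuous_on_product_coordinates])
  show ?thesis using continuous_map_compose[OF 1 2] by (simp add: o_def)
qed

lemma locally_convex_V:
  assumes "cring (scalars :: complex ring)"
  shows "locally_convex_space V"
  unfolding locally_convex_space_def
proof (intro conjI allI impI)
  show "Module.module scalars V" by (rule module_V[OF assms])
  show "topspace (topol V) = carrier V" unfolding topspace_V V_simps(1) ..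
  show "Hausdorff_space (topol V)"
  proof (rule Hausdorff_space_injective_preimage[OF _ continuous_r])
    show "Hausdorff_space (top_of_set (Cm m))" by (simp add: Hausdorff_space_subtopology)
    show "inj_on r (topspace (topol V))"
      unfolding topspace_V by (rule inj_on_inverseI[of _ J]) (rule J_r)
  qed
  have rT: "r (fst z) \<in> Cm m" "r (snd z) \<in> Cm m" if "z \<in> topspace (prod_topology (topol V) (topol V))" for z
    using that r_closed unfolding topspace_prod_topology topspace_V mem_Times_iff by blast+
  have rT': "r (snd z) \<in> Cm m" if "z \<in> topspace (prod_topology (euclidean :: complex topology) (topol V))" for z
    using that r_closed unfolding topspace_prod_topology topspace_V mem_Times_iff by blast
  show "continuous_map (prod_topology (topol V) (topol V)) (topol V) (\<lambda>(x, y). x \<oplus>\<^bsub>V\<^esub> y)"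
    unfolding case_prod_unfold V_simps(3)
  proof (rule continuous_into_V)
    show "continuous_map (prod_topology (topol V) (topol V)) euclidean (\<lambda>z. r (fst z) i + r (snd z) i)" for i
      by (intro continuous_map_complex continuous_coord continuous_map_fst continuous_map_snd)
    show "(\<lambda>i. r (fst z) i + r (snd z) i) \<in> Cm m" if "z \<in> topspace (prod_topology (topol V) (topol V))" for z
      by (intro Cm_closed rT that)
  qed
  show "continuous_map (prod_topology euclidean (topol V)) (topol V) (\<lambda>(c, x). c \<odot>\<^bsub>V\<^esub> x)"
    unfolding case_prod_unfold V_simps(4)
  proof (rule continuous_into_V)
    show "continuous_map (prod_topology euclidean (topol V)) euclidean (\<lambda>z. fst z * r (snd z) i)" for i
      by (intro continuous_map_complex continuous_coord continuous_map_fst continuous_map_snd)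
    show "(\<lambda>i. fst z * r (snd z) i) \<in> Cm m" if "z \<in> topspace (prod_topology euclidean (topol V))" for z
      by (intro Cm_closed rT' that)
  qed
  fix U assume U: "openin (topol V) U \<and> \<zero>\<^bsub>V\<^esub> \<in> U"
  then obtain U' where U': "openin (top_of_set (Cm m)) U'" "U = r -` U' \<inter> J ` Cm m"
    unfolding V_simps(5) openin_pullback_topology by blast
  then obtain Q where Q: "open Q" "U = r -` (Cm m \<inter> Q) \<inter> J ` Cm m"
    unfolding openin_open by blast
  have "r (J (\<lambda>i. 0)) \<in> Q" using U Q(2) by simp
  then have "openin (product_topology (\<lambda>_::nat. euclidean :: complex topology) UNIV) Q" "(\<lambda>i. 0) \<in> Q"
    using Q(1) by (simp_all add: euclidean_product_topology)
  then obtain Y where Y: "(\<lambda>i. 0) \<in> (\<Pi>\<^sub>E i\<in>UNIV. Y i)" "\<And>i. openin (euclidean :: complex topology) (Y i)" "(\<Pi>\<^sub>E i\<in>UNIV. Y i) \<subseteq> Q"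
    using product_topology_open_contains_basis[of "\<lambda>_. euclidean" UNIV Q "\<lambda>i. 0"] by blast
  have Y0: "0 \<in> Y i" for i using PiE_mem[OF Y(1)] by blast
  have "\<exists>e>0. ball 0 e \<subseteq> Y i" for i
  proof -
    have "open (Y i)" using Y(2)[of i] by simp
    then show ?thesis using Y0 open_contains_ball by blast
  qed
  then have "\<exists>e. \<forall>i. e i > 0 \<and> ball 0 (e i) \<subseteq> Y i" by (intro choice) blast
  then obtain e where e: "\<forall>i. e i > 0 \<and> ball 0 (e i) \<subseteq> Y i" by blast
  define B where "B = {v \<in> Cm m. \<forall>i<m. cmod (v i) < e i}"
  have BQ: "B \<subseteq> Cm m \<inter> Q"
  proof
    fix v assume v: "v \<in> B"
    have "v i \<in> Y i" for i
    proof (cases "i < m")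
      case True
      then have "v i \<in> ball 0 (e i)" using v by (simp add: B_def)
      then show ?thesis using e by blast
    next
      case False
      then show ?thesis using v Y0 by (simp add: B_def Cm_def)
    qed
    then have "v \<in> Q" using Y(3) by (auto simp: PiE_iff)
    then show "v \<in> Cm m \<inter> Q" using v by (simp add: B_def)
  qed
  have B_eq: "B = Cm m \<inter> (\<Inter>i\<in>{..<m}. {v. cmod (v i) < e i})" by (auto simp: B_def)
  have "open (\<Inter>i\<in>{..<m}. {v::nat \<Rightarrow> complex. cmod (v i) < e i})"
    by (intro open_INT finite_lessThan ballI open_Collect_less continuous_intros continuous_on_product_coordinates)
  then have oB: "openin (top_of_set (Cm m)) B" unfolding B_eq by (rule openin_open_Int)
  let ?W = "r -` B \<inter> J ` Cm m"
  have "openin (topol V) ?W" 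
    unfolding V_simps(5) openin_pullback_topology by (intro exI[of _ B] conjI oB refl)
  moreover have "convex_in V ?W"
    unfolding convex_in_def
  proof (intro conjI ballI)
    show "?W \<subseteq> carrier V" by simp
    fix x y :: 'v and t :: real assume x: "x \<in> ?W" and y: "y \<in> ?W" and t: "t \<in> {0..1}"
    define z where "z i = complex_of_real (1 - t) * r x i + complex_of_real t * r y i" for i
    have rx: "r x \<in> B" "r y \<in> B" using x y by auto
    then have cm: "r x \<in> Cm m" "r y \<in> Cm m" by (simp_all add: B_def)
    have zC: "z \<in> Cm m" unfolding z_def[abs_def] using cm by (intro Cm_closed)
    have "cmod (z i) < e i" if i: "i < m" for i
    proof -
      have b: "cmod (r x i) < e i" "cmod (r y i) < e i" using rx i by (simp_all add: B_def)
      have "cmod (z i) \<le> (1 - t) * cmod (r x i) + t * cmod (r y i)"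
        unfolding z_def using norm_triangle_ineq[of "complex_of_real (1 - t) * r x i" "complex_of_real t * r y i"] t
        by (simp add: norm_mult del: of_real_diff)
      also have "\<dots> < e i" by (rule convex_bound_lt) (use b t in auto)
      finally show ?thesis .
    qed
    then have "z \<in> B" using zC by (simp add: B_def)
    moreover have "(of_real (1 - t) \<odot>\<^bsub>V\<^esub> x) \<oplus>\<^bsub>V\<^esub> (of_real t \<odot>\<^bsub>V\<^esub> y) = J z"
      using cm by (simp add: z_def[abs_def])
    ultimately show "(of_real (1 - t) \<odot>\<^bsub>V\<^esub> x) \<oplus>\<^bsub>V\<^esub> (of_real t \<odot>\<^bsub>V\<^esub> y) \<in> ?W"
      using zC by simp
  qed
  moreover have "\<zero>\<^bsub>V\<^esub> \<in> ?W" using e by (simp add: B_def)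
  moreover have "?W \<subseteq> U" using BQ Q(2) by blast
  ultimately show "\<exists>W. openin (topol V) W \<and> convex_in V W \<and> \<zero>\<^bsub>V\<^esub> \<in> W \<and> W \<subseteq> U" by blast
qed

definition basis :: "nat \<Rightarrow> 'v" where
  "basis i = J (\<lambda>j. if j = i then 1 else 0)"

lemma unit_Cm: "i < m \<Longrightarrow> (\<lambda>j. if j = i then 1 else 0) \<in> Cm m"
  by (auto simp: Cm_def)

lemma basis_carrier: "i < m \<Longrightarrow> basis i \<in> carrier V"
  using unit_Cm by (simp add: basis_def)

lemma finsum_basis:
  assumes "cring (scalars :: complex ring)"
  shows "(\<Oplus>\<^bsub>V\<^esub>i\<in>{..<m}. c i \<odot>\<^bsub>V\<^esub> basis i) = J (\<lambda>i. if i < m then c i else 0)"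
proof -
  interpret V: module "scalars :: complex ring" V by (rule module_V[OF assms])
  have "(\<Oplus>\<^bsub>V\<^esub>i\<in>{..<k}. c i \<odot>\<^bsub>V\<^esub> basis i) = J (\<lambda>i. if i < k then c i else 0)" if "k \<le> m" for k
    using that
  proof (induction k)
    case (Suc k)
    have k: "k < m" using Suc.prems by simp
    have mem: "c i \<odot>\<^bsub>V\<^esub> basis i \<in> carrier V" if "i < m" for i
      using unit_Cm[OF that] by (simp add: basis_def)
    have "(\<lambda>i. if i < k then c i else 0) \<in> Cm m" using k by (auto simp: Cm_def)
    moreover have "c k \<odot>\<^bsub>V\<^esub> basis k = J (\<lambda>i. c k * (if i = k then 1 else 0))" "(\<lambda>i. c k * (if i = k then 1 else 0)) \<in> Cm m"
      using unit_Cm[OF k] by (simp_all add: basis_def)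
    ultimately have "(c k \<odot>\<^bsub>V\<^esub> basis k) \<oplus>\<^bsub>V\<^esub> J (\<lambda>i. if i < k then c i else 0)
        = J (\<lambda>i. c k * (if i = k then 1 else 0) + (if i < k then c i else 0))" by simp
    also have "(\<lambda>i. c k * (if i = k then 1 else 0) + (if i < k then c i else 0)) = (\<lambda>i. if i < Suc k then c i else 0)"
      by (auto simp: fun_eq_iff less_Suc_eq)
    finally have step: "(c k \<odot>\<^bsub>V\<^esub> basis k) \<oplus>\<^bsub>V\<^esub> J (\<lambda>i. if i < k then c i else 0) = J (\<lambda>i. if i < Suc k then c i else 0)" .
    have "(\<Oplus>\<^bsub>V\<^esub>i\<in>{..<Suc k}. c i \<odot>\<^bsub>V\<^esub> basis i) = (c k \<odot>\<^bsub>V\<^esub> basis k) \<oplus>\<^bsub>V\<^esub> (\<Oplus>\<^bsub>V\<^esub>i\<in>{..<k}. c i \<odot>\<^bsub>V\<^esub> basis i)"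
      unfolding lessThan_Suc using k mem by (intro V.finsum_insert) (auto simp del: V_simps)
    then show ?case using Suc step by simp
  qed (simp add: V.finsum_empty)
  then show ?thesis by simp
qed

end

locale matrix_rep = coord_space m J + group G
  for m :: nat and J :: "(nat \<Rightarrow> complex) \<Rightarrow> 'v" and G :: "('g, nat \<Rightarrow> real) lie_group" (structure) +
  fixes a :: "nat \<Rightarrow> nat \<Rightarrow> 'g \<Rightarrow> real"
  assumes top_G: "topspace (mtop (mfd G)) = carrier G"
    and a_cont: "\<And>i j. i < m \<Longrightarrow> j < m \<Longrightarrow> continuous_map (mtop (mfd G)) euclideanreal (a i j)"
    and a_one: "\<And>i j. i < m \<Longrightarrow> j < m \<Longrightarrow> a i j \<one> = (if i = j then 1 else 0)"
    and a_mult: "\<And>g h i j. g \<in> carrier G \<Longrightarrow> h \<in> carrier G \<Longrightarrow> i < m \<Longrightarrow> j < m \<Longrightarrow>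
      a i j (g \<otimes> h) = (\<Sum>k<m. a i k g * a k j h)"
begin

definition act :: "'g \<Rightarrow> (nat \<Rightarrow> complex) \<Rightarrow> nat \<Rightarrow> complex" where
  "act g v i = (if i < m then \<Sum>j<m. complex_of_real (a i j g) * v j else 0)"

definition \<pi> :: "'g \<Rightarrow> 'v \<Rightarrow> 'v" where
  "\<pi> g = (\<lambda>x\<in>J ` Cm m. J (act g (r x)))"

lemma act_Cm: "act g v \<in> Cm m"
  by (auto simp: Cm_def act_def)

lemma act_one: "v \<in> Cm m \<Longrightarrow> act \<one> v = v"
  by (auto simp: act_def a_one fun_eq_iff Cm_def if_distrib[where f="\<lambda>z. complex_of_real z * _"] cong: if_cong)

lemma act_mult:
  assumes g: "g \<in> carrier G" and h: "h \<in> carrier G"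
  shows "act (g \<otimes> h) v = act g (act h v)"
proof
  fix i
  show "act (g \<otimes> h) v i = act g (act h v) i"
  proof (cases "i < m")
    case True
    have "act (g \<otimes> h) v i = (\<Sum>j<m. \<Sum>k<m. complex_of_real (a i k g) * (complex_of_real (a k j h) * v j))"
      using True by (simp add: act_def a_mult[OF g h True] sum_distrib_right mult.assoc)
    also have "\<dots> = (\<Sum>k<m. \<Sum>j<m. complex_of_real (a i k g) * (complex_of_real (a k j h) * v j))"
      by (rule sum.swap)
    also have "\<dots> = act g (act h v) i"
      using True by (simp add: act_def sum_distrib_left)
    finally show ?thesis .
  qed (simp add: act_def)
qed

lemma \<pi>_J: "v \<in> Cm m \<Longrightarrow> \<pi> g (J v) = J (act g v)"
  by (simp add: \<pi>_def)

lemma \<pi>_mult: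
  assumes "g \<in> carrier G" "h \<in> carrier G" "x \<in> J ` Cm m"
  shows "\<pi> (g \<otimes> h) x = \<pi> g (\<pi> h x)"
  using assms by (auto simp: \<pi>_J act_mult act_Cm)

lemma \<pi>_closed: "x \<in> J ` Cm m \<Longrightarrow> \<pi> g x \<in> J ` Cm m"
  by (auto simp: \<pi>_J act_Cm)

lemma \<pi>_one: "x \<in> J ` Cm m \<Longrightarrow> \<pi> \<one> x = x"
  by (auto simp: \<pi>_J act_one)

lemma \<pi>_Bij:
  assumes g: "g \<in> carrier G"
  shows "\<pi> g \<in> Bij (J ` Cm m)"
proof -
  have "bij_betw (\<pi> g) (J ` Cm m) (J ` Cm m)"
  proof (rule bij_betwI[of _ _ _ "\<pi> (inv g)"])
    show "\<pi> g \<in> J ` Cm m \<rightarrow> J ` Cm m" "\<pi> (inv g) \<in> J ` Cm m \<rightarrow> J ` Cm m" using \<pi>_closed by blast+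
    show "\<pi> (inv g) (\<pi> g x) = x" if "x \<in> J ` Cm m" for x
      using \<pi>_mult[of "inv g" g x] g that by (simp add: \<pi>_one)
    show "\<pi> g (\<pi> (inv g) x) = x" if "x \<in> J ` Cm m" for x
      using \<pi>_mult[of g "inv g" x] g that by (simp add: \<pi>_one)
  qed
  then show ?thesis by (simp add: Bij_def \<pi>_def)
qed

lemma \<pi>_linear:
  assumes "x \<in> J ` Cm m" "y \<in> J ` Cm m"
  shows "\<pi> g (x \<oplus>\<^bsub>V\<^esub> y) = \<pi> g x \<oplus>\<^bsub>V\<^esub> \<pi> g y" "\<pi> g (c \<odot>\<^bsub>V\<^esub> x) = c \<odot>\<^bsub>V\<^esub> \<pi> g x"
proof -
  obtain v w where vw: "v \<in> Cm m" "x = J v" "w \<in> Cm m" "y = J w" using assms by blast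
  have "act g (\<lambda>i. v i + w i) = (\<lambda>i. act g v i + act g w i)" "act g (\<lambda>i. c * v i) = (\<lambda>i. c * act g v i)"
    by (auto simp: act_def fun_eq_iff distrib_left sum.distrib sum_distrib_left mult.left_commute)
  then show "\<pi> g (x \<oplus>\<^bsub>V\<^esub> y) = \<pi> g x \<oplus>\<^bsub>V\<^esub> \<pi> g y" "\<pi> g (c \<odot>\<^bsub>V\<^esub> x) = c \<odot>\<^bsub>V\<^esub> \<pi> g x"
    using vw by (simp_all add: \<pi>_J act_Cm)
qed

lemma continuous_representation_\<pi>:
  assumes "cring (scalars :: complex ring)"
  shows "continuous_representation G V \<pi>"
  unfolding continuous_representation_def
proof (intro conjI)
  show "locally_convex_space V" by (rule locally_convex_V[OF assms])
  have mem: "\<pi> g \<in> carrier (general_linear V)" if "g \<in> carrier G" for g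
  proof -
    have "\<forall>v\<in>J ` Cm m. \<forall>w\<in>J ` Cm m. \<pi> g (v \<oplus>\<^bsub>V\<^esub> w) = \<pi> g v \<oplus>\<^bsub>V\<^esub> \<pi> g w"
      by (intro ballI) (rule \<pi>_linear(1))
    moreover have "\<forall>c. \<forall>v\<in>J ` Cm m. \<pi> g (c \<odot>\<^bsub>V\<^esub> v) = c \<odot>\<^bsub>V\<^esub> \<pi> g v"
      by (intro allI ballI) (rule \<pi>_linear(2))
    ultimately show ?thesis
      unfolding general_linear_def V_simps(1) using \<pi>_Bij[OF that]
      by (simp del: V_simps ball_simps)
  qed
  show "\<pi> \<in> hom G (general_linear V)"
  proof (rule homI)
    fix g h assume g: "g \<in> carrier G" and h: "h \<in> carrier G"
    have "\<pi> (g \<otimes> h) = compose (J ` Cm m) (\<pi> g) (\<pi> h)"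
    proof (rule extensionalityI[of _ "J ` Cm m"])
      show "\<pi> (g \<otimes> h) x = compose (J ` Cm m) (\<pi> g) (\<pi> h) x" if "x \<in> J ` Cm m" for x
        using \<pi>_mult[OF g h that] that by (simp add: compose_def)
    qed (simp_all add: \<pi>_def)
    then show "\<pi> (g \<otimes> h) = \<pi> g \<otimes>\<^bsub>general_linear V\<^esub> \<pi> h"
      using \<pi>_Bij[OF g] \<pi>_Bij[OF h] by (simp add: general_linear_def BijGroup_def)
  qed (rule mem)
  let ?T = "mtop (mfd G)"
  have rT: "snd z \<in> J ` Cm m" if "z \<in> topspace (prod_topology ?T (topol V))" for z
    using that unfolding topspace_prod_topology topspace_V mem_Times_iff by blast
  have "continuous_map (prod_topology ?T (topol V)) (topol V) (\<lambda>z. J (act (fst z) (r (snd z))))"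
  proof (rule continuous_into_V)
    fix i assume i: "i < m"
    have "continuous_map (prod_topology ?T (topol V)) euclidean (\<lambda>z. \<Sum>j<k. complex_of_real (a i j (fst z)) * r (snd z) j)" if "k \<le> m" for k
      using that
    proof (induction k)
      case (Suc k)
      have "continuous_map (prod_topology ?T (topol V)) euclideanreal (\<lambda>z. a i k (fst z))"
        using continuous_map_compose[OF continuous_map_fst a_cont[OF i, of k]] Suc.prems by (simp add: o_def)
      from continuous_map_compose[OF this, of euclidean complex_of_real]
      have "continuous_map (prod_topology ?T (topol V)) euclidean (\<lambda>z. complex_of_real (a i k (fst z)))"
        by (simp add: o_def continuous_intros)
      then show ?case
        using Suc unfolding sum.lessThan_Suc
        by (intro continuous_map_complex continuous_coord continuous_map_snd) auto
    qed simp
    from this[of m] show "continuous_map (prod_topology ?T (topol V)) euclidean (\<lambda>z. act (fst z) (r (snd z)) i)"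
      using i by (simp add: act_def)
  qed (rule act_Cm)
  then show "continuous_map (prod_topology ?T (topol V)) (topol V) (\<lambda>(g, v). \<pi> g v)"
    by (rule continuous_map_eq) (simp only: case_prod_unfold \<pi>_def rT restrict_apply')
qed

end

section \<open>Smooth functions on open subsets of Euclidean space\<close>

text \<open>
  The underlying set of \<open>Euclidean_space n\<close>.
\<close>

definition Rn :: "nat \<Rightarrow> (nat \<Rightarrow> real) set" where
  "Rn n = {x. \<forall>i\<ge>n. x i = 0}"

definition line :: "(nat \<Rightarrow> real) \<Rightarrow> (nat \<Rightarrow> real) \<Rightarrow> real \<Rightarrow> nat \<Rightarrow> real" where
  "line x h t = (\<lambda>i. x i + t * h i)"

definition open_in_Rn :: "nat \<Rightarrow> (nat \<Rightarrow> real) set \<Rightarrow> bool" where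
  "open_in_Rn n U \<longleftrightarrow> openin (top_of_set (Rn n)) U"

lemma Euclidean_space_eq: "Euclidean_space n = top_of_set (Rn n)"
  by (simp add: Euclidean_space_def Rn_def euclidean_product_topology)

lemma line_0 [simp]: "line x h 0 = x"
  by (simp add: line_def)

lemma line_in_Rn: "x \<in> Rn n \<Longrightarrow> h \<in> Rn n \<Longrightarrow> line x h t \<in> Rn n"
  by (simp add: line_def Rn_def)

lemma continuous_on_line: "continuous_on UNIV (line x h)"
  unfolding line_def by (intro continuous_on_coordinatewise_then_product continuous_intros)

lemma line_shift: "line (line x h s) h t = line x h (s + t)"
  by (simp add: line_def algebra_simps fun_eq_iff)

lemma open_in_Rn_D: "open_in_Rn n U \<Longrightarrow> x \<in> U \<Longrightarrow> x \<in> Rn n"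
  unfolding open_in_Rn_def using openin_imp_subset by blast

lemma eventually_in_open_Rn:
  assumes "open_in_Rn n U" "x \<in> U" "continuous_on UNIV g" "g (0::real) = x" "\<And>t. g t \<in> Rn n"
  shows "\<exists>d>0. \<forall>t. \<bar>t\<bar> < d \<longrightarrow> g t \<in> U"
proof -
  obtain W where W: "open W" "U = Rn n \<inter> W"
    using assms(1) unfolding open_in_Rn_def openin_open by blast
  have "open (g -` W)" using W(1) assms(3) by (simp add: open_vimage)
  moreover have "0 \<in> g -` W" using assms(2,4) W(2) by simp
  ultimately obtain d where "d > 0" and d: "\<forall>t. dist t 0 < d \<longrightarrow> t \<in> g -` W"
    unfolding open_dist by blast
  have "g t \<in> U" if "\<bar>t\<bar> < d" for t
    using d that assms(5)[of t] unfolding W(2) by (simp add: dist_real_def)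
  then show ?thesis using \<open>d > 0\<close> by blast
qed

text \<open>
  Smoothness as the largest class of continuous functions that is closed under directional
  derivatives.  By coinduction, a function is smooth as soon as it belongs to some class with these
  two properties (\<open>smooth_fun_class\<close>), and no iterated derivative has to be computed.
\<close>

definition dderiv :: "((nat \<Rightarrow> real) \<Rightarrow> complex) \<Rightarrow> (nat \<Rightarrow> real) \<Rightarrow> (nat \<Rightarrow> real) \<Rightarrow> complex \<Rightarrow> bool" where
  "dderiv f x h l \<longleftrightarrow> ((\<lambda>t. f (line x h t)) has_vector_derivative l) (at 0)"

coinductive smooth_fun :: "nat \<Rightarrow> (nat \<Rightarrow> real) set \<Rightarrow> ((nat \<Rightarrow> real) \<Rightarrow> complex) \<Rightarrow> bool" for n U where
  smooth_funI: "continuous_on U f \<Longrightarrow>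
    (\<And>h. h \<in> Rn n \<Longrightarrow> \<exists>f'. smooth_fun n U f' \<and> (\<forall>x\<in>U. dderiv f x h (f' x))) \<Longrightarrow> smooth_fun n U f"

lemma smooth_fun_continuous: "smooth_fun n U f \<Longrightarrow> continuous_on U f"
  by (auto elim: smooth_fun.cases)

lemma smooth_fun_deriv:
  "smooth_fun n U f \<Longrightarrow> h \<in> Rn n \<Longrightarrow> \<exists>f'. smooth_fun n U f' \<and> (\<forall>x\<in>U. dderiv f x h (f' x))"
  by (auto elim: smooth_fun.cases)

lemma smooth_fun_class:
  assumes "\<C> f" and "\<And>f. \<C> f \<Longrightarrow> continuous_on U f"
    and "\<And>f h. \<C> f \<Longrightarrow> h \<in> Rn n \<Longrightarrow> \<exists>f'. \<C> f' \<and> (\<forall>x\<in>U. dderiv f x h (f' x))"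
  shows "smooth_fun n U f"
  using assms(1)
proof (coinduction arbitrary: f rule: smooth_fun.coinduct)
  case smooth_fun
  then show ?case using assms(2,3)[of f] by blast
qed

lemma dderiv_cong:
  assumes "open_in_Rn n U" "x \<in> U" "h \<in> Rn n" "\<And>y. y \<in> U \<Longrightarrow> f y = g y" "dderiv f x h l"
  shows "dderiv g x h l"
proof -
  obtain d where d: "d > 0" "\<forall>t. \<bar>t\<bar> < d \<longrightarrow> line x h t \<in> U"
    using eventually_in_open_Rn[OF assms(1,2) continuous_on_line[of x h] line_0 line_in_Rn[OF open_in_Rn_D[OF assms(1,2)] assms(3)]] by blast
  show ?thesis
    using assms(5) unfolding dderiv_def
    by (rule has_vector_derivative_transform_within[OF _ d(1)]) (use d assms in \<open>auto simp: dist_real_def\<close>)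
qed

lemma smooth_fun_cong:
  assumes U: "open_in_Rn n U" and f: "smooth_fun n U f" and eq: "\<And>x. x \<in> U \<Longrightarrow> f x = g x"
  shows "smooth_fun n U g"
proof (rule smooth_fun_class[where \<C>="\<lambda>g. \<exists>f. smooth_fun n U f \<and> (\<forall>x\<in>U. f x = g x)"])
  show "\<exists>f. smooth_fun n U f \<and> (\<forall>x\<in>U. f x = g x)" using f eq by blast
next
  fix g assume "\<exists>f. smooth_fun n U f \<and> (\<forall>x\<in>U. f x = g x)"
  then show "continuous_on U g" using smooth_fun_continuous continuous_on_cong by metis
next
  fix g h assume g: "\<exists>f. smooth_fun n U f \<and> (\<forall>x\<in>U. f x = g x)" and h: "h \<in> Rn n"
  then obtain f where f: "smooth_fun n U f" "\<forall>x\<in>U. f x = g x" by blast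
  obtain f' where f': "smooth_fun n U f'" "\<forall>x\<in>U. dderiv f x h (f' x)" using smooth_fun_deriv[OF f(1) h] by blast
  have "\<forall>x\<in>U. dderiv g x h (f' x)" using dderiv_cong[OF U _ h, of _ f g] f f' by blast
  then show "\<exists>f'. (\<exists>f. smooth_fun n U f \<and> (\<forall>x\<in>U. f x = f' x)) \<and> (\<forall>x\<in>U. dderiv g x h (f' x))"
    using f'(1) by blast
qed

lemma dderiv_unique: "dderiv f x h l \<Longrightarrow> dderiv f x h l' \<Longrightarrow> l = l'"
  unfolding dderiv_def by (rule vector_derivative_unique_at)

lemma smooth_fun_subset:
  assumes "smooth_fun n U f" "V \<subseteq> U"
  shows "smooth_fun n V f"
proof (rule smooth_fun_class[where \<C>="smooth_fun n U"])
  show "continuous_on V f" if "smooth_fun n U f" for f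
    using smooth_fun_continuous[OF that] assms(2) by (rule continuous_on_subset)
  show "\<exists>f'. smooth_fun n U f' \<and> (\<forall>x\<in>V. dderiv f x h (f' x))" if "smooth_fun n U f" "h \<in> Rn n" for f h
    using smooth_fun_deriv[OF that] assms(2) by blast
qed (rule assms)

lemma smooth_fun_local:
  assumes U: "open_in_Rn n U"
    and loc: "\<And>x. x \<in> U \<Longrightarrow> \<exists>V. open_in_Rn n V \<and> x \<in> V \<and> V \<subseteq> U \<and> smooth_fun n V f"
  shows "smooth_fun n U f"
proof (rule smooth_fun_class[where \<C>="\<lambda>f. \<forall>x\<in>U. \<exists>V. open_in_Rn n V \<and> x \<in> V \<and> V \<subseteq> U \<and> smooth_fun n V f"])
  show "\<forall>x\<in>U. \<exists>V. open_in_Rn n V \<and> x \<in> V \<and> V \<subseteq> U \<and> smooth_fun n V f" using loc by blast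
next
  fix f assume f: "\<forall>x\<in>U. \<exists>V. open_in_Rn n V \<and> x \<in> V \<and> V \<subseteq> U \<and> smooth_fun n V f"
  show "continuous_on U f"
    unfolding continuous_on_eq_continuous_within
  proof
    fix x assume x: "x \<in> U"
    obtain V where V: "open_in_Rn n V" "x \<in> V" "V \<subseteq> U" "smooth_fun n V f" using f x by blast
    obtain W where W: "open W" "V = Rn n \<inter> W" using V(1) unfolding open_in_Rn_def openin_open by blast
    have UW: "U \<inter> W = V" using W V(3) open_in_Rn_D[OF U] by blast
    have "continuous (at x within V) f" using smooth_fun_continuous[OF V(4)] V(2) by (simp add: continuous_on_eq_continuous_within)
    then show "continuous (at x within U) f"
      unfolding continuous_within using W V(2) UW at_within_nhd[of x W V U] by auto
  qed
next
  fix f h assume f: "\<forall>x\<in>U. \<exists>V. open_in_Rn n V \<and> x \<in> V \<and> V \<subseteq> U \<and> smooth_fun n V f" and h: "h \<in> Rn n"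
  define f' where "f' x = (THE l. dderiv f x h l)" for x
  have "\<exists>V. open_in_Rn n V \<and> x \<in> V \<and> V \<subseteq> U \<and> smooth_fun n V f' \<and> dderiv f x h (f' x)" if x: "x \<in> U" for x
  proof -
    obtain V where V: "open_in_Rn n V" "x \<in> V" "V \<subseteq> U" "smooth_fun n V f" using f x by blast
    obtain f1 where f1: "smooth_fun n V f1" "\<forall>x\<in>V. dderiv f x h (f1 x)" using smooth_fun_deriv[OF V(4) h] by blast
    have eq: "f1 y = f' y" if "y \<in> V" for y
      unfolding f'_def using f1(2) that dderiv_unique by (intro the_equality[symmetric]) blast+
    have "smooth_fun n V f'" by (rule smooth_fun_cong[OF V(1) f1(1) eq])
    then show ?thesis using V f1(2) eq[OF V(2)] by metis
  qed
  then show "\<exists>f'. (\<forall>x\<in>U. \<exists>V. open_in_Rn n V \<and> x \<in> V \<and> V \<subseteq> U \<and> smooth_fun n V f') \<and> (\<forall>x\<in>U. dderiv f x h (f' x))"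
    by blast
qed

lemma smooth_fun_const: "smooth_fun n U (\<lambda>x. c)"
proof (rule smooth_fun_class[where \<C>="\<lambda>f. \<exists>c. f = (\<lambda>x. c)"])
  fix f :: "(nat \<Rightarrow> real) \<Rightarrow> complex" and h assume "\<exists>c. f = (\<lambda>x. c)"
  then have "\<forall>x\<in>U. dderiv f x h ((\<lambda>x. 0) x)" by (auto simp: dderiv_def)
  then show "\<exists>f'. (\<exists>c. f' = (\<lambda>x. c)) \<and> (\<forall>x\<in>U. dderiv f x h (f' x))" by blast
qed auto

lemma smooth_fun_linear:
  assumes f: "smooth_fun n U f" and T: "bounded_linear T"
  shows "smooth_fun n U (\<lambda>x. T (f x))"
proof (rule smooth_fun_class[where \<C>="\<lambda>g. \<exists>f. smooth_fun n U f \<and> g = (\<lambda>x. T (f x))"])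
  show "\<exists>f'. smooth_fun n U f' \<and> (\<lambda>x. T (f x)) = (\<lambda>x. T (f' x))" using f by blast
next
  fix g assume "\<exists>f. smooth_fun n U f \<and> g = (\<lambda>x. T (f x))"
  then show "continuous_on U g"
    using smooth_fun_continuous bounded_linear.continuous_on[OF T] by blast
next
  fix g h assume "\<exists>f. smooth_fun n U f \<and> g = (\<lambda>x. T (f x))" and h: "h \<in> Rn n"
  then obtain f where f: "smooth_fun n U f" "g = (\<lambda>x. T (f x))" by blast
  obtain f' where f': "smooth_fun n U f'" "\<forall>x\<in>U. dderiv f x h (f' x)" using smooth_fun_deriv[OF f(1) h] by blast
  have "\<forall>x\<in>U. dderiv g x h (T (f' x))"
    using f'(2) bounded_linear.has_vector_derivative[OF T] unfolding dderiv_def f(2) by blast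
  then show "\<exists>f'. (\<exists>f. smooth_fun n U f \<and> f' = (\<lambda>x. T (f x))) \<and> (\<forall>x\<in>U. dderiv g x h (f' x))"
    using f'(1) by blast
qed

text \<open>
  Algebraic operations and compositions are all shown to preserve smoothness by one coinduction,
  over the class generated by given smooth functions and by \<open>d \<circ> Re \<circ> u\<close> for \<open>d\<close> in \<open>D\<close>.  This class is
  closed under derivatives by the product and chain rules if \<open>D\<close> is closed under derivatives.
\<close>

inductive gen :: "nat \<Rightarrow> (nat \<Rightarrow> real) set \<Rightarrow> (real \<Rightarrow> real) set \<Rightarrow> ((nat \<Rightarrow> real) \<Rightarrow> complex) \<Rightarrow>
    ((nat \<Rightarrow> real) \<Rightarrow> complex) \<Rightarrow> bool" for n U D u where
  gen_smooth: "smooth_fun n U f \<Longrightarrow> gen n U D u f"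
| gen_comp: "d \<in> D \<Longrightarrow> gen n U D u (\<lambda>x. complex_of_real (d (Re (u x))))"
| gen_add: "gen n U D u f \<Longrightarrow> gen n U D u g \<Longrightarrow> gen n U D u (\<lambda>x. f x + g x)"
| gen_mult: "gen n U D u f \<Longrightarrow> gen n U D u g \<Longrightarrow> gen n U D u (\<lambda>x. f x * g x)"

lemma dderiv_add: "dderiv f x h l \<Longrightarrow> dderiv g x h m \<Longrightarrow> dderiv (\<lambda>x. f x + g x) x h (l + m)"
  unfolding dderiv_def by (rule has_vector_derivative_add)

lemma dderiv_mult:
  assumes "dderiv f x h l" "dderiv g x h m"
  shows "dderiv (\<lambda>x. f x * g x) x h (f x * m + l * g x)"
  using has_vector_derivative_mult[OF assms[unfolded dderiv_def]] by (simp add: dderiv_def)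

lemma dderiv_comp_real:
  assumes u: "dderiv u x h l" and d: "(d has_real_derivative d') (at (Re (u x)))"
  shows "dderiv (\<lambda>x. complex_of_real (d (Re (u x)))) x h (complex_of_real (d' * Re l))"
proof -
  have "((\<lambda>t. Re (u (line x h t))) has_real_derivative Re l) (at 0)"
    using bounded_linear.has_vector_derivative[OF bounded_linear_Re u[unfolded dderiv_def]]
    by (simp add: has_real_derivative_iff_has_vector_derivative)
  then have "((\<lambda>t. d (Re (u (line x h t)))) has_real_derivative d' * Re l) (at 0)"
    using d by (intro DERIV_chain2[where f=d]) auto
  then have "((\<lambda>t. d (Re (u (line x h t)))) has_vector_derivative d' * Re l) (at 0)"
    by (simp add: has_real_derivative_iff_has_vector_derivative)
  from bounded_linear.has_vector_derivative[OF bounded_linear_of_real this]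
  show ?thesis unfolding dderiv_def .
qed

lemma gen_smooth_fun:
  assumes u: "smooth_fun n U u" and uS: "\<And>x. x \<in> U \<Longrightarrow> Re (u x) \<in> S"
    and D: "\<And>d. d \<in> D \<Longrightarrow> \<exists>d'\<in>D. \<forall>t\<in>S. (d has_real_derivative d' t) (at t)"
    and f: "gen n U D u f"
  shows "smooth_fun n U f"
proof (rule smooth_fun_class[where \<C>="gen n U D u"])
  show "gen n U D u f" by fact
next
  fix f assume "gen n U D u f"
  then show "continuous_on U f"
  proof induction
    case (gen_comp d)
    obtain d' where "\<forall>t\<in>S. (d has_real_derivative d' t) (at t)" using D[OF gen_comp] by blast
    then have "continuous_on S d"
      by (meson DERIV_isCont continuous_at_imp_continuous_on)
    moreover have "continuous_on U (\<lambda>x. Re (u x))"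
      by (rule continuous_on_Re[OF smooth_fun_continuous[OF u]])
    ultimately have "continuous_on U (\<lambda>x. d (Re (u x)))"
      using uS by (intro continuous_on_compose2[of S d U]) auto
    then show ?case by (intro continuous_intros)
  qed (blast intro: continuous_on_add continuous_on_mult smooth_fun_continuous)+
next
  fix f h assume f: "gen n U D u f" and h: "h \<in> Rn n"
  from f show "\<exists>f'. gen n U D u f' \<and> (\<forall>x\<in>U. dderiv f x h (f' x))"
  proof induction
    case (gen_smooth f)
    then show ?case using smooth_fun_deriv[OF gen_smooth(1) h] gen.gen_smooth by blast
  next
    case (gen_comp d)
    obtain d' where d': "d' \<in> D" "\<forall>t\<in>S. (d has_real_derivative d' t) (at t)" using D[OF gen_comp(1)] by blast
    obtain u' where u': "smooth_fun n U u'" "\<forall>x\<in>U. dderiv u x h (u' x)" using smooth_fun_deriv[OF u h] by blast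
    have "gen n U D u (\<lambda>x. complex_of_real (d' (Re (u x))) * complex_of_real (Re (u' x)))"
      by (rule gen.gen_mult[OF gen.gen_comp[OF d'(1)] gen.gen_smooth[OF smooth_fun_linear[OF u'(1)
        bounded_linear_compose[OF bounded_linear_of_real bounded_linear_Re]]]])
    moreover have "dderiv (\<lambda>x. complex_of_real (d (Re (u x)))) x h (complex_of_real (d' (Re (u x))) * complex_of_real (Re (u' x)))"
      if "x \<in> U" for x
      using dderiv_comp_real[of u x h "u' x" d "d' (Re (u x))"] u' d' uS that by simp
    ultimately show ?case by blast
  next
    case (gen_add f g)
    then obtain f' g' where "gen n U D u f'" "\<forall>x\<in>U. dderiv f x h (f' x)" "gen n U D u g'" "\<forall>x\<in>U. dderiv g x h (g' x)"
      by blast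
    then have "gen n U D u (\<lambda>x. f' x + g' x)" "\<forall>x\<in>U. dderiv (\<lambda>x. f x + g x) x h (f' x + g' x)"
      by (blast intro: gen.gen_add dderiv_add)+
    then show ?case by blast
  next
    case (gen_mult f g)
    then obtain f' g' where 1: "gen n U D u f'" "\<forall>x\<in>U. dderiv f x h (f' x)" "gen n U D u g'" "\<forall>x\<in>U. dderiv g x h (g' x)"
      by blast
    have "gen n U D u (\<lambda>x. f x * g' x + f' x * g x)"
      by (intro gen.gen_add gen.gen_mult 1 gen_mult)
    moreover have "\<forall>x\<in>U. dderiv (\<lambda>x. f x * g x) x h (f x * g' x + f' x * g x)"
      using 1 dderiv_mult by blast
    ultimately show ?case by blast
  qed
qed

lemma smooth_fun_mult: "smooth_fun n U f \<Longrightarrow> smooth_fun n U g \<Longrightarrow> smooth_fun n U (\<lambda>x. f x * g x)"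
  by (rule gen_smooth_fun[of n U f UNIV "{}", OF _ _ _ gen_mult[OF gen_smooth gen_smooth]]) simp_all

lemma smooth_fun_add: "smooth_fun n U f \<Longrightarrow> smooth_fun n U g \<Longrightarrow> smooth_fun n U (\<lambda>x. f x + g x)"
  by (rule gen_smooth_fun[of n U f UNIV "{}", OF _ _ _ gen_add[OF gen_smooth gen_smooth]]) simp_all

lemma smooth_fun_diff:
  assumes "smooth_fun n U f" "smooth_fun n U g"
  shows "smooth_fun n U (\<lambda>x. f x - g x)"
  using smooth_fun_add[OF assms(1) smooth_fun_mult[OF smooth_fun_const[of n U "-1"] assms(2)]] by simp

lemma smooth_fun_comp_real:
  assumes "smooth_fun n U u" "\<And>x. x \<in> U \<Longrightarrow> Re (u x) \<in> S" "d \<in> D"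
    "\<And>d. d \<in> D \<Longrightarrow> \<exists>d'\<in>D. \<forall>t\<in>S. (d has_real_derivative d' t) (at t)"
  shows "smooth_fun n U (\<lambda>x. complex_of_real (d (Re (u x))))"
  by (rule gen_smooth_fun[OF assms(1,2,4) gen_comp[OF assms(3)]])

lemma smooth_fun_inverse:
  assumes "smooth_fun n U u" "\<And>x. x \<in> U \<Longrightarrow> 0 < Re (u x)"
  shows "smooth_fun n U (\<lambda>x. complex_of_real (inverse (Re (u x))))"
proof (rule smooth_fun_comp_real[where S="{0<..}" and D="range (\<lambda>(c, k) t. c * inverse t ^ Suc k)"])
  show "smooth_fun n U u" by fact
  show "inverse \<in> range (\<lambda>(c, k) t. c * inverse t ^ Suc k :: real)" by (rule range_eqI[of _ _ "(1, 0)"]) auto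
  fix d assume "d \<in> range (\<lambda>(c, k) t. c * inverse t ^ Suc k :: real)"
  then obtain c k where d: "d = (\<lambda>t. c * inverse t ^ Suc k)" by auto
  have "(d has_real_derivative (- c * real (Suc k)) * inverse t ^ Suc (Suc k)) (at t)" if "t \<in> {0<..}" for t
  proof -
    have "((\<lambda>t. inverse t ^ Suc k) has_real_derivative real (Suc k) * (- (inverse t * 1 * inverse t)) * inverse t ^ k) (at t)"
      using DERIV_power_Suc[OF DERIV_inverse', of "\<lambda>t. t" 1 t UNIV k] that by (simp add: mult_ac)
    from DERIV_cmult[OF this, of c] show ?thesis unfolding d by (simp add: mult_ac)
  qed
  then show "\<exists>d'\<in>range (\<lambda>(c, k) t. c * inverse t ^ Suc k). \<forall>t\<in>{0<..}. (d has_real_derivative d' t) (at t)"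
    by (intro bexI[of _ "\<lambda>t. (- c * real (Suc k)) * inverse t ^ Suc (Suc k)"] range_eqI[of _ _ "(- c * real (Suc k), Suc k)"]) auto
qed (use assms in auto)

text \<open>
  The functions \<open>p (1 / t) exp (- 1 / t)\<close> for \<open>t > 0\<close>, extended by zero.  With polynomial factors
  \<open>p\<close> they form a class that is closed under differentiation and contains the smooth function
  \<open>bump\<close>, which vanishes exactly for \<open>t \<le> 0\<close>.
\<close>

definition flat :: "real poly \<Rightarrow> real \<Rightarrow> real" where
  "flat p t = (if 0 < t then poly p (inverse t) * exp (- inverse t) else 0)"

definition bump :: "real \<Rightarrow> real" where
  "bump t = (if 0 < t then exp (- inverse t) else 0)"

lemma poly_exp_tendsto_0: "((\<lambda>y. poly p y * exp (- y :: real)) \<longlongrightarrow> 0) at_top"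
proof (induction p)
  case (pCons a p)
  have "((\<lambda>y. a * (y ^ 0 / exp y) + poly (pCons 0 p) y * exp (- y)) \<longlongrightarrow> a * 0 + 0) at_top" if 
    "((\<lambda>y. poly (pCons 0 p) y * exp (- y)) \<longlongrightarrow> 0) at_top"
    using tendsto_power_div_exp_0[of 0] that by (intro tendsto_intros) auto
  moreover have "((\<lambda>y. poly (pCons 0 p) y * exp (- y)) \<longlongrightarrow> 0) at_top"
  proof -
    have "((\<lambda>y. \<Sum>i\<le>degree (pCons 0 p). coeff (pCons 0 p) i * (y ^ i / exp y)) \<longlongrightarrow> (\<Sum>i\<le>degree (pCons 0 p). coeff (pCons 0 p) i * 0)) at_top"
      by (intro tendsto_intros tendsto_power_div_exp_0)
    then show ?thesis
      unfolding poly_altdef[of "pCons 0 p"] sum_distrib_right by (simp add: exp_minus divide_inverse mult.assoc)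
  qed
  ultimately show ?case by (simp add: exp_minus divide_inverse algebra_simps)
qed simp

lemma flat_deriv: "(flat p has_real_derivative flat (monom 1 2 * (p - pderiv p)) t) (at t)"
proof -
  consider "t < 0" | "t = 0" | "0 < t" by linarith
  then show ?thesis
  proof cases
    case 1
    have "((\<lambda>t. 0) has_real_derivative 0) (at t)" by simp
    then have "(flat p has_real_derivative 0) (at t)"
      by (rule has_field_derivative_transform_within_open[where S="{..<0}"]) (use 1 in \<open>auto simp: flat_def\<close>)
    then show ?thesis using 1 by (simp add: flat_def)
  next
    case 3
    have "((\<lambda>t. poly p (inverse t) * exp (- inverse t)) has_real_derivative
        flat (monom 1 2 * (p - pderiv p)) t) (at t)"
      using 3 by (auto intro!: derivative_eq_intros simp: flat_def poly_monom algebra_simps power2_eq_square)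
    then show ?thesis
      by (rule has_field_derivative_transform_within_open[where S="{0<..}"]) (use 3 in \<open>auto simp: flat_def\<close>)
  next
    case 2
    have "((\<lambda>y. poly (pCons 0 p) (inverse y) * exp (- inverse y)) \<longlongrightarrow> 0) (at_right (0::real))"
      using poly_exp_tendsto_0[of "pCons 0 p"] by (rule filterlim_compose[OF _ filterlim_inverse_at_top_right])
    then have r: "((\<lambda>y. (flat p y - flat p 0) / (y - 0)) \<longlongrightarrow> 0) (at_right 0)"
      by (rule Lim_transform_eventually) (auto simp: eventually_at_right_field flat_def field_simps intro!: exI[of _ 1])
    have l: "((\<lambda>y. (flat p y - flat p 0) / (y - 0)) \<longlongrightarrow> 0) (at_left 0)"
      by (rule Lim_transform_eventually[OF tendsto_const]) (auto simp: eventually_at_left_field flat_def intro!: exI[of _ "-1"])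
    have "(flat p has_real_derivative 0) (at 0)"
      unfolding has_field_derivative_iff using r l by (simp add: filterlim_at_split)
    then show ?thesis using 2 by (simp add: flat_def)
  qed
qed

lemma smooth_fun_bump:
  assumes "smooth_fun n U u"
  shows "smooth_fun n U (\<lambda>x. complex_of_real (bump (Re (u x))))"
proof (rule smooth_fun_comp_real[where S=UNIV and D="range flat"])
  have "bump = flat 1" by (auto simp: bump_def flat_def fun_eq_iff)
  then show "bump \<in> range flat" by blast
  show "\<exists>d'\<in>range flat. \<forall>t\<in>UNIV. (d has_real_derivative d' t) (at t)" if "d \<in> range flat" for d
    using that flat_deriv by blast
qed (use assms in auto)

lemma bump_pos_iff: "0 < bump t \<longleftrightarrow> 0 < t" and bump_nonneg: "0 \<le> bump t" and bump_eq_0: "t \<le> 0 \<Longrightarrow> bump t = 0"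
  by (auto simp: bump_def)

subsection \<open>Comparison of the notions of smoothness\<close>

abbreviation E :: "nat \<Rightarrow> (real, nat \<Rightarrow> real) tvs" where "E \<equiv> euclidean_tvs"
abbreviation C :: "(real, complex) tvs" where "C \<equiv> real_tvs complex_tvs"

lemma E_simps [simp]:
  "carrier (E n) = Rn n" "topol (E n) = top_of_set (Rn n)"
  "add (E n) x y = (\<lambda>i. x i + y i)" "smult (E n) c x = (\<lambda>i. c * x i)" "zero (E n) = (\<lambda>i. 0)"
  by (simp_all add: euclidean_tvs_def Euclidean_space_eq)

lemma C_simps [simp]:
  "carrier C = UNIV" "topol C = euclidean" "add C x y = x + y" "smult C c z = complex_of_real c * z" "zero C = 0"
  by (simp_all add: real_tvs_def complex_tvs_def)

lemma minus_C [simp]: "a_minus C x y = x - y"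
proof -
  have "a_inv C y = - y"
    unfolding a_inv_def m_inv_def by (rule the_equality) (simp_all add: eq_neg_iff_add_eq_0)
  then show ?thesis by (simp add: a_minus_def)
qed

lemma minus_E: "y \<in> Rn n \<Longrightarrow> a_minus (E n) x y = (\<lambda>i. x i - y i)"
proof -
  assume y: "y \<in> Rn n"
  have "a_inv (E n) y = (\<lambda>i. - y i)"
    unfolding a_inv_def m_inv_def
  proof (rule the_equality)
    show "(\<lambda>i. - y i) \<in> carrier (add_monoid (E n)) \<and> y \<otimes>\<^bsub>add_monoid (E n)\<^esub> (\<lambda>i. - y i) = \<one>\<^bsub>add_monoid (E n)\<^esub> \<and>
      (\<lambda>i. - y i) \<otimes>\<^bsub>add_monoid (E n)\<^esub> y = \<one>\<^bsub>add_monoid (E n)\<^esub>"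
      using y by (auto simp: Rn_def)
    fix z assume "z \<in> carrier (add_monoid (E n)) \<and> y \<otimes>\<^bsub>add_monoid (E n)\<^esub> z = \<one>\<^bsub>add_monoid (E n)\<^esub> \<and>
      z \<otimes>\<^bsub>add_monoid (E n)\<^esub> y = \<one>\<^bsub>add_monoid (E n)\<^esub>"
    then have "(\<lambda>i. z i + y i) = (\<lambda>i. 0)" by simp
    then have "z i + y i = 0" for i by (rule fun_cong)
    then show "z = (\<lambda>i. - y i)" by (simp add: fun_eq_iff eq_neg_iff_add_eq_0)
  qed
  then show ?thesis by (simp add: a_minus_def)
qed

lemma has_vector_derivative_iff_quotient:
  fixes g :: "real \<Rightarrow> 'a::real_normed_vector"
  shows "(g has_vector_derivative l) (at 0) \<longleftrightarrow> ((\<lambda>t. inverse t *\<^sub>R (g t - g 0)) \<longlongrightarrow> l) (at 0)"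
proof -
  have "(g has_vector_derivative l) (at 0) \<longleftrightarrow> ((\<lambda>t. norm (g t - g 0 - t *\<^sub>R l) / norm t) \<longlongrightarrow> 0) (at 0)"
    unfolding has_vector_derivative_def has_derivative_at by (simp add: bounded_linear_scaleR_left)
  also have "\<dots> \<longleftrightarrow> ((\<lambda>t. norm (inverse t *\<^sub>R (g t - g 0) - l)) \<longlongrightarrow> 0) (at 0)"
  proof (rule tendsto_cong)
    have "norm (g t - g 0 - t *\<^sub>R l) / norm t = norm (inverse t *\<^sub>R (g t - g 0) - l)" if "t \<noteq> 0" for t
    proof -
      have "inverse t *\<^sub>R (g t - g 0) - l = inverse t *\<^sub>R (g t - g 0 - t *\<^sub>R l)"
        using that by (simp add: algebra_simps)
      then show ?thesis by (simp add: divide_inverse mult.commute)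
    qed
    then show "\<forall>\<^sub>F t in at 0. norm (g t - g 0 - t *\<^sub>R l) / norm t = norm (inverse t *\<^sub>R (g t - g 0) - l)"
      by (auto simp: eventually_at_filter)
  qed
  also have "\<dots> \<longleftrightarrow> ((\<lambda>t. inverse t *\<^sub>R (g t - g 0)) \<longlongrightarrow> l) (at 0)"
    by (simp add: tendsto_norm_zero_iff LIM_zero_iff)
  finally show ?thesis .
qed

lemma has_dir_deriv_C: "has_dir_deriv (E n) C f x h l \<longleftrightarrow> dderiv f x h l"
  unfolding has_dir_deriv_def dderiv_def has_vector_derivative_iff_quotient
  by (simp add: line_def scaleR_conv_of_real)

lemma dir_deriv_C: "dderiv f x h l \<Longrightarrow> dir_deriv (E n) C f h x = l"
  unfolding dir_deriv_def has_dir_deriv_C by (rule the_equality) (auto intro: dderiv_unique)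

lemma iter_deriv_cong:
  assumes U: "open_in_Rn n U" and eq: "\<And>x. x \<in> U \<Longrightarrow> f x = g x" and hs: "set hs \<subseteq> Rn n" and x: "x \<in> U"
  shows "iter_deriv (E n) C f hs x = iter_deriv (E n) C g hs x"
  using hs x
proof (induction hs arbitrary: x)
  case (Cons h hs)
  have "dderiv (iter_deriv (E n) C f hs) x h l \<longleftrightarrow> dderiv (iter_deriv (E n) C g hs) x h l" for l
    using Cons dderiv_cong[OF U Cons.prems(2), of h "iter_deriv (E n) C f hs" "iter_deriv (E n) C g hs" l]
      dderiv_cong[OF U Cons.prems(2), of h "iter_deriv (E n) C g hs" "iter_deriv (E n) C f hs" l] by auto
  then show ?case by (simp add: dir_deriv_def has_dir_deriv_C)
qed (use eq in simp)

lemma smooth_fun_iter_deriv: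
  assumes U: "open_in_Rn n U" and f: "smooth_fun n U f" and hs: "set hs \<subseteq> Rn n"
  shows "smooth_fun n U (iter_deriv (E n) C f hs)"
    and "\<And>x h. x \<in> U \<Longrightarrow> h \<in> Rn n \<Longrightarrow>
      dderiv (iter_deriv (E n) C f hs) x h (iter_deriv (E n) C f (h # hs) x)"
proof -
  have next_deriv: "smooth_fun n U (dir_deriv (E n) C g h)" "\<And>x. x \<in> U \<Longrightarrow> dderiv g x h (dir_deriv (E n) C g h x)"
    if g: "smooth_fun n U g" and h: "h \<in> Rn n" for g h
  proof -
    obtain g' where g': "smooth_fun n U g'" "\<forall>x\<in>U. dderiv g x h (g' x)" using smooth_fun_deriv[OF g h] by blast
    have eq: "g' x = dir_deriv (E n) C g h x" if "x \<in> U" for x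
      using dir_deriv_C[of g x h "g' x" n] g'(2) that by simp
    show "smooth_fun n U (dir_deriv (E n) C g h)" by (rule smooth_fun_cong[OF U g'(1) eq])
    show "dderiv g x h (dir_deriv (E n) C g h x)" if "x \<in> U" for x
      using bspec[OF g'(2) that] unfolding eq[OF that] .
  qed
  show s: "smooth_fun n U (iter_deriv (E n) C f hs)"
    using hs by (induction hs) (simp_all add: f next_deriv)
  show "dderiv (iter_deriv (E n) C f hs) x h (iter_deriv (E n) C f (h # hs) x)" if "x \<in> U" "h \<in> Rn n" for x h
    using next_deriv(2)[OF s that(2,1)] by simp
qed

lemma iter_deriv_append:
  "iter_deriv (E n) C f (hs @ [h]) = iter_deriv (E n) C (dir_deriv (E n) C f h) hs"
  by (induction hs) simp_all

lemma iter_deriv_sum: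
  assumes U: "open_in_Rn n U" and f: "\<And>i. i \<in> I \<Longrightarrow> smooth_fun n U (f i)"
    and hs: "set hs \<subseteq> Rn n" and x: "x \<in> U" and I: "finite I"
  shows "iter_deriv (E n) C (\<lambda>x. \<Sum>i\<in>I. c i * f i x) hs x = (\<Sum>i\<in>I. c i * iter_deriv (E n) C (f i) hs x)"
  using hs x
proof (induction hs arbitrary: x)
  case (Cons h hs)
  have "dderiv (\<lambda>x. \<Sum>i\<in>I. c i * iter_deriv (E n) C (f i) hs x) x h (\<Sum>i\<in>I. c i * iter_deriv (E n) C (f i) (h # hs) x)"
    unfolding dderiv_def
  proof (rule has_vector_derivative_sum)
    fix i assume i: "i \<in> I"
    have "((\<lambda>t. iter_deriv (E n) C (f i) hs (line x h t)) has_vector_derivative iter_deriv (E n) C (f i) (h # hs) x) (at 0)"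
      using smooth_fun_iter_deriv(2)[OF U f[OF i], of hs x h] Cons.prems by (simp add: dderiv_def)
    then show "((\<lambda>t. c i * iter_deriv (E n) C (f i) hs (line x h t)) has_vector_derivative c i * iter_deriv (E n) C (f i) (h # hs) x) (at 0)"
      by (rule has_vector_derivative_mult_right)
  qed
  note der = this
  have eq: "(\<Sum>i\<in>I. c i * iter_deriv (E n) C (f i) hs y) = iter_deriv (E n) C (\<lambda>x. \<Sum>i\<in>I. c i * f i x) hs y"
    if "y \<in> U" for y
    using Cons.IH[OF _ that] Cons.prems(1) by simp
  have "h \<in> Rn n" using Cons.prems(1) by simp
  from dderiv_cong[OF U Cons.prems(2) this eq der]
  have "dderiv (iter_deriv (E n) C (\<lambda>x. \<Sum>i\<in>I. c i * f i x) hs) x h (\<Sum>i\<in>I. c i * iter_deriv (E n) C (f i) (h # hs) x)" .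
  from dir_deriv_C[OF this] show ?case by simp
qed simp

lemma iter_deriv_diff:
  assumes U: "open_in_Rn n U" and "smooth_fun n U f" "smooth_fun n U g" "set hs \<subseteq> Rn n" "x \<in> U"
  shows "iter_deriv (E n) C (\<lambda>x. f x - g x) hs x = iter_deriv (E n) C f hs x - iter_deriv (E n) C g hs x"
proof -
  have "iter_deriv (E n) C (\<lambda>x. \<Sum>i\<in>{False, True}. (if i then 1 else -1) * (if i then f else g) x) hs x
      = (\<Sum>i\<in>{False, True}. (if i then 1 else -1) * iter_deriv (E n) C (if i then f else g) hs x)"
    by (rule iter_deriv_sum[OF U _ assms(4,5)]) (simp_all add: assms(2,3))
  then show ?thesis by simp
qed

text \<open>
  Linearity of the derivative in the direction, for continuously differentiable functions:
  the increment along \<open>h + k\<close> is split into an increment along \<open>h\<close> and one along \<open>k\<close>, and the latter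
  starts at a moving point, where continuity of the derivative is needed.
\<close>

lemma dderiv_direction_add:
  assumes U: "open_in_Rn n U" and x: "x \<in> U" and h: "h \<in> Rn n" and k: "k \<in> Rn n"
    and a: "dderiv f x h a" and fk: "\<And>y. y \<in> U \<Longrightarrow> dderiv f y k (fk y)" and cont: "continuous_on U fk"
  shows "dderiv f x (\<lambda>i. h i + k i) (a + fk x)"
proof -
  define L where "L t s = line (line x h t) k s" for t s
  have L: "L t s \<in> Rn n" for t s
    unfolding L_def by (intro line_in_Rn h k open_in_Rn_D[OF U x])
  have cL: "continuous_on UNIV (\<lambda>p. L (fst p) (snd p))"
    unfolding L_def line_def by (intro continuous_on_coordinatewise_then_product continuous_intros)
  have small: "\<exists>d>0. \<forall>t s. \<bar>t\<bar> < d \<longrightarrow> \<bar>s\<bar> < d \<longrightarrow> L t s \<in> U \<and> norm (fk (L t s) - fk x) < e" if e: "0 < e" for e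
  proof -
    obtain W where W: "open W" "U = Rn n \<inter> W" using U unfolding open_in_Rn_def openin_open by blast
    obtain V where V: "open V" "V \<inter> U = fk -` ball (fk x) e \<inter> U"
      using cont[unfolded continuous_on_open_invariant, rule_format, OF open_ball[of "fk x" e]] by blast
    have "x \<in> V \<inter> U" unfolding V(2) using x e by simp
    then have "x \<in> V" by simp
    have "open ((\<lambda>p. L (fst p) (snd p)) -` (W \<inter> V))" using W(1) V(1) cL by (intro open_vimage) auto
    moreover have "(0, 0) \<in> (\<lambda>p. L (fst p) (snd p)) -` (W \<inter> V)" using \<open>x \<in> V\<close> x W(2) by (simp add: L_def)
    ultimately obtain A B where AB: "open A" "open B" "(0, 0) \<in> A \<times> B" "A \<times> B \<subseteq> (\<lambda>p. L (fst p) (snd p)) -` (W \<inter> V)"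
      by (rule open_prod_elim)
    have "open (A \<inter> B)" "0 \<in> A \<inter> B" using AB by auto
    then obtain d where d: "d > 0" "\<forall>t. dist t 0 < d \<longrightarrow> t \<in> A \<inter> B" unfolding open_dist by blast
    have "L t s \<in> U \<and> norm (fk (L t s) - fk x) < e" if "\<bar>t\<bar> < d" "\<bar>s\<bar> < d" for t s
    proof -
      have "(t, s) \<in> A \<times> B" using d(2) that by (simp add: dist_real_def)
      then have "L t s \<in> W" "L t s \<in> V" using AB(4) by auto
      then have U': "L t s \<in> U" using W(2) L by blast
      then have "fk (L t s) \<in> ball (fk x) e" using V(2) \<open>L t s \<in> V\<close> by blast
      then show ?thesis using U' by (simp add: dist_norm norm_minus_commute)
    qed
    then show ?thesis using d(1) by blast
  qed
  have "((\<lambda>t. inverse t *\<^sub>R (f (L t t) - f (L t 0))) \<longlongrightarrow> fk x) (at 0)"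
  proof (rule tendstoI)
    fix e :: real assume "0 < e"
    then have e3: "0 < e / 3" by simp
    obtain d where d: "d > 0" "\<forall>t s. \<bar>t\<bar> < d \<longrightarrow> \<bar>s\<bar> < d \<longrightarrow> L t s \<in> U \<and> norm (fk (L t s) - fk x) < e / 3"
      using small[OF e3] by blast
    have "dist (inverse t *\<^sub>R (f (L t t) - f (L t 0))) (fk x) < e" if t: "t \<noteq> 0" "\<bar>t\<bar> < d" for t
    proof -
      have seg: "\<bar>s\<bar> < d" if "s \<in> closed_segment 0 t" for s
        using that t by (auto simp: closed_segment_eq_real_ivl split: if_splits)
      have der: "((\<lambda>s. f (L t s)) has_vector_derivative fk (L t s)) (at s within closed_segment 0 t)"
        if s: "s \<in> closed_segment 0 t" for s
      proof -
        have "dderiv f (L t s) k (fk (L t s))" using fk d(2) t seg[OF s] by blast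
        then have "((\<lambda>r. f (L t (s + r))) has_vector_derivative fk (L t s)) (at 0)"
          unfolding dderiv_def L_def line_shift .
        then have 0: "((\<lambda>r. f (L t (s + r))) has_vector_derivative fk (L t s)) (at (s - s))" by simp
        have "((\<lambda>r. r - s) has_vector_derivative 1) (at s)"
          by (auto intro!: derivative_eq_intros)
        from vector_diff_chain_at[OF this 0]
        have "((\<lambda>s. f (L t s)) has_vector_derivative fk (L t s)) (at s)" by (simp add: o_def)
        then show ?thesis by (rule has_vector_derivative_at_within)
      qed
      have "norm (f (L t t) - f (L t 0) - (t - 0) *\<^sub>R fk (L t 0)) \<le> norm (t - 0) * (2 * (e / 3))"
      proof (rule vector_differentiable_bound_linearization[OF der])
        fix s assume s: "s \<in> closed_segment 0 t"
        have "norm (fk (L t s) - fk x) < e / 3" "norm (fk (L t 0) - fk x) < e / 3" using d t seg[OF s] by auto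
        then show "norm (fk (L t s) - fk (L t 0)) \<le> 2 * (e / 3)"
          using norm_triangle_ineq4[of "fk (L t s) - fk x" "fk (L t 0) - fk x"] by simp
      qed auto
      then have "\<bar>t\<bar> * norm (inverse t *\<^sub>R (f (L t t) - f (L t 0)) - fk (L t 0)) \<le> \<bar>t\<bar> * (2 * (e / 3))"
        using t by (simp add: scaleR_right_diff_distrib flip: norm_scaleR)
      then have "norm (inverse t *\<^sub>R (f (L t t) - f (L t 0)) - fk (L t 0)) \<le> 2 * (e / 3)" using t by simp
      moreover have "norm (fk (L t 0) - fk x) < e / 3" using d t by auto
      ultimately show ?thesis
        using norm_triangle_ineq[of "inverse t *\<^sub>R (f (L t t) - f (L t 0)) - fk (L t 0)" "fk (L t 0) - fk x"] 
        by (simp add: dist_norm)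
    qed
    then show "\<forall>\<^sub>F t in at 0. dist (inverse t *\<^sub>R (f (L t t) - f (L t 0))) (fk x) < e"
      unfolding eventually_at using d(1) by (auto simp: dist_real_def)
  qed
  moreover have "((\<lambda>t. inverse t *\<^sub>R (f (L t 0) - f x)) \<longlongrightarrow> a) (at 0)"
    using a unfolding dderiv_def has_vector_derivative_iff_quotient by (simp add: L_def)
  ultimately have "((\<lambda>t. inverse t *\<^sub>R (f (L t t) - f (L t 0)) + inverse t *\<^sub>R (f (L t 0) - f x)) \<longlongrightarrow> fk x + a) (at 0)"
    by (rule tendsto_add)
  moreover have "L t t = line x (\<lambda>i. h i + k i) t" for t by (simp add: L_def line_def algebra_simps fun_eq_iff)
  ultimately show ?thesis
    unfolding dderiv_def has_vector_derivative_iff_quotient by (simp add: add.commute flip: scaleR_right_distrib)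
qed

lemma dderiv_direction_scale:
  assumes "dderiv f x h l"
  shows "dderiv f x (\<lambda>i. c * h i) (complex_of_real c * l)"
proof -
  have "((\<lambda>t. t * c) has_vector_derivative c) (at 0)"
    by (auto intro!: derivative_eq_intros simp flip: has_real_derivative_iff_has_vector_derivative)
  from vector_diff_chain_at[OF this, of "\<lambda>t. f (line x h t)" l] assms
  show ?thesis by (simp add: dderiv_def o_def line_def scaleR_conv_of_real mult.assoc mult.commute mult.left_commute)
qed

definition unit :: "nat \<Rightarrow> nat \<Rightarrow> real" where
  "unit i = (\<lambda>j. if j = i then 1 else 0)"

lemma unit_Rn: "i < n \<Longrightarrow> unit i \<in> Rn n"
  by (auto simp: unit_def Rn_def)

text \<open>
  Additivity in the direction reduces all directional derivatives to the partial ones.  This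
  makes iterated derivatives jointly continuous in the point and the directions.
\<close>

lemma dir_deriv_sum_partials:
  assumes U: "open_in_Rn n U" and f: "smooth_fun n U f" and h: "h \<in> Rn n" and x: "x \<in> U"
  shows "dir_deriv (E n) C f h x = (\<Sum>i<n. complex_of_real (h i) * dir_deriv (E n) C f (unit i) x)"
proof -
  have partial: "dderiv f y k (dir_deriv (E n) C f k y)" if "y \<in> U" "k \<in> Rn n" for y k
    using smooth_fun_iter_deriv(2)[OF U f, of "[]"] that by simp
  have cpart: "continuous_on U (dir_deriv (E n) C f k)" if "k \<in> Rn n" for k
    using smooth_fun_continuous[OF smooth_fun_iter_deriv(1)[OF U f, of "[k]"]] that by simp
  have "dderiv f x (\<lambda>j. if j < m then h j else 0) (\<Sum>i<m. complex_of_real (h i) * dir_deriv (E n) C f (unit i) x)" if "m \<le> n" for m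
    using that
  proof (induction m)
    case 0
    show ?case by (simp add: dderiv_def line_def)
  next
    case (Suc m)
    let ?k = "\<lambda>j. h m * unit m j"
    have m: "m < n" using Suc.prems by simp
    have k: "?k \<in> Rn n" using unit_Rn[OF m] by (simp add: Rn_def)
    have "dderiv f x (\<lambda>i. (if i < m then h i else 0) + ?k i)
        ((\<Sum>i<m. complex_of_real (h i) * dir_deriv (E n) C f (unit i) x) + complex_of_real (h m) * dir_deriv (E n) C f (unit m) x)"
    proof (rule dderiv_direction_add[OF U x _ k Suc.IH])
      show "(\<lambda>i. if i < m then h i else 0) \<in> Rn n" using h by (simp add: Rn_def)
      show "m \<le> n" using m by simp
      show "dderiv f y ?k (complex_of_real (h m) * dir_deriv (E n) C f (unit m) y)" if "y \<in> U" for y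
        by (rule dderiv_direction_scale[OF partial[OF that unit_Rn[OF m]]])
      show "continuous_on U (\<lambda>y. complex_of_real (h m) * dir_deriv (E n) C f (unit m) y)"
        by (intro continuous_on_mult continuous_on_const cpart unit_Rn m)
    qed
    moreover have "(\<lambda>i. (if i < m then h i else 0) + ?k i) = (\<lambda>j. if j < Suc m then h j else 0)"
      by (auto simp: unit_def fun_eq_iff less_Suc_eq)
    ultimately show ?case by simp
  qed
  from this[of n] have "dderiv f x (\<lambda>j. if j < n then h j else 0) (\<Sum>i<n. complex_of_real (h i) * dir_deriv (E n) C f (unit i) x)"
    by simp
  moreover have "(\<lambda>j. if j < n then h j else 0) = h" using h by (auto simp: Rn_def fun_eq_iff)
  ultimately show ?thesis by (intro dir_deriv_C) simp
qed

lemma continuous_map_euclidean_compose: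
  assumes "continuous_map X euclidean f" "continuous_on UNIV g"
  shows "continuous_map X euclidean (\<lambda>x. g (f x))"
  using continuous_map_compose[OF assms(1), of euclidean g] assms(2) by (simp add: o_def)

lemma continuous_map_sum_complex:
  fixes f :: "'i \<Rightarrow> 'a \<Rightarrow> complex"
  assumes "finite I" "\<And>i. i \<in> I \<Longrightarrow> continuous_map X euclidean (f i)"
  shows "continuous_map X euclidean (\<lambda>x. \<Sum>i\<in>I. f i x)"
  using assms by (induction I rule: finite_induct) (auto intro: continuous_map_complex)

lemma smooth_fun_joint_continuity:
  assumes U: "open_in_Rn n U" and f: "smooth_fun n U f"
  shows "continuous_map
    (prod_topology (subtopology (topol (E n)) U) (product_topology (\<lambda>_. topol (E n)) {..<k}))
    (topol C) (\<lambda>(x, h). iter_deriv (E n) C f (map h [0..<k]) x)"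
  using f
proof (induction k arbitrary: f)
  let ?X = "\<lambda>k::nat. prod_topology (top_of_set U) (product_topology (\<lambda>_. top_of_set (Rn n)) {..<k})"
  have sub: "subtopology (top_of_set (Rn n)) U = top_of_set U"
    using open_in_Rn_D[OF U] by (simp add: subtopology_subtopology Int_absorb1 subsetI)
  {
    case 0
    have "continuous_map (?X 0) euclidean (\<lambda>z. f (fst z))"
      using continuous_map_compose[OF continuous_map_fst, of "top_of_set U" euclidean f] smooth_fun_continuous[OF 0]
      by (simp add: o_def)
    then show ?case using sub by (simp add: case_prod_unfold)
  next
    case (Suc k)
    let ?D = "\<lambda>i. dir_deriv (E n) C f (unit i)"
    have D: "smooth_fun n U (?D i)" if "i < n" for i
      using smooth_fun_iter_deriv(1)[OF U Suc.prems, of "[unit i]"] unit_Rn[OF that] by simp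
    have IH: "continuous_map (?X k) euclidean (\<lambda>z. iter_deriv (E n) C (?D i) (map (snd z) [0..<k]) (fst z))" if "i < n" for i
      using Suc.IH[OF D[OF that]] sub by (simp add: case_prod_unfold)
    have restr: "continuous_map (?X (Suc k)) (?X k) (\<lambda>z. (fst z, restrict (snd z) {..<k}))"
    proof (intro continuous_map_pairedI continuous_map_fst)
      show "continuous_map (?X (Suc k)) (product_topology (\<lambda>_. top_of_set (Rn n)) {..<k}) (\<lambda>z. restrict (snd z) {..<k})"
        unfolding continuous_map_componentwise
      proof (intro conjI ballI)
        fix j assume j: "j \<in> {..<k}"
        have "continuous_map (?X (Suc k)) (top_of_set (Rn n)) (\<lambda>z. snd z j)"
          using continuous_map_compose[OF continuous_map_snd continuous_map_product_projection, of j "{..<Suc k}" "top_of_set U" "\<lambda>_. top_of_set (Rn n)"] j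
          by (simp add: o_def)
        then show "continuous_map (?X (Suc k)) (top_of_set (Rn n)) (\<lambda>z. restrict (snd z) {..<k} j)" using j by simp
      qed auto
    qed
    have coord: "continuous_map (?X (Suc k)) euclideanreal (\<lambda>z. snd z k i)" for i
    proof -
      have 1: "continuous_map (?X (Suc k)) (top_of_set (Rn n)) (\<lambda>z. snd z k)"
        using continuous_map_compose[OF continuous_map_snd continuous_map_product_projection, of k "{..<Suc k}" "top_of_set U" "\<lambda>_. top_of_set (Rn n)"]
        by (simp add: o_def)
      have 2: "continuous_map (top_of_set (Rn n)) euclideanreal (\<lambda>y. y i)"
        by (simp add: continuous_on_product_coordinates continuous_on_subset[OF _ subset_UNIV])
      show ?thesis using continuous_map_compose[OF 1 2] by (simp add: o_def)
    qed
    have "continuous_map (?X (Suc k)) euclidean (\<lambda>z. \<Sum>i<n. complex_of_real (snd z k i) *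
        iter_deriv (E n) C (?D i) (map (restrict (snd z) {..<k}) [0..<k]) (fst z))"
    proof (intro continuous_map_sum_complex continuous_map_complex)
      fix i assume "i \<in> {..<n}"
      then show "continuous_map (?X (Suc k)) euclidean (\<lambda>z. iter_deriv (E n) C (?D i) (map (restrict (snd z) {..<k}) [0..<k]) (fst z))"
        using continuous_map_compose[OF restr IH[of i]] by (simp add: o_def)
      show "continuous_map (?X (Suc k)) euclidean (\<lambda>z. complex_of_real (snd z k i))"
        by (rule continuous_map_euclidean_compose[OF coord]) (intro continuous_intros)
    qed simp
    moreover have "(\<Sum>i<n. complex_of_real (snd z k i) * iter_deriv (E n) C (?D i) (map (restrict (snd z) {..<k}) [0..<k]) (fst z))
        = iter_deriv (E n) C f (map (snd z) [0..<Suc k]) (fst z)" if z: "z \<in> topspace (?X (Suc k))" for z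
    proof -
      have x: "fst z \<in> U" and sz: "snd z \<in> (\<Pi>\<^sub>E j\<in>{..<Suc k}. Rn n)"
        using z by (simp_all add: mem_Times_iff)
      have hR: "snd z j \<in> Rn n" if "j < Suc k" for j
        using PiE_mem[OF sz, of j] that by simp
      have m: "map (restrict (snd z) {..<k}) [0..<k] = map (snd z) [0..<k]" by simp
      have hs: "set (map (snd z) [0..<k]) \<subseteq> Rn n" using hR by auto
      have "iter_deriv (E n) C f (map (snd z) [0..<Suc k]) (fst z)
          = iter_deriv (E n) C (dir_deriv (E n) C f (snd z k)) (map (snd z) [0..<k]) (fst z)"
        by (simp add: iter_deriv_append)
      also have "\<dots> = iter_deriv (E n) C (\<lambda>x. \<Sum>i<n. complex_of_real (snd z k i) * ?D i x) (map (snd z) [0..<k]) (fst z)"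
        by (rule iter_deriv_cong[OF U dir_deriv_sum_partials[OF U Suc.prems] hs x]) (use hR in auto)
      also have "\<dots> = (\<Sum>i<n. complex_of_real (snd z k i) * iter_deriv (E n) C (?D i) (map (snd z) [0..<k]) (fst z))"
        by (rule iter_deriv_sum[OF U _ hs x]) (use D in auto)
      finally show ?thesis unfolding m by simp
    qed
    ultimately have "continuous_map (?X (Suc k)) euclidean (\<lambda>z. iter_deriv (E n) C f (map (snd z) [0..<Suc k]) (fst z))"
      by (rule continuous_map_eq)
    then show ?case using sub by (simp add: case_prod_unfold del: upt_Suc)
  }
qed

lemma smooth_on_section_continuous:
  assumes "continuous_map
    (prod_topology (subtopology (topol (E n)) U) (product_topology (\<lambda>_. topol (E n)) {..<length hs}))
    Y (\<lambda>(x, h). F (map h [0..<length hs]) x)" and "set hs \<subseteq> Rn n" and "U \<subseteq> Rn n"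
  shows "continuous_map (top_of_set U) Y (F hs)"
proof -
  let ?k = "length hs"
  have sub: "subtopology (top_of_set (Rn n)) U = top_of_set U"
    using assms(3) by (simp add: subtopology_subtopology Int_absorb1)
  have a: "continuous_map (prod_topology (top_of_set U) (product_topology (\<lambda>_. top_of_set (Rn n)) {..<?k})) Y
      (\<lambda>z. F (map (snd z) [0..<?k]) (fst z))"
    using assms(1) sub by (simp add: case_prod_unfold)
  have "continuous_map (top_of_set U) (prod_topology (top_of_set U) (product_topology (\<lambda>_. top_of_set (Rn n)) {..<?k}))
      (\<lambda>x. (x, restrict (nth hs) {..<?k}))"
    using assms(2) by (intro continuous_map_pairedI) (auto simp: continuous_map_const PiE_iff)
  from continuous_map_compose[OF this a]
  have 1: "continuous_map (top_of_set U) Y (\<lambda>x. F (map (restrict (nth hs) {..<?k}) [0..<?k]) x)"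
    unfolding o_def fst_conv snd_conv .
  have "map (restrict (nth hs) {..<?k}) [0..<?k] = hs" by (rule nth_equalityI) auto
  with 1 show ?thesis by (simp only:)
qed

text \<open>
  The coinductive notion asks for continuity for fixed directions only; joint continuity in the
  directions is the content of \<open>smooth_fun_joint_continuity\<close>.
\<close>

theorem smooth_on_iff_smooth_fun:
  assumes U: "open_in_Rn n U"
  shows "smooth_on (E n) C U f \<longleftrightarrow> smooth_fun n U f"
proof
  assume f: "smooth_fun n U f"
  show "smooth_on (E n) C U f"
    unfolding smooth_on_def
  proof (intro conjI allI impI)
    fix hs h x assume "set hs \<subseteq> carrier (E n) \<and> h \<in> carrier (E n) \<and> x \<in> U"
    then show "\<exists>l. has_dir_deriv (E n) C (iter_deriv (E n) C f hs) x h l"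
      using smooth_fun_iter_deriv(2)[OF U f, of hs x h] by (auto simp: has_dir_deriv_C)
  qed (rule smooth_fun_joint_continuity[OF U f])
next
  assume f: "smooth_on (E n) C U f"
  show "smooth_fun n U f"
  proof (rule smooth_fun_class[where \<C>="\<lambda>g. \<exists>hs. set hs \<subseteq> Rn n \<and> g = iter_deriv (E n) C f hs"])
    show "\<exists>hs. set hs \<subseteq> Rn n \<and> f = iter_deriv (E n) C f hs" by (intro exI[of _ "[]"]) simp
  next
    fix g assume "\<exists>hs. set hs \<subseteq> Rn n \<and> g = iter_deriv (E n) C f hs"
    then obtain hs where hs: "set hs \<subseteq> Rn n" "g = iter_deriv (E n) C f hs" by blast
    have "continuous_map (top_of_set U) (topol C) (iter_deriv (E n) C f hs)"
      by (rule smooth_on_section_continuous[OF _ hs(1)]) (use f open_in_Rn_D[OF U] in \<open>auto simp: smooth_on_def\<close>)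
    then show "continuous_on U g" unfolding hs(2) by simp
  next
    fix g h assume "\<exists>hs. set hs \<subseteq> Rn n \<and> g = iter_deriv (E n) C f hs" and h: "h \<in> Rn n"
    then obtain hs where hs: "set hs \<subseteq> Rn n" "g = iter_deriv (E n) C f hs" by blast
    have "dderiv g x h (iter_deriv (E n) C f (h # hs) x)" if "x \<in> U" for x
    proof -
      obtain l where "dderiv g x h l"
        using f hs(1) h \<open>x \<in> U\<close> unfolding smooth_on_def has_dir_deriv_C E_simps hs(2) by blast
      then show ?thesis using dir_deriv_C hs(2) by simp
    qed
    then show "\<exists>f'. (\<exists>hs. set hs \<subseteq> Rn n \<and> f' = iter_deriv (E n) C f hs) \<and> (\<forall>x\<in>U. dderiv g x h (f' x))"
    proof (intro exI[of _ "iter_deriv (E n) C f (h # hs)"] conjI)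
      show "\<exists>hs'. set hs' \<subseteq> Rn n \<and> iter_deriv (E n) C f (h # hs) = iter_deriv (E n) C f hs'"
        using hs h by (intro exI[of _ "h # hs"]) simp
    qed blast
  qed
qed

text \<open>
  This gives access to the coordinates of the transition maps between charts.
\<close>

lemma smooth_on_coordinate:
  assumes U: "open_in_Rn n U" and g: "smooth_on (E n) (E m) U g"
  shows "smooth_fun n U (\<lambda>x. complex_of_real (g x i))"
proof (rule smooth_fun_class[where \<C>="\<lambda>f. \<exists>hs. set hs \<subseteq> Rn n \<and> f = (\<lambda>x. complex_of_real (iter_deriv (E n) (E m) g hs x i))"])
  show "\<exists>hs. set hs \<subseteq> Rn n \<and> (\<lambda>x. complex_of_real (g x i)) = (\<lambda>x. complex_of_real (iter_deriv (E n) (E m) g hs x i))"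
    by (intro exI[of _ "[]"]) simp
  have cont: "continuous_map (top_of_set U) (top_of_set (Rn m)) (iter_deriv (E n) (E m) g hs)" if "set hs \<subseteq> Rn n" for hs
    by (rule smooth_on_section_continuous[OF _ that]) (use g open_in_Rn_D[OF U] in \<open>auto simp: smooth_on_def\<close>)
  have coord: "continuous_on UNIV (\<lambda>y::nat \<Rightarrow> real. y i)" by (rule continuous_on_product_coordinates)
  fix f assume "\<exists>hs. set hs \<subseteq> Rn n \<and> f = (\<lambda>x. complex_of_real (iter_deriv (E n) (E m) g hs x i))"
  then obtain hs where hs: "set hs \<subseteq> Rn n" "f = (\<lambda>x. complex_of_real (iter_deriv (E n) (E m) g hs x i))" by blast
  have "continuous_on U (iter_deriv (E n) (E m) g hs)" using cont[OF hs(1)] by simp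
  then show "continuous_on U f"
    unfolding hs(2) using continuous_on_compose2[OF coord, of U "iter_deriv (E n) (E m) g hs"] by (intro continuous_intros) auto
  fix h assume h: "h \<in> Rn n"
  have "dderiv f x h (complex_of_real (iter_deriv (E n) (E m) g (h # hs) x i))" if x: "x \<in> U" for x
  proof -
    let ?F = "iter_deriv (E n) (E m) g hs"
    let ?q = "\<lambda>t. a_minus (E m) (?F (line x h t)) (?F x)"
    have Fx: "?F x \<in> Rn m" using cont[OF hs(1)] x by (auto simp: continuous_map_def)
    have iff: "has_dir_deriv (E n) (E m) ?F x h l \<longleftrightarrow>
        limitin (top_of_set (Rn m)) (\<lambda>t. (\<lambda>j. inverse t * (?F (line x h t) j - ?F x j))) l (at 0)" for l
      unfolding has_dir_deriv_def by (simp add: minus_E[OF Fx] line_def)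
    have lim: "((\<lambda>t. (\<lambda>j. inverse t * (?F (line x h t) j - ?F x j))) \<longlongrightarrow> l) (at 0)" if "has_dir_deriv (E n) (E m) ?F x h l" for l
      using that unfolding iff limitin_subtopology by simp
    obtain l where l: "has_dir_deriv (E n) (E m) ?F x h l"
      using g hs(1) h x unfolding smooth_on_def E_simps by blast
    have "iter_deriv (E n) (E m) g (h # hs) x = l"
      unfolding iter_deriv.simps dir_deriv_def
    proof (rule the_equality)
      show "has_dir_deriv (E n) (E m) ?F x h l" by (rule l)
      fix l' assume "has_dir_deriv (E n) (E m) ?F x h l'"
      then show "l' = l" using lim[OF l] lim by (intro tendsto_unique[OF trivial_limit_at]) auto
    qed
    moreover have "((\<lambda>t. inverse t * (?F (line x h t) i - ?F x i)) \<longlongrightarrow> l i) (at 0)"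
      using continuous_on_tendsto_compose[OF coord lim[OF l]] by simp
    then have "((\<lambda>t. inverse t *\<^sub>R (?F (line x h t) i - ?F (line x h 0) i)) \<longlongrightarrow> l i) (at 0)" by simp
    then have "((\<lambda>t. ?F (line x h t) i) has_vector_derivative l i) (at 0)"
      unfolding has_vector_derivative_iff_quotient .
    from bounded_linear.has_vector_derivative[OF bounded_linear_of_real this]
    have "dderiv f x h (complex_of_real (l i))" unfolding dderiv_def hs(2) .
    ultimately show ?thesis by simp
  qed
  then show "\<exists>f'. (\<exists>hs. set hs \<subseteq> Rn n \<and> f' = (\<lambda>x. complex_of_real (iter_deriv (E n) (E m) g hs x i))) \<and> (\<forall>x\<in>U. dderiv f x h (f' x))"
  proof (intro exI[of _ "\<lambda>x. complex_of_real (iter_deriv (E n) (E m) g (h # hs) x i)"] conjI)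
    show "\<exists>hs'. set hs' \<subseteq> Rn n \<and> (\<lambda>x. complex_of_real (iter_deriv (E n) (E m) g (h # hs) x i))
        = (\<lambda>x. complex_of_real (iter_deriv (E n) (E m) g hs' x i))"
      using hs h by (intro exI[of _ "h # hs"]) simp
  qed blast
qed

section \<open>Smooth functions on manifolds\<close>

locale smooth_mfd =
  fixes P :: "('p, nat \<Rightarrow> real) manifold" and n :: nat
  assumes manifold: "smooth_manifold P" and model_P: "model P = E n"
begin

abbreviation X :: "'p set" where "X \<equiv> topspace (mtop P)"
abbreviation smooth :: "('p \<Rightarrow> complex) \<Rightarrow> bool" where "smooth \<equiv> smooth_map P (tvs_manifold C)"

lemma Hausdorff_P: "Hausdorff_space (mtop P)"
  using manifold by (simp add: smooth_manifold_def locally_convex_manifold_def)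

lemma charts_cover: "p \<in> X \<Longrightarrow> \<exists>U \<phi>. (U, \<phi>) \<in> charts P \<and> p \<in> U"
  using manifold unfolding smooth_manifold_def locally_convex_manifold_def by blast

lemma chart:
  assumes "(U, \<phi>) \<in> charts P"
  shows "openin (mtop P) U" and "open_in_Rn n (\<phi> ` U)"
    and "homeomorphic_map (subtopology (mtop P) U) (top_of_set (\<phi> ` U)) \<phi>"
    and "inj_on \<phi> U" and "U \<subseteq> X"
proof -
  have *: "openin (mtop P) U \<and> openin (topol (model P)) (\<phi> ` U) \<and>
      homeomorphic_map (subtopology (mtop P) U) (subtopology (topol (model P)) (\<phi> ` U)) \<phi>"
    using manifold assms unfolding smooth_manifold_def locally_convex_manifold_def by blast
  show 1: "openin (mtop P) U" using * by blast
  show 2: "open_in_Rn n (\<phi> ` U)" using * by (simp add: model_P open_in_Rn_def)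
  have "subtopology (top_of_set (Rn n)) (\<phi> ` U) = top_of_set (\<phi> ` U)"
    using open_in_Rn_D[OF 2] by (simp add: subtopology_subtopology Int_absorb1 subsetI)
  then show 3: "homeomorphic_map (subtopology (mtop P) U) (top_of_set (\<phi> ` U)) \<phi>" using * by (simp add: model_P)
  show 4: "U \<subseteq> X" by (rule openin_subset[OF 1])
  have "topspace (subtopology (mtop P) U) = U" using 4 by (simp add: Int_absorb1)
  then show "inj_on \<phi> U" using homeomorphic_imp_injective_map[OF 3] by simp
qed

lemma transition_smooth:
  assumes "(U, \<phi>) \<in> charts P" "(W, \<psi>) \<in> charts P"
  shows "smooth_on (E n) (E n) (\<phi> ` (U \<inter> W)) (\<psi> \<circ> inv_into U \<phi>)"
  using manifold assms unfolding smooth_manifold_def locally_convex_manifold_def model_P by blast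

lemma chart_image_open:
  assumes c: "(U, \<phi>) \<in> charts P" and V: "openin (mtop P) V" "V \<subseteq> U"
  shows "open_in_Rn n (\<phi> ` V)"
proof -
  have "openin (subtopology (mtop P) U) V"
    using V by (simp add: openin_open_subtopology[OF chart(1)[OF c]])
  then have "openin (top_of_set (\<phi> ` U)) (\<phi> ` V)"
    using homeomorphic_imp_open_map[OF chart(3)[OF c]] by (simp add: open_map_def)
  then show ?thesis
    using chart(2)[OF c] unfolding open_in_Rn_def by (meson openin_trans)
qed

text \<open>
  Continuity on \<open>P\<close> is a consequence of continuity in the charts, which cover \<open>P\<close>.
\<close>

lemma smooth_iff:
  "smooth f \<longleftrightarrow> (\<forall>(U, \<phi>)\<in>charts P. smooth_fun n (\<phi> ` U) (\<lambda>x. f (inv_into U \<phi> x)))"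
proof -
  have eq: "smooth f \<longleftrightarrow> continuous_map (mtop P) euclidean f \<and>
      (\<forall>(U, \<phi>)\<in>charts P. smooth_fun n (\<phi> ` U) (\<lambda>x. f (inv_into U \<phi> x)))"
    using smooth_on_iff_smooth_fun chart(2)
    unfolding smooth_map_def by (auto simp: tvs_manifold_def model_P o_def)
  have "continuous_map (mtop P) euclidean f"
    if s: "\<forall>(U, \<phi>)\<in>charts P. smooth_fun n (\<phi> ` U) (\<lambda>x. f (inv_into U \<phi> x))"
    unfolding continuous_map_euclidean_iff_dist
  proof (intro ballI allI impI)
    fix p :: 'p and e :: real assume p: "p \<in> X" and e: "0 < e"
    obtain U \<phi> where c: "(U, \<phi>) \<in> charts P" and pU: "p \<in> U" using charts_cover[OF p] by blast
    have "continuous_on (\<phi> ` U) (\<lambda>x. f (inv_into U \<phi> x))" using s c smooth_fun_continuous by blast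
    then have 1: "continuous_map (top_of_set (\<phi> ` U)) euclidean (\<lambda>x. f (inv_into U \<phi> x))" by simp
    have "continuous_map (subtopology (mtop P) U) (top_of_set (\<phi> ` U)) \<phi>"
      by (rule homeomorphic_imp_continuous_map[OF chart(3)[OF c]])
    from continuous_map_compose[OF this 1]
    have "continuous_map (subtopology (mtop P) U) euclidean (\<lambda>q. f (inv_into U \<phi> (\<phi> q)))" by (simp add: o_def)
    then have "\<forall>x\<in>topspace (subtopology (mtop P) U). \<forall>e>0. \<exists>V. openin (subtopology (mtop P) U) V \<and> x \<in> V \<and>
        (\<forall>y\<in>V. dist (f (inv_into U \<phi> (\<phi> y))) (f (inv_into U \<phi> (\<phi> x))) < e)"
      unfolding continuous_map_euclidean_iff_dist .
    moreover have "p \<in> topspace (subtopology (mtop P) U)" using p pU by simp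
    ultimately obtain V where V: "openin (subtopology (mtop P) U) V" "p \<in> V"
      "\<forall>y\<in>V. dist (f (inv_into U \<phi> (\<phi> y))) (f (inv_into U \<phi> (\<phi> p))) < e" using e by blast
    have V': "openin (mtop P) V" "V \<subseteq> U"
      using V(1) by (auto simp: openin_open_subtopology[OF chart(1)[OF c]])
    have "dist (f y) (f p) < e" if "y \<in> V" for y
      using V(3) that V'(2) pU inv_into_f_f[OF chart(4)[OF c]] by (metis subsetD)
    then show "\<exists>V. openin (mtop P) V \<and> p \<in> V \<and> (\<forall>y\<in>V. dist (f y) (f p) < e)" using V V' by blast
  qed
  then show ?thesis using eq by blast
qed

lemma smoothI: "(\<And>U \<phi>. (U, \<phi>) \<in> charts P \<Longrightarrow> smooth_fun n (\<phi> ` U) (\<lambda>x. f (inv_into U \<phi> x))) \<Longrightarrow> smooth f"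
  unfolding smooth_iff by blast

lemma smoothD: "smooth f \<Longrightarrow> (U, \<phi>) \<in> charts P \<Longrightarrow> smooth_fun n (\<phi> ` U) (\<lambda>x. f (inv_into U \<phi> x))"
  unfolding smooth_iff by blast

lemma smooth_continuous: "smooth f \<Longrightarrow> continuous_map (mtop P) euclidean f"
  by (simp add: smooth_map_def tvs_manifold_def)

lemma smooth_local:
  assumes "\<And>p. p \<in> X \<Longrightarrow> \<exists>V g. openin (mtop P) V \<and> p \<in> V \<and> smooth g \<and> (\<forall>q\<in>V. f q = g q)"
  shows "smooth f"
proof (rule smoothI)
  fix U \<phi> assume c: "(U, \<phi>) \<in> charts P"
  show "smooth_fun n (\<phi> ` U) (\<lambda>x. f (inv_into U \<phi> x))"
  proof (rule smooth_fun_local[OF chart(2)[OF c]])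
    fix x assume "x \<in> \<phi> ` U"
    then obtain p where p: "p \<in> U" "x = \<phi> p" by blast
    then have "p \<in> X" using chart(5)[OF c] by blast
    then obtain V g where V: "openin (mtop P) V" "p \<in> V" "smooth g" "\<forall>q\<in>V. f q = g q" using assms by blast
    have o: "open_in_Rn n (\<phi> ` (V \<inter> U))"
      by (rule chart_image_open[OF c openin_Int[OF V(1) chart(1)[OF c]]]) blast
    have "smooth_fun n (\<phi> ` (V \<inter> U)) (\<lambda>x. g (inv_into U \<phi> x))"
      by (rule smooth_fun_subset[OF smoothD[OF V(3) c]]) blast
    moreover have "g (inv_into U \<phi> y) = f (inv_into U \<phi> y)" if "y \<in> \<phi> ` (V \<inter> U)" for y
      using that V(4) inv_into_f_f[OF chart(4)[OF c]] by auto
    ultimately have "smooth_fun n (\<phi> ` (V \<inter> U)) (\<lambda>x. f (inv_into U \<phi> x))" by (rule smooth_fun_cong[OF o])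
    then show "\<exists>V. open_in_Rn n V \<and> x \<in> V \<and> V \<subseteq> \<phi> ` U \<and> smooth_fun n V (\<lambda>x. f (inv_into U \<phi> x))"
      using o p V(2) by (intro exI[of _ "\<phi> ` (V \<inter> U)"]) auto
  qed
qed

lemma smooth_cong: "smooth f \<Longrightarrow> (\<And>p. p \<in> X \<Longrightarrow> f p = g p) \<Longrightarrow> smooth g"
  by (rule smooth_local) (metis openin_topspace)

lemma smooth_const: "smooth (\<lambda>p. c)"
  and smooth_add: "smooth f \<Longrightarrow> smooth g \<Longrightarrow> smooth (\<lambda>p. f p + g p)"
  and smooth_mult: "smooth f \<Longrightarrow> smooth g \<Longrightarrow> smooth (\<lambda>p. f p * g p)"
  and smooth_diff: "smooth f \<Longrightarrow> smooth g \<Longrightarrow> smooth (\<lambda>p. f p - g p)"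
  and smooth_bump: "smooth f \<Longrightarrow> smooth (\<lambda>p. complex_of_real (bump (Re (f p))))"
  and smooth_cnj: "smooth f \<Longrightarrow> smooth (\<lambda>p. cnj (f p))"
  by (rule smoothI, intro smooth_fun_const smooth_fun_add smooth_fun_mult smooth_fun_diff smooth_fun_bump
      smooth_fun_linear[OF _ bounded_linear_cnj]; rule smoothD; assumption)+

lemma smooth_inverse:
  assumes "smooth f" "\<And>p. p \<in> X \<Longrightarrow> 0 < Re (f p)"
  shows "smooth (\<lambda>p. complex_of_real (inverse (Re (f p))))"
proof (rule smoothI)
  fix U \<phi> assume c: "(U, \<phi>) \<in> charts P"
  show "smooth_fun n (\<phi> ` U) (\<lambda>x. complex_of_real (inverse (Re (f (inv_into U \<phi> x)))))"
  proof (rule smooth_fun_inverse[OF smoothD[OF assms(1) c]])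
    fix x assume "x \<in> \<phi> ` U"
    then have "inv_into U \<phi> x \<in> X" using inv_into_into[of x \<phi> U] chart(5)[OF c] by blast
    then show "0 < Re (f (inv_into U \<phi> x))" by (rule assms(2))
  qed
qed

lemma smooth_sum: "(\<And>i. i \<in> I \<Longrightarrow> smooth (f i)) \<Longrightarrow> smooth (\<lambda>p. \<Sum>i\<in>I. f i p)"
  by (induction I rule: infinite_finite_induct) (simp_all add: smooth_const smooth_add)

lemma smooth_prod: "(\<And>i. i \<in> I \<Longrightarrow> smooth (f i)) \<Longrightarrow> smooth (\<lambda>p. \<Prod>i\<in>I. f i p)"
  by (induction I rule: infinite_finite_induct) (simp_all add: smooth_const smooth_mult)

subsection \<open>Bump functions\<close>

text \<open>
  Only the first \<open>n\<close> coordinates of a point of the model space may differ from zero.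
\<close>

definition box :: "(nat \<Rightarrow> real) \<Rightarrow> real \<Rightarrow> (nat \<Rightarrow> real) set" where
  "box x0 s = (\<Pi>\<^sub>E i\<in>UNIV. if i < n then {x0 i - s .. x0 i + s} else {0})"

lemma compact_box: "compact (box x0 s)"
proof -
  have "compactin (product_topology (\<lambda>_::nat. euclideanreal) UNIV) (box x0 s)"
    unfolding box_def compactin_PiE by auto
  then show ?thesis by (simp add: euclidean_product_topology)
qed

lemma small_box:
  assumes "open_in_Rn n W" "x0 \<in> W"
  shows "\<exists>s>0. box x0 s \<subseteq> W"
proof -
  obtain V where V: "open V" "W = Rn n \<inter> V" using assms(1) unfolding open_in_Rn_def openin_open by blast
  have "openin (product_topology (\<lambda>_::nat. euclideanreal) UNIV) V" "x0 \<in> V"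
    using V assms(2) by (simp_all add: euclidean_product_topology)
  then obtain Y where Y: "x0 \<in> (\<Pi>\<^sub>E i\<in>UNIV. Y i)" "\<And>i. openin euclideanreal (Y i)" "(\<Pi>\<^sub>E i\<in>UNIV. Y i) \<subseteq> V"
    using product_topology_open_contains_basis[of "\<lambda>_. euclideanreal" UNIV V x0] by blast
  have "\<exists>r>0. \<forall>z. \<bar>z - x0 i\<bar> \<le> r \<longrightarrow> z \<in> Y i" for i
  proof -
    have "open (Y i)" using Y(2)[of i] by simp
    moreover have "x0 i \<in> Y i" using PiE_mem[OF Y(1)] by blast
    ultimately obtain e where e: "e > 0" "cball (x0 i) e \<subseteq> Y i" using open_contains_cball by blast
    have "z \<in> Y i" if "\<bar>z - x0 i\<bar> \<le> e" for z
      using e(2) that by (auto simp: dist_real_def abs_minus_commute)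
    then show ?thesis using e(1) by blast
  qed
  then have "\<exists>r. \<forall>i. r i > 0 \<and> (\<forall>z. \<bar>z - x0 i\<bar> \<le> r i \<longrightarrow> z \<in> Y i)" by (intro choice) blast
  then obtain r where r': "\<forall>i. r i > 0 \<and> (\<forall>z. \<bar>z - x0 i\<bar> \<le> r i \<longrightarrow> z \<in> Y i)" by blast
  then have r: "r i > 0" "\<bar>z - x0 i\<bar> \<le> r i \<Longrightarrow> z \<in> Y i" for i z by blast+
  define s where "s = Min (insert 1 (r ` {..<n}))"
  have s: "0 < s" "\<And>i. i < n \<Longrightarrow> s \<le> r i" using r(1) by (auto simp: s_def)
  have x0: "x0 i = 0" if "i \<ge> n" for i using open_in_Rn_D[OF assms] that by (simp add: Rn_def)
  have "y \<in> W" if y: "y \<in> box x0 s" for y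
  proof -
    have yi: "y i \<in> (if i < n then {x0 i - s .. x0 i + s} else {0})" for i
      using y unfolding box_def by (auto simp: PiE_iff)
    have "y i \<in> Y i" for i
    proof (rule r(2))
      show "\<bar>y i - x0 i\<bar> \<le> r i"
      proof (cases "i < n")
        case True
        then show ?thesis using yi[of i] s(2)[of i] by (simp add: abs_le_iff)
      next
        case False
        then show ?thesis using yi[of i] x0[of i] r(1)[of i] by (simp add: less_imp_le)
      qed
    qed
    then have "y \<in> V" using Y(3) by (auto simp: PiE_iff)
    moreover have "y i = 0" if "i \<ge> n" for i using yi[of i] that by simp
    then have "y \<in> Rn n" by (simp add: Rn_def)
    ultimately show ?thesis using V by blast
  qed
  then show ?thesis using s(1) by blast
qed

text \<open>
  A product of flat functions of the coordinates of one chart.  It is extended by zero: outside the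
  chart domain it vanishes in a neighbourhood, because the preimage of the compact box on which
  it lives is closed in the Hausdorff space \<open>P\<close>.
\<close>

lemma bump_function:
  assumes V: "openin (mtop P) V" and p: "p \<in> V"
  shows "\<exists>f. smooth (\<lambda>q. complex_of_real (f q)) \<and> (\<forall>q. 0 \<le> f q) \<and> 0 < f p \<and> (\<forall>q. q \<notin> V \<longrightarrow> f q = (0::real))"
proof -
  have "p \<in> X" using p openin_subset[OF V] by blast
  then obtain U \<phi> where c: "(U, \<phi>) \<in> charts P" and pU: "p \<in> U" using charts_cover by blast
  note inj = inv_into_f_f[OF chart(4)[OF c]]
  define x0 where "x0 = \<phi> p"
  have oW: "open_in_Rn n (\<phi> ` (U \<inter> V))"
    by (rule chart_image_open[OF c openin_Int[OF chart(1)[OF c] V]]) blast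
  have "x0 \<in> \<phi> ` (U \<inter> V)" using p pU by (simp add: x0_def)
  then obtain s where s: "0 < s" "box x0 s \<subseteq> \<phi> ` (U \<inter> V)" using small_box[OF oW] by blast
  define b where "b q = (\<Prod>i<n. bump (s\<^sup>2 - (\<phi> q i - x0 i)\<^sup>2))" for q
  define f where "f q = (if q \<in> U then b q else 0)" for q
  define K where "K = inv_into U \<phi> ` box x0 s"
  have chart_Rn: "\<phi> q \<in> Rn n" if "q \<in> U" for q using open_in_Rn_D[OF chart(2)[OF c]] that by blast
  have inbox: "q \<in> K \<and> q \<in> V" if q: "q \<in> U" "b q \<noteq> 0" for q
  proof -
    have "\<phi> q i \<in> (if i < n then {x0 i - s .. x0 i + s} else {0})" for i
    proof (cases "i < n")
      case True
      then have "bump (s\<^sup>2 - (\<phi> q i - x0 i)\<^sup>2) \<noteq> 0" using q(2) unfolding b_def by auto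
      then have "\<bar>\<phi> q i - x0 i\<bar>\<^sup>2 \<le> s\<^sup>2" using bump_eq_0[of "s\<^sup>2 - (\<phi> q i - x0 i)\<^sup>2"] by fastforce
      then have "\<bar>\<phi> q i - x0 i\<bar> \<le> s" by (rule power2_le_imp_le) (use s(1) in simp)
      then show ?thesis using True by (auto simp: abs_le_iff)
    next
      case False
      then show ?thesis using chart_Rn[OF q(1)] by (simp add: Rn_def)
    qed
    then have "\<phi> q \<in> box x0 s" unfolding box_def by (intro PiE_I) (assumption | simp only: UNIV_I not_True_eq_False)+
    note inb = this
    then obtain r where r: "r \<in> U \<inter> V" "\<phi> q = \<phi> r" using s(2) by blast
    then have "q = r" using inj_onD[OF chart(4)[OF c] r(2) q(1)] by blast
    moreover have "q \<in> K" unfolding K_def using imageI[OF inb, of "inv_into U \<phi>"] inj[OF q(1)] by simp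
    ultimately show ?thesis using r(1) by blast
  qed
  have KU: "K \<subseteq> U"
    unfolding K_def using s(2) inv_into_into[of _ \<phi> U] by blast
  have "closedin (mtop P) K"
  proof (rule compactin_imp_closedin[OF Hausdorff_P])
    obtain g where g: "homeomorphic_maps (subtopology (mtop P) U) (top_of_set (\<phi> ` U)) \<phi> g"
      using chart(3)[OF c] unfolding homeomorphic_map_maps by blast
    have gc: "continuous_map (top_of_set (\<phi> ` U)) (subtopology (mtop P) U) g" using g by (simp add: homeomorphic_maps_def)
    have "compactin (top_of_set (\<phi> ` U)) (box x0 s)"
      using compact_box s(2) by (auto simp: compactin_subtopology)
    from image_compactin[OF this gc] have "compactin (mtop P) (g ` box x0 s)"
      by (simp add: compactin_subtopology)
    moreover have "g x = inv_into U \<phi> x" if x: "x \<in> box x0 s" for x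
    proof -
      obtain q where q: "q \<in> U" "x = \<phi> q" using x s(2) by blast
      have "q \<in> topspace (subtopology (mtop P) U)" using q chart(5)[OF c] by auto
      then have "g (\<phi> q) = q" using g by (simp add: homeomorphic_maps_def)
      then show ?thesis using q inj by simp
    qed
    then have "g ` box x0 s = K" unfolding K_def by (rule image_cong[OF refl])
    ultimately show "compactin (mtop P) K" by simp
  qed
  then have oK: "openin (mtop P) (X - K)" by blast
  have "smooth (\<lambda>q. complex_of_real (f q))"
  proof (rule smoothI)
    fix W \<psi> assume d: "(W, \<psi>) \<in> charts P"
    note inj' = inv_into_f_f[OF chart(4)[OF d]]
    show "smooth_fun n (\<psi> ` W) (\<lambda>x. complex_of_real (f (inv_into W \<psi> x)))"
    proof (rule smooth_fun_local[OF chart(2)[OF d]])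
      fix x assume "x \<in> \<psi> ` W"
      then obtain q where q: "q \<in> W" "x = \<psi> q" by blast
      show "\<exists>S. open_in_Rn n S \<and> x \<in> S \<and> S \<subseteq> \<psi> ` W \<and> smooth_fun n S (\<lambda>x. complex_of_real (f (inv_into W \<psi> x)))"
      proof (cases "q \<in> U")
        case True
        let ?S = "\<psi> ` (W \<inter> U)"
        have oS: "open_in_Rn n ?S"
          by (rule chart_image_open[OF d openin_Int[OF chart(1)[OF d] chart(1)[OF c]]]) blast
        have co: "smooth_fun n ?S (\<lambda>x. complex_of_real ((\<phi> \<circ> inv_into W \<psi>) x i))" for i
          by (rule smooth_on_coordinate[OF oS transition_smooth[OF d c]])
        have fac: "smooth_fun n ?S (\<lambda>x. complex_of_real (bump (s\<^sup>2 - (\<phi> (inv_into W \<psi> x) i - x0 i)\<^sup>2)))" for i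
        proof -
          let ?u = "\<lambda>x. complex_of_real ((\<phi> \<circ> inv_into W \<psi>) x i) - complex_of_real (x0 i)"
          have "smooth_fun n ?S (\<lambda>x. complex_of_real (s\<^sup>2) - ?u x * ?u x)"
            by (intro smooth_fun_diff smooth_fun_mult smooth_fun_const co)
          from smooth_fun_bump[OF this] show ?thesis by (simp add: power2_eq_square)
        qed
        have "smooth_fun n ?S (\<lambda>x. \<Prod>i<m. complex_of_real (bump (s\<^sup>2 - (\<phi> (inv_into W \<psi> x) i - x0 i)\<^sup>2)))" for m
          by (induction m) (simp_all add: smooth_fun_const smooth_fun_mult fac)
        then have "smooth_fun n ?S (\<lambda>x. complex_of_real (b (inv_into W \<psi> x)))" by (simp add: b_def)
        moreover have "complex_of_real (b (inv_into W \<psi> x)) = complex_of_real (f (inv_into W \<psi> x))" if "x \<in> ?S" for x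
          using that by (auto simp: f_def inj')
        ultimately have "smooth_fun n ?S (\<lambda>x. complex_of_real (f (inv_into W \<psi> x)))" by (rule smooth_fun_cong[OF oS])
        then show ?thesis using oS q True by (intro exI[of _ ?S]) auto
      next
        case False
        let ?S = "\<psi> ` (W \<inter> (X - K))"
        have oS: "open_in_Rn n ?S"
          by (rule chart_image_open[OF d openin_Int[OF chart(1)[OF d] oK]]) blast
        have "0 = complex_of_real (f (inv_into W \<psi> x))" if x: "x \<in> ?S" for x
        proof -
          obtain r where r: "r \<in> W" "r \<notin> K" "x = \<psi> r" using x by blast
          then have "f r = 0" using inbox[of r] unfolding f_def by presburger
          then show ?thesis using r inj' by simp
        qed
        then have "smooth_fun n ?S (\<lambda>x. complex_of_real (f (inv_into W \<psi> x)))"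
          by (rule smooth_fun_cong[OF oS smooth_fun_const])
        moreover have "x \<in> ?S" using q False KU chart(5)[OF d] by auto
        ultimately show ?thesis using oS by (intro exI[of _ ?S]) auto
      qed
    qed
  qed
  moreover have "0 \<le> f q" for q by (simp add: f_def b_def prod_nonneg bump_nonneg)
  moreover have "0 < f p" using pU s(1) by (simp add: f_def b_def x0_def prod_pos bump_pos_iff)
  moreover have "f q = 0" if "q \<notin> V" for q using inbox[of q] that by (auto simp: f_def)
  ultimately show ?thesis by blast
qed

lemma separating_function:
  assumes "p \<in> X" "q \<in> X" "p \<noteq> q"
  shows "\<exists>f. smooth (\<lambda>q. complex_of_real (f q)) \<and> (\<forall>q. 0 \<le> f q) \<and> 0 < f p \<and> f q = (0::real)"
proof -
  obtain V W where V: "openin (mtop P) V" "openin (mtop P) W" "p \<in> V" "q \<in> W" "disjnt V W"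
    using Hausdorff_P assms unfolding Hausdorff_space_def by metis
  obtain f where f: "smooth (\<lambda>q. complex_of_real (f q)) \<and> (\<forall>q. 0 \<le> f q) \<and> 0 < f p \<and> (\<forall>q. q \<notin> V \<longrightarrow> f q = (0::real))"
    using bump_function[OF V(1,3)] by blast
  have "q \<notin> V" using V(4,5) by (auto simp: disjnt_def)
  then show ?thesis using f by blast
qed

end

section \<open>Characters of the algebra of smooth functions\<close>

context smooth_mfd
begin

abbreviation A :: "(complex, 'p \<Rightarrow> complex) tvs" where "A \<equiv> smooth_algebra P"

lemma A_simps [simp]:
  "carrier A = smooth_functions P" "add A f g = (\<lambda>p\<in>X. f p + g p)" "mult A f g = (\<lambda>p\<in>X. f p * g p)"
  "smult A c f = (\<lambda>p\<in>X. c * f p)" "one A = (\<lambda>p\<in>X. 1)" "zero A = (\<lambda>p\<in>X. 0)" "topol A = smooth_topology P"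
  by (simp_all add: smooth_algebra_def Let_def)

lemma mem_A: "f \<in> smooth_functions P \<longleftrightarrow> f \<in> extensional X \<and> smooth f"
  by (simp add: smooth_functions_def)

lemma restrict_mem_A: "smooth f \<Longrightarrow> restrict f X \<in> smooth_functions P"
  unfolding mem_A by (auto intro: smooth_cong)

lemma restrict_A: "f \<in> smooth_functions P \<Longrightarrow> restrict f X = f"
  by (simp add: mem_A extensional_restrict)

lemma point_evaluation_character:
  assumes p: "p \<in> X"
  shows "point_evaluation P p \<in> characters A"
proof -
  have one: "(\<lambda>p\<in>X. 1) \<in> smooth_functions P" by (rule restrict_mem_A[OF smooth_const])
  have "point_evaluation P p (\<lambda>p\<in>X. 1) \<noteq> 0" using one p by (simp add: point_evaluation_def)
  moreover have "(\<lambda>p\<in>X. f p + g p) \<in> smooth_functions P" "(\<lambda>p\<in>X. f p * g p) \<in> smooth_functions P"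
    "(\<lambda>p\<in>X. c * f p) \<in> smooth_functions P" if "f \<in> smooth_functions P" "g \<in> smooth_functions P" for f g c
    using that unfolding mem_A[of f] mem_A[of g]
    by (auto intro!: restrict_mem_A smooth_add smooth_mult smooth_const)
  ultimately show ?thesis
    using p one unfolding characters_def point_evaluation_def by (auto intro!: bexI[of _ "\<lambda>p\<in>X. 1"])
qed

lemma point_evaluation_inj:
  assumes "p \<in> X" "q \<in> X" "point_evaluation P p = point_evaluation P q"
  shows "p = q"
proof (rule ccontr)
  assume "p \<noteq> q"
  then obtain f where f: "smooth (\<lambda>q. complex_of_real (f q))" "0 < f p" "f q = (0::real)"
    using separating_function[OF assms(1,2)] by blast
  let ?F = "restrict (\<lambda>q. complex_of_real (f q)) X"
  have "?F \<in> smooth_functions P" by (rule restrict_mem_A[OF f(1)])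
  then have "point_evaluation P p ?F = complex_of_real (f p)" "point_evaluation P q ?F = complex_of_real (f q)"
    using assms(1,2) by (simp_all add: point_evaluation_def)
  then show False using assms(3) f by simp
qed

context
  fixes \<omega> assumes \<omega>: "\<omega> \<in> characters A"
begin

abbreviation ev :: "('p \<Rightarrow> complex) \<Rightarrow> complex" where "ev f \<equiv> \<omega> (restrict f X)"

lemma ev_add: "smooth f \<Longrightarrow> smooth g \<Longrightarrow> ev (\<lambda>p. f p + g p) = ev f + ev g"
proof -
  assume f: "smooth f" and g: "smooth g"
  have "\<omega> (add A (restrict f X) (restrict g X)) = ev f + ev g"
    using \<omega> restrict_mem_A[OF f] restrict_mem_A[OF g] by (simp only: characters_def mem_Collect_eq A_simps)
  moreover have "add A (restrict f X) (restrict g X) = (\<lambda>p\<in>X. f p + g p)" by (auto simp: restrict_def)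
  ultimately show ?thesis by simp
qed

lemma ev_mult: "smooth f \<Longrightarrow> smooth g \<Longrightarrow> ev (\<lambda>p. f p * g p) = ev f * ev g"
proof -
  assume f: "smooth f" and g: "smooth g"
  have "\<omega> (mult A (restrict f X) (restrict g X)) = ev f * ev g"
    using \<omega> restrict_mem_A[OF f] restrict_mem_A[OF g] by (simp only: characters_def mem_Collect_eq A_simps)
  moreover have "mult A (restrict f X) (restrict g X) = (\<lambda>p\<in>X. f p * g p)" by (auto simp: restrict_def)
  ultimately show ?thesis by simp
qed

lemma ev_one: "ev (\<lambda>p. 1) = 1"
proof -
  obtain a where a: "a \<in> smooth_functions P" "\<omega> a \<noteq> 0"
    using \<omega> unfolding characters_def A_simps by blast
  have "smooth a" using a mem_A by blast
  then have "ev (\<lambda>p. a p * 1) = ev a * ev (\<lambda>p. 1)" by (rule ev_mult[OF _ smooth_const])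
  then show ?thesis using a by (simp add: restrict_A)
qed

lemma ev_const: "ev (\<lambda>p. c) = c"
proof -
  have "\<omega> (smult A c (\<lambda>p\<in>X. 1)) = c * ev (\<lambda>p. 1)"
    using \<omega> restrict_mem_A[OF smooth_const[of 1]] by (simp only: characters_def mem_Collect_eq A_simps)
  moreover have "smult A c (\<lambda>p\<in>X. 1) = (\<lambda>p\<in>X. c)" by (auto simp: restrict_def)
  ultimately show ?thesis by (simp add: ev_one)
qed

lemma ev_shift: "smooth f \<Longrightarrow> ev (\<lambda>p. f p - c) = ev f - c"
  using ev_add[OF _ smooth_const, of f "-c"] ev_const[of "-c"] by simp

lemma ev_sum: "finite I \<Longrightarrow> (\<And>i. i \<in> I \<Longrightarrow> smooth (f i)) \<Longrightarrow> ev (\<lambda>p. \<Sum>i\<in>I. f i p) = (\<Sum>i\<in>I. ev (f i))"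
  by (induction I rule: finite_induct) (simp_all add: ev_const ev_add smooth_sum)

text \<open>
  Such a function is invertible, so it is not in the kernel of a character.
\<close>

lemma ev_positive:
  assumes f: "smooth (\<lambda>p. complex_of_real (f p))" "\<And>p. p \<in> X \<Longrightarrow> 0 < f p"
  shows "ev (\<lambda>p. complex_of_real (f p)) \<noteq> 0"
proof
  assume z: "ev (\<lambda>p. complex_of_real (f p)) = 0"
  let ?g = "\<lambda>p. complex_of_real (inverse (Re (complex_of_real (f p))))"
  have g: "smooth ?g" by (rule smooth_inverse[OF f(1)]) (simp add: f(2))
  have "restrict (\<lambda>p. complex_of_real (f p) * ?g p) X = restrict (\<lambda>p. 1) X"
  proof (rule restrict_ext)
    fix p assume "p \<in> X"
    then have "f p \<noteq> 0" using f(2) by fastforce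
    then show "complex_of_real (f p) * ?g p = 1" by simp
  qed
  then have "1 = ev (\<lambda>p. complex_of_real (f p) * ?g p)" using ev_one by simp
  also have "\<dots> = 0" using ev_mult[OF f(1) g] z by simp
  finally show False by simp
qed

text \<open>
  In this form an element of the kernel of \<open>\<omega>\<close> can be multiplied by nonnegative smooth functions
  and added to other such elements without cancellation.
\<close>

definition kernel_fun :: "('p \<Rightarrow> real) \<Rightarrow> bool" where
  "kernel_fun h \<longleftrightarrow> smooth (\<lambda>p. complex_of_real (h p)) \<and> (\<forall>p. 0 \<le> h p) \<and> ev (\<lambda>p. complex_of_real (h p)) = 0"

lemma kernel_fun_mult:
  assumes "kernel_fun h" "smooth (\<lambda>p. complex_of_real (f p))" "\<And>p. 0 \<le> f p"
  shows "kernel_fun (\<lambda>p. h p * f p)"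
  using assms ev_mult[of "\<lambda>p. complex_of_real (h p)" "\<lambda>p. complex_of_real (f p)"]
    smooth_mult[of "\<lambda>p. complex_of_real (h p)" "\<lambda>p. complex_of_real (f p)"]
  by (simp add: kernel_fun_def)

text \<open>
  A function that takes a value different from \<open>ev f\<close> at \<open>p\<close> thus yields an element of the kernel
  that is positive at \<open>p\<close>.
\<close>

lemma kernel_fun_square:
  assumes f: "smooth f"
  shows "kernel_fun (\<lambda>p. (cmod (f p - ev f))\<^sup>2)"
proof -
  have s: "smooth (\<lambda>p. f p - ev f)" by (intro smooth_diff f smooth_const)
  have eq: "complex_of_real ((cmod (f p - ev f))\<^sup>2) = (f p - ev f) * cnj (f p - ev f)" for p
    by (rule complex_norm_square)
  have "ev (\<lambda>p. (f p - ev f) * cnj (f p - ev f)) = 0"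
    using ev_mult[OF s smooth_cnj[OF s]] ev_shift[OF f, of "ev f"] by simp
  then show ?thesis
    unfolding kernel_fun_def eq using smooth_mult[OF s smooth_cnj[OF s]] by simp
qed

text \<open>
  Second countability: one function is selected for every basic open set on which some function in
  the kernel is positive.
\<close>

lemma countable_kernel_cover:
  assumes cover: "\<forall>p\<in>X. \<exists>h. kernel_fun h \<and> 0 < h p"
  shows "\<exists>h :: nat \<Rightarrow> 'p \<Rightarrow> real. (\<forall>n. kernel_fun (h n)) \<and> (\<forall>p\<in>X. \<exists>n. 0 < h n p)"
proof -
  obtain \<B> where \<B>: "countable \<B>" "\<forall>B\<in>\<B>. openin (mtop P) B"
    "\<forall>U x. openin (mtop P) U \<and> x \<in> U \<longrightarrow> (\<exists>B\<in>\<B>. x \<in> B \<and> B \<subseteq> U)"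
    using manifold unfolding smooth_manifold_def second_countable_space_def by blast
  define pos where "pos B h \<longleftrightarrow> kernel_fun h \<and> (\<forall>q\<in>B. 0 < h q)" for B h
  define sel where "sel B = (if \<exists>h. pos B h then SOME h. pos B h else (\<lambda>p. 0))" for B
  have zero: "kernel_fun (\<lambda>p. 0)" using smooth_const[of 0] ev_const[of 0] by (simp add: kernel_fun_def)
  have sel: "kernel_fun (sel B)" for B
  proof (cases "\<exists>h. pos B h")
    case True
    then have "pos B (sel B)" unfolding sel_def using someI_ex[OF True] by simp
    then show ?thesis by (simp add: pos_def)
  qed (simp add: sel_def zero)
  have sel_pos: "0 < sel B q" if "pos B h" "q \<in> B" for B h q
  proof -
    have ex: "\<exists>h. pos B h" using that(1) by blast
    then have "pos B (sel B)" unfolding sel_def using someI_ex[OF ex] by simp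
    then show ?thesis using that(2) by (simp add: pos_def)
  qed
  define \<B>' where "\<B>' = insert {} \<B>"
  have c: "countable \<B>'" "\<B>' \<noteq> {}" using \<B>(1) by (simp_all add: \<B>'_def)
  define h where "h n = sel (from_nat_into \<B>' n)" for n
  have "\<exists>n. 0 < h n p" if p: "p \<in> X" for p
  proof -
    obtain k where k: "kernel_fun k" "0 < k p" using cover p by blast
    have "continuous_map (mtop P) euclidean (\<lambda>p. complex_of_real (k p))"
      using k by (intro smooth_continuous) (simp add: kernel_fun_def)
    from continuous_map_euclidean_compose[OF this, of Re]
    have ck: "continuous_map (mtop P) euclideanreal k" by (simp add: continuous_intros)
    have "openin (mtop P) {q \<in> X. k q \<in> {0<..}}"
      by (rule openin_continuous_map_preimage[OF ck]) simp
    then obtain B where B: "B \<in> \<B>" "p \<in> B" "B \<subseteq> {q \<in> X. k q \<in> {0<..}}"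
      using \<B>(3) p k(2) by (metis (no_types, lifting) greaterThan_iff mem_Collect_eq)
    have "pos B k" using k(1) B(3) by (auto simp: pos_def)
    then have "0 < sel B p" using sel_pos B(2) by blast
    moreover obtain n where "from_nat_into \<B>' n = B"
      using from_nat_into_surj[OF c(1), of B] B(1) by (auto simp: \<B>'_def)
    ultimately show ?thesis by (metis h_def)
  qed
  then show ?thesis using sel by (intro exI[of _ h]) (simp add: h_def)
qed

text \<open>
  If a character is no point evaluation, countably many nonnegative functions \<open>h n\<close> in its kernel have
  no common zero.  Cutting \<open>h n\<close> off where an earlier \<open>h j\<close> reaches \<open>1 / (n + 1)\<close> gives
  functions \<open>k n\<close> in the kernel that still have no common zero and of which locally only finitely many
  do not vanish.  The weighted average \<open>\<psi>\<close> of the numbers \<open>n\<close> with weights \<open>k n\<close> is a smooth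
  function that is at least \<open>N\<close> wherever \<open>k 0, \<dots>, k N\<close> vanish.  For \<open>r\<close> the value of the character
  at \<open>\<psi>\<close> and \<open>N > |r|\<close>, the function \<open>|\<psi> - r|\<^sup>2 + k 0 + \<dots> + k N\<close> is then strictly positive, hence
  invertible, but in the kernel.
\<close>

theorem character_is_point_evaluation: "\<exists>p\<in>X. \<omega> = point_evaluation P p"
proof (rule ccontr)
  assume contra: "\<not> ?thesis"
  have "\<exists>h. kernel_fun h \<and> 0 < h p" if p: "p \<in> X" for p
  proof -
    have "\<omega> \<in> extensional (smooth_functions P)" using \<omega> by (simp add: characters_def)
    moreover have "point_evaluation P p \<in> extensional (smooth_functions P)" by (simp add: point_evaluation_def)
    moreover have "\<omega> \<noteq> point_evaluation P p" using contra p by blast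
    ultimately obtain f where f: "f \<in> smooth_functions P" "\<omega> f \<noteq> point_evaluation P p f"
      by (metis extensionalityI)
    then have "f p \<noteq> ev f" by (simp add: point_evaluation_def restrict_A)
    moreover have "smooth f" using f(1) mem_A by blast
    ultimately show ?thesis using kernel_fun_square[of f] by (intro exI[of _ "\<lambda>p. (cmod (f p - ev f))\<^sup>2"]) simp
  qed
  then obtain h :: "nat \<Rightarrow> 'p \<Rightarrow> real" where h: "\<forall>n. kernel_fun (h n)" and hcov: "\<forall>p\<in>X. \<exists>n. 0 < h n p"
    using countable_kernel_cover by blast
  have hs: "smooth (\<lambda>p. complex_of_real (h n p))" and hnn: "0 \<le> h n p" for n p
    using h by (simp_all add: kernel_fun_def)
  define cut where "cut n p = (\<Prod>j<n. bump (1 / real (Suc n) - h j p))" for n p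
  have cut_s: "smooth (\<lambda>p. complex_of_real (cut n p))" for n
  proof -
    have "smooth (\<lambda>p. complex_of_real (bump (Re (complex_of_real (1 / real (Suc n)) - complex_of_real (h j p)))))" for j
      by (intro smooth_bump smooth_diff smooth_const hs)
    then have "smooth (\<lambda>p. \<Prod>j<n. complex_of_real (bump (1 / real (Suc n) - h j p)))"
      by (intro smooth_prod) simp
    then show ?thesis by (simp add: cut_def)
  qed
  have cut_nn: "0 \<le> cut n p" for n p by (simp add: cut_def prod_nonneg bump_nonneg)
  define k where "k n p = h n p * cut n p" for n p
  have k: "kernel_fun (k n)" for n unfolding k_def using h cut_s cut_nn by (intro kernel_fun_mult) auto
  have ks: "smooth (\<lambda>p. complex_of_real (k n p))" and knn: "0 \<le> k n p" for n p
    using k by (simp_all add: kernel_fun_def)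
  have kcov: "\<exists>n. 0 < k n p" if p: "p \<in> X" for p
  proof -
    define n where "n = (LEAST n. 0 < h n p)"
    have n: "0 < h n p" using hcov p unfolding n_def by (auto intro: LeastI)
    have "h j p = 0" if "j < n" for j
      using not_less_Least[of j "\<lambda>n. 0 < h n p"] that hnn[of j p] unfolding n_def by fastforce
    then have "0 < cut n p" unfolding cut_def by (intro prod_pos) (simp add: bump_pos_iff)
    then show ?thesis using n by (intro exI[of _ n]) (simp add: k_def)
  qed
  have locfin: "\<exists>V m. openin (mtop P) V \<and> p \<in> V \<and> (\<forall>q\<in>V. \<forall>n\<ge>m. k n q = 0)" if p: "p \<in> X" for p
  proof -
    obtain j where j: "0 < h j p" using hcov p by blast
    define d where "d = h j p / 2"
    have ch: "continuous_map (mtop P) euclideanreal (h j)"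
      using continuous_map_euclidean_compose[OF smooth_continuous[OF hs[of j]], of Re] by (simp add: continuous_intros)
    let ?V = "{q \<in> X. h j q \<in> {d<..}}"
    have V: "openin (mtop P) ?V" by (rule openin_continuous_map_preimage[OF ch]) simp
    obtain N where N: "1 / real (Suc N) < d" using j nat_approx_posE[of d] by (auto simp: d_def)
    have "k n q = 0" if q: "q \<in> ?V" and n: "n \<ge> max (Suc j) N" for q n
    proof -
      have "1 / real (Suc n) \<le> 1 / real (Suc N)" using n by (intro divide_left_mono) auto
      then have "1 / real (Suc n) - h j q \<le> 0" using q N by simp
      then have "bump (1 / real (Suc n) - h j q) = 0" by (rule bump_eq_0)
      moreover have "j < n" using n by simp
      ultimately have "cut n q = 0" unfolding cut_def by (intro prod_zero) auto
      then show ?thesis by (simp add: k_def)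
    qed
    moreover have "p \<in> ?V" using p j by (simp add: d_def)
    ultimately show ?thesis using V by (intro exI[of _ ?V] exI[of _ "max (Suc j) N"]) blast
  qed
  define S where "S c p = suminf (\<lambda>n. c n * k n p)" for c :: "nat \<Rightarrow> real" and p
  have S_eq: "S c q = (\<Sum>n<m. c n * k n q)" if "\<forall>n\<ge>m. k n q = 0" for c q m
    unfolding S_def using that by (intro suminf_finite) auto
  have S_smooth: "smooth (\<lambda>p. complex_of_real (S c p))" for c
  proof (rule smooth_local)
    fix p assume p: "p \<in> X"
    obtain V m where V: "openin (mtop P) V" "p \<in> V" "\<forall>q\<in>V. \<forall>n\<ge>m. k n q = 0" using locfin[OF p] by blast
    have "smooth (\<lambda>q. \<Sum>n<m. complex_of_real (c n) * complex_of_real (k n q))"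
      by (intro smooth_sum smooth_mult smooth_const ks)
    moreover have "complex_of_real (S c q) = (\<Sum>n<m. complex_of_real (c n) * complex_of_real (k n q))" if "q \<in> V" for q
      using S_eq[OF bspec[OF V(3) that], of c] by simp
    ultimately show "\<exists>V g. openin (mtop P) V \<and> p \<in> V \<and> smooth g \<and> (\<forall>q\<in>V. complex_of_real (S c q) = g q)"
      using V(1,2) by blast
  qed
  let ?S0 = "S (\<lambda>n. 1)" and ?S1 = "S real"
  have S0_pos: "0 < ?S0 p" if p: "p \<in> X" for p
  proof -
    obtain m where m: "\<forall>n\<ge>m. k n p = 0" using locfin[OF p] by blast
    obtain n where n: "0 < k n p" using kcov[OF p] by blast
    have "n < m"
    proof (rule ccontr)
      assume "\<not> n < m"
      then show False using m n by simp
    qed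
    then have "0 < (\<Sum>n<m. 1 * k n p)" using n knn by (intro sum_pos2[of _ n]) auto
    then show ?thesis using S_eq[OF m] by simp
  qed
  define \<psi> where "\<psi> p = ?S1 p * inverse (?S0 p)" for p
  have \<psi>s: "smooth (\<lambda>p. complex_of_real (\<psi> p))"
  proof -
    have "smooth (\<lambda>p. complex_of_real (?S1 p) * complex_of_real (inverse (Re (complex_of_real (?S0 p)))))"
      by (intro smooth_mult smooth_inverse S_smooth) (simp add: S0_pos)
    then show ?thesis by (simp add: \<psi>_def)
  qed
  define r where "r = ev (\<lambda>p. complex_of_real (\<psi> p))"
  obtain N :: nat where N: "cmod r < real N" using reals_Archimedean2 by blast
  define g where "g p = (cmod (complex_of_real (\<psi> p) - r))\<^sup>2 + (\<Sum>n\<le>N. k n p)" for p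
  have sq: "kernel_fun (\<lambda>p. (cmod (complex_of_real (\<psi> p) - r))\<^sup>2)"
    unfolding r_def by (rule kernel_fun_square[OF \<psi>s])
  have gs: "smooth (\<lambda>p. complex_of_real (g p))" and "ev (\<lambda>p. complex_of_real (g p)) = 0"
  proof -
    have a: "smooth (\<lambda>p. \<Sum>n\<le>N. complex_of_real (k n p))" by (intro smooth_sum ks)
    have b: "smooth (\<lambda>p. complex_of_real ((cmod (complex_of_real (\<psi> p) - r))\<^sup>2))" using sq by (simp add: kernel_fun_def)
    have eq: "complex_of_real (g p) = complex_of_real ((cmod (complex_of_real (\<psi> p) - r))\<^sup>2) + (\<Sum>n\<le>N. complex_of_real (k n p))" for p
      by (simp add: g_def)
    show "smooth (\<lambda>p. complex_of_real (g p))" unfolding eq by (rule smooth_add[OF b a])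
    have "ev (\<lambda>p. \<Sum>n\<le>N. complex_of_real (k n p)) = 0"
      using k by (subst ev_sum) (simp_all add: ks kernel_fun_def)
    then show "ev (\<lambda>p. complex_of_real (g p)) = 0"
      unfolding eq ev_add[OF b a] using sq by (simp add: kernel_fun_def)
  qed
  moreover have "0 < g p" if p: "p \<in> X" for p
  proof (rule ccontr)
    assume "\<not> 0 < g p"
    moreover have "0 \<le> (\<Sum>n\<le>N. k n p)" by (intro sum_nonneg knn)
    moreover have "0 \<le> (cmod (complex_of_real (\<psi> p) - r))\<^sup>2" by simp
    ultimately have z: "(cmod (complex_of_real (\<psi> p) - r))\<^sup>2 = 0" "(\<Sum>n\<le>N. k n p) = 0"
      unfolding g_def by linarith+
    then have r: "r = complex_of_real (\<psi> p)" by simp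
    have kz: "k n p = 0" if "n \<le> N" for n using z(2) knn that by (simp add: sum_nonneg_eq_0_iff)
    obtain m where m: "\<forall>n\<ge>m. k n p = 0" using locfin[OF p] by blast
    have "real N * ?S0 p = (\<Sum>n<m. real N * k n p)" using S_eq[OF m] by (simp add: sum_distrib_left)
    also have "\<dots> \<le> (\<Sum>n<m. real n * k n p)"
    proof (rule sum_mono)
      fix n show "real N * k n p \<le> real n * k n p"
        using kz[of n] knn[of n p] by (cases "n \<le> N") (auto intro: mult_right_mono)
    qed
    also have "\<dots> = ?S1 p" using S_eq[OF m] by simp
    finally have "real N \<le> \<psi> p" using S0_pos[OF p] by (simp add: \<psi>_def field_simps)
    then show False using N r by simp
  qed
  ultimately show False using ev_positive[OF gs] by blast
qed

end

end

section \<open>Averaging smooth functions over the group\<close>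

context compact_group
begin

text \<open>
  By the mean value theorem the difference quotient of \<open>F g\<close> is a value of \<open>F' g\<close> near \<open>0\<close>, and this
  is close to \<open>F' g 0\<close> uniformly in \<open>g\<close>.
\<close>

lemma mean_has_derivative:
  fixes F F' :: "'g \<Rightarrow> real \<Rightarrow> real"
  assumes d: "0 < d" and F: "\<And>t. \<bar>t\<bar> < d \<Longrightarrow> cont (\<lambda>g. F g t)"
    and F': "continuous_map (prod_topology T (top_of_set {-d<..<d})) euclideanreal (\<lambda>z. F' (fst z) (snd z))"
    and der: "\<And>g t. g \<in> carrier G \<Longrightarrow> \<bar>t\<bar> < d \<Longrightarrow> (F g has_real_derivative F' g t) (at t)"
  shows "((\<lambda>t. mean (\<lambda>g. F g t)) has_real_derivative mean (\<lambda>g. F' g 0)) (at 0)"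
  unfolding DERIV_def
proof (rule LIM_I)
  fix e :: real assume e: "0 < e"
  have "0 \<in> topspace (top_of_set {-d<..<d})" "0 < e / 2" using d e by simp_all
  from compact_uniform_continuity[OF compact_T F' this]
  obtain V where V: "openin (top_of_set {-d<..<d}) V" "0 \<in> V"
    "\<forall>g\<in>topspace T. \<forall>t\<in>V. dist (F' g t) (F' g 0) < e / 2" by auto
  have "openin (top_of_set {-d<..<d}) V \<longleftrightarrow> open V \<and> V \<subseteq> {-d<..<d}" by (rule openin_open_eq) simp
  then have "open V" "V \<subseteq> {-d<..<d}" using V(1) by simp_all
  then obtain \<delta> where \<delta>: "0 < \<delta>" "ball 0 \<delta> \<subseteq> V" using V(2) open_contains_ball by blast
  have near: "\<bar>s\<bar> < d" "g \<in> carrier G \<Longrightarrow> \<bar>F' g s - F' g 0\<bar> < e / 2" if "\<bar>s\<bar> < \<delta>" for s g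
  proof -
    have "s \<in> ball 0 \<delta>" using that by (simp add: dist_real_def)
    then have s: "s \<in> V" using \<delta>(2) by blast
    then have "s \<in> {-d<..<d}" using \<open>V \<subseteq> {-d<..<d}\<close> by blast
    then show "\<bar>s\<bar> < d" by auto
    show "\<bar>F' g s - F' g 0\<bar> < e / 2" if g: "g \<in> carrier G"
    proof -
      have "g \<in> topspace T" using g by (simp add: topspace_T)
      from bspec[OF bspec[OF V(3) this] s] show ?thesis by (simp add: dist_real_def)
    qed
  qed
  have F'0: "cont (\<lambda>g. F' g 0)"
  proof -
    have "continuous_map T (prod_topology T (top_of_set {-d<..<d})) (\<lambda>g. (g, 0))"
      using d by (intro continuous_map_pairedI) auto
    from continuous_map_compose[OF this F'] show ?thesis by (simp add: o_def)
  qed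
  have "norm ((mean (\<lambda>g. F g (0 + t)) - mean (\<lambda>g. F g 0)) / t - mean (\<lambda>g. F' g 0)) < e"
    if t: "t \<noteq> 0" "norm (t - 0) < \<delta>" for t
  proof -
    have td: "\<bar>t\<bar> < \<delta>" using t by simp
    have c: "cont (\<lambda>g. F g t)" "cont (\<lambda>g. F g 0)" using F near(1)[OF td] d by simp_all
    have cd: "cont (\<lambda>g. F g t - F g 0)" using c by (intro continuous_map_diff)
    have cq: "cont (\<lambda>g. (1 / t) * (F g t - F g 0))" using cd by (intro continuous_map_real_mult_left)
    have "\<bar>mean (\<lambda>g. (1 / t) * (F g t - F g 0) - F' g 0)\<bar> \<le> e / 2"
    proof (rule mean_abs_le)
      show "cont (\<lambda>g. (1 / t) * (F g t - F g 0) - F' g 0)" using cq F'0 by (intro continuous_map_diff)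
      fix g assume g: "g \<in> carrier G"
      have "\<exists>s. \<bar>s\<bar> < \<delta> \<and> F g t - F g 0 = t * F' g s"
      proof (cases "0 < t")
        case True
        have "\<exists>s>0. s < t \<and> F g t - F g 0 = (t - 0) * F' g s"
          by (rule MVT2[OF True], rule der[OF g], rule near(1)) (use td in linarith)
        then obtain s where "0 < s" "s < t" "F g t - F g 0 = (t - 0) * F' g s" by blast
        then show ?thesis using td by (intro exI[of _ s]) simp
      next
        case False
        then have "t < 0" using t by simp
        have "\<exists>s>t. s < 0 \<and> F g 0 - F g t = (0 - t) * F' g s"
          by (rule MVT2[OF \<open>t < 0\<close>], rule der[OF g], rule near(1)) (use td in linarith)
        then obtain s where "t < s" "s < 0" "F g 0 - F g t = (0 - t) * F' g s" by blast
        then show ?thesis using td by (intro exI[of _ s]) simp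
      qed
      then obtain s where s: "\<bar>s\<bar> < \<delta>" "F g t - F g 0 = t * F' g s" by blast
      have "(1 / t) * (F g t - F g 0) - F' g 0 = F' g s - F' g 0" using s(2) t(1) by simp
      then show "\<bar>(1 / t) * (F g t - F g 0) - F' g 0\<bar> \<le> e / 2" using near(2)[OF s(1) g] by simp
    qed
    also have "mean (\<lambda>g. (1 / t) * (F g t - F g 0) - F' g 0) = (1 / t) * (mean (\<lambda>g. F g t) - mean (\<lambda>g. F g 0)) - mean (\<lambda>g. F' g 0)"
      unfolding mean_diff[OF cq F'0] mean_cmult[OF cd] mean_diff[OF c] ..
    finally show ?thesis using e by simp
  qed
  then show "\<exists>s>0. \<forall>x. x \<noteq> 0 \<and> norm (x - 0) < s \<longrightarrow>
      norm ((mean (\<lambda>g. F g (0 + x)) - mean (\<lambda>g. F g 0)) / x - mean (\<lambda>g. F' g 0)) < e"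
    using \<delta>(1) by blast
qed

end

locale smooth_dynamics = smooth_mfd P n + compact_group G "mtop (mfd G)"
  for P :: "('p, nat \<Rightarrow> real) manifold" and n :: nat
    and G :: "('g, nat \<Rightarrow> real) lie_group" (structure) +
  fixes \<alpha> :: "'g \<Rightarrow> ('p \<Rightarrow> complex) \<Rightarrow> 'p \<Rightarrow> complex"
  assumes \<alpha>_hom: "\<alpha> \<in> hom G (algebra_Aut (smooth_algebra P))"
    and \<alpha>_continuous: "continuous_map (prod_topology (mtop (mfd G)) (smooth_topology P)) (smooth_topology P) (\<lambda>(g, f). \<alpha> g f)"
    and module_A: "Module.module scalars (smooth_algebra P)"
begin

lemma \<alpha>_automorphism:
  assumes g: "g \<in> carrier G"
  shows "\<alpha> g \<in> Bij (smooth_functions P)" and "\<alpha> g \<in> ring_hom A A"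
    and "f \<in> smooth_functions P \<Longrightarrow> \<alpha> g (c \<odot>\<^bsub>A\<^esub> f) = c \<odot>\<^bsub>A\<^esub> \<alpha> g f"
proof -
  have "\<alpha> g \<in> carrier (algebra_Aut A)" using hom_in_carrier[OF \<alpha>_hom g] .
  then have *: "\<alpha> g \<in> Bij (smooth_functions P) \<and> \<alpha> g \<in> ring_hom A A \<and> (\<forall>c. \<forall>f\<in>smooth_functions P. \<alpha> g (c \<odot>\<^bsub>A\<^esub> f) = c \<odot>\<^bsub>A\<^esub> \<alpha> g f)"
    unfolding algebra_Aut_def by (simp del: A_simps(2-))
  show "\<alpha> g \<in> Bij (smooth_functions P)" "\<alpha> g \<in> ring_hom A A" using * by blast+
  show "f \<in> smooth_functions P \<Longrightarrow> \<alpha> g (c \<odot>\<^bsub>A\<^esub> f) = c \<odot>\<^bsub>A\<^esub> \<alpha> g f" using * by blast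
qed

lemma \<alpha>_closed: "g \<in> carrier G \<Longrightarrow> f \<in> smooth_functions P \<Longrightarrow> \<alpha> g f \<in> smooth_functions P"
  using ring_hom_closed[OF \<alpha>_automorphism(2)] by simp

lemma \<alpha>_add: "g \<in> carrier G \<Longrightarrow> f \<in> smooth_functions P \<Longrightarrow> h \<in> smooth_functions P \<Longrightarrow> \<alpha> g (f \<oplus>\<^bsub>A\<^esub> h) = \<alpha> g f \<oplus>\<^bsub>A\<^esub> \<alpha> g h"
  using ring_hom_add[OF \<alpha>_automorphism(2)] by (simp del: A_simps(2-))

lemma \<alpha>_times: "g \<in> carrier G \<Longrightarrow> f \<in> smooth_functions P \<Longrightarrow> h \<in> smooth_functions P \<Longrightarrow> \<alpha> g (f \<otimes>\<^bsub>A\<^esub> h) = \<alpha> g f \<otimes>\<^bsub>A\<^esub> \<alpha> g h"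
  using ring_hom_mult[OF \<alpha>_automorphism(2)] by (simp del: A_simps(2-))

lemma \<alpha>_unit: "g \<in> carrier G \<Longrightarrow> \<alpha> g \<one>\<^bsub>A\<^esub> = \<one>\<^bsub>A\<^esub>"
  using ring_hom_one[OF \<alpha>_automorphism(2)] .

lemma \<alpha>_mult:
  assumes "g \<in> carrier G" "h \<in> carrier G" "f \<in> smooth_functions P"
  shows "\<alpha> (g \<otimes> h) f = \<alpha> g (\<alpha> h f)"
proof -
  have "\<alpha> (g \<otimes> h) = \<alpha> g \<otimes>\<^bsub>algebra_Aut A\<^esub> \<alpha> h" by (rule hom_mult[OF \<alpha>_hom assms(1,2)])
  also have "\<dots> = compose (smooth_functions P) (\<alpha> g) (\<alpha> h)"
    using \<alpha>_automorphism(1) assms(1,2) by (simp add: algebra_Aut_def BijGroup_def)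
  finally show ?thesis using assms(3) by (simp add: compose_def)
qed

lemma \<alpha>_one:
  assumes f: "f \<in> smooth_functions P"
  shows "\<alpha> \<one> f = f"
proof -
  have "\<alpha> \<one> (\<alpha> \<one> f) = \<alpha> \<one> f" using \<alpha>_mult[of \<one> \<one> f] f by simp
  moreover have "inj_on (\<alpha> \<one>) (smooth_functions P)"
    using \<alpha>_automorphism(1)[OF one_closed] by (simp add: Bij_def bij_betw_def)
  ultimately show ?thesis using f \<alpha>_closed[OF one_closed f] by (auto dest: inj_onD)
qed

lemma topspace_smooth_topology: "topspace (smooth_topology P) = smooth_functions P"
  unfolding smooth_topology_def topology_generated_by_topspace by (auto simp: smooth_ball_def)

lemma orbit_continuous:
  assumes f: "f \<in> smooth_functions P"
  shows "continuous_map (mtop (mfd G)) (smooth_topology P) (\<lambda>g. \<alpha> g f)"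
proof -
  have "continuous_map (mtop (mfd G)) (prod_topology (mtop (mfd G)) (smooth_topology P)) (\<lambda>g. (g, f))"
    using f by (intro continuous_map_pairedI) (simp_all add: topspace_smooth_topology)
  from continuous_map_compose[OF this \<alpha>_continuous] show ?thesis by (simp add: o_def)
qed

text \<open>
  The topology on the smooth functions makes the derivatives of \<open>\<alpha> g f\<close> depend on \<open>g\<close> continuously,
  uniformly on compact boxes around \<open>x\<close>; for fixed \<open>g\<close> they are continuous in \<open>x\<close>.
\<close>

lemma orbit_derivatives_continuous:
  assumes c: "(U, \<phi>) \<in> charts P" and f: "f \<in> smooth_functions P" and hs: "set hs \<subseteq> Rn n"
  defines "D \<equiv> \<lambda>g. iter_deriv (E n) C (\<lambda>y. \<alpha> g f (inv_into U \<phi> y)) hs"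
  shows "continuous_map (prod_topology (mtop (mfd G)) (top_of_set (\<phi> ` U))) euclidean (\<lambda>z. D (fst z) (snd z))"
  unfolding continuous_map_euclidean_iff_dist
proof (intro ballI allI impI)
  fix z :: "'g \<times> (nat \<Rightarrow> real)" and e :: real
  assume z: "z \<in> topspace (prod_topology (mtop (mfd G)) (top_of_set (\<phi> ` U)))" and e: "0 < e"
  obtain g0 x0 where z_eq: "z = (g0, x0)" by (cases z)
  have g0: "g0 \<in> carrier G" and x0: "x0 \<in> \<phi> ` U" using z by (simp_all add: z_eq topspace_T)
  have sm: "smooth_fun n (\<phi> ` U) (\<lambda>y. \<alpha> g f (inv_into U \<phi> y))" if "g \<in> carrier G" for g
    using \<alpha>_closed[OF that f] by (intro smoothD[OF _ c]) (simp add: mem_A)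
  have "continuous_on (\<phi> ` U) (D g0)"
    unfolding D_def by (rule smooth_fun_continuous[OF smooth_fun_iter_deriv(1)[OF chart(2)[OF c] sm[OF g0] hs]])
  then have "continuous_map (top_of_set (\<phi> ` U)) euclidean (D g0)" by simp
  moreover have "x0 \<in> topspace (top_of_set (\<phi> ` U))" "0 < e / 2" using x0 e by simp_all
  ultimately obtain W where W: "openin (top_of_set (\<phi> ` U)) W" "x0 \<in> W" "\<forall>y\<in>W. dist (D g0 y) (D g0 x0) < e / 2"
    unfolding continuous_map_euclidean_iff_dist by blast
  have "open_in_Rn n W" using W(1) chart(2)[OF c] unfolding open_in_Rn_def by (rule openin_trans)
  then obtain s where s: "s > 0" "box x0 s \<subseteq> W" using small_box W(2) by blast
  have WU: "W \<subseteq> \<phi> ` U" using openin_imp_subset[OF W(1)] .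
  define N where "N = \<phi> ` U \<inter> (\<Inter>i\<in>{..<n}. {y. \<bar>y i - x0 i\<bar> < s})"
  have "open (\<Inter>i\<in>{..<n}. {y::nat \<Rightarrow> real. \<bar>y i - x0 i\<bar> < s})"
    by (intro open_INT finite_lessThan ballI open_Collect_less continuous_intros continuous_on_product_coordinates)
  then have oN: "openin (top_of_set (\<phi> ` U)) N" unfolding N_def by (rule openin_open_Int)
  have NB: "N \<subseteq> box x0 s"
  proof
    fix y assume y: "y \<in> N"
    then have yU: "y \<in> \<phi> ` U" by (simp add: N_def)
    have y0: "y i = 0" if "n \<le> i" for i using open_in_Rn_D[OF chart(2)[OF c] yU] that by (simp add: Rn_def)
    have yi: "\<bar>y i - x0 i\<bar> < s" if "i < n" for i using y that by (simp add: N_def)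
    have "y i \<in> (if i < n then {x0 i - s..x0 i + s} else {0})" for i
      using y0[of i] yi[of i] by (auto simp: abs_less_iff)
    then show "y \<in> box x0 s" unfolding box_def PiE_UNIV_domain by blast
  qed
  let ?B = "smooth_ball P (\<alpha> g0 f) U \<phi> (box x0 s) hs (e / 2)"
  have "openin (smooth_topology P) ?B"
    unfolding smooth_topology_def
  proof (rule topology_generated_by_Basis)
    have "box x0 s \<subseteq> Rn n" using s(2) WU open_in_Rn_D[OF chart(2)[OF c]] by blast
    then have "compactin (topol (model P)) (box x0 s)"
      by (simp add: model_P compactin_subtopology compact_box)
    moreover have "box x0 s \<subseteq> \<phi> ` U" using s(2) WU by blast
    ultimately show "?B \<in> insert (smooth_functions P) {smooth_ball P f U \<phi> K hs \<epsilon> | f U \<phi> K hs \<epsilon>.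
             f \<in> smooth_functions P \<and> (U, \<phi>) \<in> charts P \<and>
             compactin (topol (model P)) K \<and> K \<subseteq> \<phi> ` U \<and>
             set hs \<subseteq> carrier (model P) \<and> 0 < \<epsilon>}"
      using \<alpha>_closed[OF g0 f] c hs e
      by (intro insertI2 CollectI exI[of _ "\<alpha> g0 f"] exI[of _ U] exI[of _ \<phi>] exI[of _ "box x0 s"] exI[of _ hs] exI[of _ "e / 2"])
        (simp add: model_P)
  qed
  then have oV: "openin (mtop (mfd G)) {g \<in> topspace (mtop (mfd G)). \<alpha> g f \<in> ?B}"
    by (rule openin_continuous_map_preimage[OF orbit_continuous[OF f]])
  have diff: "iter_deriv (E n) C (\<lambda>y. \<alpha> g f (inv_into U \<phi> y) - \<alpha> g0 f (inv_into U \<phi> y)) hs y = D g y - D g0 y"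
    if "g \<in> carrier G" "y \<in> \<phi> ` U" for g y
    unfolding D_def by (rule iter_deriv_diff[OF chart(2)[OF c] sm[OF that(1)] sm[OF g0] hs that(2)])
  have g0V: "\<alpha> g0 f \<in> ?B"
    unfolding smooth_ball_def model_P
  proof (intro CollectI conjI ballI)
    fix x assume "x \<in> box x0 s"
    then have "x \<in> \<phi> ` U" using s(2) WU by blast
    from diff[OF g0 this] show "cmod (iter_deriv (E n) C (\<lambda>y. \<alpha> g0 f (inv_into U \<phi> y) - \<alpha> g0 f (inv_into U \<phi> y)) hs x) < e / 2"
      using e by simp
  qed (rule \<alpha>_closed[OF g0 f])
  show "\<exists>Q. openin (prod_topology (mtop (mfd G)) (top_of_set (\<phi> ` U))) Q \<and> z \<in> Q \<and>
      (\<forall>y\<in>Q. dist (D (fst y) (snd y)) (D (fst z) (snd z)) < e)"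
  proof (intro exI[of _ "{g \<in> topspace (mtop (mfd G)). \<alpha> g f \<in> ?B} \<times> N"] conjI ballI)
    show "openin (prod_topology (mtop (mfd G)) (top_of_set (\<phi> ` U))) ({g \<in> topspace (mtop (mfd G)). \<alpha> g f \<in> ?B} \<times> N)"
      using oV oN by (simp add: openin_prod_Times_iff)
    show "z \<in> {g \<in> topspace (mtop (mfd G)). \<alpha> g f \<in> ?B} \<times> N"
      using g0 g0V x0 s(1) by (simp add: z_eq topspace_T N_def)
    fix w assume w: "w \<in> {g \<in> topspace (mtop (mfd G)). \<alpha> g f \<in> ?B} \<times> N"
    then have g: "fst w \<in> carrier G" "\<alpha> (fst w) f \<in> ?B" and y: "snd w \<in> box x0 s"
      using NB by (auto simp: topspace_T)
    have yW: "snd w \<in> W" "snd w \<in> \<phi> ` U" using y s(2) WU by blast+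
    have "cmod (D (fst w) (snd w) - D g0 (snd w)) < e / 2"
      using g(2) y unfolding smooth_ball_def model_P diff[OF g(1) yW(2), symmetric] by blast
    then show "dist (D (fst w) (snd w)) (D (fst z) (snd z)) < e"
      using bspec[OF W(3) yW(1)] dist_triangle_half_r[of "D g0 (snd w)" "D (fst w) (snd w)" e "D g0 x0"]
      by (simp add: z_eq dist_norm dist_commute norm_minus_commute)
  qed
qed

lemma orbit_pointwise_continuous:
  assumes f: "f \<in> smooth_functions P" and p: "p \<in> X"
  shows "cont (\<lambda>g. Re (\<alpha> g f p))"
proof -
  obtain U \<phi> where c: "(U, \<phi>) \<in> charts P" and pU: "p \<in> U" using charts_cover[OF p] by blast
  have "continuous_map (mtop (mfd G)) (prod_topology (mtop (mfd G)) (top_of_set (\<phi> ` U))) (\<lambda>g. (g, \<phi> p))"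
    using pU by (intro continuous_map_pairedI) auto
  from continuous_map_compose[OF this orbit_derivatives_continuous[OF c f, of "[]"]]
  have "continuous_map (mtop (mfd G)) euclidean (\<lambda>g. \<alpha> g f p)"
    using inv_into_f_f[OF chart(4)[OF c] pU] by (simp add: o_def)
  from continuous_map_euclidean_compose[OF this, of Re] show ?thesis by (simp add: continuous_intros)
qed

text \<open>
  The class of averages of iterated derivatives of \<open>\<alpha> g f\<close> is closed under directional
  derivatives, as these can be taken inside the mean.
\<close>

lemma smooth_average:
  assumes k: "cont k" and f: "f \<in> smooth_functions P"
  shows "smooth (\<lambda>p. complex_of_real (mean (\<lambda>g. k g * Re (\<alpha> g f p))))"
proof (rule smoothI)
  fix U \<phi> assume c: "(U, \<phi>) \<in> charts P"
  define D where "D hs g = iter_deriv (E n) C (\<lambda>y. \<alpha> g f (inv_into U \<phi> y)) hs" for hs g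
  have U: "open_in_Rn n (\<phi> ` U)" by (rule chart(2)[OF c])
  have sm: "smooth_fun n (\<phi> ` U) (\<lambda>y. \<alpha> g f (inv_into U \<phi> y))" if "g \<in> carrier G" for g
    using \<alpha>_closed[OF that f] by (intro smoothD[OF _ c]) (simp add: mem_A)
  have joint: "continuous_map (prod_topology (mtop (mfd G)) Y) euclideanreal (\<lambda>z. k (fst z) * Re (D hs (fst z) (u (snd z))))"
    if "set hs \<subseteq> Rn n" "continuous_map Y (top_of_set (\<phi> ` U)) u" for hs and u :: "'y \<Rightarrow> nat \<Rightarrow> real" and Y
  proof -
    have "continuous_map (prod_topology (mtop (mfd G)) Y) (prod_topology (mtop (mfd G)) (top_of_set (\<phi> ` U))) (\<lambda>z. (fst z, u (snd z)))"
      using continuous_map_compose[OF continuous_map_snd that(2)]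
      by (intro continuous_map_pairedI continuous_map_fst) (simp add: o_def)
    from continuous_map_compose[OF this orbit_derivatives_continuous[OF c f that(1)]]
    have "continuous_map (prod_topology (mtop (mfd G)) Y) euclidean (\<lambda>z. D hs (fst z) (u (snd z)))"
      by (simp add: o_def D_def)
    from continuous_map_euclidean_compose[OF this, of Re]
    have "continuous_map (prod_topology (mtop (mfd G)) Y) euclideanreal (\<lambda>z. Re (D hs (fst z) (u (snd z))))"
      by (simp add: continuous_intros)
    then show ?thesis by (intro continuous_map_real_mult cont_compose[OF k] continuous_map_fst)
  qed
  show "smooth_fun n (\<phi> ` U) (\<lambda>x. complex_of_real (mean (\<lambda>g. k g * Re (\<alpha> g f (inv_into U \<phi> x)))))"
  proof (rule smooth_fun_class[where \<C> = "\<lambda>F. \<exists>hs. set hs \<subseteq> Rn n \<and> F = (\<lambda>x. complex_of_real (mean (\<lambda>g. k g * Re (D hs g x))))"])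
    show "\<exists>hs. set hs \<subseteq> Rn n \<and> (\<lambda>x. complex_of_real (mean (\<lambda>g. k g * Re (\<alpha> g f (inv_into U \<phi> x))))) =
        (\<lambda>x. complex_of_real (mean (\<lambda>g. k g * Re (D hs g x))))"
      by (rule exI[of _ "[]"]) (simp add: D_def)
  next
    fix F assume "\<exists>hs. set hs \<subseteq> Rn n \<and> F = (\<lambda>x. complex_of_real (mean (\<lambda>g. k g * Re (D hs g x))))"
    then obtain hs where hs: "set hs \<subseteq> Rn n" and F: "F = (\<lambda>x. complex_of_real (mean (\<lambda>g. k g * Re (D hs g x))))" by blast
    have "continuous_map (top_of_set (\<phi> ` U)) (top_of_set (\<phi> ` U)) (\<lambda>x. x)" by simp
    from continuous_map_mean[OF joint[OF hs this]]
    have "continuous_on (\<phi> ` U) (\<lambda>x. mean (\<lambda>g. k g * Re (D hs g x)))" by simp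
    then show "continuous_on (\<phi> ` U) F" unfolding F by (intro continuous_intros)
  next
    fix F h assume "\<exists>hs. set hs \<subseteq> Rn n \<and> F = (\<lambda>x. complex_of_real (mean (\<lambda>g. k g * Re (D hs g x))))" and h: "h \<in> Rn n"
    then obtain hs where hs: "set hs \<subseteq> Rn n" and F: "F = (\<lambda>x. complex_of_real (mean (\<lambda>g. k g * Re (D hs g x))))" by blast
    have hhs: "set (h # hs) \<subseteq> Rn n" using h hs by simp
    have "dderiv F x h (complex_of_real (mean (\<lambda>g. k g * Re (D (h # hs) g x))))" if x: "x \<in> \<phi> ` U" for x
    proof -
      have xR: "x \<in> Rn n" by (rule open_in_Rn_D[OF U x])
      obtain d where d: "d > 0" "\<forall>t. \<bar>t\<bar> < d \<longrightarrow> line x h t \<in> \<phi> ` U"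
        using eventually_in_open_Rn[OF U x continuous_on_line[of x h] line_0 line_in_Rn[OF xR h]] by blast
      have "continuous_map (top_of_set {-d<..<d}) (top_of_set (\<phi> ` U)) (line x h)"
        using d(2) continuous_on_subset[OF continuous_on_line, of "{-d<..<d}" x h]
        by (auto simp: abs_less_iff)
      note cl = joint[OF hs this] joint[OF hhs this]
      have cF: "cont (\<lambda>g. k g * Re (D hs g (line x h t)))" if "\<bar>t\<bar> < d" for t
      proof -
        have "continuous_map (mtop (mfd G)) (prod_topology (mtop (mfd G)) (top_of_set {-d<..<d})) (\<lambda>g. (g, t))"
          using that by (intro continuous_map_pairedI) auto
        from continuous_map_compose[OF this cl(1)] show ?thesis by (simp add: o_def)
      qed
      have der: "((\<lambda>t. k g * Re (D hs g (line x h t))) has_real_derivative k g * Re (D (h # hs) g (line x h t))) (at t)"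
        if g: "g \<in> carrier G" and t: "\<bar>t\<bar> < d" for g t
      proof -
        have "line x h t \<in> \<phi> ` U" using d(2) t by blast
        from smooth_fun_iter_deriv(2)[OF U sm[OF g] hs this h]
        have "((\<lambda>s. D hs g (line x h (t + s))) has_vector_derivative D (h # hs) g (line x h t)) (at 0)"
          unfolding dderiv_def line_shift D_def .
        from bounded_linear.has_vector_derivative[OF bounded_linear_Re this]
        have "((\<lambda>s. Re (D hs g (line x h (s + t)))) has_real_derivative Re (D (h # hs) g (line x h t))) (at 0)"
          by (simp add: has_real_derivative_iff_has_vector_derivative add.commute)
        then have "((\<lambda>s. Re (D hs g (line x h s))) has_real_derivative Re (D (h # hs) g (line x h t))) (at (0 + t))"
          unfolding DERIV_shift .
        then show ?thesis using DERIV_cmult[of "\<lambda>s. Re (D hs g (line x h s))" _ t UNIV "k g"] by simp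
      qed
      have "((\<lambda>t. mean (\<lambda>g. k g * Re (D hs g (line x h t)))) has_real_derivative
          mean (\<lambda>g. k g * Re (D (h # hs) g (line x h 0)))) (at 0)"
        by (rule mean_has_derivative[OF d(1) cF cl(2) der])
      then have "((\<lambda>t. mean (\<lambda>g. k g * Re (D hs g (line x h t)))) has_vector_derivative
          mean (\<lambda>g. k g * Re (D (h # hs) g x))) (at 0)"
        by (simp add: has_real_derivative_iff_has_vector_derivative)
      from bounded_linear.has_vector_derivative[OF bounded_linear_of_real this]
      show ?thesis unfolding dderiv_def F by simp
    qed
    then show "\<exists>F'. (\<exists>hs. set hs \<subseteq> Rn n \<and> F' = (\<lambda>x. complex_of_real (mean (\<lambda>g. k g * Re (D hs g x))))) \<and>
        (\<forall>x\<in>\<phi> ` U. dderiv F x h (F' x))"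
      using hhs by (intro exI[of _ "\<lambda>x. complex_of_real (mean (\<lambda>g. k g * Re (D (h # hs) g x)))"] conjI exI[of _ "h # hs"]) blast+
  qed
qed

end

section \<open>The induced action\<close>

context smooth_dynamics
begin

abbreviation \<sigma> :: "'p \<Rightarrow> 'g \<Rightarrow> 'p" where "\<sigma> \<equiv> induced_action P \<alpha>"

lemma smooth_functions_ring_closed:
  assumes "f \<in> smooth_functions P" "h \<in> smooth_functions P"
  shows "f \<oplus>\<^bsub>A\<^esub> h \<in> smooth_functions P" "f \<otimes>\<^bsub>A\<^esub> h \<in> smooth_functions P" "c \<odot>\<^bsub>A\<^esub> f \<in> smooth_functions P" "\<one>\<^bsub>A\<^esub> \<in> smooth_functions P"
  using assms unfolding mem_A[of f] mem_A[of h] by (auto intro!: restrict_mem_A smooth_add smooth_mult smooth_const)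

lemma character_simps:
  assumes "\<omega> \<in> characters A" "f \<in> smooth_functions P" "h \<in> smooth_functions P"
  shows "\<omega> (f \<oplus>\<^bsub>A\<^esub> h) = \<omega> f + \<omega> h" "\<omega> (f \<otimes>\<^bsub>A\<^esub> h) = \<omega> f * \<omega> h" "\<omega> (c \<odot>\<^bsub>A\<^esub> f) = c * \<omega> f"
  using assms unfolding characters_def A_simps(1) by blast+

lemma character_compose:
  assumes \<omega>: "\<omega> \<in> characters A" and g: "g \<in> carrier G"
  shows "compose (smooth_functions P) \<omega> (\<alpha> g) \<in> characters A"
proof -
  have one: "\<one>\<^bsub>A\<^esub> \<in> smooth_functions P" using restrict_mem_A[OF smooth_const] by simp
  obtain f where f: "f \<in> smooth_functions P" "\<omega> f \<noteq> 0" using \<omega> unfolding characters_def A_simps(1) by blast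
  have "f \<otimes>\<^bsub>A\<^esub> \<one>\<^bsub>A\<^esub> = restrict f X" by (auto simp: restrict_def fun_eq_iff)
  then have "f \<otimes>\<^bsub>A\<^esub> \<one>\<^bsub>A\<^esub> = f" unfolding restrict_A[OF f(1)] .
  then have "\<omega> \<one>\<^bsub>A\<^esub> \<noteq> 0" using character_simps(2)[OF \<omega> f(1) one] f(2) by (metis mult_zero_right)
  then have "compose (smooth_functions P) \<omega> (\<alpha> g) \<one>\<^bsub>A\<^esub> \<noteq> 0"
    using one \<alpha>_unit[OF g] by (simp add: compose_def del: A_simps)
  moreover have "compose (smooth_functions P) \<omega> (\<alpha> g) (a \<oplus>\<^bsub>A\<^esub> b) = compose (smooth_functions P) \<omega> (\<alpha> g) a + compose (smooth_functions P) \<omega> (\<alpha> g) b"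
    "compose (smooth_functions P) \<omega> (\<alpha> g) (a \<otimes>\<^bsub>A\<^esub> b) = compose (smooth_functions P) \<omega> (\<alpha> g) a * compose (smooth_functions P) \<omega> (\<alpha> g) b"
    "compose (smooth_functions P) \<omega> (\<alpha> g) (c \<odot>\<^bsub>A\<^esub> a) = c * compose (smooth_functions P) \<omega> (\<alpha> g) a"
    if a: "a \<in> smooth_functions P" and b: "b \<in> smooth_functions P" for a b c
    using smooth_functions_ring_closed[OF a b] a b \<alpha>_closed[OF g a] \<alpha>_closed[OF g b]
    by (simp_all add: compose_def \<alpha>_add[OF g a b] \<alpha>_times[OF g a b] \<alpha>_automorphism(3)[OF g a] character_simps[OF \<omega>] del: A_simps)
  ultimately show ?thesis
    unfolding characters_def A_simps(1) using one by (intro CollectI conjI ballI allI bexI[of _ "\<one>\<^bsub>A\<^esub>"]) auto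
qed

lemma points_separated:
  assumes "p \<in> X" "q \<in> X" "\<And>f. f \<in> smooth_functions P \<Longrightarrow> f p = f q"
  shows "p = q"
  by (rule point_evaluation_inj[OF assms(1,2)]) (simp add: point_evaluation_def assms(3) cong: restrict_cong)

text \<open>
  The composition of a point evaluation with \<open>\<alpha> g\<close> is a character, hence evaluation at one and
  only one point.
\<close>

lemma
  assumes p: "p \<in> X" and g: "g \<in> carrier G"
  shows \<sigma>_closed: "\<sigma> p g \<in> X" and \<sigma>_eval: "f \<in> smooth_functions P \<Longrightarrow> f (\<sigma> p g) = \<alpha> g f p"
proof -
  let ?Q = "\<lambda>q. q \<in> X \<and> point_evaluation P q = compose (smooth_functions P) (point_evaluation P p) (\<alpha> g)"
  obtain q where q: "?Q q"
    using character_is_point_evaluation[OF character_compose[OF point_evaluation_character[OF p] g]] by force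
  have "?Q (\<sigma> p g)"
    unfolding induced_action_def
    by (rule theI[of ?Q, OF q]) (use q point_evaluation_inj in metis)
  then have 1: "\<sigma> p g \<in> X" and 2: "point_evaluation P (\<sigma> p g) = compose (smooth_functions P) (point_evaluation P p) (\<alpha> g)" by blast+
  show "\<sigma> p g \<in> X" by (rule 1)
  show "f (\<sigma> p g) = \<alpha> g f p" if f: "f \<in> smooth_functions P"
    using fun_cong[OF 2, of f] f \<alpha>_closed[OF g f] by (simp add: point_evaluation_def compose_def)
qed

lemma \<sigma>_one: "p \<in> X \<Longrightarrow> \<sigma> p \<one> = p"
  by (rule points_separated) (simp_all add: \<sigma>_closed \<sigma>_eval \<alpha>_one)

lemma linA_\<alpha>:
  assumes "tensor_product A V" "g \<in> carrier G"
  shows "tensor_product.linA A (\<alpha> g)"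
  unfolding tensor_product.linA_def[OF assms(1)] A_simps(1)
  using \<alpha>_closed \<alpha>_add \<alpha>_automorphism(3) assms(2) by blast

lemma linF_character:
  assumes "tensor_product A V" "\<omega> \<in> characters A"
  shows "tensor_product.linF A \<omega>"
  unfolding tensor_product.linF_def[OF assms(1)] A_simps(1)
  using character_simps[OF assms(2)] by blast

lemma linV_representation:
  assumes "tensor_product A V" "continuous_representation G V \<pi>" "g \<in> carrier G"
  shows "tensor_product.linV V (\<pi> g)"
proof -
  have "\<pi> g \<in> carrier (general_linear V)"
    using assms(2,3) unfolding continuous_representation_def by (blast intro: hom_in_carrier)
  then show ?thesis
    unfolding tensor_product.linV_def[OF assms(1)] general_linear_def by (auto simp: Bij_def bij_betw_def)
qed

lemma tensor_product_representation:
  assumes "continuous_representation G V \<pi>"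
  shows "tensor_product A V"
  using assms module_A unfolding continuous_representation_def locally_convex_space_def tensor_product_def by blast

text \<open>
  An element \<open>g\<close> of the stabilizer of \<open>p\<close> makes \<open>\<pi> (g\<inverse>)\<close> fix the values at \<open>p\<close> of equivariant
  tensors, that is, all vectors.
\<close>

theorem free_action_if_free_system:
  assumes free: "free_dynamical_system TYPE('v) A G \<alpha>"
  shows "free_action G X \<sigma>"
  unfolding free_action_def
proof
  fix p assume p: "p \<in> X"
  obtain \<R> :: "(('g \<Rightarrow> 'v \<Rightarrow> 'v) \<times> (complex, 'v) tvs) set" where
    rep: "\<forall>(\<pi>, V)\<in>\<R>. continuous_representation G V \<pi>"
    and sep: "\<forall>g\<in>carrier G. g \<noteq> \<one> \<longrightarrow> (\<exists>(\<pi>, V)\<in>\<R>. \<exists>v\<in>carrier V. \<pi> g v \<noteq> v)"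
    and surj: "\<forall>(\<pi>, V)\<in>\<R>. \<forall>\<omega>\<in>characters A. tensor_eval V \<omega> ` equivariants A G \<alpha> V \<pi> = carrier V"
    using free unfolding free_dynamical_system_def by blast
  have "g = \<one>" if g: "g \<in> carrier G" and stab: "\<sigma> p g = p" for g
  proof (rule ccontr)
    assume "g \<noteq> \<one>"
    then have "inv g \<noteq> \<one>" using g by (metis inv_inv inv_one)
    then obtain \<pi> V v where R: "(\<pi>, V) \<in> \<R>" and v: "v \<in> carrier V" "\<pi> (inv g) v \<noteq> v" using sep g by blast
    have r: "continuous_representation G V \<pi>" using rep R by blast
    let ?\<omega> = "point_evaluation P p"
    have \<omega>: "?\<omega> \<in> characters A" by (rule point_evaluation_character[OF p])
    have "v \<in> tensor_eval V ?\<omega> ` equivariants A G \<alpha> V \<pi>" using surj R \<omega> v(1) by blast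
    then obtain S where S: "S \<in> equivariants A G \<alpha> V \<pi>" "v = tensor_eval V ?\<omega> S" by blast
    have tp: "tensor_product A V" by (rule tensor_product_representation[OF r])
    have St: "S \<in> tensor A V" and eq: "tensor_map A V (\<alpha> g) (\<lambda>v. v) S = tensor_map A V (\<lambda>a. a) (\<pi> (inv g)) S"
      using S(1) g unfolding equivariants_def by blast+
    have "?\<omega> (\<alpha> g f) = ?\<omega> f" if "f \<in> carrier A" for f
      using that \<sigma>_eval[OF p g, of f] \<alpha>_closed[OF g] stab by (simp add: point_evaluation_def)
    from tensor_product.eval_invariant[OF tp linA_\<alpha>[OF tp g] linV_representation[OF tp r inv_closed[OF g]] linF_character[OF tp \<omega>] this St eq]
    have "\<pi> (inv g) (tensor_eval V ?\<omega> S) = tensor_eval V ?\<omega> S" .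
    then show False using v(2) S(2) by simp
  qed
  then show "stabilizer G (\<lambda>g p. \<sigma> p g) p = {\<one>}"
    using \<sigma>_one[OF p] by (auto simp: stabilizer_def)
qed

section \<open>Equivariant functions with prescribed value\<close>

text \<open>
  For \<open>g\<close> outside \<open>W\<close> the points \<open>p\<close> and \<open>p g\<close> differ, so some smooth nonnegative function vanishes
  near \<open>p g\<close> but not at \<open>p\<close>.  By compactness of the complement of \<open>W\<close>, a product of finitely many such
  functions works.
\<close>

lemma concentrated_function:
  assumes p: "p \<in> X" and free: "\<And>g. g \<in> carrier G \<Longrightarrow> \<sigma> p g = p \<Longrightarrow> g = \<one>"
    and W: "openin (mtop (mfd G)) W" "\<one> \<in> W"
  shows "\<exists>F\<in>smooth_functions P. (\<forall>g\<in>carrier G. 0 \<le> Re (\<alpha> g F p)) \<and> 0 < Re (\<alpha> \<one> F p) \<and>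
    (\<forall>g\<in>carrier G. g \<notin> W \<longrightarrow> Re (\<alpha> g F p) = 0)"
proof -
  let ?T = "mtop (mfd G)"
  let ?K = "carrier G - W"
  have "compactin ?T ?K"
    using closedin_compact_space[OF compact_T] W(1) by (metis closedin_diff closedin_topspace topspace_T)
  have "\<exists>f. smooth (\<lambda>q. complex_of_real (f q)) \<and> (\<forall>q. 0 \<le> f q) \<and> 0 < f p \<and> f (\<sigma> p g) = (0::real)" if g: "g \<in> ?K" for g
  proof (rule separating_function[OF p])
    show "\<sigma> p g \<in> X" using \<sigma>_closed[OF p] g by blast
    show "p \<noteq> \<sigma> p g" using free[of g] g W(2) by auto
  qed
  then have "\<forall>g\<in>?K. \<exists>f. smooth (\<lambda>q. complex_of_real (f q)) \<and> (\<forall>q. 0 \<le> f q) \<and> 0 < f p \<and> f (\<sigma> p g) = (0::real)" by blast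
  from bchoice[OF this] obtain f :: "'g \<Rightarrow> 'p \<Rightarrow> real" where
    f: "\<forall>g\<in>?K. smooth (\<lambda>q. complex_of_real (f g q)) \<and> (\<forall>q. 0 \<le> f g q) \<and> 0 < f g p \<and> f g (\<sigma> p g) = 0" by blast
  \<comment> \<open>On \<open>U g\<close> the factor \<open>bump (f g - f g p / 2)\<close> below vanishes, although it is positive at \<open>p\<close>.\<close>
  define U where "U g = {h \<in> topspace ?T. f g (\<sigma> p h) < f g p / 2}" for g
  have "openin ?T (U g)" if g: "g \<in> ?K" for g
  proof -
    let ?f = "restrict (\<lambda>q. complex_of_real (f g q)) X"
    have fA: "?f \<in> smooth_functions P" using f g by (intro restrict_mem_A) blast
    have eq: "Re (\<alpha> h ?f p) = f g (\<sigma> p h)" if "h \<in> carrier G" for h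
      using \<sigma>_closed[OF p that] by (simp add: \<sigma>_eval[OF p that fA, symmetric])
    have "openin ?T {h \<in> topspace ?T. Re (\<alpha> h ?f p) \<in> {..<f g p / 2}}"
      by (rule openin_continuous_map_preimage[OF orbit_pointwise_continuous[OF fA p]]) simp
    moreover have "{h \<in> topspace ?T. Re (\<alpha> h ?f p) \<in> {..<f g p / 2}} = U g"
      unfolding U_def by (rule Collect_cong) (auto simp: eq topspace_T)
    ultimately show ?thesis by simp
  qed
  then have op: "\<forall>V\<in>U ` ?K. openin ?T V" by blast
  have "g \<in> U g" if "g \<in> ?K" for g using f that by (simp add: U_def topspace_T)
  then have "?K \<subseteq> \<Union>(U ` ?K)" by blast
  then obtain \<F> where "finite \<F>" "\<F> \<subseteq> U ` ?K" "?K \<subseteq> \<Union>\<F>"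
    using \<open>compactin ?T ?K\<close> op unfolding compactin_def by meson
  then obtain I where I: "finite I" "I \<subseteq> ?K" "?K \<subseteq> (\<Union>g\<in>I. U g)"
    by (metis finite_subset_image)
  define b where "b q = (\<Prod>g\<in>I. bump (f g q - f g p / 2))" for q
  define F where "F = restrict (\<lambda>q. complex_of_real (b q)) X"
  have "smooth (\<lambda>q. \<Prod>g\<in>I. complex_of_real (bump (Re (complex_of_real (f g q) - complex_of_real (f g p / 2)))))"
    using f I(2) by (intro smooth_prod smooth_bump smooth_diff smooth_const) blast
  then have FA: "F \<in> smooth_functions P"
    unfolding F_def b_def by (intro restrict_mem_A) simp
  have Fv: "Re (\<alpha> g F p) = b (\<sigma> p g)" if "g \<in> carrier G" for g
    using \<sigma>_closed[OF p that] by (simp add: \<sigma>_eval[OF p that FA, symmetric]) (simp add: F_def)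
  show ?thesis
  proof (intro bexI[OF _ FA] conjI ballI impI)
    show "0 \<le> Re (\<alpha> g F p)" if "g \<in> carrier G" for g
      unfolding Fv[OF that] b_def by (intro prod_nonneg ballI bump_nonneg)
    have "0 < b p" unfolding b_def
    proof (rule prod_pos)
      fix g assume "g \<in> I"
      then have "0 < f g p" using f I(2) by blast
      then show "0 < bump (f g p - f g p / 2)" unfolding bump_pos_iff by simp
    qed
    then show "0 < Re (\<alpha> \<one> F p)" unfolding Fv[OF one_closed] \<sigma>_one[OF p] .
    fix h assume h: "h \<in> carrier G" "h \<notin> W"
    then obtain g where g: "g \<in> I" "h \<in> U g" using I(3) by blast
    then have "bump (f g (\<sigma> p h) - f g p / 2) = 0" by (intro bump_eq_0) (simp add: U_def)
    then show "Re (\<alpha> h F p) = 0" unfolding Fv[OF h(1)] b_def using I(1) g(1) by (rule_tac prod_zero) auto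
  qed
qed

lemma mean_abs: "cont f \<Longrightarrow> \<bar>mean f\<bar> \<le> mean (\<lambda>x. \<bar>f x\<bar>)"
proof -
  assume f: "cont f"
  have a: "cont (\<lambda>x. \<bar>f x\<bar>)" by (rule continuous_map_real_abs[OF f])
  have "mean f \<le> mean (\<lambda>x. \<bar>f x\<bar>)" by (rule mean_mono[OF f a]) simp
  moreover have "mean (\<lambda>x. - f x) \<le> mean (\<lambda>x. \<bar>f x\<bar>)"
    by (rule mean_mono[OF _ a]) (use f in \<open>auto intro: continuous_map_minus\<close>)
  ultimately show ?thesis using mean_minus[OF f] by simp
qed

text \<open>
  With \<open>F\<close> concentrated where the rows of \<open>a g - 1\<close> have absolute sum below \<open>1/2\<close>, the matrix of
  averages differs from \<open>M\<close> times the identity by rows of absolute sum at most \<open>M / 2\<close>, where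
  \<open>M > 0\<close> is the mean of the weight.  Hence it is strictly diagonally dominant.
\<close>

lemma average_invertible:
  fixes m :: nat
  assumes a: "\<And>i j. i < m \<Longrightarrow> j < m \<Longrightarrow> cont (a i j)"
    and a1: "\<And>i j. i < m \<Longrightarrow> j < m \<Longrightarrow> a i j \<one> = (if i = j then 1 else (0::real))"
    and p: "p \<in> X" and free: "\<And>g. g \<in> carrier G \<Longrightarrow> \<sigma> p g = p \<Longrightarrow> g = \<one>"
  shows "\<exists>F\<in>smooth_functions P. \<forall>v. \<exists>u. \<forall>i<m. (\<Sum>j<m. complex_of_real (mean (\<lambda>g. a i j g * Re (\<alpha> g F p))) * u j) = v i"
proof -
  let ?T = "mtop (mfd G)"
  let ?\<delta> = "\<lambda>i j. if i = j then 1 else (0::real)"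
  \<comment> \<open>The sum over all entries bounds the absolute sum of each row.\<close>
  define d where "d g = (\<Sum>i<m. \<Sum>j<m. \<bar>a i j g - ?\<delta> i j\<bar>)" for g
  have ad: "cont (\<lambda>g. a i j g - ?\<delta> i j)" if "i < m" "j < m" for i j
    using a[OF that] by (intro continuous_map_diff) simp_all
  have d: "cont d" unfolding d_def
    by (intro continuous_map_sum continuous_map_real_abs ad finite_lessThan) auto
  let ?W = "{g \<in> topspace ?T. d g \<in> {..<1/2}}"
  have "openin ?T ?W" by (rule openin_continuous_map_preimage[OF d]) simp
  moreover have "\<one> \<in> ?W" using a1 by (simp add: topspace_T d_def)
  ultimately obtain F where F: "F \<in> smooth_functions P" "\<forall>g\<in>carrier G. 0 \<le> Re (\<alpha> g F p)" "0 < Re (\<alpha> \<one> F p)"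
    "\<forall>g\<in>carrier G. g \<notin> ?W \<longrightarrow> Re (\<alpha> g F p) = 0"
    using concentrated_function[OF p free, of ?W] by blast
  define w where "w g = Re (\<alpha> g F p)" for g
  have w: "cont w" unfolding w_def by (rule orbit_pointwise_continuous[OF F(1) p])
  have w0: "0 \<le> w g" "d g * w g \<le> (1/2) * w g" if g: "g \<in> carrier G" for g
  proof -
    show "0 \<le> w g" using F(2) g by (simp add: w_def)
    show "d g * w g \<le> (1/2) * w g"
    proof (cases "g \<in> ?W")
      case True
      then show ?thesis using \<open>0 \<le> w g\<close> by (intro mult_right_mono) auto
    next
      case False
      then show ?thesis using F(4) g by (simp add: w_def)
    qed
  qed
  define M where "M = mean w"
  have M: "0 < M" unfolding M_def
    by (rule mean_pos[OF w w0(1) one_closed]) (use F(3) in \<open>simp_all add: w_def\<close>)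
  define R where "R i j = mean (\<lambda>g. a i j g * w g)" for i j
  have "(\<Sum>j\<in>{..<m} - {i}. cmod (complex_of_real (R i j))) < cmod (complex_of_real (R i i))" if i: "i < m" for i
  proof -
    have cw: "cont (\<lambda>g. \<bar>a i j g - ?\<delta> i j\<bar> * w g)" if "j < m" for j
      using ad[OF i that] w by (intro continuous_map_real_mult continuous_map_real_abs)
    have dev: "\<bar>R i j - ?\<delta> i j * M\<bar> \<le> mean (\<lambda>g. \<bar>a i j g - ?\<delta> i j\<bar> * w g)" if j: "j < m" for j
    proof -
      have c: "cont (\<lambda>g. a i j g * w g)" "cont (\<lambda>g. ?\<delta> i j * w g)" "cont (\<lambda>g. (a i j g - ?\<delta> i j) * w g)"
        using a[OF i j] ad[OF i j] w by (intro continuous_map_real_mult; simp)+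
      have "R i j - ?\<delta> i j * M = mean (\<lambda>g. a i j g * w g - ?\<delta> i j * w g)"
        unfolding R_def M_def mean_diff[OF c(1,2)] mean_cmult[OF w] ..
      also have "\<dots> = mean (\<lambda>g. (a i j g - ?\<delta> i j) * w g)" by (simp only: left_diff_distrib)
      finally have "\<bar>R i j - ?\<delta> i j * M\<bar> \<le> mean (\<lambda>g. \<bar>(a i j g - ?\<delta> i j) * w g\<bar>)"
        using mean_abs[OF c(3)] by simp
      also have "\<dots> = mean (\<lambda>g. \<bar>a i j g - ?\<delta> i j\<bar> * w g)"
        using w0(1) by (intro mean_cong) (simp add: abs_mult)
      finally show ?thesis .
    qed
    have "(\<Sum>j<m. \<bar>R i j - ?\<delta> i j * M\<bar>) \<le> (\<Sum>j<m. mean (\<lambda>g. \<bar>a i j g - ?\<delta> i j\<bar> * w g))"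
      using dev by (intro sum_mono) simp
    also have "\<dots> = mean (\<lambda>g. \<Sum>j<m. \<bar>a i j g - ?\<delta> i j\<bar> * w g)"
      using cw by (intro mean_sum[symmetric]) auto
    also have "\<dots> \<le> mean (\<lambda>g. (1/2) * w g)"
    proof (rule mean_mono)
      show "cont (\<lambda>g. \<Sum>j<m. \<bar>a i j g - ?\<delta> i j\<bar> * w g)" using cw by (intro continuous_map_sum) auto
      show "cont (\<lambda>g. (1/2) * w g)" using w by (rule continuous_map_real_mult_left)
      fix g assume g: "g \<in> carrier G"
      have "(\<Sum>j<m. \<bar>a i j g - ?\<delta> i j\<bar>) \<le> d g"
        unfolding d_def by (rule member_le_sum[of i "{..<m}" "\<lambda>i. \<Sum>j<m. \<bar>a i j g - ?\<delta> i j\<bar>"]) (use i in \<open>auto intro: sum_nonneg\<close>)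
      then have "(\<Sum>j<m. \<bar>a i j g - ?\<delta> i j\<bar>) * w g \<le> d g * w g" using w0(1)[OF g] by (rule mult_right_mono)
      then show "(\<Sum>j<m. \<bar>a i j g - ?\<delta> i j\<bar> * w g) \<le> (1/2) * w g"
        unfolding sum_distrib_right[symmetric] using w0(2)[OF g] by (rule order_trans)
    qed
    also have "\<dots> = (1/2) * M" unfolding M_def by (rule mean_cmult[OF w])
    also have "(\<Sum>j<m. \<bar>R i j - ?\<delta> i j * M\<bar>) = \<bar>R i i - M\<bar> + (\<Sum>j\<in>{..<m} - {i}. \<bar>R i j\<bar>)"
    proof -
      have "(\<Sum>j<m. \<bar>R i j - ?\<delta> i j * M\<bar>) = \<bar>R i i - ?\<delta> i i * M\<bar> + (\<Sum>j\<in>{..<m} - {i}. \<bar>R i j - ?\<delta> i j * M\<bar>)"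
        using i by (intro sum.remove) auto
      also have "(\<Sum>j\<in>{..<m} - {i}. \<bar>R i j - ?\<delta> i j * M\<bar>) = (\<Sum>j\<in>{..<m} - {i}. \<bar>R i j\<bar>)" by (intro sum.cong) auto
      finally show ?thesis by simp
    qed
    finally have "\<bar>R i i - M\<bar> + (\<Sum>j\<in>{..<m} - {i}. \<bar>R i j\<bar>) \<le> (1/2) * M" .
    moreover have "M - \<bar>R i i\<bar> \<le> \<bar>R i i - M\<bar>" by linarith
    ultimately have "(\<Sum>j\<in>{..<m} - {i}. \<bar>R i j\<bar>) < \<bar>R i i\<bar>" using M by linarith
    then show ?thesis by simp
  qed
  then have "\<exists>u. \<forall>i<m. (\<Sum>j<m. complex_of_real (R i j) * u j) = v i" for v
    by (rule diagonally_dominant_solvable)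
  then show ?thesis using F(1) unfolding R_def w_def by blast
qed

lemma finsum_A:
  assumes "finite I" "\<And>i. i \<in> I \<Longrightarrow> s i \<in> smooth_functions P"
  shows "(\<Oplus>\<^bsub>A\<^esub>i\<in>I. c i \<odot>\<^bsub>A\<^esub> s i) = (\<lambda>q\<in>X. \<Sum>i\<in>I. c i * s i q)"
proof -
  interpret M: module "scalars :: complex ring" A by (rule module_A)
  show ?thesis
    using assms
  proof (induction I rule: finite_induct)
    case empty
    show ?case by (simp add: M.finsum_empty)
  next
    case (insert i I)
    have mem: "c j \<odot>\<^bsub>A\<^esub> s j \<in> carrier A" if "j \<in> insert i I" for j
      using smooth_functions_ring_closed(3)[OF insert.prems[OF that] insert.prems[OF that]] by simp
    have "(\<Oplus>\<^bsub>A\<^esub>j\<in>insert i I. c j \<odot>\<^bsub>A\<^esub> s j) = (c i \<odot>\<^bsub>A\<^esub> s i) \<oplus>\<^bsub>A\<^esub> (\<Oplus>\<^bsub>A\<^esub>j\<in>I. c j \<odot>\<^bsub>A\<^esub> s j)"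
      by (rule M.finsum_insert[OF insert.hyps]) (use mem in blast)+
    also have "(\<Oplus>\<^bsub>A\<^esub>j\<in>I. c j \<odot>\<^bsub>A\<^esub> s j) = (\<lambda>q\<in>X. \<Sum>j\<in>I. c j * s j q)"
      by (rule insert.IH) (use insert.prems in blast)
    finally show ?case using insert.hyps by (auto simp: fun_eq_iff)
  qed
qed

text \<open>
  The \<open>i\<close>-th coordinate of the average of \<open>F (q g) \<pi>(g) u\<close> over \<open>g\<close>, for the representation \<open>\<pi>\<close> with
  matrix \<open>a\<close>; only the real part of \<open>F\<close> enters.
\<close>

definition equivariant_average :: "nat \<Rightarrow> (nat \<Rightarrow> nat \<Rightarrow> 'g \<Rightarrow> real) \<Rightarrow> ('p \<Rightarrow> complex) \<Rightarrow> (nat \<Rightarrow> complex) \<Rightarrow> nat \<Rightarrow> 'p \<Rightarrow> complex" where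
  "equivariant_average m a F u i = (\<lambda>q\<in>X. \<Sum>j<m. u j * complex_of_real (mean (\<lambda>g. a i j g * Re (\<alpha> g F q))))"

lemma equivariant_average_smooth:
  assumes "\<And>i j. i < m \<Longrightarrow> j < m \<Longrightarrow> cont (a i j)" "F \<in> smooth_functions P" "i < m"
  shows "equivariant_average m a F u i \<in> smooth_functions P"
  unfolding equivariant_average_def using assms
  by (intro restrict_mem_A smooth_sum smooth_mult smooth_const smooth_average) auto

text \<open>
  Replacing \<open>q\<close> by \<open>q h\<close> amounts to the substitution of \<open>h\<inverse> g\<close> for \<open>g\<close> in the factor \<open>a i j g\<close>, by
  invariance of the mean; multiplicativity of \<open>a\<close> then takes the factor at \<open>h\<inverse>\<close> out.
\<close>

lemma equivariant_average_equivariant: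
  assumes a: "\<And>i j. i < m \<Longrightarrow> j < m \<Longrightarrow> cont (a i j)"
    and am: "\<And>g h i j. g \<in> carrier G \<Longrightarrow> h \<in> carrier G \<Longrightarrow> i < m \<Longrightarrow> j < m \<Longrightarrow> a i j (g \<otimes> h) = (\<Sum>k<m. a i k g * a k j h)"
    and F: "F \<in> smooth_functions P" and i: "i < m" and h: "h \<in> carrier G"
  shows "\<alpha> h (equivariant_average m a F u i) = (\<Oplus>\<^bsub>A\<^esub>k\<in>{..<m}. complex_of_real (a i k (inv h)) \<odot>\<^bsub>A\<^esub> equivariant_average m a F u k)"
proof -
  have sm: "equivariant_average m a F u k \<in> smooth_functions P" if "k < m" for k by (rule equivariant_average_smooth[OF a F that])
  have avg: "mean (\<lambda>g. a i j g * Re (\<alpha> g F (\<sigma> q h))) = (\<Sum>k<m. a i k (inv h) * mean (\<lambda>g. a k j g * Re (\<alpha> g F q)))"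
    if j: "j < m" and q: "q \<in> X" for j q
  proof -
    have w: "cont (\<lambda>g. Re (\<alpha> g F q))" by (rule orbit_pointwise_continuous[OF F q])
    have c: "cont (\<lambda>g. a k j g * Re (\<alpha> g F q))" if "k < m" for k
      using a[OF that j] w by (rule continuous_map_real_mult)
    have ci: "cont (\<lambda>g. a i j (inv h \<otimes> g) * Re (\<alpha> g F q))"
      using cont_left[OF a[OF i j] inv_closed[OF h]] w by (rule continuous_map_real_mult)
    have "mean (\<lambda>g. a i j g * Re (\<alpha> g F (\<sigma> q h))) = mean (\<lambda>g. a i j (inv h \<otimes> (h \<otimes> g)) * Re (\<alpha> (h \<otimes> g) F q))"
    proof (rule mean_cong)
      fix g assume g: "g \<in> carrier G"
      have "\<alpha> g F (\<sigma> q h) = \<alpha> (h \<otimes> g) F q"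
        using \<sigma>_eval[OF q h \<alpha>_closed[OF g F]] \<alpha>_mult[OF h g F] by simp
      moreover have "inv h \<otimes> (h \<otimes> g) = g" using g h by (simp add: m_assoc[symmetric])
      ultimately show "a i j g * Re (\<alpha> g F (\<sigma> q h)) = a i j (inv h \<otimes> (h \<otimes> g)) * Re (\<alpha> (h \<otimes> g) F q)" by simp
    qed
    also have "\<dots> = mean (\<lambda>g. a i j (inv h \<otimes> g) * Re (\<alpha> g F q))" by (rule mean_translate_left[OF ci h])
    also have "\<dots> = mean (\<lambda>g. \<Sum>k<m. a i k (inv h) * (a k j g * Re (\<alpha> g F q)))"
      using h i j by (intro mean_cong) (simp add: am sum_distrib_right mult.assoc)
    also have "\<dots> = (\<Sum>k<m. mean (\<lambda>g. a i k (inv h) * (a k j g * Re (\<alpha> g F q))))"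
      by (rule mean_sum) (use c in \<open>auto intro: continuous_map_real_mult_left\<close>)
    also have "\<dots> = (\<Sum>k<m. a i k (inv h) * mean (\<lambda>g. a k j g * Re (\<alpha> g F q)))"
      using c by (intro sum.cong refl mean_cmult) simp
    finally show ?thesis .
  qed
  show ?thesis
  proof (rule extensionalityI[of _ X])
    show "\<alpha> h (equivariant_average m a F u i) \<in> extensional X" using \<alpha>_closed[OF h sm[OF i]] by (simp add: mem_A)
    have fs: "(\<Oplus>\<^bsub>A\<^esub>k\<in>{..<m}. complex_of_real (a i k (inv h)) \<odot>\<^bsub>A\<^esub> equivariant_average m a F u k)
        = (\<lambda>q\<in>X. \<Sum>k<m. complex_of_real (a i k (inv h)) * equivariant_average m a F u k q)"
      by (rule finsum_A) (simp_all add: sm)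
    show "(\<Oplus>\<^bsub>A\<^esub>k\<in>{..<m}. complex_of_real (a i k (inv h)) \<odot>\<^bsub>A\<^esub> equivariant_average m a F u k) \<in> extensional X"
      unfolding fs by simp
    fix q assume q: "q \<in> X"
    have "\<alpha> h (equivariant_average m a F u i) q = equivariant_average m a F u i (\<sigma> q h)" using \<sigma>_eval[OF q h sm[OF i]] by simp
    also have "\<dots> = (\<Sum>j<m. u j * complex_of_real (\<Sum>k<m. a i k (inv h) * mean (\<lambda>g. a k j g * Re (\<alpha> g F q))))"
      unfolding equivariant_average_def using \<sigma>_closed[OF q h] avg[OF _ q] by simp
    also have "\<dots> = (\<Sum>j<m. \<Sum>k<m. complex_of_real (a i k (inv h)) * (u j * complex_of_real (mean (\<lambda>g. a k j g * Re (\<alpha> g F q)))))"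
      by (simp add: sum_distrib_left mult.left_commute)
    also have "\<dots> = (\<Sum>k<m. \<Sum>j<m. complex_of_real (a i k (inv h)) * (u j * complex_of_real (mean (\<lambda>g. a k j g * Re (\<alpha> g F q)))))"
      by (rule sum.swap)
    also have "\<dots> = (\<Sum>k<m. complex_of_real (a i k (inv h)) * equivariant_average m a F u k q)"
      using q by (simp add: equivariant_average_def sum_distrib_left)
    finally show "\<alpha> h (equivariant_average m a F u i) q = (\<Oplus>\<^bsub>A\<^esub>k\<in>{..<m}. complex_of_real (a i k (inv h)) \<odot>\<^bsub>A\<^esub> equivariant_average m a F u k) q"
      unfolding fs using q by simp
  qed
qed

text \<open>
  The tensor \<open>\<Sum>i. s i \<otimes> e i\<close>, with \<open>s i\<close> the coordinates of an equivariant average and \<open>e i\<close> the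
  standard basis, is equivariant, and its value at \<open>p\<close> is the image of \<open>u\<close> under an invertible
  matrix.
\<close>

lemma evaluation_surjective:
  fixes J :: "(nat \<Rightarrow> complex) \<Rightarrow> 'v"
  assumes rep: "matrix_rep m J G a" and fr: "free_action G X \<sigma>" and \<omega>: "\<omega> \<in> characters A"
  shows "tensor_eval (coord_space.V m J) \<omega> ` equivariants A G \<alpha> (coord_space.V m J) (matrix_rep.\<pi> m J a)
    = carrier (coord_space.V m J)"
proof -
  interpret M: matrix_rep m J G a by (rule rep)
  interpret Am: module "scalars :: complex ring" A by (rule module_A)
  have cr: "cring (scalars :: complex ring)" by (rule Am.R.is_cring)
  have crep: "continuous_representation G M.V M.\<pi>" by (rule M.continuous_representation_\<pi>[OF cr])
  have tp: "tensor_product A M.V" by (rule tensor_product_representation[OF crep])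
  interpret tensor_product A M.V by (rule tp)
  have lF: "linF \<omega>" by (rule linF_character[OF tp \<omega>])
  show ?thesis
  proof (intro equalityI subsetI)
    fix x assume "x \<in> tensor_eval M.V \<omega> ` equivariants A G \<alpha> M.V M.\<pi>"
    then obtain S where S: "S \<in> tensor A M.V" "x = tensor_eval M.V \<omega> S" unfolding equivariants_def by blast
    then obtain s where "s \<in> free" "S = cls s" unfolding tensor_eq by blast
    then show "x \<in> carrier M.V" using S(2) tensor_eval_cls[OF lF] evt_closed by metis
  next
    fix x assume "x \<in> carrier M.V"
    then obtain v where v: "v \<in> Cm m" "x = J v" unfolding M.V_simps(1) by blast
    obtain p where p: "p \<in> X" "\<omega> = point_evaluation P p" using character_is_point_evaluation[OF \<omega>] by blast
    have "g = \<one>" if "g \<in> carrier G" "\<sigma> p g = p" for g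
    proof -
      have "g \<in> stabilizer G (\<lambda>g p. \<sigma> p g) p" using that by (simp add: stabilizer_def)
      then show ?thesis using fr p(1) unfolding free_action_def by blast
    qed
    from average_invertible[OF M.a_cont M.a_one p(1) this]
    obtain F where F: "F \<in> smooth_functions P"
      "\<forall>v. \<exists>u. \<forall>i<m. (\<Sum>j<m. complex_of_real (mean (\<lambda>g. a i j g * Re (\<alpha> g F p))) * u j) = v i" by blast
    from spec[OF F(2), of v] obtain u where
      u: "\<forall>i<m. (\<Sum>j<m. complex_of_real (mean (\<lambda>g. a i j g * Re (\<alpha> g F p))) * u j) = v i" by blast
    let ?s = "equivariant_average m a F u"
    have s: "?s i \<in> carrier A" if "i \<in> {..<m}" for i
      using equivariant_average_smooth[OF M.a_cont F(1)] that by simp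
    have e: "M.basis i \<in> carrier M.V" if "i \<in> {..<m}" for i using M.basis_carrier that by simp
    define t where "t = (\<Sum>i\<in>{..<m}. Poly_Mapping.single (?s i, M.basis i) (1::complex))"
    have eqv: "t \<in> free \<and> tensor_map A M.V (\<alpha> h) (\<lambda>v. v) (cls t) = tensor_map A M.V (\<lambda>a. a) (M.\<pi> (inv h)) (cls t) \<and>
        tensor_eval M.V \<omega> (cls t) = (\<Oplus>\<^bsub>M.V\<^esub>i\<in>{..<m}. \<omega> (?s i) \<odot>\<^bsub>M.V\<^esub> M.basis i)" if h: "h \<in> carrier G" for h
    proof -
      let ?c = "\<lambda>i j. complex_of_real (a i j (inv h))"
      have fs: "\<alpha> h (?s i) = (\<Oplus>\<^bsub>A\<^esub>j\<in>{..<m}. ?c i j \<odot>\<^bsub>A\<^esub> ?s j)" if "i \<in> {..<m}" for i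
        using equivariant_average_equivariant[OF M.a_cont M.a_mult F(1) _ h] that by blast
      have he: "M.\<pi> (inv h) (M.basis j) = (\<Oplus>\<^bsub>M.V\<^esub>i\<in>{..<m}. ?c i j \<odot>\<^bsub>M.V\<^esub> M.basis i)" if "j \<in> {..<m}" for j
      proof -
        have "M.\<pi> (inv h) (M.basis j) = J (M.act (inv h) (\<lambda>i. if i = j then 1 else 0))"
          unfolding M.basis_def using that by (intro M.\<pi>_J M.unit_Cm) simp
        also have "M.act (inv h) (\<lambda>i. if i = j then 1 else 0) = (\<lambda>i. if i < m then ?c i j else 0)"
          using that by (auto simp: M.act_def fun_eq_iff if_distrib[where f="\<lambda>z. _ * z"] cong: if_cong)
        finally show ?thesis unfolding M.finsum_basis[OF cr] .
      qed
      note me = matrix_equivariant[OF linA_\<alpha>[OF tp h] linV_representation[OF tp crep inv_closed[OF h]] finite_lessThan s e fs he, folded t_def]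
      show ?thesis by (intro conjI me lF)
    qed
    have "cls t \<in> tensor A M.V" unfolding tensor_eq using eqv[OF one_closed] by blast
    then have "cls t \<in> equivariants A G \<alpha> M.V M.\<pi>" unfolding equivariants_def using eqv by blast
    moreover have "tensor_eval M.V \<omega> (cls t) = x"
    proof -
      have "\<omega> (?s i) = v i" if i: "i < m" for i
      proof -
        have "\<omega> (?s i) = (\<Sum>j<m. u j * complex_of_real (mean (\<lambda>g. a i j g * Re (\<alpha> g F p))))"
          using s[of i] i p by (simp add: point_evaluation_def equivariant_average_def)
        then show ?thesis using u i by (simp add: mult.commute)
      qed
      then have "(\<lambda>i. if i < m then \<omega> (?s i) else 0) = v" using v(1) by (auto simp: Cm_def fun_eq_iff)
      then show ?thesis using eqv[OF one_closed] unfolding M.finsum_basis[OF cr] v(2) by simp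
    qed
    ultimately show "x \<in> tensor_eval M.V \<omega> ` equivariants A G \<alpha> M.V M.\<pi>" by blast
  qed
qed

text \<open>
  The family consists of all continuous representations on subsets of the given type whose
  evaluation maps are surjective.  It contains a copy of every representation by real matrices.
\<close>

theorem free_system_if_free_action:
  assumes card: "(UNIV :: real set) \<lesssim> (UNIV :: 'v set)" and fr: "free_action G X \<sigma>"
  shows "free_dynamical_system TYPE('v) A G \<alpha>"
proof -
  interpret Am: module "scalars :: complex ring" A by (rule module_A)
  let ?R = "{(\<pi> :: 'g \<Rightarrow> 'v \<Rightarrow> 'v, V). continuous_representation G V \<pi> \<and>
    (\<forall>\<omega>\<in>characters A. tensor_eval V \<omega> ` equivariants A G \<alpha> V \<pi> = carrier V)}"
  have "\<exists>(\<pi>, V)\<in>?R. \<exists>v\<in>carrier V. \<pi> g v \<noteq> v" if g: "g \<in> carrier G" "g \<noteq> \<one>" for g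
  proof -
    obtain m :: nat and a where a: "\<forall>i<m. \<forall>j<m. cont (a i j)"
      "\<forall>i<m. \<forall>j<m. a i j \<one> = (if i = j then 1 else 0)"
      "\<forall>g\<in>carrier G. \<forall>h\<in>carrier G. \<forall>i<m. \<forall>j<m. a i j (g \<otimes> h) = (\<Sum>k<m. a i k g * a k j h)"
      "\<exists>i<m. \<exists>j<m. a i j g \<noteq> (if i = j then 1 else 0)"
      using matrix_representations_separate_points[OF g] by blast
    obtain J :: "(nat \<Rightarrow> complex) \<Rightarrow> 'v" where J: "inj_on J (Cm m)" using Cm_embedding[OF card] by blast
    have rep: "matrix_rep m J G a"
      by unfold_locales (use J a topspace_T in auto)
    interpret M: matrix_rep m J G a by (rule rep)
    obtain i j where ij: "i < m" "j < m" "a i j g \<noteq> (if i = j then 1 else 0)" using a(4) by blast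
    have "M.\<pi> g (M.basis j) \<noteq> M.basis j"
    proof
      assume "M.\<pi> g (M.basis j) = M.basis j"
      then have "J (M.act g (\<lambda>i. if i = j then 1 else 0)) = J (\<lambda>i. if i = j then 1 else 0)"
        unfolding M.basis_def using M.\<pi>_J[OF M.unit_Cm[OF ij(2)]] by simp
      from inj_onD[OF J this M.act_Cm M.unit_Cm[OF ij(2)]]
      have "M.act g (\<lambda>i. if i = j then 1 else 0) i = (if i = j then 1 else 0)" by simp
      moreover have "M.act g (\<lambda>i. if i = j then 1 else 0) i = complex_of_real (a i j g)"
        using ij(1,2) by (simp add: M.act_def if_distrib[where f="\<lambda>z. _ * z"] cong: if_cong)
      ultimately show False using ij(3) by (auto split: if_splits)
    qed
    moreover have "(M.\<pi>, M.V) \<in> ?R"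
      using M.continuous_representation_\<pi>[OF Am.R.is_cring] evaluation_surjective[OF rep fr] by blast
    ultimately show ?thesis using M.basis_carrier[OF ij(2)] by blast
  qed
  then show ?thesis
    unfolding free_dynamical_system_def by (intro exI[of _ ?R] conjI) auto
qed

end

theorem corollary6p3p8:
  fixes P :: "('p, nat \<Rightarrow> real) manifold"
    and G :: "('g, nat \<Rightarrow> real) lie_group"
    and \<alpha> :: "'g \<Rightarrow> ('p \<Rightarrow> complex) \<Rightarrow> ('p \<Rightarrow> complex)"
  assumes "smooth_manifold P"
    and "compact_Lie_group G"
    and "smooth_dynamical_system (smooth_algebra P) G \<alpha>"
    and "(UNIV :: real set) \<lesssim> (UNIV :: 'v set)"
  shows "free_dynamical_system TYPE('v) (smooth_algebra P) G \<alpha> \<longleftrightarrow>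
         free_action G (topspace (mtop P)) (induced_action P \<alpha>)"
proof -
  obtain n where n: "model P = E n" using assms(1) unfolding smooth_manifold_def by blast
  interpret smooth_mfd P n using assms(1) n by unfold_locales
  have L: "Lie_group G" "compact_space (mtop (mfd G))" using assms(2) unfolding compact_Lie_group_def by blast+
  then interpret group G unfolding Lie_group_def by blast
  interpret compact_group G "mtop (mfd G)"
  proof unfold_locales
    show "topspace (mtop (mfd G)) = carrier G" using L(1) unfolding Lie_group_def by blast
    show "Hausdorff_space (mtop (mfd G))"
      using L(1) unfolding Lie_group_def smooth_manifold_def locally_convex_manifold_def by blast
    show "continuous_map (prod_topology (mtop (mfd G)) (mtop (mfd G))) (mtop (mfd G)) (\<lambda>(x, y). x \<otimes>\<^bsub>G\<^esub> y)"
      using L(1) unfolding Lie_group_def smooth_map_def prod_manifold_def by simp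
    show "continuous_map (mtop (mfd G)) (mtop (mfd G)) (\<lambda>x. inv\<^bsub>G\<^esub> x)"
      using L(1) unfolding Lie_group_def smooth_map_def by simp
  qed (rule L(2))
  interpret smooth_dynamics P n G \<alpha>
  proof (intro smooth_dynamics.intro smooth_mfd_axioms compact_group_axioms smooth_dynamics_axioms.intro)
    show "\<alpha> \<in> hom G (algebra_Aut A)" using assms(3) unfolding smooth_dynamical_system_def by blast
    show "continuous_map (prod_topology (mtop (mfd G)) (smooth_topology P)) (smooth_topology P) (\<lambda>(g, f). \<alpha> g f)"
      using assms(3) unfolding smooth_dynamical_system_def smooth_map_def
      by (simp add: prod_manifold_def tvs_manifold_def real_tvs_def)
    show "Module.module scalars A"
      using assms(3) unfolding smooth_dynamical_system_def locally_convex_algebra_def locally_convex_space_def by blast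
  qed
  show ?thesis using free_action_if_free_system free_system_if_free_action[OF assms(4)] by blast
qed

end
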